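(* Let $A\to M$ be a vector bundle and let $\theta\in C^\infty(T^*\Pi A)$ be a proto-bialgebroid structure, i.e. $\kappa(\theta)=3$ and $\{\theta,\theta\}=0$; write $\theta=\mu+L^*\gamma+\pi^*\phi+L^*\bar\pi^*\psi$ with $\mu=h_{d_A}$, $\gamma=h_{d_{A^*}}$, where $d_A$ and $d_{A^*}$ are degree-one vector fields on $\Pi A$ and $\Pi A^*$, $\phi\in\Gamma(\bigwedge^3A^* )$ and $\psi\in\Gamma(\bigwedge^3A)$. Then the following formulas define a Courant algebroid structure on the bundle $A\oplus A^*$ (for $X,Y\in\Gamma(A)$, $\xi,\eta\in\Gamma(A^* )$, $f\in C^\infty(M)$): $$\langle X+\xi,Y+\eta\rangle=\eta(X)+\xi(Y),$$ $$(X+\xi)\circ(Y+\eta)=\big([X,Y]_A+L_\xi^{A^*}Y-i_\eta d_{A^*}X-\psi(\xi,\eta)\big)+\big([\xi,\eta]_{A^*}+L_X^A\eta-i_Yd_A\xi-\phi(X,Y)\big),$$ $$\mathcal Df=d_Af+d_{A^*}f,$$ where $\phi$ is viewed as a bundle map $\bigwedge^2A\to A^*$ and $\psi$ as a bundle map $\bigwedge^2A^*\to A$, and the anchor $\rho$ is determined by $\rho(e)f=\langle\mathcal Df,e\rangle$.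
   Context: Courant algebroid: a vector bundle $E\to M$ with a nondegenerate symmetric bilinear form $\langle\cdot,\cdot\rangle$, an $\mathbb R$-bilinear operation $\circ$ on $\Gamma(E)$ and a bundle map $\rho:E\to TM$ such that, with $\mathcal D:C^\infty(M)\to\Gamma(E)$, $\langle\mathcal Df,e\rangle=\rho(e)f$: (1) $e_1\circ(e_2\circ e_3)=(e_1\circ e_2)\circ e_3+e_2\circ(e_1\circ e_3)$; (2) $\rho(e_1\circ e_2)=[\rho(e_1),\rho(e_2)]$; (3) $e_1\circ fe_2=f(e_1\circ e_2)+(\rho(e_1)f)e_2$; (4) $e\circ e=\frac12\mathcal D\langle e,e\rangle$; (5) $\rho(e)\langle h_1,h_2\rangle=\langle e\circ h_1,h_2\rangle+\langle h_1,e\circ h_2\rangle$. $\Pi A$ is the supermanifold with functions $\Gamma(\bigwedge A^* )$, local coordinates $(x^i,\xi^a)$ ($\xi^a$ odd, corresponding to a local frame $e^a$ of $A^*$ dual to a frame $e_a$ of $A$); $\Pi A^*$ has functions $\Gamma(\bigwedge A)$, coordinates $(x^i,\theta_a)$. $T^*\Pi A$ has Darboux coordinates $(x^i,\xi^a,x_i^*,\xi_a^* )$ and even Poisson bracket $\{x_i^*,x^j\}=\delta_i^j$, $\{\xi_a^*,\xi^b\}=\delta_a^b$, other coordinate brackets zero, $\{F,G\}=-(-1)^{\tilde F\tilde G}\{G,F\}$, $\{F,\cdot\}$ a derivation of parity $\tilde F$; $T^*\Pi A^*$ has coordinates $(x^i,\theta_a,x_i^*,\theta_*^a)$. $\pi:T^*\Pi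 A\to\Pi A$, $\bar\pi:T^*\Pi A^*\to\Pi A^*$ are the projections. The hamiltonian lift of $v=v^\alpha\partial_\alpha$ is $h_v=v^\alpha x_\alpha^*$. The Legendre transform $L:T^*\Pi A\to T^*\Pi A^*$ is the canonical symplectomorphism with $L^*x^i=x^i$, $L^*\theta_a=\xi_a^*$, $L^*x_i^*=x_i^*$, $L^*\theta_*^a=\xi^a$. Gradings on fibrewise-polynomial functions on $T^*\Pi A$: $\epsilon$ is the total degree in $(x_i^*,\xi_a^* )$, $\delta$ is the total degree in $(x_i^*,\xi^a)$, and $\kappa=\epsilon+\delta$ (so $x_i^*$ has $\kappa$-degree 2 and $\xi^a,\xi_a^*$ have $\kappa$-degree 1). A function $\theta$ with $\kappa(\theta)=3$ decomposes uniquely into $(\epsilon,\delta)$-bidegrees $(1,2)$, $(2,1)$, $(0,3)$, $(3,0)$, which are respectively $\mu=h_{d_A}$, $L^*\gamma=L^*h_{d_{A^*}}$, $\pi^*\phi$, $L^*\bar\pi^*\psi$. The vector field $d_A$, regarded as a degree-one derivation of $\Gamma(\bigwedge A^* )$ (not necessarily squaring to zero), defines an anchor $a$ by $a(X)f=(d_Af)(X)$ and a skew bracket by $\xi([X,Y]_A)=a(X)\xi(Y)-a(Y)\xi(X)-d_A\xi(X,Y)$; likewise $d_{A^*}$ defines $a_*$, $[\cdot,\cdot]_{A^*}$. $i_X$ is contraction, $L_X^A=[d_A,i_X]$, $L_\xi^{A^*}=[d_{A^*},i_\xi]$ (supercommutators). Conventions: $(i_Y\alpha)(Z)=\alpha(Y,Z)$,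 $\phi(X,Y)(Z)=\phi(X,Y,Z)$, and similarly for $\psi$. *)

theory Defs
  imports
    "HOL-Analysis.Analysis"
    "HOL-Library.Function_Algebras"
    "HOL-Library.Multiset"
begin

text \<open>Covectors are functions on vectors, so that a dual bundle is again a family of
  subspaces of a real vector space.\<close>

instantiation "fun" :: (type, real_vector) real_vector
begin
definition scaleR_fun :: "real \<Rightarrow> ('a \<Rightarrow> 'b) \<Rightarrow> 'a \<Rightarrow> 'b"
  where "scaleR_fun c f = (\<lambda>x. c *\<^sub>R f x)"
instance
  by standard (auto simp: scaleR_fun_def fun_eq_iff scaleR_add_right scaleR_add_left)
end

text \<open>Points of $R^n$ are the elements of \<^term>\<open>topspace (Euclidean_space n)\<close>, i.e. the
  functions \<^typ>\<open>nat \<Rightarrow> real\<close> vanishing from index \<open>n\<close> on; this admits \<open>n = 0\<close>.\<close>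

definition partial :: "nat \<Rightarrow> ((nat \<Rightarrow> real) \<Rightarrow> real) \<Rightarrow> (nat \<Rightarrow> real) \<Rightarrow> real" where
  "partial i g x = deriv (\<lambda>t. g (x(i := t))) (x i)"

primrec Ck_on :: "nat \<Rightarrow> nat \<Rightarrow> (nat \<Rightarrow> real) set \<Rightarrow> ((nat \<Rightarrow> real) \<Rightarrow> real) \<Rightarrow> bool" where
  "Ck_on n 0 V g \<longleftrightarrow> continuous_on V g"
| "Ck_on n (Suc k) V g \<longleftrightarrow> continuous_on V g \<and>
     (\<forall>i<n. (\<forall>x\<in>V. (\<lambda>t. g (x(i := t))) field_differentiable (at (x i))) \<and>
            Ck_on n k V (partial i g))"

definition smooth_on :: "nat \<Rightarrow> (nat \<Rightarrow> real) set \<Rightarrow> ((nat \<Rightarrow> real) \<Rightarrow> real) \<Rightarrow> bool" where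
  "smooth_on n V g \<longleftrightarrow> (\<forall>k. Ck_on n k V g)"

type_synonym 'm chart = "'m set \<times> ('m \<Rightarrow> nat \<Rightarrow> real)"

record 'm manifold =
  mdim :: nat
  atlas :: "'m chart set"

definition chart_inv :: "'m chart \<Rightarrow> (nat \<Rightarrow> real) \<Rightarrow> 'm" where
  "chart_inv c = inv_into (fst c) (snd c)"

text \<open>The underlying set of the manifold is the whole type; Hausdorff and second countable are
  type class constraints.\<close>

definition smooth_manifold :: "'m::{t2_space,second_countable_topology} manifold \<Rightarrow> bool" where
  "smooth_manifold M \<longleftrightarrow>
     (\<Union>c\<in>atlas M. fst c) = UNIV \<and>
     (\<forall>c\<in>atlas M. open (fst c) \<and> openin (Euclidean_space (mdim M)) (snd c ` fst c) \<and>
        homeomorphism (fst c) (snd c ` fst c) (snd c) (chart_inv c)) \<and>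
     (\<forall>c\<in>atlas M. \<forall>c'\<in>atlas M. \<forall>j<mdim M.
        smooth_on (mdim M) (snd c ` (fst c \<inter> fst c')) (\<lambda>y. snd c' (chart_inv c y) j))"

definition smooth_fun_on :: "'m manifold \<Rightarrow> 'm set \<Rightarrow> ('m \<Rightarrow> real) \<Rightarrow> bool" where
  "smooth_fun_on M W f \<longleftrightarrow>
     (\<forall>c\<in>atlas M. smooth_on (mdim M) (snd c ` (fst c \<inter> W)) (\<lambda>y. f (chart_inv c y)))"

definition smooth_functions :: "'m manifold \<Rightarrow> ('m \<Rightarrow> real) set" where
  "smooth_functions M = {f. smooth_fun_on M UNIV f}"

definition pd :: "'m chart \<Rightarrow> nat \<Rightarrow> ('m \<Rightarrow> real) \<Rightarrow> 'm \<Rightarrow> real" where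
  "pd c i f m = partial i (\<lambda>y. f (chart_inv c y)) (snd c m)"

text \<open>Tangent vectors as derivations at \<open>m\<close> of the algebra of smooth functions, extended by zero
  to arbitrary functions.\<close>

definition tangent_space :: "'m manifold \<Rightarrow> 'm \<Rightarrow> (('m \<Rightarrow> real) \<Rightarrow> real) set" where
  "tangent_space M m = {D.
     (\<forall>f\<in>smooth_functions M. \<forall>g\<in>smooth_functions M.
        D (\<lambda>p. f p + g p) = D f + D g \<and> D (\<lambda>p. f p * g p) = f m * D g + g m * D f) \<and>
     (\<forall>f\<in>smooth_functions M. \<forall>c. D (\<lambda>p. c * f p) = c * D f) \<and>
     (\<forall>f. f \<notin> smooth_functions M \<longrightarrow> D f = 0)}"

text \<open>The fibres are subspaces of one real vector space \<^typ>\<open>'v\<close>. This ambient space is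
  only a container (for an arbitrary family of fibres one can take their direct sum): it carries
  no topology and need not be finite dimensional. The smooth structure is given by
  local frames.\<close>

type_synonym ('m, 'v) frame = "'m set \<times> (nat \<Rightarrow> 'm \<Rightarrow> 'v)"

record ('m, 'v) vbundle =
  brank :: nat
  fibre :: "'m \<Rightarrow> 'v set"
  frames :: "('m, 'v) frame set"

text \<open>The coframe $e^a$ dual to a frame $e_a$; covectors vanish outside the fibre.\<close>

definition coframe ::
    "('m, 'v::real_vector) vbundle \<Rightarrow> ('m, 'v) frame \<Rightarrow> nat \<Rightarrow> 'm \<Rightarrow> 'v \<Rightarrow> real" where
  "coframe B e a m v =
     (if v \<in> fibre B m
      then representation ((\<lambda>b. snd e b m) ` {..<brank B}) v (snd e a m) else 0)"

definition vector_bundle ::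
    "'m::{t2_space,second_countable_topology} manifold \<Rightarrow> ('m, 'v::real_vector) vbundle \<Rightarrow> bool"
  where
  "vector_bundle M B \<longleftrightarrow>
     (\<Union>e\<in>frames B. fst e) = UNIV \<and>
     (\<forall>m. subspace (fibre B m)) \<and>
     (\<forall>e\<in>frames B. open (fst e) \<and>
        (\<forall>m\<in>fst e. inj_on (\<lambda>a. snd e a m) {..<brank B} \<and>
           independent ((\<lambda>a. snd e a m) ` {..<brank B}) \<and>
           span ((\<lambda>a. snd e a m) ` {..<brank B}) = fibre B m)) \<and>
     (\<forall>e\<in>frames B. \<forall>e'\<in>frames B. \<forall>a<brank B. \<forall>b<brank B.
        smooth_fun_on M (fst e \<inter> fst e') (\<lambda>m. coframe B e b m (snd e' a m)))"

definition sections_on ::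
    "'m manifold \<Rightarrow> ('m, 'v::real_vector) vbundle \<Rightarrow> 'm set \<Rightarrow> ('m \<Rightarrow> 'v) set" where
  "sections_on M B W = {X. (\<forall>m\<in>W. X m \<in> fibre B m) \<and>
     (\<forall>e\<in>frames B. \<forall>a<brank B. smooth_fun_on M (W \<inter> fst e) (\<lambda>m. coframe B e a m (X m)))}"

abbreviation sections where "sections M B \<equiv> sections_on M B UNIV"

definition dual_space :: "'v::real_vector set \<Rightarrow> ('v \<Rightarrow> real) set" where
  "dual_space F = {\<xi>. (\<forall>u\<in>F. \<forall>v\<in>F. \<xi> (u + v) = \<xi> u + \<xi> v) \<and>
     (\<forall>u\<in>F. \<forall>c. \<xi> (c *\<^sub>R u) = c * \<xi> u) \<and> (\<forall>u. u \<notin> F \<longrightarrow> \<xi> u = 0)}"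

definition dual_frame ::
    "('m, 'v::real_vector) vbundle \<Rightarrow> ('m, 'v) frame \<Rightarrow> ('m, 'v \<Rightarrow> real) frame" where
  "dual_frame B e = (fst e, coframe B e)"

definition dual_bundle ::
    "('m, 'v::real_vector) vbundle \<Rightarrow> ('m, 'v \<Rightarrow> real) vbundle" where
  "dual_bundle B = \<lparr> brank = brank B, fibre = (\<lambda>m. dual_space (fibre B m)),
                     frames = dual_frame B ` frames B \<rparr>"

definition sum_frame ::
    "('m, 'v::real_vector) vbundle \<Rightarrow> ('m, 'v) frame \<Rightarrow> ('m, 'v \<times> ('v \<Rightarrow> real)) frame" where
  "sum_frame B e = (fst e, \<lambda>a m. if a < brank B then (snd e a m, 0)
                               else (0, coframe B e (a - brank B) m))"

definition double_bundle ::
    "('m, 'v::real_vector) vbundle \<Rightarrow> ('m, 'v \<times> ('v \<Rightarrow> real)) vbundle" where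
  "double_bundle B = \<lparr> brank = 2 * brank B,
     fibre = (\<lambda>m. fibre B m \<times> dual_space (fibre B m)),
     frames = sum_frame B ` frames B \<rparr>"

text \<open>An anchor \<open>\<rho> m u\<close> is a tangent vector at \<open>m\<close>, that is, a derivation on functions.\<close>

definition act_anchor ::
    "('m \<Rightarrow> 'e \<Rightarrow> ('m \<Rightarrow> real) \<Rightarrow> real) \<Rightarrow> ('m \<Rightarrow> 'e) \<Rightarrow> ('m \<Rightarrow> real) \<Rightarrow> 'm \<Rightarrow> real" where
  "act_anchor \<rho> e f = (\<lambda>m. \<rho> m (e m) f)"

definition fibre_metric ::
    "'m manifold \<Rightarrow> ('m, 'e::real_vector) vbundle \<Rightarrow> ('m \<Rightarrow> 'e \<Rightarrow> 'e \<Rightarrow> real) \<Rightarrow> bool" where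
  "fibre_metric M E g \<longleftrightarrow>
     (\<forall>m. \<forall>u\<in>fibre E m. \<forall>v\<in>fibre E m. \<forall>w\<in>fibre E m. \<forall>c.
        g m u v = g m v u \<and> g m (u + v) w = g m u w + g m v w \<and>
        g m (c *\<^sub>R u) v = c * g m u v) \<and>
     (\<forall>m. \<forall>u\<in>fibre E m. (\<forall>v\<in>fibre E m. g m u v = 0) \<longrightarrow> u = 0) \<and>
     (\<forall>e\<in>sections M E. \<forall>h\<in>sections M E. (\<lambda>m. g m (e m) (h m)) \<in> smooth_functions M)"

definition bundle_map_to_tangent ::
    "'m manifold \<Rightarrow> ('m, 'e::real_vector) vbundle \<Rightarrow>
       ('m \<Rightarrow> 'e \<Rightarrow> ('m \<Rightarrow> real) \<Rightarrow> real) \<Rightarrow> bool" where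
  "bundle_map_to_tangent M E \<rho> \<longleftrightarrow>
     (\<forall>m. \<forall>u\<in>fibre E m. \<rho> m u \<in> tangent_space M m) \<and>
     (\<forall>m. \<forall>u\<in>fibre E m. \<forall>v\<in>fibre E m. \<forall>c.
        \<rho> m (u + v) = \<rho> m u + \<rho> m v \<and> \<rho> m (c *\<^sub>R u) = c *\<^sub>R \<rho> m u) \<and>
     (\<forall>e\<in>sections M E. \<forall>f\<in>smooth_functions M. act_anchor \<rho> e f \<in> smooth_functions M)"

definition courant_algebroid ::
    "'m::{t2_space,second_countable_topology} manifold \<Rightarrow> ('m, 'e::real_vector) vbundle \<Rightarrow>
     ('m \<Rightarrow> 'e \<Rightarrow> 'e \<Rightarrow> real) \<Rightarrow> (('m \<Rightarrow> 'e) \<Rightarrow> ('m \<Rightarrow> 'e) \<Rightarrow> 'm \<Rightarrow> 'e) \<Rightarrow>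
     ('m \<Rightarrow> 'e \<Rightarrow> ('m \<Rightarrow> real) \<Rightarrow> real) \<Rightarrow> (('m \<Rightarrow> real) \<Rightarrow> 'm \<Rightarrow> 'e) \<Rightarrow> bool" where
  "courant_algebroid M E g circ \<rho> D \<longleftrightarrow>
     smooth_manifold M \<and> vector_bundle M E \<and> fibre_metric M E g \<and>
     bundle_map_to_tangent M E \<rho> \<and>
     (\<forall>f\<in>smooth_functions M. D f \<in> sections M E \<and>
        (\<forall>e\<in>sections M E. \<forall>m. g m (D f m) (e m) = act_anchor \<rho> e f m)) \<and>
     (\<forall>e\<^sub>1\<in>sections M E. \<forall>e\<^sub>2\<in>sections M E. circ e\<^sub>1 e\<^sub>2 \<in> sections M E) \<and>
     (\<forall>e\<^sub>1\<in>sections M E. \<forall>e\<^sub>2\<in>sections M E. \<forall>h\<in>sections M E. \<forall>c::real.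
        circ (e\<^sub>1 + e\<^sub>2) h = circ e\<^sub>1 h + circ e\<^sub>2 h \<and>
        circ h (e\<^sub>1 + e\<^sub>2) = circ h e\<^sub>1 + circ h e\<^sub>2 \<and>
        circ (c *\<^sub>R e\<^sub>1) h = c *\<^sub>R circ e\<^sub>1 h \<and> circ h (c *\<^sub>R e\<^sub>1) = c *\<^sub>R circ h e\<^sub>1) \<and>
     (\<forall>e\<^sub>1\<in>sections M E. \<forall>e\<^sub>2\<in>sections M E. \<forall>e\<^sub>3\<in>sections M E.
        circ e\<^sub>1 (circ e\<^sub>2 e\<^sub>3) = circ (circ e\<^sub>1 e\<^sub>2) e\<^sub>3 + circ e\<^sub>2 (circ e\<^sub>1 e\<^sub>3)) \<and>
     (\<forall>e\<^sub>1\<in>sections M E. \<forall>e\<^sub>2\<in>sections M E. \<forall>f\<in>smooth_functions M.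
        act_anchor \<rho> (circ e\<^sub>1 e\<^sub>2) f =
          act_anchor \<rho> e\<^sub>1 (act_anchor \<rho> e\<^sub>2 f) - act_anchor \<rho> e\<^sub>2 (act_anchor \<rho> e\<^sub>1 f)) \<and>
     (\<forall>e\<^sub>1\<in>sections M E. \<forall>e\<^sub>2\<in>sections M E. \<forall>f\<in>smooth_functions M.
        circ e\<^sub>1 (\<lambda>m. f m *\<^sub>R e\<^sub>2 m) =
          (\<lambda>m. f m *\<^sub>R circ e\<^sub>1 e\<^sub>2 m + act_anchor \<rho> e\<^sub>1 f m *\<^sub>R e\<^sub>2 m)) \<and>
     (\<forall>e\<in>sections M E. circ e e = (1/2::real) *\<^sub>R D (\<lambda>m. g m (e m) (e m))) \<and>
     (\<forall>e\<in>sections M E. \<forall>h\<^sub>1\<in>sections M E. \<forall>h\<^sub>2\<in>sections M E.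
        act_anchor \<rho> e (\<lambda>m. g m (h\<^sub>1 m) (h\<^sub>2 m)) =
          (\<lambda>m. g m (circ e h\<^sub>1 m) (h\<^sub>2 m) + g m (h\<^sub>1 m) (circ e h\<^sub>2 m)))"

text \<open>An element of $\bigwedge F^*$, possibly inhomogeneous, is a function on lists of vectors: its
  values on lists of length \<open>k\<close> are its component of degree \<open>k\<close>.\<close>

definition alternating_form :: "'v::real_vector set \<Rightarrow> ('v list \<Rightarrow> real) \<Rightarrow> bool" where
  "alternating_form F \<omega> \<longleftrightarrow>
     (\<forall>us\<in>lists F. \<forall>ws\<in>lists F. \<forall>u\<in>F. \<forall>v\<in>F. \<forall>c.
        \<omega> (us @ (u + v) # ws) = \<omega> (us @ u # ws) + \<omega> (us @ v # ws) \<and>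
        \<omega> (us @ (c *\<^sub>R u) # ws) = c * \<omega> (us @ u # ws)) \<and>
     (\<forall>us\<in>lists F. \<not> distinct us \<longrightarrow> \<omega> us = 0) \<and>
     (\<forall>us. us \<notin> lists F \<longrightarrow> \<omega> us = 0)"

type_synonym ('m, 'v) form = "'m \<Rightarrow> 'v list \<Rightarrow> real"

text \<open>The smooth sections over \<open>W\<close> of $\bigwedge B^*$, i.e. the functions on $\Pi B$ over \<open>W\<close>.\<close>

definition forms_on ::
    "'m manifold \<Rightarrow> ('m, 'v::real_vector) vbundle \<Rightarrow> 'm set \<Rightarrow> ('m, 'v) form set" where
  "forms_on M B W = {\<omega>. (\<forall>m\<in>W. alternating_form (fibre B m) (\<omega> m)) \<and>
     (\<forall>e\<in>frames B. \<forall>S\<subseteq>{..<brank B}. smooth_fun_on M (W \<inter> fst e)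
        (\<lambda>m. \<omega> m (map (\<lambda>a. snd e a m) (sorted_list_of_set S))))}"

definition kforms_on ::
    "'m manifold \<Rightarrow> ('m, 'v::real_vector) vbundle \<Rightarrow> nat \<Rightarrow> 'm set \<Rightarrow> ('m, 'v) form set" where
  "kforms_on M B k W =
     {\<omega> \<in> forms_on M B W. \<forall>m\<in>W. \<forall>us. length us \<noteq> k \<longrightarrow> \<omega> m us = 0}"

definition form0 :: "('m \<Rightarrow> real) \<Rightarrow> ('m, 'v) form" where
  "form0 f = (\<lambda>m us. if us = [] then f m else 0)"

definition form1 :: "('m \<Rightarrow> 'v \<Rightarrow> real) \<Rightarrow> ('m, 'v) form" where
  "form1 \<xi> = (\<lambda>m us. case us of [v] \<Rightarrow> \<xi> m v | _ \<Rightarrow> 0)"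

text \<open>A section of \<open>B\<close> as a one-form on the dual bundle, and back.\<close>

definition section_form ::
    "('m, 'v::real_vector) vbundle \<Rightarrow> ('m \<Rightarrow> 'v) \<Rightarrow> ('m, 'v \<Rightarrow> real) form" where
  "section_form B X = form1 (\<lambda>m \<xi>. if \<xi> \<in> dual_space (fibre B m) then \<xi> (X m) else 0)"

definition form_section ::
    "('m, 'v::real_vector) vbundle \<Rightarrow> ('m, 'v \<Rightarrow> real) form \<Rightarrow> 'm \<Rightarrow> 'v" where
  "form_section B \<beta> m =
     (THE v. v \<in> fibre B m \<and> (\<forall>\<xi>\<in>dual_space (fibre B m). \<beta> m [\<xi>] = \<xi> v))"

definition form_cosection :: "('m, 'v) form \<Rightarrow> 'm \<Rightarrow> 'v \<Rightarrow> real" where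
  "form_cosection \<beta> m = (\<lambda>v. \<beta> m [v])"

definition contract :: "('m \<Rightarrow> 'v) \<Rightarrow> ('m, 'v) form \<Rightarrow> ('m, 'v) form" where
  "contract X \<omega> = (\<lambda>m us. \<omega> m (X m # us))"

text \<open>The fibrewise polynomial functions on $T^*\Pi B$ at a fixed base point, in coordinates: real
  polynomials in even generators $x_i^*$ (\<open>i < n\<close>) and odd generators numbered \<open>0, \<dots>, 2r - 1\<close>.
  The odd generator \<open>a < r\<close> is $\xi^a$ and the odd generator \<open>r + a\<close> is $\xi_a^*$. The coefficient
  at \<open>(P, S)\<close> belongs to the product of the $x_i^*$ with \<open>i\<close> in the multiset \<open>P\<close>, followed by
  the product of the odd generators in \<open>S\<close> in increasing order. The pullback from $\Pi B$ is
  the inclusion of the polynomials in the $\xi^a$.\<close>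

type_synonym superpoly = "nat multiset \<times> nat set \<Rightarrow> real"

definition shuffle_sign :: "nat set \<Rightarrow> nat set \<Rightarrow> real" where
  "shuffle_sign S T = (-1) ^ card {(i, j). i \<in> S \<and> j \<in> T \<and> j < i}"

definition superprod :: "superpoly \<Rightarrow> superpoly \<Rightarrow> superpoly"  (infixl "\<odot>" 70) where
  "F \<odot> G = (\<lambda>(P, S). \<Sum>Q | Q \<subseteq># P. \<Sum>T\<in>Pow S.
              shuffle_sign T (S - T) * F (Q, T) * G (P - Q, S - T))"

definition super_one :: superpoly where
  "super_one = (\<lambda>(P, S). if P = {#} \<and> S = {} then 1 else 0)"

definition even_gen :: "nat \<Rightarrow> superpoly" where
  "even_gen i = (\<lambda>(P, S). if P = {#i#} \<and> S = {} then 1 else 0)"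

definition odd_gen :: "nat \<Rightarrow> superpoly" where
  "odd_gen q = (\<lambda>(P, S). if P = {#} \<and> S = {q} then 1 else 0)"

definition d_even :: "nat \<Rightarrow> superpoly \<Rightarrow> superpoly" where
  "d_even i F = (\<lambda>(P, S). real (count P i + 1) * F (add_mset i P, S))"

definition d_left :: "nat \<Rightarrow> superpoly \<Rightarrow> superpoly" where
  "d_left q F = (\<lambda>(P, S). if q \<in> S then 0 else shuffle_sign {q} S * F (P, insert q S))"

definition d_right :: "nat \<Rightarrow> superpoly \<Rightarrow> superpoly" where
  "d_right q F = (\<lambda>(P, S). if q \<in> S then 0 else shuffle_sign S {q} * F (P, insert q S))"

definition d_base :: "'m chart \<Rightarrow> nat \<Rightarrow> ('m \<Rightarrow> superpoly) \<Rightarrow> 'm \<Rightarrow> superpoly" where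
  "d_base c i F m = (\<lambda>z. pd c i (\<lambda>p. F p z) m)"

text \<open>The Poisson bracket with $\{x_i^*, x^j\} = \delta_i^j$ and
  $\{\xi_a^*, \xi^b\} = \{\xi^b, \xi_a^*\} = \delta_a^b$. With right derivatives of the first argument
  and left derivatives of the second one, $\{F, \cdot\}$ is a derivation of the parity of \<open>F\<close>.\<close>

definition poisson ::
    "nat \<Rightarrow> nat \<Rightarrow> 'm chart \<Rightarrow> ('m \<Rightarrow> superpoly) \<Rightarrow> ('m \<Rightarrow> superpoly) \<Rightarrow> 'm \<Rightarrow> superpoly" where
  "poisson n r c F G m =
     (\<Sum>i<n. d_even i (F m) \<odot> d_base c i G m - d_base c i F m \<odot> d_even i (G m)) +
     (\<Sum>a<r. d_right (r + a) (F m) \<odot> d_left a (G m) + d_right a (F m) \<odot> d_left (r + a) (G m))"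

text \<open>The algebra morphism sending $x_j^*$ to \<open>ev j\<close> (assumed even) and the odd generator \<open>q\<close>
  to \<open>od q\<close> (assumed odd).\<close>

definition substitute ::
    "(nat \<Rightarrow> superpoly) \<Rightarrow> (nat \<Rightarrow> superpoly) \<Rightarrow> superpoly \<Rightarrow> superpoly" where
  "substitute ev od F = (\<Sum>(P, S) | F (P, S) \<noteq> 0. F (P, S) *\<^sub>R
     foldr (\<odot>) (map ev (sorted_list_of_multiset P) @ map od (sorted_list_of_set S)) super_one)"

text \<open>A function is the family of its coordinate representations, one for each coordinate chart
  of the base and local frame of the bundle.\<close>

type_synonym ('m, 'v) ctfun = "'m chart \<Rightarrow> ('m, 'v) frame \<Rightarrow> 'm \<Rightarrow> superpoly"

text \<open>Expressions of the Darboux coordinates of \<open>(c', e')\<close> through those of \<open>(c, e)\<close> at \<open>m\<close>.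
  The coordinates of the base $\Pi B$ change by $\xi'^b = e'^b(e_a)\,\xi^a$, and momenta like
  coordinate vector fields, $z'^*_\alpha = (\partial z^\beta/\partial z'^\alpha)\, z_\beta^*$ for
  $z = (x^i, \xi^a)$.\<close>

definition odd_change ::
    "('m, 'v::real_vector) vbundle \<Rightarrow> ('m, 'v) frame \<Rightarrow> ('m, 'v) frame \<Rightarrow> 'm \<Rightarrow>
       nat \<Rightarrow> superpoly" where
  "odd_change B e e' m q = (let r = brank B in
     if q < r then (\<Sum>a<r. coframe B e' q m (snd e a m) *\<^sub>R odd_gen a)
     else (\<Sum>a<r. coframe B e a m (snd e' (q - r) m) *\<^sub>R odd_gen (r + a)))"

definition even_change ::
    "'m manifold \<Rightarrow> ('m, 'v::real_vector) vbundle \<Rightarrow> 'm chart \<Rightarrow> 'm chart \<Rightarrow>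
       ('m, 'v) frame \<Rightarrow> ('m, 'v) frame \<Rightarrow> 'm \<Rightarrow> nat \<Rightarrow> superpoly" where
  "even_change M B c c' e e' m j = (let r = brank B in
     (\<Sum>i<mdim M. pd c' j (\<lambda>p. snd c p i) m *\<^sub>R even_gen i) +
     (\<Sum>a<r. \<Sum>b<r. pd c' j (\<lambda>p. coframe B e a p (snd e' b p)) m *\<^sub>R
        (odd_change B e e' m b \<odot> odd_gen (r + a))))"

definition ctfun ::
    "'m manifold \<Rightarrow> ('m, 'v::real_vector) vbundle \<Rightarrow> ('m, 'v) ctfun \<Rightarrow> bool" where
  "ctfun M B F \<longleftrightarrow>
     (\<forall>c\<in>atlas M. \<forall>e\<in>frames B.
        (\<exists>N. \<forall>m\<in>fst c \<inter> fst e. \<forall>P S. F c e m (P, S) \<noteq> 0 \<longrightarrow>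
           set_mset P \<subseteq> {..<mdim M} \<and> S \<subseteq> {..<2 * brank B} \<and> size P \<le> N) \<and>
        (\<forall>z. smooth_fun_on M (fst c \<inter> fst e) (\<lambda>m. F c e m z))) \<and>
     (\<forall>c\<in>atlas M. \<forall>c'\<in>atlas M. \<forall>e\<in>frames B. \<forall>e'\<in>frames B.
        \<forall>m\<in>fst c \<inter> fst c' \<inter> fst e \<inter> fst e'.
        F c e m = substitute (even_change M B c c' e e' m) (odd_change B e e' m) (F c' e' m))"

definition epsilon_degree :: "nat \<Rightarrow> nat multiset \<times> nat set \<Rightarrow> nat" where
  "epsilon_degree r = (\<lambda>(P, S). size P + card (S \<inter> {r..<2 * r}))"

definition delta_degree :: "nat \<Rightarrow> nat multiset \<times> nat set \<Rightarrow> nat" where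
  "delta_degree r = (\<lambda>(P, S). size P + card (S \<inter> {..<r}))"

definition kappa_homogeneous ::
    "'m manifold \<Rightarrow> ('m, 'v::real_vector) vbundle \<Rightarrow> nat \<Rightarrow> ('m, 'v) ctfun \<Rightarrow> bool" where
  "kappa_homogeneous M B k F \<longleftrightarrow>
     (\<forall>c\<in>atlas M. \<forall>e\<in>frames B. \<forall>m\<in>fst c \<inter> fst e. \<forall>z. F c e m z \<noteq> 0 \<longrightarrow>
        epsilon_degree (brank B) z + delta_degree (brank B) z = k)"

definition proto_bialgebroid ::
    "'m manifold \<Rightarrow> ('m, 'v::real_vector) vbundle \<Rightarrow> ('m, 'v) ctfun \<Rightarrow> bool" where
  "proto_bialgebroid M B \<theta> \<longleftrightarrow> ctfun M B \<theta> \<and> kappa_homogeneous M B 3 \<theta> \<and>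
     (\<forall>c\<in>atlas M. \<forall>e\<in>frames B. \<forall>m\<in>fst c \<inter> fst e.
        poisson (mdim M) (brank B) c (\<theta> c e) (\<theta> c e) m = 0)"

text \<open>The pullback to $T^*\Pi B$ of a form on \<open>B\<close>. The coefficient convention corresponds to
  $\omega(X_1, \dots, X_k) = i_{X_k} \cdots i_{X_1} \omega$ with $i_X = X^a \partial/\partial\xi^a$.\<close>

definition pi_pullback ::
    "('m, 'v::real_vector) vbundle \<Rightarrow> ('m, 'v) form \<Rightarrow> ('m, 'v) ctfun" where
  "pi_pullback B \<omega> c e m = (\<lambda>(P, S). if P = {#} \<and> S \<subseteq> {..<brank B}
     then \<omega> m (map (\<lambda>a. snd e a m) (sorted_list_of_set S)) else 0)"

text \<open>A vector field $v = v^\alpha \partial_\alpha$ on $\Pi B$ is given by its action on functions,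
  including those defined over open subsets of \<open>M\<close> only: \<open>d \<omega> m\<close> is meaningful
  whenever \<open>\<omega>\<close> is smooth near \<open>m\<close>. Its components are $v^\alpha = v(z^\alpha)$ for the
  coordinates $z = (x^i, \xi^a)$, with $\xi^a$ the dual frame.\<close>

type_synonym ('m, 'v) form_op = "('m, 'v) form \<Rightarrow> ('m, 'v) form"

definition even_component ::
    "('m, 'v::real_vector) vbundle \<Rightarrow> ('m, 'v) form_op \<Rightarrow> nat \<Rightarrow> ('m, 'v) ctfun" where
  "even_component B d i c e m = pi_pullback B (d (form0 (\<lambda>p. snd c p i))) c e m"

definition odd_component ::
    "('m, 'v::real_vector) vbundle \<Rightarrow> ('m, 'v) form_op \<Rightarrow> nat \<Rightarrow> ('m, 'v) ctfun" where
  "odd_component B d a c e m = pi_pullback B (d (form1 (coframe B e a))) c e m"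

definition vector_field_Pi ::
    "'m::topological_space manifold \<Rightarrow> ('m, 'v::real_vector) vbundle \<Rightarrow> ('m, 'v) form_op \<Rightarrow> bool"
  where
  "vector_field_Pi M B d \<longleftrightarrow>
     (\<forall>W \<omega>. open W \<and> \<omega> \<in> forms_on M B W \<longrightarrow> d \<omega> \<in> forms_on M B W \<and>
        (\<forall>c\<in>atlas M. \<forall>e\<in>frames B. \<forall>m\<in>W \<inter> fst c \<inter> fst e.
           pi_pullback B (d \<omega>) c e m =
             (\<Sum>i<mdim M. even_component B d i c e m \<odot> d_base c i (pi_pullback B \<omega> c e) m) +
             (\<Sum>a<brank B. odd_component B d a c e m \<odot> d_left a (pi_pullback B \<omega> c e m))))"

definition degree_one ::
    "'m::topological_space manifold \<Rightarrow> ('m, 'v::real_vector) vbundle \<Rightarrow> ('m, 'v) form_op \<Rightarrow> bool"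
  where
  "degree_one M B d \<longleftrightarrow> (\<forall>W k \<omega>. open W \<and> \<omega> \<in> kforms_on M B k W \<longrightarrow>
     d \<omega> \<in> kforms_on M B (Suc k) W)"

definition hamiltonian_lift ::
    "'m manifold \<Rightarrow> ('m, 'v::real_vector) vbundle \<Rightarrow> ('m, 'v) form_op \<Rightarrow> ('m, 'v) ctfun" where
  "hamiltonian_lift M B d c e m =
     (\<Sum>i<mdim M. even_component B d i c e m \<odot> even_gen i) +
     (\<Sum>a<brank B. odd_component B d a c e m \<odot> odd_gen (brank B + a))"

text \<open>The pullback $L^*$ from $T^*\Pi B^*$ to $T^*\Pi B$: the odd generators of the former are
  $\theta_a$ (number \<open>a\<close>) and $\theta_*^a$ (number \<open>r + a\<close>), and $L^*\theta_a = \xi_a^*$,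
  $L^*\theta_*^a = \xi^a$.\<close>

definition legendre_pullback ::
    "('m, 'v::real_vector) vbundle \<Rightarrow> ('m, 'v \<Rightarrow> real) ctfun \<Rightarrow> ('m, 'v) ctfun" where
  "legendre_pullback B G c e m = substitute even_gen
     (\<lambda>q. if q < brank B then odd_gen (brank B + q) else odd_gen (q - brank B))
     (G c (dual_frame B e) m)"

definition lie_derivative ::
    "('m, 'v) form_op \<Rightarrow> ('m \<Rightarrow> 'v) \<Rightarrow> ('m, 'v) form \<Rightarrow> ('m, 'v) form" where
  "lie_derivative d X \<omega> = d (contract X \<omega>) + contract X (d \<omega>)"

definition anchor_of ::
    "('m, 'v) form_op \<Rightarrow> ('m \<Rightarrow> 'v) \<Rightarrow> ('m \<Rightarrow> real) \<Rightarrow> 'm \<Rightarrow> real" where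
  "anchor_of d X f m = d (form0 f) m [X m]"

text \<open>The value of $[X, Y]$ at \<open>m\<close> is determined by its pairing with the sections \<open>\<xi>\<close> of the dual
  bundle defined near \<open>m\<close>.\<close>

definition bracket_of ::
    "'m::topological_space manifold \<Rightarrow> ('m, 'v::real_vector) vbundle \<Rightarrow> ('m, 'v) form_op \<Rightarrow>
       ('m \<Rightarrow> 'v) \<Rightarrow> ('m \<Rightarrow> 'v) \<Rightarrow> 'm \<Rightarrow> 'v" where
  "bracket_of M B d X Y m = (THE v. v \<in> fibre B m \<and>
     (\<forall>W \<xi>. open W \<and> m \<in> W \<and> \<xi> \<in> sections_on M (dual_bundle B) W \<longrightarrow>
        \<xi> m v = anchor_of d X (\<lambda>p. \<xi> p (Y p)) m - anchor_of d Y (\<lambda>p. \<xi> p (X p)) m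
                - d (form1 \<xi>) m [X m, Y m]))"

definition double_pairing ::
    "'m \<Rightarrow> 'v \<times> ('v \<Rightarrow> real) \<Rightarrow> 'v \<times> ('v \<Rightarrow> real) \<Rightarrow> real" where
  "double_pairing m = (\<lambda>(X, \<xi>) (Y, \<eta>). \<eta> X + \<xi> Y)"

definition double_circ ::
    "'m::topological_space manifold \<Rightarrow> ('m, 'v::real_vector) vbundle \<Rightarrow> ('m, 'v) form_op \<Rightarrow>
     ('m, 'v \<Rightarrow> real) form_op \<Rightarrow> ('m, 'v) form \<Rightarrow> ('m, 'v \<Rightarrow> real) form \<Rightarrow>
     ('m \<Rightarrow> 'v \<times> ('v \<Rightarrow> real)) \<Rightarrow> ('m \<Rightarrow> 'v \<times> ('v \<Rightarrow> real)) \<Rightarrow> 'm \<Rightarrow> 'v \<times> ('v \<Rightarrow> real)" where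
  "double_circ M A dA dA' \<phi> \<psi> e\<^sub>1 e\<^sub>2 =
     (let X = fst \<circ> e\<^sub>1; \<xi> = snd \<circ> e\<^sub>1; Y = fst \<circ> e\<^sub>2; \<eta> = snd \<circ> e\<^sub>2 in
      (\<lambda>m. (bracket_of M A dA X Y m
              + form_section A (lie_derivative dA' \<xi> (section_form A Y)) m
              - form_section A (contract \<eta> (dA' (section_form A X))) m
              - form_section A (contract \<eta> (contract \<xi> \<psi>)) m,
            bracket_of M (dual_bundle A) dA' \<xi> \<eta> m
              + form_cosection (lie_derivative dA X (form1 \<eta>)) m
              - form_cosection (contract Y (dA (form1 \<xi>))) m
              - form_cosection (contract Y (contract X \<phi>)) m)))"

definition double_D ::
    "('m, 'v::real_vector) vbundle \<Rightarrow> ('m, 'v) form_op \<Rightarrow> ('m, 'v \<Rightarrow> real) form_op \<Rightarrow>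
       ('m \<Rightarrow> real) \<Rightarrow> 'm \<Rightarrow> 'v \<times> ('v \<Rightarrow> real)" where
  "double_D A dA dA' f m =
     (form_section A (dA' (form0 f)) m, form_cosection (dA (form0 f)) m)"

definition double_anchor ::
    "'m manifold \<Rightarrow> ('m, 'v::real_vector) vbundle \<Rightarrow> ('m, 'v) form_op \<Rightarrow>
       ('m, 'v \<Rightarrow> real) form_op \<Rightarrow> 'm \<Rightarrow> 'v \<times> ('v \<Rightarrow> real) \<Rightarrow> ('m \<Rightarrow> real) \<Rightarrow> real" where
  "double_anchor M A dA dA' m u f =
     (if f \<in> smooth_functions M then double_pairing m (double_D A dA dA' f m) u else 0)"

end

theory Submission
  imports Defs
begin

text \<open>
  Over the common domain of a chart and a frame \<open>e\<^sub>a\<close> of \<open>A\<close>, join \<open>e\<^sub>a\<close> and the dual frame \<open>e\<^sup>a\<close> to a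
  frame \<open>E\<^sub>I\<close>, \<open>I < 2r\<close>, of \<open>A \<oplus> A\<^sup>*\<close>. The pairing is constant in it: \<open>E\<^sub>I\<close> pairs to \<open>1\<close> with \<open>E\<^sub>I\<^sub>'\<close>, where
  \<open>I \<mapsto> I'\<close> exchanges \<open>e\<^sub>a\<close> and \<open>e\<^sup>a\<close>, and to \<open>0\<close> with the other frame vectors. Expanding the formula for
  the bracket shows that all its terms combine to
  \<open>(s \<circ> t)\<^sub>K = \<rho>(s) t\<^sub>K - \<rho>(t) s\<^sub>K + \<Sum>\<^sub>I \<rho>\<^sub>K\<^sub>'(s\<^sub>I) t\<^sub>I\<^sub>' + \<Sum>\<^sub>I\<^sub>J T\<^sub>I\<^sub>J\<^sub>K\<^sub>' s\<^sub>I t\<^sub>J\<close>,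
  with \<open>\<rho>\<^sub>I\<close> the anchor of \<open>E\<^sub>I\<close> and one totally antisymmetric array \<open>T\<close>, built from the structure
  functions of the two brackets and from \<open>- \<phi>\<close> and \<open>- \<psi>\<close> (\<open>loc_circ\<close>).

  The same functions are the coefficients of \<open>\<theta>\<close>: with \<open>\<eta>\<^sup>I\<close> the odd coordinates \<open>\<xi>\<^sup>a, \<xi>\<^sub>a\<^sup>*\<close>, the
  coefficient of \<open>x\<^sub>i\<^sup>* \<eta>\<^sup>I\<close> is \<open>\<rho>\<^sub>I\<^sup>i\<close> and the coefficient of \<open>\<eta>\<^sup>I \<eta>\<^sup>J \<eta>\<^sup>K\<close> for \<open>I < J < K\<close> is \<open>- T\<^sub>I\<^sub>J\<^sub>K\<close>
  (\<open>theta_momentum_coeff\<close>, \<open>theta_cubic_coeff\<close>). Sorted by the degree in the momenta \<open>x\<^sub>i\<^sup>*\<close>, the equation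
  \<open>{\<theta>, \<theta>} = 0\<close> therefore consists of three identities: \<open>\<Sum>\<^sub>I \<rho>\<^sub>I\<^sup>i \<rho>\<^sub>I\<^sub>'\<^sup>j = 0\<close>
  (\<open>anchor_coeff_isotropic\<close>), \<open>[\<rho>\<^sub>I, \<rho>\<^sub>J] = \<Sum>\<^sub>K T\<^sub>I\<^sub>J\<^sub>K \<rho>\<^sub>K\<^sub>'\<close> (\<open>anchor_coeff_bracket\<close>), and an identity
  relating the derivatives of \<open>T\<close> to its square (\<open>cubic_coeff_quadratic\<close>).

  What remains is algebra over the ring of functions on the domain, with the derivations \<open>\<rho>\<^sub>I\<close>; this is
  the locale \<open>courant_frame\<close>. The Leibniz rule, the invariance of the pairing and the formula for the
  symmetric part of the bracket follow from the antisymmetry of \<open>T\<close>. The first two identities make the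
  anchor compatible with brackets (\<open>anch_circ\<close>) and give \<open>\<D>f \<circ> t = 0\<close> (\<open>circ_grad_left\<close>). From this
  the Jacobiator is antisymmetric under adjacent transpositions and linear over functions, so
  that it suffices to evaluate it on the frame, where it vanishes by the third identity (\<open>jacobi\<close>).
\<close>

section \<open>Smooth functions in charts\<close>

text \<open>The mean value theorem in each variable in turn.\<close>

lemma double_mean_value:
  fixes F F1 F12 :: "real \<Rightarrow> real \<Rightarrow> real"
  assumes h: "0 < h"
    and 1: "\<And>s t. \<lbrakk>s \<in> {a..a+h}; t \<in> {b..b+h}\<rbrakk> \<Longrightarrow> ((\<lambda>s. F s t) has_real_derivative F1 s t) (at s)"
    and 2: "\<And>s t. \<lbrakk>s \<in> {a..a+h}; t \<in> {b..b+h}\<rbrakk> \<Longrightarrow> ((\<lambda>t. F1 s t) has_real_derivative F12 s t) (at t)"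
  obtains s t where "s \<in> {a..a+h}" "t \<in> {b..b+h}"
    "F (a+h) (b+h) - F (a+h) b - F a (b+h) + F a b = h * h * F12 s t"
proof -
  have "\<exists>s>a. s < a+h \<and> (F (a+h) (b+h) - F (a+h) b) - (F a (b+h) - F a b)
      = (a+h-a) * (F1 s (b+h) - F1 s b)"
    by (rule MVT2) (use h in \<open>auto intro!: derivative_intros 1\<close>)
  then obtain s where s: "a < s" "s < a+h" and
    e1: "(F (a+h) (b+h) - F (a+h) b) - (F a (b+h) - F a b) = h * (F1 s (b+h) - F1 s b)"
    by auto
  have "\<exists>t>b. t < b+h \<and> F1 s (b+h) - F1 s b = (b+h-b) * F12 s t"
    by (rule MVT2) (use h s in \<open>auto intro!: 2\<close>)
  then obtain t where t: "b < t" "t < b+h" and e2: "F1 s (b+h) - F1 s b = h * F12 s t" by auto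
  show thesis
    by (rule that[of s t]) (use s t e1 e2 in auto)
qed

text \<open>The second difference is symmetric in the two variables, so both mixed derivatives take,
  near \<open>(a, b)\<close>, the same value; by continuity they agree at \<open>(a, b)\<close>.\<close>

lemma mixed_partials_eq:
  fixes F F1 F2 F12 F21 :: "real \<Rightarrow> real \<Rightarrow> real"
  assumes W: "open W" "(a, b) \<in> W"
    and 1: "\<And>s t. (s, t) \<in> W \<Longrightarrow> ((\<lambda>s. F s t) has_real_derivative F1 s t) (at s)"
    and 2: "\<And>s t. (s, t) \<in> W \<Longrightarrow> ((\<lambda>t. F s t) has_real_derivative F2 s t) (at t)"
    and 12: "\<And>s t. (s, t) \<in> W \<Longrightarrow> ((\<lambda>t. F1 s t) has_real_derivative F12 s t) (at t)"
    and 21: "\<And>s t. (s, t) \<in> W \<Longrightarrow> ((\<lambda>s. F2 s t) has_real_derivative F21 s t) (at s)"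
    and c12: "continuous_on W (\<lambda>(s, t). F12 s t)"
    and c21: "continuous_on W (\<lambda>(s, t). F21 s t)"
  shows "F12 a b = F21 a b"
proof (rule ccontr)
  assume ne: "F12 a b \<noteq> F21 a b"
  define e where "e = \<bar>F12 a b - F21 a b\<bar> / 2"
  have e: "e > 0" using ne by (simp add: e_def)
  have "isCont (\<lambda>(s, t). F12 s t) (a, b)" "isCont (\<lambda>(s, t). F21 s t) (a, b)"
    using c12 c21 W by (auto simp: continuous_on_eq_continuous_at)
  then obtain d1 d2 where d: "d1 > 0" "d2 > 0"
    and d1: "\<And>s t. dist (s, t) (a, b) < d1 \<Longrightarrow> dist (F12 s t) (F12 a b) < e"
    and d2: "\<And>s t. dist (s, t) (a, b) < d2 \<Longrightarrow> dist (F21 s t) (F21 a b) < e"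
    unfolding continuous_at_eps_delta using e by (smt (verit, best) case_prod_conv)
  obtain d3 where d3: "d3 > 0" "ball (a, b) d3 \<subseteq> W" using W by (meson openE)
  define h where "h = Min {d1, d2, d3} / 4"
  have h: "h > 0" "4 * h \<le> d1" "4 * h \<le> d2" "4 * h \<le> d3" using d d3 by (auto simp: h_def)
  have near: "dist (s, t) (a, b) < 4 * h" if "s \<in> {a..a+h}" "t \<in> {b..b+h}" for s t
  proof -
    have "dist (s, t) (a, b) \<le> dist s a + dist t b"
      unfolding dist_Pair_Pair using sqrt_sum_squares_le_sum_abs[of "dist s a" "dist t b"] by simp
    also have "\<dots> \<le> 2 * h" using that by (auto simp: dist_real_def)
    finally show ?thesis using h by simp
  qed
  have inW: "(s, t) \<in> W" if "s \<in> {a..a+h}" "t \<in> {b..b+h}" for s t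
    using near[OF that] h d3 by (auto simp: subset_iff mem_ball dist_commute)
  obtain s t where st: "s \<in> {a..a+h}" "t \<in> {b..b+h}"
    and E1: "F (a+h) (b+h) - F (a+h) b - F a (b+h) + F a b = h * h * F12 s t"
    by (rule double_mean_value[of h a b F F1 F12]) (use h 1 12 inW in auto)
  obtain t' s' where st': "t' \<in> {b..b+h}" "s' \<in> {a..a+h}"
    and E2: "F (a+h) (b+h) - F a (b+h) - F (a+h) b + F a b = h * h * F21 s' t'"
    by (rule double_mean_value[of h b a "\<lambda>t s. F s t" "\<lambda>t s. F2 s t" "\<lambda>t s. F21 s t"])
      (use h 2 21 inW in auto)
  have "h * h * F12 s t = h * h * F21 s' t'" using E1 E2 by linarith
  then have eq: "F12 s t = F21 s' t'" using h by simp
  have "dist (F12 s t) (F12 a b) < e" using near[OF st] h by (intro d1) simp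
  moreover have "dist (F21 s' t') (F21 a b) < e" using near[OF st'(2,1)] h by (intro d2) simp
  ultimately have "\<bar>F12 a b - F21 a b\<bar> < 2 * e" using eq by (simp add: dist_real_def)
  then show False by (simp add: e_def)
qed

lemma Euclidean_space_top_of_set: "Euclidean_space n = top_of_set (topspace (Euclidean_space n))"
  by (simp add: Euclidean_space_def euclidean_product_topology)

lemma openin_Euclidean_space:
  assumes "openin (Euclidean_space n) V"
  shows "\<exists>W. open W \<and> V = {x. \<forall>i\<ge>n. x i = 0} \<inter> W"
proof -
  have "topspace (Euclidean_space n) = {x. \<forall>i\<ge>n. x i = 0}"
    by (simp add: topspace_Euclidean_space)
  then have "openin (top_of_set {x. \<forall>i\<ge>n. x i = 0}) V"
    using assms Euclidean_space_top_of_set[of n] by simp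
  then show ?thesis by (auto simp: openin_open)
qed

lemma continuous_fun_upd: "continuous_on UNIV (\<lambda>t::real. (x::nat \<Rightarrow> real)(i := t))"
proof -
  have "continuous_on UNIV (\<lambda>t::real. if k = i then t else x k)" for k
    by (cases "k = i") (auto intro!: continuous_intros)
  then show ?thesis by (intro continuous_on_coordinatewise_then_product) (simp add: fun_upd_def)
qed

lemma continuous_fun_upd2: "continuous_on UNIV (\<lambda>(s::real, t::real). (x::nat \<Rightarrow> real)(i := s, j := t))"
proof -
  have "continuous_on UNIV (\<lambda>p::real\<times>real. if k = j then snd p else if k = i then fst p else x k)" for k
    by (cases "k = j"; cases "k = i") (auto intro!: continuous_intros)
  then have "continuous_on UNIV (\<lambda>p::real\<times>real. (x(i := fst p, j := snd p)))"
    by (intro continuous_on_coordinatewise_then_product) (simp add: fun_upd_def)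
  then show ?thesis by (simp add: case_prod_beta')
qed

text \<open>Partial derivatives only see the coordinate lines through a point. An open subset of the
  Euclidean space of dimension \<open>n\<close> is not open among all sequences, but it meets the lines in the
  first \<open>n\<close> directions in open sets.\<close>

lemma open_slice:
  assumes "openin (Euclidean_space n) V" "x \<in> V" "i < n"
  shows "open {t. x(i := t) \<in> V}"
proof -
  obtain W where W: "open W" "V = {x. \<forall>i\<ge>n. x i = 0} \<inter> W" using openin_Euclidean_space[OF assms(1)] by blast
  have "open ((\<lambda>t. x(i := t)) -` W)"
    by (rule open_vimage[OF W(1) continuous_fun_upd])
  moreover have "{t. x(i := t) \<in> V} = (\<lambda>t. x(i := t)) -` W" using assms W by auto
  ultimately show ?thesis by simp
qed

lemma open_slice2:
  assumes "openin (Euclidean_space n) V" "x \<in> V" "i < n" "j < n"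
  shows "open {(s, t). x(i := s, j := t) \<in> V}"
proof -
  obtain W where W: "open W" "V = {x. \<forall>i\<ge>n. x i = 0} \<inter> W" using openin_Euclidean_space[OF assms(1)] by blast
  have "open ((\<lambda>(s, t). x(i := s, j := t)) -` W)"
    by (rule open_vimage[OF W(1) continuous_fun_upd2])
  moreover have "{(s, t). x(i := s, j := t) \<in> V} = (\<lambda>(s, t). x(i := s, j := t)) -` W" using assms W by auto
  ultimately show ?thesis by simp
qed

lemma eventually_slice:
  assumes "openin (Euclidean_space n) V" "x \<in> V" "i < n"
  shows "\<forall>\<^sub>F t in nhds (x i). x(i := t) \<in> V"
  using open_slice[OF assms] assms(2) by (auto simp: eventually_nhds)

lemma partial_cong:
  assumes "openin (Euclidean_space n) V" "x \<in> V" "i < n" "\<And>y. y \<in> V \<Longrightarrow> f y = g y"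
  shows "partial i f x = partial i g x"
  unfolding partial_def
  by (rule deriv_cong_ev) (use eventually_slice[OF assms(1-3)] assms(4) in \<open>auto elim: eventually_mono\<close>)

lemma slice_differentiable_cong:
  assumes "openin (Euclidean_space n) V" "x \<in> V" "i < n" "\<And>y. y \<in> V \<Longrightarrow> f y = g y"
    and d: "(\<lambda>t. f (x(i := t))) field_differentiable (at (x i))"
  shows "(\<lambda>t. g (x(i := t))) field_differentiable (at (x i))"
proof -
  have ev: "\<forall>\<^sub>F t in nhds (x i). f (x(i := t)) = g (x(i := t))"
    using eventually_slice[OF assms(1-3)] by (rule eventually_mono) (use assms(4) in auto)
  have "(\<lambda>t. f (x(i := t))) field_differentiable (at (x i)) \<longleftrightarrow>
      (\<lambda>t. g (x(i := t))) field_differentiable (at (x i))"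
    unfolding field_differentiable_def using DERIV_cong_ev[OF refl ev refl] by metis
  then show ?thesis using d by simp
qed

lemma Ck_on_cong:
  assumes "openin (Euclidean_space n) V" "\<And>y. y \<in> V \<Longrightarrow> f y = g y" "Ck_on n k V f"
  shows "Ck_on n k V g"
  using assms(2,3)
proof (induction k arbitrary: f g)
  case 0 then show ?case using continuous_on_cong[of V V f g] by simp
next
  case (Suc k)
  show ?case unfolding Ck_on.simps
  proof (intro conjI allI impI ballI)
    show "continuous_on V g" using Suc.prems continuous_on_cong[of V V f g] by simp
  next
    fix i x assume "i < n" "x \<in> V"
    then show "(\<lambda>t. g (x(i := t))) field_differentiable at (x i)"
      using slice_differentiable_cong[OF assms(1), of x i f g] Suc.prems by simp
  next
    fix i assume i: "i < n"
    show "Ck_on n k V (partial i g)"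
      by (rule Suc.IH[of "partial i f"])
        (use Suc.prems partial_cong[OF assms(1) _ i, of _ f g] i in auto)
  qed
qed

lemma Ck_on_mono: "Ck_on n k V f \<Longrightarrow> V' \<subseteq> V \<Longrightarrow> Ck_on n k V' f"
  by (induction k arbitrary: f) (auto intro: continuous_on_subset)

lemma Ck_on_SucD: "Ck_on n (Suc k) V f \<Longrightarrow> Ck_on n k V f"
  by (induction k arbitrary: f) auto

text \<open>Smoothness on a manifold will be established frame by frame, hence only near each point.\<close>

lemma Ck_on_local:
  assumes "openin (Euclidean_space n) V"
    and "\<And>x. x \<in> V \<Longrightarrow> \<exists>V'. x \<in> V' \<and> openin (Euclidean_space n) V' \<and> Ck_on n k V' f"
  shows "Ck_on n k V f"
  using assms(2)
proof (induction k arbitrary: f)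
  have cont: "continuous_on V f"
    if *: "\<And>x. x \<in> V \<Longrightarrow> \<exists>V'. x \<in> V' \<and> openin (Euclidean_space n) V' \<and> continuous_on V' f"
    for f :: "(nat \<Rightarrow> real) \<Rightarrow> real"
    unfolding continuous_on_eq_continuous_within
  proof
    fix x assume x: "x \<in> V"
    obtain V' where V': "x \<in> V'" "openin (Euclidean_space n) V'" "continuous_on V' f" using *[OF x] by blast
    obtain W' where W': "open W'" "V' = {x. \<forall>i\<ge>n. x i = 0} \<inter> W'" using openin_Euclidean_space[OF V'(2)] by blast
    obtain W where W: "V = {x. \<forall>i\<ge>n. x i = 0} \<inter> W" using openin_Euclidean_space[OF assms(1)] by blast
    have "continuous (at x within V') f" using V' by (simp add: continuous_on_eq_continuous_within)
    then have "continuous (at x within (V \<inter> W')) f"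
      by (rule continuous_within_subset) (use W W' in auto)
    moreover have "at x within (V \<inter> W') = at x within V"
      by (rule at_within_nhd[of x W']) (use W' V' in auto)
    ultimately show "continuous (at x within V) f" by (simp add: continuous_within)
  qed
  {
    case 0 then show ?case using cont[of f] by simp
  next
    case (Suc k)
    show ?case unfolding Ck_on.simps
    proof (intro conjI allI impI ballI)
      show "continuous_on V f" by (rule cont) (use Suc.prems in fastforce)
    next
      fix i x assume "i < n" "x \<in> V"
      then show "(\<lambda>t. f (x(i := t))) field_differentiable at (x i)" using Suc.prems[of x] by auto
    next
      fix i assume i: "i < n"
      show "Ck_on n k V (partial i f)"
        by (rule Suc.IH) (use Suc.prems i in fastforce)
    qed
  }
qed

lemma partial_const: "partial i (\<lambda>_. c) x = 0"
  by (simp add: partial_def)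

lemma Ck_on_const: "Ck_on n k V (\<lambda>_. c)"
  by (induction k arbitrary: c) (auto simp: partial_const[abs_def])

context
  fixes f g :: "(nat \<Rightarrow> real) \<Rightarrow> real" and i x
  assumes f: "(\<lambda>t. f (x(i := t))) field_differentiable (at (x i))"
    and g: "(\<lambda>t. g (x(i := t))) field_differentiable (at (x i))"
begin

lemma partial_add: "partial i (\<lambda>x. f x + g x) x = partial i f x + partial i g x"
  unfolding partial_def using f g by (rule deriv_add)

lemma partial_mult: "partial i (\<lambda>x. f x * g x) x = partial i f x * g x + f x * partial i g x"
  unfolding partial_def using deriv_mult[OF f g] by simp

end

lemma Ck_on_add:
  assumes "openin (Euclidean_space n) V" "Ck_on n k V f" "Ck_on n k V g"
  shows "Ck_on n k V (\<lambda>x. f x + g x)"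
  using assms(2,3)
proof (induction k arbitrary: f g)
  case 0 then show ?case by (simp add: continuous_on_add)
next
  case (Suc k)
  show ?case unfolding Ck_on.simps
  proof (intro conjI allI impI ballI)
    show "continuous_on V (\<lambda>x. f x + g x)" using Suc.prems by (simp add: continuous_on_add)
  next
    fix i x assume "i < n" "x \<in> V"
    then show "(\<lambda>t. f (x(i := t)) + g (x(i := t))) field_differentiable at (x i)"
      using Suc.prems by (intro field_differentiable_add) auto
  next
    fix i assume i: "i < n"
    show "Ck_on n k V (partial i (\<lambda>x. f x + g x))"
    proof (rule Ck_on_cong[OF assms(1)])
      show "Ck_on n k V (\<lambda>x. partial i f x + partial i g x)"
        using Suc i by auto
    qed (use Suc.prems i in \<open>simp add: partial_add\<close>)
  qed
qed

lemma Ck_on_mult: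
  assumes "openin (Euclidean_space n) V" "Ck_on n k V f" "Ck_on n k V g"
  shows "Ck_on n k V (\<lambda>x. f x * g x)"
  using assms(2,3)
proof (induction k arbitrary: f g)
  case 0 then show ?case by (simp add: continuous_on_mult)
next
  case (Suc k)
  have fg: "Ck_on n k V f" "Ck_on n k V g" using Suc.prems Ck_on_SucD by blast+
  show ?case unfolding Ck_on.simps
  proof (intro conjI allI impI ballI)
    show "continuous_on V (\<lambda>x. f x * g x)" using Suc.prems by (simp add: continuous_on_mult)
  next
    fix i x assume "i < n" "x \<in> V"
    then show "(\<lambda>t. f (x(i := t)) * g (x(i := t))) field_differentiable at (x i)"
      using Suc.prems by (intro field_differentiable_mult) auto
  next
    fix i assume i: "i < n"
    show "Ck_on n k V (partial i (\<lambda>x. f x * g x))"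
    proof (rule Ck_on_cong[OF assms(1)])
      show "Ck_on n k V (\<lambda>x. partial i f x * g x + f x * partial i g x)"
        using Suc.IH Suc.prems fg i by (intro Ck_on_add[OF assms(1)]) auto
    qed (use Suc.prems i in \<open>simp add: partial_mult\<close>)
  qed
qed

lemma smooth_on_const: "smooth_on n V (\<lambda>_. c)"
  by (simp add: smooth_on_def Ck_on_const)

lemma smooth_on_add: "\<lbrakk>openin (Euclidean_space n) V; smooth_on n V f; smooth_on n V g\<rbrakk>
    \<Longrightarrow> smooth_on n V (\<lambda>x. f x + g x)"
  by (simp add: smooth_on_def Ck_on_add)

lemma smooth_on_mult: "\<lbrakk>openin (Euclidean_space n) V; smooth_on n V f; smooth_on n V g\<rbrakk>
    \<Longrightarrow> smooth_on n V (\<lambda>x. f x * g x)"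
  by (simp add: smooth_on_def Ck_on_mult)

lemma smooth_on_cong: "\<lbrakk>openin (Euclidean_space n) V; smooth_on n V f; \<And>y. y \<in> V \<Longrightarrow> f y = g y\<rbrakk>
    \<Longrightarrow> smooth_on n V g"
  unfolding smooth_on_def using Ck_on_cong by blast

lemma smooth_on_mono: "\<lbrakk>smooth_on n V f; V' \<subseteq> V\<rbrakk> \<Longrightarrow> smooth_on n V' f"
  unfolding smooth_on_def using Ck_on_mono by blast

lemma smooth_on_local:
  assumes "openin (Euclidean_space n) V"
    and "\<And>x. x \<in> V \<Longrightarrow> \<exists>V'. x \<in> V' \<and> openin (Euclidean_space n) V' \<and> smooth_on n V' f"
  shows "smooth_on n V f"
  unfolding smooth_on_def
  by (intro allI Ck_on_local[OF assms(1)]) (use assms(2) in \<open>fastforce simp: smooth_on_def\<close>)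

lemma smooth_on_slice: "\<lbrakk>smooth_on n V f; x \<in> V; i < n\<rbrakk>
    \<Longrightarrow> (\<lambda>t. f (x(i := t))) field_differentiable (at (x i))"
  unfolding smooth_on_def using Ck_on.simps(2)[of n 0 V f] by blast

lemma smooth_on_partial: "\<lbrakk>smooth_on n V f; i < n\<rbrakk> \<Longrightarrow> smooth_on n V (partial i f)"
  unfolding smooth_on_def using Ck_on.simps(2)[of n _ V f] by blast

lemma smooth_on_continuous: "smooth_on n V f \<Longrightarrow> continuous_on V f"
  unfolding smooth_on_def using Ck_on.simps(1)[of n V f] by blast

lemma partial_commute:
  assumes V: "openin (Euclidean_space n) V" and f: "smooth_on n V f" and x: "x \<in> V"
    and ij: "i < n" "j < n"
  shows "partial i (partial j f) x = partial j (partial i f) x"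
proof (cases "i = j")
  case False
  define W where "W = {(s, t). x(i := s, j := t) \<in> V}"
  have der: "((\<lambda>t. g (y(k := t))) has_real_derivative partial k g y) (at (y k))"
    if "smooth_on n V g" "y \<in> V" "k < n" for g y k
    using smooth_on_slice[OF that] by (simp add: partial_def DERIV_deriv_iff_field_differentiable)
  have cont: "continuous_on W (\<lambda>(s, t). g (x(i := s, j := t)))" if "smooth_on n V g" for g
  proof -
    have "continuous_on W (g \<circ> (\<lambda>(s, t). x(i := s, j := t)))"
    proof (rule continuous_on_compose)
      show "continuous_on W (\<lambda>(s, t). x(i := s, j := t))"
        using continuous_on_subset[OF continuous_fun_upd2] by blast
      show "continuous_on ((\<lambda>(s, t). x(i := s, j := t)) ` W) g"
        by (rule continuous_on_subset[OF smooth_on_continuous[OF that]]) (auto simp: W_def)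
    qed
    then show ?thesis by (simp add: comp_def case_prod_beta')
  qed
  have d1: "((\<lambda>s. g (x(i := s, j := t))) has_real_derivative partial i g (x(i := s, j := t))) (at s)"
    and d2: "((\<lambda>t. g (x(i := s, j := t))) has_real_derivative partial j g (x(i := s, j := t))) (at t)"
    if "smooth_on n V g" "(s, t) \<in> W" for g s t
    using der[of g "x(i := s, j := t)" i] der[of g "x(i := s, j := t)" j] that False ij
    by (auto simp: W_def fun_upd_twist)
  have "partial j (partial i f) (x(i := x i, j := x j)) = partial i (partial j f) (x(i := x i, j := x j))"
  proof (rule mixed_partials_eq[of W "x i" "x j" "\<lambda>s t. f (x(i := s, j := t))"
        "\<lambda>s t. partial i f (x(i := s, j := t))" "\<lambda>s t. partial j f (x(i := s, j := t))"])
    show "open W" unfolding W_def by (rule open_slice2[OF V x ij])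
    show "(x i, x j) \<in> W" using x by (simp add: W_def)
  qed (rule d1 d2 cont smooth_on_partial f ij | assumption)+
  then show ?thesis by simp
qed simp

lemma smooth_manifold_chart:
  assumes "smooth_manifold M" "c \<in> atlas M"
  shows "open (fst c)" "openin (Euclidean_space (mdim M)) (snd c ` fst c)"
    "\<And>m. m \<in> fst c \<Longrightarrow> chart_inv c (snd c m) = m"
  using assms by (auto simp: smooth_manifold_def homeomorphism_def)

lemma openin_chart_image:
  assumes "smooth_manifold M" "c \<in> atlas M" "open W"
  shows "openin (Euclidean_space (mdim M)) (snd c ` (fst c \<inter> W))"
proof -
  have h: "homeomorphism (fst c) (snd c ` fst c) (snd c) (chart_inv c)" "open (fst c)"
    and o: "openin (Euclidean_space (mdim M)) (snd c ` fst c)"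
    using assms by (auto simp: smooth_manifold_def)
  have "openin (top_of_set (fst c)) (fst c \<inter> W)" using assms(3) by (simp add: openin_open_Int)
  then have "openin (top_of_set (snd c ` fst c)) (snd c ` (fst c \<inter> W))"
    using homeomorphism_imp_open_map[OF h(1)] by blast
  moreover have "snd c ` fst c \<subseteq> topspace (Euclidean_space (mdim M))"
    using o by (rule openin_subset)
  ultimately have "openin (subtopology (Euclidean_space (mdim M)) (snd c ` fst c)) (snd c ` (fst c \<inter> W))"
    by (subst Euclidean_space_top_of_set) (simp add: subtopology_subtopology inf_absorb2)
  then show ?thesis using o by (simp add: openin_open_subtopology)
qed

text \<open>The next notions describe the smooth functions on the domain \<open>U\<close> of one chart as a commutative
  ring with the commuting derivations \<open>\<partial>/\<partial>x\<^sup>i\<close>. Functions are extended by \<open>0\<close> outside \<open>U\<close>, so that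
  identities on \<open>U\<close> become equalities in the ring of all functions on the manifold.\<close>

definition smooth_in_chart :: "'m manifold \<Rightarrow> 'm chart \<Rightarrow> 'm set \<Rightarrow> ('m \<Rightarrow> real) \<Rightarrow> bool" where
  "smooth_in_chart M c U f \<longleftrightarrow> smooth_on (mdim M) (snd c ` U) (\<lambda>y. f (chart_inv c y))"

lemma smooth_fun_on_chart: "smooth_fun_on M W f \<longleftrightarrow> (\<forall>c\<in>atlas M. smooth_in_chart M c (fst c \<inter> W) f)"
  by (simp add: smooth_fun_on_def smooth_in_chart_def)

definition restrict_fun :: "'m set \<Rightarrow> ('m \<Rightarrow> real) \<Rightarrow> 'm \<Rightarrow> real" where
  "restrict_fun U f = (\<lambda>m. if m \<in> U then f m else 0)"

definition chart_funs :: "'m manifold \<Rightarrow> 'm chart \<Rightarrow> 'm set \<Rightarrow> ('m \<Rightarrow> real) set" where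
  "chart_funs M c U = {f. (\<forall>m. m \<notin> U \<longrightarrow> f m = 0) \<and> smooth_in_chart M c U f}"

definition chart_deriv :: "'m chart \<Rightarrow> 'm set \<Rightarrow> nat \<Rightarrow> ('m \<Rightarrow> real) \<Rightarrow> 'm \<Rightarrow> real" where
  "chart_deriv c U i f = restrict_fun U (pd c i f)"

locale chart_domain =
  fixes M :: "'m::{t2_space,second_countable_topology} manifold" and c :: "'m chart" and U :: "'m set"
  assumes smooth_manifold: "smooth_manifold M" and chart: "c \<in> atlas M"
    and open_domain: "open U" and domain_subset: "U \<subseteq> fst c"
begin

lemma chart_inv_chart [simp]: "m \<in> U \<Longrightarrow> chart_inv c (snd c m) = m"
  using smooth_manifold_chart(3)[OF smooth_manifold chart] domain_subset by blast

lemma openin_image: "openin (Euclidean_space (mdim M)) (snd c ` U)"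
  using openin_chart_image[OF smooth_manifold chart open_domain] domain_subset by (simp add: inf_absorb2)

lemma smooth_in_chart_cong:
  "\<lbrakk>smooth_in_chart M c U f; \<And>m. m \<in> U \<Longrightarrow> f m = g m\<rbrakk> \<Longrightarrow> smooth_in_chart M c U g"
  unfolding smooth_in_chart_def by (erule smooth_on_cong[OF openin_image]) auto

lemma smooth_in_chart_const: "smooth_in_chart M c U (\<lambda>_. k)"
  unfolding smooth_in_chart_def by (rule smooth_on_const)

lemma smooth_in_chart_add: "\<lbrakk>smooth_in_chart M c U f; smooth_in_chart M c U g\<rbrakk>
    \<Longrightarrow> smooth_in_chart M c U (\<lambda>m. f m + g m)"
  unfolding smooth_in_chart_def by (rule smooth_on_add[OF openin_image])

lemma smooth_in_chart_mult: "\<lbrakk>smooth_in_chart M c U f; smooth_in_chart M c U g\<rbrakk>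
    \<Longrightarrow> smooth_in_chart M c U (\<lambda>m. f m * g m)"
  unfolding smooth_in_chart_def by (rule smooth_on_mult[OF openin_image])

lemma smooth_in_chart_uminus: "smooth_in_chart M c U f \<Longrightarrow> smooth_in_chart M c U (\<lambda>m. - f m)"
  using smooth_in_chart_mult[OF smooth_in_chart_const[of "-1"], of f] by simp

lemma smooth_in_chart_sum: "(\<And>x. x \<in> X \<Longrightarrow> smooth_in_chart M c U (f x))
    \<Longrightarrow> smooth_in_chart M c U (\<lambda>m. \<Sum>x\<in>X. f x m)"
  by (induction X rule: infinite_finite_induct)
    (auto simp: smooth_in_chart_const intro!: smooth_in_chart_add)

lemma smooth_in_chart_pd:
  assumes "smooth_in_chart M c U f" "i < mdim M"
  shows "smooth_in_chart M c U (pd c i f)"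
  unfolding smooth_in_chart_def
proof (rule smooth_on_cong[OF openin_image])
  show "smooth_on (mdim M) (snd c ` U) (partial i (\<lambda>y. f (chart_inv c y)))"
    by (rule smooth_on_partial[OF assms[unfolded smooth_in_chart_def]])
qed (auto simp: pd_def)

lemma pd_cong:
  assumes "m \<in> U" "i < mdim M" "\<And>p. p \<in> U \<Longrightarrow> f p = g p"
  shows "pd c i f m = pd c i g m"
  unfolding pd_def by (rule partial_cong[OF openin_image]) (use assms in auto)

lemma pd_add:
  assumes "smooth_in_chart M c U f" "smooth_in_chart M c U g" "m \<in> U" "i < mdim M"
  shows "pd c i (\<lambda>p. f p + g p) m = pd c i f m + pd c i g m"
  unfolding pd_def
  by (intro partial_add smooth_on_slice[where f = "\<lambda>y. f (chart_inv c y)"] smooth_on_slice[where f = "\<lambda>y. g (chart_inv c y)"])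
    (use assms in \<open>auto simp: smooth_in_chart_def\<close>)

lemma pd_mult:
  assumes "smooth_in_chart M c U f" "smooth_in_chart M c U g" "m \<in> U" "i < mdim M"
  shows "pd c i (\<lambda>p. f p * g p) m = pd c i f m * g m + f m * pd c i g m"
proof -
  have "partial i (\<lambda>y. f (chart_inv c y) * g (chart_inv c y)) (snd c m)
     = partial i (\<lambda>y. f (chart_inv c y)) (snd c m) * g (chart_inv c (snd c m))
       + f (chart_inv c (snd c m)) * partial i (\<lambda>y. g (chart_inv c y)) (snd c m)"
    by (intro partial_mult smooth_on_slice[where f = "\<lambda>y. f (chart_inv c y)"] smooth_on_slice[where f = "\<lambda>y. g (chart_inv c y)"])
      (use assms in \<open>auto simp: smooth_in_chart_def\<close>)
  then show ?thesis using assms by (simp add: pd_def)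
qed

lemma pd_const [simp]: "pd c i (\<lambda>_. k) m = 0"
  by (simp add: pd_def partial_const)

lemma pd_sum:
  assumes "\<And>x. x \<in> X \<Longrightarrow> smooth_in_chart M c U (f x)" "m \<in> U" "i < mdim M"
  shows "pd c i (\<lambda>p. \<Sum>x\<in>X. f x p) m = (\<Sum>x\<in>X. pd c i (f x) m)"
  using assms(1)
  by (induction X rule: infinite_finite_induct)
    (simp_all add: pd_add[OF _ _ assms(2,3)] smooth_in_chart_sum)

lemma pd_commute:
  assumes "smooth_in_chart M c U f" "m \<in> U" "i < mdim M" "j < mdim M"
  shows "pd c i (pd c j f) m = pd c j (pd c i f) m"
proof -
  have "pd c i (pd c j f) m = partial i (partial j (\<lambda>y. f (chart_inv c y))) (snd c m)"
    if "i < mdim M" for i j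
    unfolding pd_def[of c i]
    by (rule partial_cong[OF openin_image _ that]) (use assms(2) in \<open>auto simp: pd_def\<close>)
  then show ?thesis
    using partial_commute[OF openin_image assms(1)[unfolded smooth_in_chart_def] _ assms(3,4)] assms by simp
qed

lemma restrict_fun_in: "smooth_in_chart M c U f \<Longrightarrow> restrict_fun U f \<in> chart_funs M c U"
  using smooth_in_chart_cong[of f "restrict_fun U f"] by (auto simp: chart_funs_def restrict_fun_def)

lemma chart_funs_smooth: "f \<in> chart_funs M c U \<Longrightarrow> smooth_in_chart M c U f"
  by (simp add: chart_funs_def)

lemma chart_funs_zero: "0 \<in> chart_funs M c U"
  using smooth_in_chart_const[of 0] by (simp add: chart_funs_def zero_fun_def)

lemma chart_funs_add: "\<lbrakk>f \<in> chart_funs M c U; g \<in> chart_funs M c U\<rbrakk> \<Longrightarrow> f + g \<in> chart_funs M c U"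
  using smooth_in_chart_add[of f g] by (simp add: chart_funs_def plus_fun_def)

lemma chart_funs_mult: "\<lbrakk>f \<in> chart_funs M c U; g \<in> chart_funs M c U\<rbrakk> \<Longrightarrow> f * g \<in> chart_funs M c U"
  using smooth_in_chart_mult[of f g] by (simp add: chart_funs_def times_fun_def)

lemma chart_funs_uminus: "f \<in> chart_funs M c U \<Longrightarrow> - f \<in> chart_funs M c U"
  using smooth_in_chart_uminus[of f] by (simp add: chart_funs_def fun_Compl_def)

lemma chart_deriv_in: "\<lbrakk>f \<in> chart_funs M c U; i < mdim M\<rbrakk> \<Longrightarrow> chart_deriv c U i f \<in> chart_funs M c U"
  unfolding chart_deriv_def by (intro restrict_fun_in smooth_in_chart_pd chart_funs_smooth)

end

lemma smooth_in_chart_local: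
  assumes "smooth_manifold M" "c \<in> atlas M" "open U" "U \<subseteq> fst c"
    and "\<And>m. m \<in> U \<Longrightarrow> \<exists>U'. m \<in> U' \<and> open U' \<and> U' \<subseteq> fst c \<and> smooth_in_chart M c U' f"
  shows "smooth_in_chart M c U f"
  unfolding smooth_in_chart_def
proof (rule smooth_on_local)
  interpret chart_domain M c U by unfold_locales fact+
  show "openin (Euclidean_space (mdim M)) (snd c ` U)" by (rule openin_image)
  fix y assume "y \<in> snd c ` U"
  then obtain m where m: "m \<in> U" "y = snd c m" by blast
  obtain U' where U': "m \<in> U'" "open U'" "U' \<subseteq> fst c" "smooth_in_chart M c U' f"
    using assms(5)[OF m(1)] by blast
  interpret U': chart_domain M c U' by unfold_locales fact+
  show "\<exists>V'. y \<in> V' \<and> openin (Euclidean_space (mdim M)) V' \<and> smooth_on (mdim M) V' (\<lambda>y. f (chart_inv c y))"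
    using U' U'.openin_image m by (intro exI[of _ "snd c ` U'"]) (auto simp: smooth_in_chart_def)
qed

section \<open>Coefficients of the Poisson bracket of a cubic element\<close>

lemma sum_fun_apply: "(\<Sum>x\<in>X. f x) K = (\<Sum>x\<in>X. f x K)" for f :: "'b \<Rightarrow> 'c \<Rightarrow> 'a::comm_monoid_add"
  by (induction X rule: infinite_finite_induct) auto

text \<open>The coefficient of a superproduct at \<open>(P, S)\<close> is a sum over the sub-multisets of \<open>P\<close> and the
  subsets of \<open>S\<close>. For a cubic element only few of these contribute; the following rules list them.\<close>

lemma submultisets_add_mset:
  "{Q. Q \<subseteq># add_mset x P} = {Q. Q \<subseteq># P} \<union> add_mset x ` {Q. Q \<subseteq># P}"
proof (intro equalityI subsetI)
  fix Q assume "Q \<in> {Q. Q \<subseteq># add_mset x P}"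
  then have Q: "Q \<subseteq># add_mset x P" by simp
  show "Q \<in> {Q. Q \<subseteq># P} \<union> add_mset x ` {Q. Q \<subseteq># P}"
  proof (cases "x \<in># Q")
    case True
    then obtain Q' where "Q = add_mset x Q'" by (meson mset_add)
    then show ?thesis using Q by auto
  next
    case False
    have "count Q y \<le> count P y" for y
      using mset_subset_eq_count[OF Q, of y] False by (cases "y = x") (auto simp: not_in_iff)
    then show ?thesis by (simp add: subseteq_mset_def)
  qed
next
  fix Q assume "Q \<in> {Q. Q \<subseteq># P} \<union> add_mset x ` {Q. Q \<subseteq># P}"
  then consider "Q \<subseteq># P" | Q' where "Q = add_mset x Q'" "Q' \<subseteq># P" by blast
  then show "Q \<in> {Q. Q \<subseteq># add_mset x P}"
  proof cases
    case 1
    then have "Q \<subseteq># add_mset x P" by (rule subset_mset.order_trans) simp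
    then show ?thesis by simp
  qed simp
qed

lemma submultisets_empty: "{Q. Q \<subseteq># {#}} = {{#}}"
  by simp

lemma finite_submultisets [simp]: "finite {Q. Q \<subseteq># P}"
  by (induction P) (simp_all only: submultisets_empty submultisets_add_mset finite_Un finite_imageI finite.intros)

lemma submultisets_single: "{Q. Q \<subseteq># {#j#}} = {{#}, {#j#}}"
  unfolding submultisets_add_mset submultisets_empty by auto

lemma sum_Pow_insert:
  assumes "finite S" "x \<notin> S"
  shows "(\<Sum>T\<in>Pow (insert x S). h T) = (\<Sum>T\<in>Pow S. h T) + (\<Sum>T\<in>Pow S. h (insert x T))"
proof -
  have "inj_on (insert x) (Pow S)"
    using assms(2) by (intro inj_onI) (metis Pow_iff insert_ident subset_iff)
  then show ?thesis unfolding Pow_insert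
    by (subst sum.union_disjoint) (use assms in \<open>auto simp: sum.reindex\<close>)
qed

lemma shuffle_sign_empty [simp]: "shuffle_sign {} T = 1" "shuffle_sign S {} = 1"
  by (simp_all add: shuffle_sign_def)

text \<open>Together with the next lemma this evaluates the sign of a shuffle of explicitly given sets.\<close>

lemma shuffle_sign_insert_left:
  assumes "finite S" "finite T" "x \<notin> S"
  shows "shuffle_sign (insert x S) T = shuffle_sign {x} T * shuffle_sign S T"
proof -
  define inv where "inv A = {(i, j). i \<in> A \<and> j \<in> T \<and> j < i}" for A
  have fin: "finite (inv A)" if "finite A" for A
    by (rule finite_subset[of _ "A \<times> T"]) (use that assms in \<open>auto simp: inv_def\<close>)
  have "card (inv {x} \<union> inv S) = card (inv {x}) + card (inv S)"
  proof (rule card_Un_disjoint)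
    show "finite (inv {x})" "finite (inv S)" by (rule fin, use assms in simp)+
    show "inv {x} \<inter> inv S = {}" using assms by (auto simp: inv_def)
  qed
  moreover have "inv (insert x S) = inv {x} \<union> inv S" by (auto simp: inv_def)
  moreover have "shuffle_sign A T = (-1) ^ card (inv A)" for A by (simp add: shuffle_sign_def inv_def)
  ultimately show ?thesis by (simp only: power_add)
qed

lemma shuffle_sign_insert_right:
  assumes "finite T" "y \<notin> T"
  shows "shuffle_sign {x} (insert y T) = (if y < x then -1 else 1) * shuffle_sign {x} T"
proof -
  have "{(i, j). i \<in> {x} \<and> j \<in> insert y T \<and> j < i}
      = (if y < x then insert (x, y) {(i, j). i \<in> {x} \<and> j \<in> T \<and> j < i} else {(i, j). i \<in> {x} \<and> j \<in> T \<and> j < i})"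
    by auto
  moreover have "finite {(i, j). i \<in> {x} \<and> j \<in> T \<and> j < i}"
    by (rule finite_subset[of _ "{x} \<times> T"]) (use assms in auto)
  ultimately show ?thesis using assms by (simp add: shuffle_sign_def)
qed

lemmas shuffle_sign_simps = shuffle_sign_insert_left[of "insert y S" for y S] shuffle_sign_insert_right

lemma superprod_infinite: "infinite S \<Longrightarrow> (F \<odot> G) (P, S) = 0"
  by (simp add: superprod_def)

lemma superprod_coeff0: "(F \<odot> G) (P, {}) = (\<Sum>Q | Q \<subseteq># P. F (Q, {}) * G (P - Q, {}))"
  by (simp add: superprod_def)

lemma superprod_coeff2:
  assumes "I < J"
  shows "(F \<odot> G) (P, {I, J}) = (\<Sum>Q | Q \<subseteq># P.
      F (Q, {}) * G (P - Q, {I, J}) + F (Q, {I}) * G (P - Q, {J})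
      - F (Q, {J}) * G (P - Q, {I}) + F (Q, {I, J}) * G (P - Q, {}))"
proof -
  have d: "I \<noteq> J" "J \<noteq> I" "\<not> J < I" "J > I" using assms by auto
  show ?thesis unfolding superprod_def
    by (simp add: sum_Pow_insert d insert_Diff_if shuffle_sign_simps algebra_simps)
qed

lemma superprod_coeff4:
  assumes "I < J" "J < K" "K < L"
  shows "(F \<odot> G) (P, {I, J, K, L}) = (\<Sum>Q | Q \<subseteq># P.
      F (Q, {}) * G (P - Q, {I, J, K, L})
      + F (Q, {I}) * G (P - Q, {J, K, L}) - F (Q, {J}) * G (P - Q, {I, K, L})
      + F (Q, {K}) * G (P - Q, {I, J, L}) - F (Q, {L}) * G (P - Q, {I, J, K})
      + F (Q, {I, J}) * G (P - Q, {K, L}) - F (Q, {I, K}) * G (P - Q, {J, L})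
      + F (Q, {I, L}) * G (P - Q, {J, K}) + F (Q, {J, K}) * G (P - Q, {I, L})
      - F (Q, {J, L}) * G (P - Q, {I, K}) + F (Q, {K, L}) * G (P - Q, {I, J})
      + F (Q, {I, J, K}) * G (P - Q, {L}) - F (Q, {I, J, L}) * G (P - Q, {K})
      + F (Q, {I, K, L}) * G (P - Q, {J}) - F (Q, {J, K, L}) * G (P - Q, {I})
      + F (Q, {I, J, K, L}) * G (P - Q, {}))"
proof -
  have d: "I \<noteq> J" "J \<noteq> I" "\<not> J < I" "I < K" "I \<noteq> K" "K \<noteq> I" "\<not> K < I" "I < L" "I \<noteq> L" "L \<noteq> I" "\<not> L < I"
    "J \<noteq> K" "K \<noteq> J" "\<not> K < J" "J < L" "J \<noteq> L" "L \<noteq> J" "\<not> L < J" "K \<noteq> L" "L \<noteq> K" "\<not> L < K"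
    using assms by auto
  show ?thesis unfolding superprod_def
    by (simp add: sum_Pow_insert d assms insert_Diff_if shuffle_sign_simps algebra_simps)
qed

text \<open>The support of an element of total degree three, where \<open>x\<^sub>i\<^sup>*\<close> counts twice: its monomials are
  \<open>x\<^sub>i\<^sup>* \<eta>\<^sup>I\<close> and \<open>\<eta>\<^sup>I \<eta>\<^sup>J \<eta>\<^sup>K\<close>, with \<open>\<eta>\<^sup>I\<close> the odd generators.\<close>

definition cubic :: "nat \<Rightarrow> superpoly \<Rightarrow> bool" where
  "cubic r F \<longleftrightarrow> (\<forall>P S. F (P, S) \<noteq> 0 \<longrightarrow> S \<subseteq> {..<2 * r} \<and> 2 * size P + card S = 3)"

lemma cubic_zero: "cubic r F \<Longrightarrow> 2 * size P + card S \<noteq> 3 \<Longrightarrow> F (P, S) = 0"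
  unfolding cubic_def by blast

definition alternating3 :: "nat set \<Rightarrow> (nat \<Rightarrow> nat \<Rightarrow> nat \<Rightarrow> real) \<Rightarrow> bool" where
  "alternating3 N t \<longleftrightarrow> (\<forall>I\<in>N. \<forall>J\<in>N. \<forall>K\<in>N. t J I K = - t I J K \<and> t I K J = - t I J K)"

lemma alternating3_swap:
  assumes "alternating3 N t" "I \<in> N" "J \<in> N" "K \<in> N"
  shows "t J I K = - t I J K" "t I K J = - t I J K"
  using assms unfolding alternating3_def by blast+

lemma alternating3_eq:
  assumes "alternating3 N t" "I \<in> N" "J \<in> N"
  shows "t I I J = 0" "t I J I = 0" "t J I I = 0"
  using alternating3_swap(1)[OF assms(1), of I I J] alternating3_swap(2)[OF assms(1), of J I I]
    alternating3_swap(2)[OF assms(1), of I I J] assms by auto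

definition odd_coeffs :: "nat \<Rightarrow> superpoly \<Rightarrow> (nat \<Rightarrow> nat \<Rightarrow> nat \<Rightarrow> real) \<Rightarrow> bool" where
  "odd_coeffs r F t \<longleftrightarrow> (\<forall>I J K. I < J \<and> J < K \<and> K < 2 * r \<longrightarrow> F ({#}, {I, J, K}) = t I J K)"

text \<open>Extending the coefficients of \<open>\<eta>\<^sup>I \<eta>\<^sup>J \<eta>\<^sup>K\<close> to an alternating array absorbs all signs of the odd
  derivatives. Left and right derivatives agree because the remaining monomial has even degree.\<close>

lemma d_odd_coeff2:
  assumes t: "alternating3 {..<2*r} t" "odd_coeffs r F t" and q: "q < 2 * r" "I < J" "J < 2 * r"
  shows "d_left q F ({#}, {I, J}) = t q I J" "d_right q F ({#}, {I, J}) = t q I J"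
proof -
  have o: "F ({#}, {A, B, C}) = t A B C" if "A < B" "B < C" "C < 2 * r" for A B C
    using t that by (auto simp: odd_coeffs_def)
  consider "q < I" | "q = I" | "I < q" "q < J" | "q = J" | "J < q" by linarith
  then have "d_left q F ({#}, {I, J}) = t q I J \<and> d_right q F ({#}, {I, J}) = t q I J"
  proof cases
    case 1
    then show ?thesis using o[of q I J] q by (simp add: d_left_def d_right_def shuffle_sign_simps)
  next
    case 2
    then show ?thesis using alternating3_eq[OF t(1), of I J] q by (simp add: d_left_def d_right_def)
  next
    case 3
    have "F ({#}, {q, I, J}) = - t q I J"
      using o[of I q J] alternating3_swap(1)[OF t(1), of q I J] 3 q by (simp add: insert_commute)
    then show ?thesis using 3 q by (simp add: d_left_def d_right_def shuffle_sign_simps)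
  next
    case 4
    then show ?thesis using alternating3_eq[OF t(1), of J I] q by (simp add: d_left_def d_right_def)
  next
    case 5
    have "{q, I, J} = {I, J, q}" by blast
    then have "F ({#}, {q, I, J}) = t q I J"
      using o[of I J q] alternating3_swap(1)[OF t(1), of q I J] alternating3_swap(2)[OF t(1), of I q J] 5 q
      by simp
    then show ?thesis using 5 q by (simp add: d_left_def d_right_def shuffle_sign_simps)
  qed
  then show "d_left q F ({#}, {I, J}) = t q I J" "d_right q F ({#}, {I, J}) = t q I J" by blast+
qed

lemma d_odd_coeff0: "d_left q F (P, {}) = F (P, {q})" "d_right q F (P, {}) = F (P, {q})"
  by (simp_all add: d_left_def d_right_def)

lemma d_odd_zero:
  assumes "cubic r F" "finite S" "2 * size P + card S \<noteq> 2"
  shows "d_left q F (P, S) = 0" "d_right q F (P, S) = 0"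
  using assms cubic_zero[OF assms(1), of P "insert q S"] by (auto simp: d_left_def d_right_def)

lemma d_even_zero:
  assumes "cubic r F" "2 * size P + card S \<noteq> 1"
  shows "d_even i F (P, S) = 0"
  using assms cubic_zero[OF assms(1), of "add_mset i P" S] by (auto simp: d_even_def)

lemma d_even_coeff1: "d_even i F ({#}, S) = F ({#i#}, S)"
  by (simp add: d_even_def)

text \<open>The bracket of an odd \<open>F\<close> with itself at one point; \<open>G i\<close> stands for \<open>\<partial>F/\<partial>x\<^sup>i\<close>. The two summands of
  each kind coincide, which accounts for the factor \<open>2\<close> below.\<close>

definition poisson_square :: "nat \<Rightarrow> nat \<Rightarrow> superpoly \<Rightarrow> (nat \<Rightarrow> superpoly) \<Rightarrow> superpoly" where
  "poisson_square n r F G = (\<Sum>i<n. d_even i F \<odot> G i - G i \<odot> d_even i F)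
     + (\<Sum>a<r. d_right (r + a) F \<odot> d_left a F + d_right a F \<odot> d_left (r + a) F)"

lemma poisson_square_coeff:
  assumes "\<And>i. i < n \<Longrightarrow> (d_even i F \<odot> G i - G i \<odot> d_even i F) z = 2 * A i"
    and "\<And>a. a < r \<Longrightarrow> (d_right (r + a) F \<odot> d_left a F + d_right a F \<odot> d_left (r + a) F) z = 2 * B a"
    and "poisson_square n r F G z = 0"
  shows "(\<Sum>i<n. A i) + (\<Sum>a<r. B a) = 0"
proof -
  have "poisson_square n r F G z
     = (\<Sum>i<n. (d_even i F \<odot> G i - G i \<odot> d_even i F) z)
     + (\<Sum>a<r. (d_right (r + a) F \<odot> d_left a F + d_right a F \<odot> d_left (r + a) F) z)"
    unfolding poisson_square_def plus_fun_apply sum_fun_apply ..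
  also have "\<dots> = (\<Sum>i<n. 2 * A i) + (\<Sum>a<r. 2 * B a)"
    using assms by (intro arg_cong2[where f = "(+)"] sum.cong) auto
  finally show ?thesis using assms(3) by (simp add: sum_distrib_left[symmetric])
qed

lemma superprod_momenta2:
  assumes "H ({#}, {}) = 0" "K ({#}, {}) = 0"
  shows "(H \<odot> K) ({#i, j#}, {}) = (if i = j then H ({#i#}, {}) * K ({#i#}, {})
     else H ({#i#}, {}) * K ({#j#}, {}) + H ({#j#}, {}) * K ({#i#}, {}))"
proof -
  have "{Q. Q \<subseteq># {#i, j#}} = {{#}, {#j#}, {#i#}, {#i, j#}}"
    unfolding submultisets_add_mset submultisets_empty by auto
  then show ?thesis using assms by (auto simp: superprod_coeff0)
qed

text \<open>The part of the bracket that is quadratic in the momenta. A derivative in \<open>x\<^sup>i\<close> keeps the total degree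
  three, which no product of momenta alone has; only the odd derivatives contribute.\<close>

lemma poisson_square_momenta2:
  assumes F: "cubic r F" and G: "\<And>i. i < n \<Longrightarrow> cubic r (G i)"
    and z: "poisson_square n r F G ({#i, j#}, {}) = 0"
  shows "(\<Sum>a<r. F ({#i#}, {r + a}) * F ({#j#}, {a}) + F ({#i#}, {a}) * F ({#j#}, {r + a})) = 0"
proof -
  have A: "(d_even k F \<odot> G k - G k \<odot> d_even k F) ({#i, j#}, {}) = 2 * 0" if "k < n" for k
  proof -
    have "G k (P, {}) = 0" for P
    proof (rule cubic_zero[OF G[OF that]])
      show "2 * size P + card ({} :: nat set) \<noteq> 3" by simp presburger
    qed
    then show ?thesis by (simp add: superprod_coeff0)
  qed
  \<comment> \<open>The monomial \<open>x\<^sub>i\<^sup>* x\<^sub>i\<^sup>*\<close> splits into its factors in one way only, which gives half the value.\<close>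
  let ?B = "\<lambda>a. (F ({#i#}, {r + a}) * F ({#j#}, {a}) + F ({#i#}, {a}) * F ({#j#}, {r + a})) * (if i = j then 1/2 else 1)"
  have B: "(d_right (r + a) F \<odot> d_left a F + d_right a F \<odot> d_left (r + a) F) ({#i, j#}, {}) = 2 * ?B a" for a
  proof -
    have "F ({#}, {q}) = 0" for q using cubic_zero[OF F, of "{#}" "{q}"] by simp
    then show ?thesis
      by (simp add: superprod_momenta2 d_odd_coeff0 algebra_simps)
  qed
  have "(\<Sum>i<n. 0) + (\<Sum>a<r. ?B a) = 0"
    by (rule poisson_square_coeff[OF A B z])
  then show ?thesis by (simp add: sum_distrib_right[symmetric] split: if_splits)
qed

text \<open>The part of the bracket that is linear in the momenta. One factor supplies a monomial with a
  momentum; hence the coefficients \<open>t\<close> of the other one enter linearly, with one index contracted.\<close>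

lemma poisson_square_momentum1:
  assumes F: "cubic r F" and G: "\<And>i. i < n \<Longrightarrow> cubic r (G i)"
    and t: "alternating3 {..<2*r} t" "odd_coeffs r F t"
    and z: "poisson_square n r F G ({#j#}, {I, J}) = 0" and IJ: "I < J" "J < 2 * r"
  shows "(\<Sum>i<n. F ({#i#}, {I}) * G i ({#j#}, {J}) - F ({#i#}, {J}) * G i ({#j#}, {I}))
       + (\<Sum>a<r. F ({#j#}, {r + a}) * t a I J + F ({#j#}, {a}) * t (r + a) I J) = 0"
proof (rule poisson_square_coeff[OF _ _ z])
  have ne: "I \<noteq> J" using IJ by simp
  fix i assume "i < n"
  then have G0: "G i (P, S) = 0" if "2 * size P + card S \<noteq> 3" for P S
    using cubic_zero[OF G] that by blast
  show "(d_even i F \<odot> G i - G i \<odot> d_even i F) ({#j#}, {I, J}) =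
      2 * (F ({#i#}, {I}) * G i ({#j#}, {J}) - F ({#i#}, {J}) * G i ({#j#}, {I}))"
    using ne by (simp add: superprod_coeff2[OF IJ(1)] submultisets_single G0 d_even_zero[OF F] d_even_coeff1)
next
  have ne: "I \<noteq> J" using IJ by simp
  fix a assume "a < r"
  then show "(d_right (r + a) F \<odot> d_left a F + d_right a F \<odot> d_left (r + a) F) ({#j#}, {I, J}) =
      2 * (F ({#j#}, {r + a}) * t a I J + F ({#j#}, {a}) * t (r + a) I J)"
    using ne IJ by (simp add: superprod_coeff2[OF IJ(1)] submultisets_single d_odd_zero[OF F] d_odd_coeff0
        d_odd_coeff2[OF t] algebra_simps)
qed

text \<open>The part of the bracket that is free of momenta. It has degree four in the odd generators, and the
  summand for each \<open>a\<close> lists the six ways of distributing these to two cubic factors.\<close>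

lemma poisson_square_momentum0:
  assumes F: "cubic r F" and G: "\<And>i. i < n \<Longrightarrow> cubic r (G i)"
    and t: "alternating3 {..<2*r} t" "odd_coeffs r F t"
    and g: "\<And>i. i < n \<Longrightarrow> odd_coeffs r (G i) (g i)"
    and z: "poisson_square n r F G ({#}, {I, J, K, L}) = 0"
    and IJ: "I < J" "J < K" "K < L" "L < 2 * r"
  shows "(\<Sum>i<n. F ({#i#}, {I}) * g i J K L - F ({#i#}, {J}) * g i I K L
           + F ({#i#}, {K}) * g i I J L - F ({#i#}, {L}) * g i I J K)
       + (\<Sum>a<r. t (r + a) I J * t a K L - t (r + a) I K * t a J L + t (r + a) I L * t a J K
           + t (r + a) J K * t a I L - t (r + a) J L * t a I K + t (r + a) K L * t a I J) = 0"
proof (rule poisson_square_coeff[OF _ _ z])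
  have ne: "I \<noteq> J" "I \<noteq> K" "I \<noteq> L" "J \<noteq> K" "J \<noteq> L" "K \<noteq> L" using IJ by auto
  fix i assume i: "i < n"
  have G0: "G i (P, S) = 0" if "2 * size P + card S \<noteq> 3" for P S
    using cubic_zero[OF G[OF i]] that by blast
  have G3: "G i ({#}, {A, B, C}) = g i A B C" if "A < B" "B < C" "C < 2 * r" for A B C
    using g[OF i] that by (auto simp: odd_coeffs_def)
  show "(d_even i F \<odot> G i - G i \<odot> d_even i F) ({#}, {I, J, K, L}) =
      2 * (F ({#i#}, {I}) * g i J K L - F ({#i#}, {J}) * g i I K L
           + F ({#i#}, {K}) * g i I J L - F ({#i#}, {L}) * g i I J K)"
    using ne IJ by (simp add: superprod_coeff4[OF IJ(1-3)] submultisets_empty G0 G3 d_even_zero[OF F] d_even_coeff1)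
next
  have ne: "I \<noteq> J" "I \<noteq> K" "I \<noteq> L" "J \<noteq> K" "J \<noteq> L" "K \<noteq> L" using IJ by auto
  fix a assume "a < r"
  then show "(d_right (r + a) F \<odot> d_left a F + d_right a F \<odot> d_left (r + a) F) ({#}, {I, J, K, L}) =
      2 * (t (r + a) I J * t a K L - t (r + a) I K * t a J L + t (r + a) I L * t a J K
           + t (r + a) J K * t a I L - t (r + a) J L * t a I K + t (r + a) K L * t a I J)"
    using ne IJ by (simp add: superprod_coeff4[OF IJ(1-3)] submultisets_empty d_odd_zero[OF F] d_odd_coeff0
        d_odd_coeff2[OF t] algebra_simps)
qed

section \<open>Coefficients of lifts and of their Legendre transforms\<close>

text \<open>Multiplication by a generator picks out one splitting of the monomial, so the double sum of the
  superproduct collapses to a single term.\<close>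

lemma superprod_single_term:
  assumes "finite S" "Q\<^sub>0 \<subseteq># P" "T\<^sub>0 \<subseteq> S"
    and z: "\<And>Q T. \<lbrakk>Q \<subseteq># P; T \<subseteq> S; F (Q, T) \<noteq> 0; G (P - Q, S - T) \<noteq> 0\<rbrakk> \<Longrightarrow> Q = Q\<^sub>0 \<and> T = T\<^sub>0"
  shows "(F \<odot> G) (P, S) = shuffle_sign T\<^sub>0 (S - T\<^sub>0) * F (Q\<^sub>0, T\<^sub>0) * G (P - Q\<^sub>0, S - T\<^sub>0)"
proof -
  define h where "h z = shuffle_sign (snd z) (S - snd z) * F z * G (P - fst z, S - snd z)" for z
  have "(F \<odot> G) (P, S) = (\<Sum>z\<in>{Q. Q \<subseteq># P} \<times> Pow S. h z)"
    unfolding superprod_def prod.case sum.cartesian_product by (simp add: h_def case_prod_beta')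
  also have "\<dots> = (\<Sum>z\<in>{(Q\<^sub>0, T\<^sub>0)}. h z)"
  proof (rule sum.mono_neutral_right)
    show "\<forall>z\<in>{Q. Q \<subseteq># P} \<times> Pow S - {(Q\<^sub>0, T\<^sub>0)}. h z = 0"
    proof
      fix z assume z': "z \<in> {Q. Q \<subseteq># P} \<times> Pow S - {(Q\<^sub>0, T\<^sub>0)}"
      show "h z = 0"
      proof (rule ccontr)
        assume "h z \<noteq> 0"
        then have "F (fst z, snd z) \<noteq> 0" "G (P - fst z, S - snd z) \<noteq> 0" by (auto simp: h_def)
        then have "fst z = Q\<^sub>0 \<and> snd z = T\<^sub>0" using z z' by fastforce
        then show False using z' by (simp add: prod_eq_iff)
      qed
    qed
  qed (use assms(1-3) in auto)
  finally show ?thesis by (simp add: h_def)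
qed

lemma superprod_zero:
  assumes "\<And>Q T. \<lbrakk>Q \<subseteq># P; T \<subseteq> S; F (Q, T) \<noteq> 0; G (P - Q, S - T) \<noteq> 0\<rbrakk> \<Longrightarrow> False"
  shows "(F \<odot> G) (P, S) = 0"
  unfolding superprod_def prod.case
proof (intro sum.neutral ballI)
  fix Q T assume "Q \<in> {Q. Q \<subseteq># P}" "T \<in> Pow S"
  then have "F (Q, T) = 0 \<or> G (P - Q, S - T) = 0" using assms[of Q T] by auto
  then show "shuffle_sign T (S - T) * F (Q, T) * G (P - Q, S - T) = 0" by auto
qed

lemma even_gen_nonzero: "even_gen i (P, S) \<noteq> 0 \<longleftrightarrow> P = {#i#} \<and> S = {}"
  and odd_gen_nonzero: "odd_gen q (P, S) \<noteq> 0 \<longleftrightarrow> P = {#} \<and> S = {q}"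
  by (simp_all add: even_gen_def odd_gen_def)

lemma submultiset_Diff_single:
  assumes "Q \<subseteq># P" "P - Q = {#i#}"
  shows "i \<in># P" "Q = P - {#i#}"
proof -
  have "P = Q + {#i#}" using assms by (metis subset_mset.add_diff_inverse)
  then show "i \<in># P" "Q = P - {#i#}" by simp_all
qed

lemma superprod_odd_gen_right:
  assumes "finite S"
  shows "(F \<odot> odd_gen q) (P, S) = (if q \<in> S then shuffle_sign (S - {q}) {q} * F (P, S - {q}) else 0)"
proof (cases "q \<in> S")
  case True
  have "(F \<odot> odd_gen q) (P, S) = shuffle_sign (S - {q}) (S - (S - {q})) * F (P, S - {q}) * odd_gen q (P - P, S - (S - {q}))"
  proof (rule superprod_single_term[OF assms])
    fix Q T assume "Q \<subseteq># P" "T \<subseteq> S" "odd_gen q (P - Q, S - T) \<noteq> 0"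
    then have "P \<subseteq># Q" "S - T = {q}" by (auto simp: odd_gen_nonzero Diff_eq_empty_iff_mset)
    then show "Q = P \<and> T = S - {q}" using \<open>Q \<subseteq># P\<close> \<open>T \<subseteq> S\<close> by (auto intro: subset_mset.antisym)
  qed auto
  moreover have "S - (S - {q}) = {q}" using True by auto
  ultimately show ?thesis using True by (simp add: odd_gen_def)
next
  case False
  have "(F \<odot> odd_gen q) (P, S) = 0"
    by (rule superprod_zero) (use False in \<open>auto simp: odd_gen_nonzero\<close>)
  then show ?thesis using False by simp
qed

lemma superprod_odd_gen_left:
  assumes "finite S"
  shows "(odd_gen q \<odot> F) (P, S) = (if q \<in> S then shuffle_sign {q} (S - {q}) * F (P, S - {q}) else 0)"
proof (cases "q \<in> S")
  case True
  have "(odd_gen q \<odot> F) (P, S) = shuffle_sign {q} (S - {q}) * odd_gen q ({#}, {q}) * F (P - {#}, S - {q})"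
    by (rule superprod_single_term[OF assms]) (use True in \<open>auto simp: odd_gen_nonzero\<close>)
  then show ?thesis using True by (simp add: odd_gen_def)
next
  case False
  have "(odd_gen q \<odot> F) (P, S) = 0"
    by (rule superprod_zero) (use False in \<open>auto simp: odd_gen_nonzero\<close>)
  then show ?thesis using False by simp
qed

lemma superprod_even_gen_right:
  assumes "finite S"
  shows "(F \<odot> even_gen i) (P, S) = (if i \<in># P then F (P - {#i#}, S) else 0)"
proof (cases "i \<in># P")
  case True
  then have "P - (P - {#i#}) = {#i#}"
    by (metis add_diff_cancel_right' insert_DiffM2 add_diff_cancel_left')
  moreover have "(F \<odot> even_gen i) (P, S) = shuffle_sign S (S - S) * F (P - {#i#}, S) * even_gen i (P - (P - {#i#}), S - S)"
  proof (rule superprod_single_term[OF assms])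
    fix Q T assume a: "Q \<subseteq># P" "T \<subseteq> S" "even_gen i (P - Q, S - T) \<noteq> 0"
    then have d: "P - Q = {#i#}" "S - T = {}" by (simp_all only: even_gen_nonzero)
    show "Q = P - {#i#} \<and> T = S"
      using submultiset_Diff_single(2)[OF a(1) d(1)] a(2) d(2) by (intro conjI) auto
  qed auto
  ultimately show ?thesis using True by (simp add: even_gen_def)
next
  case False
  have "(F \<odot> even_gen i) (P, S) = 0"
  proof (rule superprod_zero)
    fix Q T assume a: "Q \<subseteq># P" "T \<subseteq> S" "even_gen i (P - Q, S - T) \<noteq> 0"
    then have "P - Q = {#i#}" by (simp only: even_gen_nonzero)
    then show False using submultiset_Diff_single(1)[OF a(1)] False by simp
  qed
  then show ?thesis using False by simp
qed

lemma superprod_even_gen_left: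
  assumes "finite S"
  shows "(even_gen i \<odot> F) (P, S) = (if i \<in># P then F (P - {#i#}, S) else 0)"
proof (cases "i \<in># P")
  case True
  have "(even_gen i \<odot> F) (P, S) = shuffle_sign {} (S - {}) * even_gen i ({#i#}, {}) * F (P - {#i#}, S - {})"
    by (rule superprod_single_term[OF assms]) (use True in \<open>auto simp: even_gen_nonzero\<close>)
  then show ?thesis using True by (simp add: even_gen_def)
next
  case False
  have "(even_gen i \<odot> F) (P, S) = 0"
    by (rule superprod_zero) (use False in \<open>auto simp: even_gen_nonzero\<close>)
  then show ?thesis using False by simp
qed

text \<open>The sign by which a product of odd generators differs from the increasing one.\<close>

primrec inversion_sign :: "nat list \<Rightarrow> real" where
  "inversion_sign [] = 1"
| "inversion_sign (x # xs) = shuffle_sign {x} (set xs) * inversion_sign xs"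

lemma odd_monomial_coeff:
  assumes "finite S"
  shows "foldr (\<odot>) (map odd_gen xs) super_one (P, S)
     = (if P = {#} \<and> S = set xs \<and> distinct xs then inversion_sign xs else 0)"
  using assms
proof (induction xs arbitrary: S)
  case Nil then show ?case by (simp add: super_one_def)
next
  case (Cons x xs)
  have eq: "foldr (\<odot>) (map odd_gen (x # xs)) super_one (P, S)
     = (if x \<in> S then shuffle_sign {x} (S - {x})
          * (if P = {#} \<and> S - {x} = set xs \<and> distinct xs then inversion_sign xs else 0) else 0)"
    using Cons.IH[OF finite_Diff[OF Cons.prems]] by (simp add: superprod_odd_gen_left[OF Cons.prems])
  show ?case
  proof (cases "x \<in> S \<and> S - {x} = set xs")
    case True
    then have S: "S = insert x (set xs)" "x \<notin> set xs" by blast+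
    show ?thesis unfolding eq using S(2) by (simp add: S(1))
  next
    case False
    then have "\<not> (S = set (x # xs) \<and> distinct (x # xs))" by auto
    then show ?thesis unfolding eq using False by (auto simp del: list.set distinct.simps)
  qed
qed

lemma monomial_coeff:
  assumes "finite S"
  shows "foldr (\<odot>) (map even_gen ps @ map odd_gen xs) super_one (P, S)
     = (if P = mset ps \<and> S = set xs \<and> distinct xs then inversion_sign xs else 0)"
proof (induction ps arbitrary: P)
  case Nil then show ?case using odd_monomial_coeff[OF assms] by simp
next
  case (Cons i ps)
  have "i \<in># P \<and> P - {#i#} = mset ps \<longleftrightarrow> P = add_mset i (mset ps)"
    by (metis add_mset_remove_trivial insert_DiffM union_single_eq_member add_mset_add_single)
  moreover have "foldr (\<odot>) (map even_gen (i # ps) @ map odd_gen xs) super_one (P, S)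
     = (if i \<in># P then (if P - {#i#} = mset ps \<and> S = set xs \<and> distinct xs then inversion_sign xs else 0) else 0)"
    using Cons.IH[of "P - {#i#}"] by (simp add: superprod_even_gen_left[OF assms])
  ultimately show ?case unfolding mset.simps by presburger
qed

text \<open>A substitution that permutes the odd generators by an involution \<open>\<sigma>\<close> maps monomials to monomials
  up to sign, so each coefficient of the result comes from exactly one coefficient of \<open>G\<close>.\<close>

lemma substitute_coeff:
  assumes fin: "finite {z. G z \<noteq> 0}" and supp: "\<And>P S. G (P, S) \<noteq> 0 \<Longrightarrow> S \<subseteq> X"
    and inv: "\<And>q. q \<in> X \<Longrightarrow> \<sigma> q \<in> X \<and> \<sigma> (\<sigma> q) = q"
    and S: "S \<subseteq> X" "finite X"
  shows "substitute even_gen (\<lambda>q. odd_gen (\<sigma> q)) G (P, S)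
     = G (P, \<sigma> ` S) * inversion_sign (map \<sigma> (sorted_list_of_set (\<sigma> ` S)))"
proof -
  have finS: "finite S" using S finite_subset by blast
  have ss: "\<sigma> ` (\<sigma> ` S') = S'" if "S' \<subseteq> X" for S'
    using inv that by (force simp: image_image)
  have inj: "inj_on \<sigma> X" using inv by (metis inj_onI)
  have "substitute even_gen (\<lambda>q. odd_gen (\<sigma> q)) G (P, S)
     = (\<Sum>z\<in>{z. G z \<noteq> 0}. G z * foldr (\<odot>) (map even_gen (sorted_list_of_multiset (fst z))
         @ map odd_gen (map \<sigma> (sorted_list_of_set (snd z)))) super_one (P, S))"
    unfolding substitute_def sum_fun_apply
    by (auto simp: case_prod_beta' scaleR_fun_def comp_def sum_fun_apply intro!: sum.cong)
  also have "\<dots> = (\<Sum>z\<in>{z. G z \<noteq> 0}. if z = (P, \<sigma> ` S) then G (P, \<sigma> ` S) * inversion_sign (map \<sigma> (sorted_list_of_set (\<sigma> ` S))) else 0)"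
  proof (intro sum.cong refl)
    fix z assume z: "z \<in> {z. G z \<noteq> 0}"
    obtain P' S' where z': "z = (P', S')" by (cases z)
    then have S': "S' \<subseteq> X" using supp z by auto
    have finS': "finite S'" using S' S finite_subset by blast
    have "S = \<sigma> ` S' \<longleftrightarrow> S' = \<sigma> ` S" using ss[OF S'] ss[OF S(1)] by auto
    moreover have "distinct (map \<sigma> (sorted_list_of_set S'))"
      using finS' inj_on_subset[OF inj S'] by (simp add: distinct_map)
    ultimately show "G z * foldr (\<odot>) (map even_gen (sorted_list_of_multiset (fst z))
         @ map odd_gen (map \<sigma> (sorted_list_of_set (snd z)))) super_one (P, S)
       = (if z = (P, \<sigma> ` S) then G (P, \<sigma> ` S) * inversion_sign (map \<sigma> (sorted_list_of_set (\<sigma> ` S))) else 0)"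
      unfolding monomial_coeff[OF finS] z' using finS' by auto
  qed
  also have "\<dots> = G (P, \<sigma> ` S) * inversion_sign (map \<sigma> (sorted_list_of_set (\<sigma> ` S)))"
    using fin by (simp add: sum.delta')
  finally show ?thesis .
qed

definition form_supported :: "nat \<Rightarrow> nat \<Rightarrow> superpoly \<Rightarrow> bool" where
  "form_supported r k F \<longleftrightarrow> (\<forall>P S. F (P, S) \<noteq> 0 \<longrightarrow> P = {#} \<and> S \<subseteq> {..<r} \<and> card S = k)"

lemma pi_pullback_supported:
  assumes "\<omega> \<in> kforms_on M B k W" "m \<in> W"
  shows "form_supported (brank B) k (pi_pullback B \<omega> c e m)"
  unfolding form_supported_def
proof (intro allI impI)
  fix P S assume nz: "pi_pullback B \<omega> c e m (P, S) \<noteq> 0"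
  then have 1: "P = {#}" "S \<subseteq> {..<brank B}" and 2: "\<omega> m (map (\<lambda>a. snd e a m) (sorted_list_of_set S)) \<noteq> 0"
    by (auto simp: pi_pullback_def split: if_splits)
  have "\<forall>us. length us \<noteq> k \<longrightarrow> \<omega> m us = 0" using assms by (simp add: kforms_on_def)
  with 2 have "length (map (\<lambda>a. snd e a m) (sorted_list_of_set S)) = k" by blast
  then have "card S = k" by simp
  then show "P = {#} \<and> S \<subseteq> {..<brank B} \<and> card S = k"
    using 1 by blast
qed

text \<open>Hamiltonian lifts, with components \<open>E\<close> and \<open>O'\<close>, at one point. For a vector field of degree one the
  components \<open>E i\<close> are linear and the components \<open>O' a\<close> quadratic in the \<open>\<xi>\<^sup>a\<close>.\<close>

definition ham :: "nat \<Rightarrow> nat \<Rightarrow> (nat \<Rightarrow> superpoly) \<Rightarrow> (nat \<Rightarrow> superpoly) \<Rightarrow> superpoly" where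
  "ham n r E O' = (\<Sum>i<n. E i \<odot> even_gen i) + (\<Sum>a<r. O' a \<odot> odd_gen (r + a))"

context
  fixes n r :: nat and E O' :: "nat \<Rightarrow> superpoly"
  assumes E: "\<And>i. i < n \<Longrightarrow> form_supported r 1 (E i)"
    and O': "\<And>a. a < r \<Longrightarrow> form_supported r 2 (O' a)"
begin

lemma ham_coeff:
  assumes "finite S"
  shows "ham n r E O' (P, S) = (\<Sum>i<n. if i \<in># P then E i (P - {#i#}, S) else 0)
     + (\<Sum>a<r. if r + a \<in> S then shuffle_sign (S - {r + a}) {r + a} * O' a (P, S - {r + a}) else 0)"
  by (simp add: ham_def sum_fun_apply superprod_even_gen_right[OF assms] superprod_odd_gen_right[OF assms])

text \<open>A lift contains only the monomials \<open>\<xi>\<^sup>a x\<^sub>i\<^sup>*\<close> and \<open>\<xi>\<^sup>b \<xi>\<^sup>c \<xi>\<^sub>a\<^sup>*\<close>. In particular its support is finite,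
  which gives its image under a substitution a meaning.\<close>

lemma ham_nonzero:
  assumes "ham n r E O' (P, S) \<noteq> 0"
  shows "(\<exists>i<n. \<exists>a<r. P = {#i#} \<and> S = {a}) \<or> (P = {#} \<and> S \<subseteq> {..<2 * r} \<and> card S = 3
     \<and> (\<exists>a<r. r + a \<in> S \<and> S - {r + a} \<subseteq> {..<r}))"
proof -
  have fin: "finite S"
  proof (rule ccontr)
    assume "infinite S"
    then have "ham n r E O' (P, S) = 0" by (simp add: ham_def sum_fun_apply superprod_infinite)
    then show False using assms by simp
  qed
  consider i where "i < n" "i \<in># P" "E i (P - {#i#}, S) \<noteq> 0"
    | a where "a < r" "r + a \<in> S" "O' a (P, S - {r + a}) \<noteq> 0"
  proof -
    have "(\<Sum>i<n. if i \<in># P then E i (P - {#i#}, S) else 0) \<noteq> 0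
      \<or> (\<Sum>a<r. if r + a \<in> S then shuffle_sign (S - {r + a}) {r + a} * O' a (P, S - {r + a}) else 0) \<noteq> 0"
      using assms by (auto simp: ham_coeff[OF fin])
    then show thesis
    proof
      assume "(\<Sum>i<n. if i \<in># P then E i (P - {#i#}, S) else 0) \<noteq> 0"
      then obtain i where "i \<in> {..<n}" "(if i \<in># P then E i (P - {#i#}, S) else 0) \<noteq> 0"
        by (rule sum.not_neutral_contains_not_neutral)
      then show thesis using that(1)[of i] by (auto split: if_splits)
    next
      assume "(\<Sum>a<r. if r + a \<in> S then shuffle_sign (S - {r + a}) {r + a} * O' a (P, S - {r + a}) else 0) \<noteq> 0"
      then obtain a where "a \<in> {..<r}"
        "(if r + a \<in> S then shuffle_sign (S - {r + a}) {r + a} * O' a (P, S - {r + a}) else 0) \<noteq> 0"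
        by (rule sum.not_neutral_contains_not_neutral)
      then show thesis using that(2)[of a] by (auto split: if_splits)
    qed
  qed
  then show ?thesis
  proof cases
    case 1
    then have "P - {#i#} = {#}" "S \<subseteq> {..<r}" "card S = 1"
      using E[of i] by (auto simp: form_supported_def)
    moreover have "P = {#i#}" using 1 \<open>P - {#i#} = {#}\<close> by (metis insert_DiffM)
    ultimately show ?thesis using 1 by (auto simp: card_1_singleton_iff)
  next
    case 2
    then have s: "P = {#}" "S - {r + a} \<subseteq> {..<r}" "card (S - {r + a}) = 2"
      using O'[of a] by (auto simp: form_supported_def)
    have "card S = 3" using s(3) 2(2) fin by (simp add: card_Diff_singleton_if)
    moreover have "S \<subseteq> {..<2 * r}" using s(2) 2 by auto
    ultimately show ?thesis using 2 s by blast
  qed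
qed

lemma finite_ham_support: "finite {z. ham n r E O' z \<noteq> 0}"
proof (rule finite_subset)
  show "{z. ham n r E O' z \<noteq> 0} \<subseteq> (insert {#} ((\<lambda>i. {#i#}) ` {..<n})) \<times> Pow {..<2 * r}"
    using ham_nonzero by fastforce
qed auto

lemma ham_coeff1: "i < n \<Longrightarrow> ham n r E O' ({#i#}, {b}) = E i ({#}, {b})"
proof -
  assume i: "i < n"
  have z: "O' a ({#i#}, X) = 0" if "a < r" for a X
  proof (rule ccontr)
    assume "O' a ({#i#}, X) \<noteq> 0"
    then have "{#i#} = {#}" using O'[OF that] unfolding form_supported_def by blast
    then show False by simp
  qed
  have "(\<Sum>a<r. if r + a \<in> {b} then shuffle_sign ({b} - {r + a}) {r + a} * O' a ({#i#}, {b} - {r + a}) else 0) = 0"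
    by (intro sum.neutral) (simp add: z)
  then show ?thesis using i ham_coeff[of "{b}" "{#i#}"] by simp
qed

lemma ham_coeff3:
  assumes "I < J" "J < r" "r \<le> K" "K < 2 * r"
  shows "ham n r E O' ({#}, {I, J, K}) = O' (K - r) ({#}, {I, J})"
proof -
  have "(\<Sum>a<r. if r + a \<in> {I, J, K} then shuffle_sign ({I, J, K} - {r + a}) {r + a} * O' a ({#}, {I, J, K} - {r + a}) else 0)
     = (\<Sum>a<r. if a = K - r then O' (K - r) ({#}, {I, J}) else 0)"
  proof (intro sum.cong refl)
    fix a assume "a \<in> {..<r}"
    then have "r + a \<in> {I, J, K} \<longleftrightarrow> a = K - r" using assms by auto
    moreover have "{I, J, K} - {K} = {I, J}" using assms by auto
    moreover have "shuffle_sign {I, J} {K} = 1" using assms by (simp add: shuffle_sign_simps)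
    ultimately show "(if r + a \<in> {I, J, K} then shuffle_sign ({I, J, K} - {r + a}) {r + a} * O' a ({#}, {I, J, K} - {r + a}) else 0)
       = (if a = K - r then O' (K - r) ({#}, {I, J}) else 0)"
      using assms by auto
  qed
  then show ?thesis using assms by (simp add: ham_coeff)
qed

end

lemma sorted_list_of_set3: "I < J \<Longrightarrow> J < K \<Longrightarrow> sorted_list_of_set {I, J, K} = [I, J, K]" for I J K :: nat
  using sorted_list_of_set.idem_if_sorted_distinct[of "[I, J, K]"] by simp

definition swap_odd :: "nat \<Rightarrow> nat \<Rightarrow> nat" where
  "swap_odd r q = (if q < r then r + q else q - r)"

lemma swap_odd_in: "q \<in> {..<2 * r} \<Longrightarrow> swap_odd r q \<in> {..<2 * r} \<and> swap_odd r (swap_odd r q) = q"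
  by (auto simp: swap_odd_def)

text \<open>The image of a lift under the Legendre transform. The exchange turns the increasing monomial with
  indices \<open>J - r < K - r < r + I\<close> into the one with indices \<open>J, K, I\<close>, an even permutation of
  \<open>I < J < K\<close>: no sign appears.\<close>

lemma legendre_ham_coeff:
  fixes n r :: nat and E O' :: "nat \<Rightarrow> superpoly"
  assumes E: "\<And>i. i < n \<Longrightarrow> form_supported r 1 (E i)"
    and O': "\<And>a. a < r \<Longrightarrow> form_supported r 2 (O' a)"
  shows "i < n \<Longrightarrow> I < 2 * r \<Longrightarrow> substitute even_gen (\<lambda>q. odd_gen (swap_odd r q)) (ham n r E O') ({#i#}, {I})
      = (if I < r then 0 else E i ({#}, {I - r}))"
    and "I < J \<Longrightarrow> J < K \<Longrightarrow> K < 2 * r \<Longrightarrow>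
      substitute even_gen (\<lambda>q. odd_gen (swap_odd r q)) (ham n r E O') ({#}, {I, J, K})
      = (if I < r \<and> r \<le> J then O' I ({#}, {J - r, K - r}) else 0)"
proof -
  note H = ham_nonzero[where n = n and r = r and E = E and O' = O', OF E O']
  have supp: "S \<subseteq> {..<2 * r}" if "ham n r E O' (P, S) \<noteq> 0" for P S
    using H[OF _ _ that] by fastforce
  note C = substitute_coeff[of "ham n r E O'" "{..<2*r}" "swap_odd r",
      OF finite_ham_support[where n = n and r = r and E = E and O' = O', OF E O'] supp swap_odd_in _ finite_lessThan]
  {
    assume i: "i < n" and I: "I < 2 * r"
    have "substitute even_gen (\<lambda>q. odd_gen (swap_odd r q)) (ham n r E O') ({#i#}, {I})
        = E i ({#}, {swap_odd r I})"
      using C[where S = "{I}" and P = "{#i#}"] I ham_coeff1[where n = n and r = r and E = E and O' = O', OF E O' i] by simp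
    moreover have "E i ({#}, {swap_odd r I}) = 0" if "I < r"
      using E[OF i] that by (force simp: form_supported_def swap_odd_def)
    ultimately show "substitute even_gen (\<lambda>q. odd_gen (swap_odd r q)) (ham n r E O') ({#i#}, {I})
      = (if I < r then 0 else E i ({#}, {I - r}))" by (simp add: swap_odd_def)
  next
    assume IJ: "I < J" "J < K" "K < 2 * r"
    have eq: "substitute even_gen (\<lambda>q. odd_gen (swap_odd r q)) (ham n r E O') ({#}, {I, J, K})
      = ham n r E O' ({#}, {swap_odd r I, swap_odd r J, swap_odd r K})
        * inversion_sign (map (swap_odd r) (sorted_list_of_set {swap_odd r I, swap_odd r J, swap_odd r K}))"
      using C[where S = "{I, J, K}" and P = "{#}"] IJ by simp
    show "substitute even_gen (\<lambda>q. odd_gen (swap_odd r q)) (ham n r E O') ({#}, {I, J, K})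
      = (if I < r \<and> r \<le> J then O' I ({#}, {J - r, K - r}) else 0)"
    proof (cases "I < r \<and> r \<le> J")
      case True
      have h: "J - r < K - r" "K - r < r" "K - r < r + I" "r \<le> r + I" "r + I < 2 * r" "J - r < r" using True IJ by linarith+
      have set: "{swap_odd r I, swap_odd r J, swap_odd r K} = {J - r, K - r, r + I}"
        using True IJ by (auto simp: swap_odd_def)
      have "ham n r E O' ({#}, {J - r, K - r, r + I}) = O' I ({#}, {J - r, K - r})"
        using ham_coeff3[where n = n and r = r and E = E and O' = O' and I = "J - r" and J = "K - r" and K = "r + I", OF E O']
          h by simp
      moreover have "sorted_list_of_set {J - r, K - r, r + I} = [J - r, K - r, r + I]"
        by (rule sorted_list_of_set3) fact+
      moreover have "inversion_sign [J, K, I] = 1"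
        using True IJ by (simp add: shuffle_sign_simps)
      moreover have "map (swap_odd r) [J - r, K - r, r + I] = [J, K, I]"
        using True IJ h by (simp add: swap_odd_def)
      ultimately show ?thesis unfolding eq set using True by simp
    next
      case False
      have "ham n r E O' ({#}, {swap_odd r I, swap_odd r J, swap_odd r K}) = 0"
      proof (rule ccontr)
        assume "ham n r E O' ({#}, {swap_odd r I, swap_odd r J, swap_odd r K}) \<noteq> 0"
        from H[OF _ _ this] obtain a where a: "a < r" "r + a \<in> {swap_odd r I, swap_odd r J, swap_odd r K}"
          "{swap_odd r I, swap_odd r J, swap_odd r K} - {r + a} \<subseteq> {..<r}" by auto
        have "\<not> J < r"
        proof
          assume "J < r"
          then have sw: "swap_odd r I = r + I" "swap_odd r J = r + J" using IJ by (simp_all add: swap_odd_def)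
          have "r + I \<noteq> r + a \<or> r + J \<noteq> r + a" using IJ by simp
          then have "r + I < r \<or> r + J < r" using a(3) unfolding sw by blast
          then show False by simp
        qed
        moreover have "\<not> r \<le> I"
        proof
          assume "r \<le> I"
          then have "swap_odd r I < r" "swap_odd r J < r" "swap_odd r K < r"
            using IJ unfolding swap_odd_def by auto
          then show False using a(2) by auto
        qed
        ultimately show False using False by simp
      qed
      then show ?thesis unfolding eq by (simp only: False if_False mult_zero_left)
    qed
  }
qed

lemma legendre_form_coeff:
  assumes F: "form_supported r 3 F"
  shows "I < 2 * r \<Longrightarrow> substitute even_gen (\<lambda>q. odd_gen (swap_odd r q)) F ({#i#}, {I}) = 0"
    and "I < J \<Longrightarrow> J < K \<Longrightarrow> K < 2 * r \<Longrightarrow>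
      substitute even_gen (\<lambda>q. odd_gen (swap_odd r q)) F ({#}, {I, J, K})
      = (if r \<le> I then F ({#}, {I - r, J - r, K - r}) else 0)"
proof -
  have supp: "S \<subseteq> {..<2 * r}" if "F (P, S) \<noteq> 0" for P S
    using F that unfolding form_supported_def by fastforce
  have "finite {z. F z \<noteq> 0}"
    by (rule finite_subset[of _ "{{#}} \<times> Pow {..<r}"]) (use F in \<open>fastforce simp: form_supported_def\<close>)+
  note C = substitute_coeff[of F "{..<2*r}" "swap_odd r", OF this supp swap_odd_in _ finite_lessThan]
  have "F ({#i#}, S) = 0" for S using F by (force simp: form_supported_def)
  then show "substitute even_gen (\<lambda>q. odd_gen (swap_odd r q)) F ({#i#}, {I}) = 0" if "I < 2 * r"
    using C[where S = "{I}" and P = "{#i#}"] that by simp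
  assume IJ: "I < J" "J < K" "K < 2 * r"
  have eq: "substitute even_gen (\<lambda>q. odd_gen (swap_odd r q)) F ({#}, {I, J, K})
      = F ({#}, {swap_odd r I, swap_odd r J, swap_odd r K})
        * inversion_sign (map (swap_odd r) (sorted_list_of_set {swap_odd r I, swap_odd r J, swap_odd r K}))"
    using C[where S = "{I, J, K}" and P = "{#}"] IJ by simp
  show "substitute even_gen (\<lambda>q. odd_gen (swap_odd r q)) F ({#}, {I, J, K})
      = (if r \<le> I then F ({#}, {I - r, J - r, K - r}) else 0)"
  proof (cases "r \<le> I")
    case True
    have "sorted_list_of_set {I - r, J - r, K - r} = [I - r, J - r, K - r]"
      using True IJ by (intro sorted_list_of_set3) linarith+
    moreover have "inversion_sign [I, J, K] = 1"
      using True IJ by (simp add: shuffle_sign_simps)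
    moreover have "I - r < r" "J - r < r" "K - r < r" "\<not> I < r" "\<not> J < r" "\<not> K < r"
      using True IJ by linarith+
    ultimately show ?thesis unfolding eq using True IJ by (simp add: swap_odd_def)
  next
    case False
    have "F ({#}, {swap_odd r I, swap_odd r J, swap_odd r K}) = 0"
    proof (rule ccontr)
      assume "F ({#}, {swap_odd r I, swap_odd r J, swap_odd r K}) \<noteq> 0"
      then have "swap_odd r I < r" using F by (auto simp: form_supported_def)
      then show False using False by (simp add: swap_odd_def)
    qed
    then show ?thesis unfolding eq using False by simp
  qed
qed

section \<open>Frames of a bundle, of its dual and of the double\<close>

lemma sum_lessThan_double: "(\<Sum>I<2 * r. h I) = (\<Sum>a<r. h a) + (\<Sum>a<r. h (r + a))" for r :: nat and h :: "nat \<Rightarrow> 'a::comm_monoid_add"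
proof -
  have "(\<Sum>I<2 * r. h I) = (\<Sum>I<r. h I) + (\<Sum>I=r..<2 * r. h I)"
    by (simp add: lessThan_atLeast0 sum.atLeastLessThan_concat)
  also have "(\<Sum>I=r..<2 * r. h I) = (\<Sum>a<r. h (r + a))"
    by (rule sum.reindex_bij_witness[of _ "\<lambda>a. r + a" "\<lambda>I. I - r"]) auto
  finally show ?thesis .
qed

text \<open>Frames are families of vectors but linear independence is a property of sets; the criterion on
  families also yields that no vector is repeated.\<close>

lemma independent_family:
  fixes f :: "nat \<Rightarrow> 'v::real_vector"
  assumes "\<And>c. (\<Sum>a<r. c a *\<^sub>R f a) = 0 \<Longrightarrow> \<forall>a<r. c a = 0"
  shows "inj_on f {..<r}" "independent (f ` {..<r})"
proof -
  show inj: "inj_on f {..<r}"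
  proof (rule inj_onI, rule ccontr)
    fix a b assume ab: "a \<in> {..<r}" "b \<in> {..<r}" "f a = f b" "a \<noteq> b"
    let ?c = "\<lambda>k. (if k = a then 1 else 0) - (if k = b then 1 else (0::real))"
    have "(\<Sum>k<r. ?c k *\<^sub>R f k) = (\<Sum>k<r. if k = a then f k else 0) - (\<Sum>k<r. if k = b then f k else 0)"
      unfolding sum_subtractf[symmetric] by (rule sum.cong) auto
    then have "(\<Sum>k<r. ?c k *\<^sub>R f k) = 0" using ab by simp
    then have "?c a = 0" using assms[of ?c] ab by blast
    then show False using ab by simp
  qed
  show "independent (f ` {..<r})"
  proof
    assume "dependent (f ` {..<r})"
    then obtain u v where v: "v \<in> f ` {..<r}" "u v \<noteq> 0" and s: "(\<Sum>v\<in>f ` {..<r}. u v *\<^sub>R v) = 0"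
      using dependent_finite[of "f ` {..<r}"] by auto
    have "(\<Sum>a<r. u (f a) *\<^sub>R f a) = 0" using s by (simp add: sum.reindex[OF inj])
    then show False using assms[of "\<lambda>a. u (f a)"] v by auto
  qed
qed

definition frame_at :: "('m, 'v::real_vector) vbundle \<Rightarrow> ('m, 'v) frame \<Rightarrow> 'm \<Rightarrow> bool" where
  "frame_at B e m \<longleftrightarrow> inj_on (\<lambda>a. snd e a m) {..<brank B} \<and>
     independent ((\<lambda>a. snd e a m) ` {..<brank B}) \<and>
     span ((\<lambda>a. snd e a m) ` {..<brank B}) = fibre B m"

lemma frame_atI:
  assumes "subspace (fibre B m)" "\<And>a. a < brank B \<Longrightarrow> snd e a m \<in> fibre B m"
    and "\<And>v. v \<in> fibre B m \<Longrightarrow> \<exists>c. v = (\<Sum>a<brank B. c a *\<^sub>R snd e a m)"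
    and "\<And>c. (\<Sum>a<brank B. c a *\<^sub>R snd e a m) = 0 \<Longrightarrow> \<forall>a<brank B. c a = 0"
  shows "frame_at B e m"
  unfolding frame_at_def
proof (intro conjI equalityI)
  show "span ((\<lambda>a. snd e a m) ` {..<brank B}) \<subseteq> fibre B m"
    by (rule span_minimal) (use assms(1,2) in auto)
  show "fibre B m \<subseteq> span ((\<lambda>a. snd e a m) ` {..<brank B})"
  proof
    fix v assume "v \<in> fibre B m"
    then obtain c where v: "v = (\<Sum>a<brank B. c a *\<^sub>R snd e a m)" using assms(3) by blast
    show "v \<in> span ((\<lambda>a. snd e a m) ` {..<brank B})"
      unfolding v by (intro span_sum span_scale span_base) auto
  qed
next
  show "inj_on (\<lambda>a. snd e a m) {..<brank B}" "independent ((\<lambda>a. snd e a m) ` {..<brank B})"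
    by (rule independent_family, rule assms(4), assumption)+
qed

context
  fixes B :: "('m, 'v::real_vector) vbundle" and e m
  assumes fr: "frame_at B e m"
begin

lemma frame_subspace: "subspace (fibre B m)"
  using fr subspace_span[of "(\<lambda>a. snd e a m) ` {..<brank B}"] by (simp add: frame_at_def)

lemma frame_in_fibre: "a < brank B \<Longrightarrow> snd e a m \<in> fibre B m"
  using fr span_base[of "snd e a m" "(\<lambda>a. snd e a m) ` {..<brank B}"] by (simp add: frame_at_def)

lemma coframe_expand: "v \<in> fibre B m \<Longrightarrow> (\<Sum>a<brank B. coframe B e a m v *\<^sub>R snd e a m) = v"
proof -
  assume v: "v \<in> fibre B m"
  let ?E = "(\<lambda>a. snd e a m) ` {..<brank B}"
  have "(\<Sum>b\<in>?E. representation ?E v b *\<^sub>R b) = v"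
    using fr v by (intro real_vector.sum_representation_eq) (auto simp: frame_at_def)
  then show ?thesis using fr v by (simp add: frame_at_def sum.reindex coframe_def)
qed

lemma coframe_add: "\<lbrakk>u \<in> fibre B m; v \<in> fibre B m\<rbrakk>
    \<Longrightarrow> coframe B e a m (u + v) = coframe B e a m u + coframe B e a m v"
  using fr frame_subspace by (simp add: frame_at_def coframe_def representation_add subspace_add)

lemma coframe_scale: "u \<in> fibre B m \<Longrightarrow> coframe B e a m (k *\<^sub>R u) = k * coframe B e a m u"
  using fr frame_subspace by (simp add: frame_at_def coframe_def representation_scale subspace_scale)

lemma coframe_frame: "\<lbrakk>a < brank B; b < brank B\<rbrakk>
    \<Longrightarrow> coframe B e b m (snd e a m) = (if a = b then 1 else 0)"
  using fr frame_in_fibre[of a]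
  by (auto simp: frame_at_def coframe_def representation_basis inj_on_def)

lemma coframe_in_dual: "coframe B e a m \<in> dual_space (fibre B m)"
  by (auto simp: dual_space_def coframe_add coframe_scale) (simp add: coframe_def)

lemma dual_add: "\<lbrakk>\<xi> \<in> dual_space (fibre B m); u \<in> fibre B m; v \<in> fibre B m\<rbrakk> \<Longrightarrow> \<xi> (u + v) = \<xi> u + \<xi> v"
  by (simp add: dual_space_def)

lemma dual_scale: "\<lbrakk>\<xi> \<in> dual_space (fibre B m); u \<in> fibre B m\<rbrakk> \<Longrightarrow> \<xi> (k *\<^sub>R u) = k * \<xi> u"
  by (simp add: dual_space_def)

lemma dual_zero: "\<xi> \<in> dual_space (fibre B m) \<Longrightarrow> \<xi> 0 = 0"
  using dual_scale[of \<xi> 0 0] frame_subspace by (simp add: subspace_0)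

lemma dual_sum:
  assumes "\<xi> \<in> dual_space (fibre B m)" "\<And>a. a \<in> X \<Longrightarrow> u a \<in> fibre B m"
  shows "\<xi> (\<Sum>a\<in>X. k a *\<^sub>R u a) = (\<Sum>a\<in>X. k a * \<xi> (u a))"
  using assms(2)
proof (induction X rule: infinite_finite_induct)
  case (insert x X)
  then have "(\<Sum>a\<in>X. k a *\<^sub>R u a) \<in> fibre B m"
    using frame_subspace by (intro subspace_sum subspace_scale) auto
  then show ?case using insert assms(1) frame_subspace
    by (simp add: dual_add dual_scale subspace_scale)
qed (simp_all add: dual_zero[OF assms(1)])

lemma coframe_combination: "b < brank B \<Longrightarrow> coframe B e b m (\<Sum>a<brank B. k a *\<^sub>R snd e a m) = k b"
proof -
  assume b: "b < brank B"
  have "coframe B e b m (\<Sum>a<brank B. k a *\<^sub>R snd e a m) = (\<Sum>a<brank B. k a * coframe B e b m (snd e a m))"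
    by (rule dual_sum[OF coframe_in_dual]) (auto intro: frame_in_fibre)
  also have "\<dots> = (\<Sum>a<brank B. if a = b then k a else 0)"
    using b by (intro sum.cong) (auto simp: coframe_frame)
  finally show ?thesis using b by simp
qed

lemma combination_in_fibre: "(\<Sum>a<brank B. k a *\<^sub>R snd e a m) \<in> fibre B m"
  using frame_subspace by (intro subspace_sum subspace_scale) (auto intro: frame_in_fibre)

lemma fibre_eqI:
  assumes "u \<in> fibre B m" "v \<in> fibre B m" "\<And>a. a < brank B \<Longrightarrow> coframe B e a m u = coframe B e a m v"
  shows "u = v"
proof -
  have "u = (\<Sum>a<brank B. coframe B e a m u *\<^sub>R snd e a m)" using coframe_expand[OF assms(1)] by simp
  also have "\<dots> = (\<Sum>a<brank B. coframe B e a m v *\<^sub>R snd e a m)" using assms(3) by simp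
  also have "\<dots> = v" by (rule coframe_expand[OF assms(2)])
  finally show ?thesis .
qed

lemma dual_apply: "\<lbrakk>\<xi> \<in> dual_space (fibre B m); v \<in> fibre B m\<rbrakk>
    \<Longrightarrow> \<xi> v = (\<Sum>a<brank B. coframe B e a m v * \<xi> (snd e a m))"
  using dual_sum[of \<xi> "{..<brank B}" "\<lambda>a. snd e a m" "\<lambda>a. coframe B e a m v"] coframe_expand[of v]
    frame_in_fibre by simp

lemma subspace_dual_space: "subspace (dual_space (fibre B m))"
  unfolding subspace_def dual_space_def by (auto simp: scaleR_fun_def algebra_simps)

lemma dual_expand:
  assumes "\<xi> \<in> dual_space (fibre B m)"
  shows "\<xi> = (\<Sum>a<brank B. \<xi> (snd e a m) *\<^sub>R coframe B e a m)"
proof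
  fix v
  have "(\<Sum>a<brank B. \<xi> (snd e a m) *\<^sub>R coframe B e a m) v = (\<Sum>a<brank B. \<xi> (snd e a m) * coframe B e a m v)"
    by (simp add: sum_fun_apply scaleR_fun_def)
  also have "\<dots> = \<xi> v"
  proof (cases "v \<in> fibre B m")
    case True then show ?thesis using dual_apply[OF assms] by (simp add: mult.commute)
  next
    case False then show ?thesis using assms by (simp add: coframe_def dual_space_def)
  qed
  finally show "\<xi> v = (\<Sum>a<brank B. \<xi> (snd e a m) *\<^sub>R coframe B e a m) v" ..
qed

text \<open>Evaluating a relation between the \<open>e\<^sup>a\<close> on the \<open>e\<^sub>b\<close> shows that the coframe is again a frame, so the
  results on a bundle also apply to its dual.\<close>

lemma dual_frame_at: "frame_at (dual_bundle B) (dual_frame B e) m"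
proof (rule frame_atI)
  fix \<xi> assume "\<xi> \<in> fibre (dual_bundle B) m"
  then show "\<exists>c. \<xi> = (\<Sum>a<brank (dual_bundle B). c a *\<^sub>R snd (dual_frame B e) a m)"
    using dual_expand[of \<xi>] by (auto simp: dual_bundle_def dual_frame_def)
next
  fix c :: "nat \<Rightarrow> real"
  assume s: "(\<Sum>a<brank (dual_bundle B). c a *\<^sub>R snd (dual_frame B e) a m) = 0"
  show "\<forall>a<brank (dual_bundle B). c a = 0"
  proof (intro allI impI)
    fix b assume b: "b < brank (dual_bundle B)"
    have "0 = (\<Sum>a<brank B. c a *\<^sub>R coframe B e a m) (snd e b m)"
      using s by (simp add: dual_bundle_def dual_frame_def)
    also have "\<dots> = (\<Sum>a<brank B. c a * coframe B e a m (snd e b m))"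
      by (simp add: sum_fun_apply scaleR_fun_def)
    also have "\<dots> = (\<Sum>a<brank B. if a = b then c a else 0)"
      using b by (intro sum.cong) (auto simp: coframe_frame dual_bundle_def)
    finally show "c b = 0" using b by (simp add: dual_bundle_def)
  qed
qed (auto simp: dual_bundle_def dual_frame_def subspace_dual_space coframe_in_dual)

lemma coframe_dual:
  assumes "\<xi> \<in> dual_space (fibre B m)" "a < brank B"
  shows "coframe (dual_bundle B) (dual_frame B e) a m \<xi> = \<xi> (snd e a m)"
proof -
  have "snd (dual_frame B e) b m = coframe B e b m" for b by (simp add: dual_frame_def)
  then show ?thesis
    using dual_expand[OF assms(1)] assms(2)
      Submission.coframe_combination[OF dual_frame_at, of a "\<lambda>b. \<xi> (snd e b m)"] by (simp add: dual_bundle_def)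
qed

text \<open>The vectors \<open>E\<^sub>I\<close>, which are \<open>(e\<^sub>I, 0)\<close> for \<open>I < r\<close> and \<open>(0, e\<^sup>a)\<close> for \<open>I = r + a\<close>.\<close>

lemma double_frame_at: "frame_at (double_bundle B) (sum_frame B e) m"
proof (rule frame_atI)
  have s: "(\<Sum>a<2 * brank B. c a *\<^sub>R snd (sum_frame B e) a m)
     = (\<Sum>a<brank B. c a *\<^sub>R snd e a m, \<Sum>a<brank B. c (brank B + a) *\<^sub>R coframe B e a m)" for c :: "nat \<Rightarrow> real"
    unfolding sum_lessThan_double by (simp add: sum_frame_def sum_prod)
  show "\<exists>c. u = (\<Sum>a<brank (double_bundle B). c a *\<^sub>R snd (sum_frame B e) a m)"
    if u: "u \<in> fibre (double_bundle B) m" for u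
  proof -
    have "fst u = (\<Sum>a<brank B. coframe B e a m (fst u) *\<^sub>R snd e a m)"
      "snd u = (\<Sum>a<brank B. snd u (snd e a m) *\<^sub>R coframe B e a m)"
      using u coframe_expand[of "fst u"] dual_expand[of "snd u"] by (auto simp: double_bundle_def)
    then show ?thesis
      by (intro exI[of _ "\<lambda>a. if a < brank B then coframe B e a m (fst u) else snd u (snd e (a - brank B) m)"])
        (simp add: double_bundle_def s prod_eq_iff)
  qed
  show "\<forall>a<brank (double_bundle B). c a = 0"
    if z: "(\<Sum>a<brank (double_bundle B). c a *\<^sub>R snd (sum_frame B e) a m) = 0" for c
  proof (intro allI impI)
    fix a assume a: "a < brank (double_bundle B)"
    have z1: "(\<Sum>a<brank B. c a *\<^sub>R snd e a m) = 0" and z2: "(\<Sum>a<brank B. c (brank B + a) *\<^sub>R coframe B e a m) = 0"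
      using z by (auto simp: double_bundle_def s zero_prod_def)
    show "c a = 0"
    proof (cases "a < brank B")
      case True
      have "coframe B e a m 0 = 0" using coframe_scale[of 0 a 0] subspace_0[OF frame_subspace] by simp
      then show ?thesis using coframe_combination[OF True, of c] z1 by simp
    next
      case False
      then have b: "a - brank B < brank B" using a by (simp add: double_bundle_def)
      have "0 = (\<Sum>k<brank B. c (brank B + k) *\<^sub>R coframe B e k m) (snd e (a - brank B) m)" by (simp add: z2)
      also have "\<dots> = (\<Sum>k<brank B. c (brank B + k) * coframe B e k m (snd e (a - brank B) m))"
        by (simp add: sum_fun_apply scaleR_fun_def)
      also have "\<dots> = (\<Sum>k<brank B. if k = a - brank B then c (brank B + k) else 0)"
        using b by (intro sum.cong) (auto simp: coframe_frame)
      finally show ?thesis using b False by simp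
    qed
  qed
qed (auto simp: double_bundle_def sum_frame_def frame_in_fibre coframe_in_dual subspace_0
      frame_subspace subspace_dual_space subspace_Times)

lemma coframe_double:
  assumes "v \<in> fibre B m" "\<xi> \<in> dual_space (fibre B m)" "I < 2 * brank B"
  shows "coframe (double_bundle B) (sum_frame B e) I m (v, \<xi>)
    = (if I < brank B then coframe B e I m v else \<xi> (snd e (I - brank B) m))"
proof -
  have u: "(v, \<xi>) \<in> fibre (double_bundle B) m" using assms by (simp add: double_bundle_def)
  let ?c = "\<lambda>J. coframe (double_bundle B) (sum_frame B e) J m (v, \<xi>)"
  have ex: "(v, \<xi>) = (\<Sum>J<2 * brank B. ?c J *\<^sub>R snd (sum_frame B e) J m)"
    using Submission.coframe_expand[OF double_frame_at u] by (simp add: double_bundle_def)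
  show ?thesis
  proof (cases "I < brank B")
    case True
    have "coframe B e I m v = coframe B e I m (\<Sum>J<2 * brank B. ?c J *\<^sub>R fst (snd (sum_frame B e) J m))"
      by (subst ex[THEN arg_cong[where f = fst], simplified]) (simp add: fst_sum)
    also have "\<dots> = (\<Sum>J<2 * brank B. ?c J * coframe B e I m (fst (snd (sum_frame B e) J m)))"
      by (rule dual_sum[OF coframe_in_dual]) (auto simp: sum_frame_def frame_in_fibre subspace_0 frame_subspace)
    also have "\<dots> = (\<Sum>J<2 * brank B. if J = I then ?c J else 0)"
      using True by (intro sum.cong) (auto simp: sum_frame_def coframe_frame dual_zero[OF coframe_in_dual])
    finally show ?thesis using True by simp
  next
    case False
    then have b: "I - brank B < brank B" using assms by simp
    have "\<xi> (snd e (I - brank B) m) = (\<Sum>J<2 * brank B. ?c J *\<^sub>R snd (snd (sum_frame B e) J m)) (snd e (I - brank B) m)"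
      by (subst ex[THEN arg_cong[where f = snd], simplified]) (simp add: snd_sum)
    also have "\<dots> = (\<Sum>J<2 * brank B. ?c J * snd (snd (sum_frame B e) J m) (snd e (I - brank B) m))"
      by (simp add: sum_fun_apply scaleR_fun_def)
    also have "\<dots> = (\<Sum>J<2 * brank B. if J = I then ?c J else 0)"
      using b False by (intro sum.cong) (auto simp: sum_frame_def coframe_frame)
    finally show ?thesis using False assms by simp
  qed
qed

end

section \<open>Sections and forms in frames\<close>

lemma chart_domain_Int:
  assumes "smooth_manifold M" "c \<in> atlas M" "open W"
  shows "chart_domain M c (fst c \<inter> W)"
  using assms smooth_manifold_chart(1)[OF assms(1,2)] by unfold_locales auto

context
  fixes M :: "'m::{t2_space,second_countable_topology} manifold" and W :: "'m set"
  assumes M: "smooth_manifold M" and W: "open W"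
begin

lemma smooth_fun_on_cong:
  "\<lbrakk>smooth_fun_on M W f; \<And>m. m \<in> W \<Longrightarrow> f m = g m\<rbrakk> \<Longrightarrow> smooth_fun_on M W g"
  unfolding smooth_fun_on_chart
  using chart_domain.smooth_in_chart_cong[OF chart_domain_Int[OF M _ W]] by (metis IntD2)

lemma smooth_fun_on_const: "smooth_fun_on M W (\<lambda>_. k)"
  unfolding smooth_fun_on_chart
  using chart_domain.smooth_in_chart_const[OF chart_domain_Int[OF M _ W]] by blast

lemma smooth_fun_on_add:
  "\<lbrakk>smooth_fun_on M W f; smooth_fun_on M W g\<rbrakk> \<Longrightarrow> smooth_fun_on M W (\<lambda>m. f m + g m)"
  unfolding smooth_fun_on_chart
  using chart_domain.smooth_in_chart_add[OF chart_domain_Int[OF M _ W]] by simp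

lemma smooth_fun_on_mult:
  "\<lbrakk>smooth_fun_on M W f; smooth_fun_on M W g\<rbrakk> \<Longrightarrow> smooth_fun_on M W (\<lambda>m. f m * g m)"
  unfolding smooth_fun_on_chart
  using chart_domain.smooth_in_chart_mult[OF chart_domain_Int[OF M _ W]] by simp

lemma smooth_fun_on_sum: "(\<And>x. x \<in> X \<Longrightarrow> smooth_fun_on M W (f x)) \<Longrightarrow> smooth_fun_on M W (\<lambda>m. \<Sum>x\<in>X. f x m)"
  by (induction X rule: infinite_finite_induct) (simp_all add: smooth_fun_on_const smooth_fun_on_add)

end

lemma smooth_in_chart_subset:
  assumes "smooth_fun_on M W f" "c \<in> atlas M" "U \<subseteq> fst c \<inter> W"
  shows "smooth_in_chart M c U f"
  using assms unfolding smooth_fun_on_def smooth_in_chart_def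
  by (meson image_mono smooth_on_mono)

lemma smooth_fun_on_subset: "smooth_fun_on M W f \<Longrightarrow> W' \<subseteq> W \<Longrightarrow> smooth_fun_on M W' f"
  unfolding smooth_fun_on_chart using smooth_in_chart_subset[of M W f]
  by (metis Int_mono order_refl smooth_fun_on_chart)

lemma chart_coordinate_smooth:
  assumes "smooth_manifold M" "c \<in> atlas M" "i < mdim M"
  shows "smooth_fun_on M (fst c) (\<lambda>p. snd c p i)"
  using assms unfolding smooth_fun_on_def smooth_manifold_def by blast

lemma vector_bundle_frame_at: "vector_bundle M B \<longleftrightarrow>
     (\<Union>e\<in>frames B. fst e) = UNIV \<and> (\<forall>m. subspace (fibre B m)) \<and>
     (\<forall>e\<in>frames B. open (fst e) \<and> (\<forall>m\<in>fst e. frame_at B e m)) \<and>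
     (\<forall>e\<in>frames B. \<forall>e'\<in>frames B. \<forall>a<brank B. \<forall>b<brank B.
        smooth_fun_on M (fst e \<inter> fst e') (\<lambda>m. coframe B e b m (snd e' a m)))"
  unfolding vector_bundle_def frame_at_def ..

lemma form_slot_dual:
  assumes "alternating_form F \<omega>" "us \<in> lists F" "ws \<in> lists F"
  shows "(\<lambda>u. \<omega> (us @ u # ws)) \<in> dual_space F"
  using assms unfolding alternating_form_def dual_space_def by auto

text \<open>Expand the vanishing value on a repeated argument \<open>u + v\<close>.\<close>

lemma form_swap:
  assumes F: "alternating_form F \<omega>" "subspace F" and l: "us \<in> lists F" "ws \<in> lists F" "u \<in> F" "v \<in> F"
  shows "\<omega> (us @ v # u # ws) = - \<omega> (us @ u # v # ws)"
proof -
  have add: "\<omega> (us' @ (x + y) # ws') = \<omega> (us' @ x # ws') + \<omega> (us' @ y # ws')"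
    if "us' \<in> lists F" "ws' \<in> lists F" "x \<in> F" "y \<in> F" for us' ws' x y
    using F that unfolding alternating_form_def by blast
  have z: "\<omega> (us @ x # x # ws) = 0" if "x \<in> F" for x
  proof -
    have "us @ x # x # ws \<in> lists F" "\<not> distinct (us @ x # x # ws)" using l that by auto
    then show ?thesis using F unfolding alternating_form_def by blast
  qed
  have uv: "u + v \<in> F" using F l by (simp add: subspace_add)
  have "0 = \<omega> (us @ (u + v) # (u + v) # ws)" using z[OF uv] by simp
  also have "\<dots> = \<omega> (us @ u # (u + v) # ws) + \<omega> (us @ v # (u + v) # ws)"
    using l uv by (intro add) auto
  also have "\<omega> (us @ u # (u + v) # ws) = \<omega> (us @ u # u # ws) + \<omega> (us @ u # v # ws)"
    using add[of "us @ [u]" ws u v] l by simp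
  also have "\<omega> (us @ v # (u + v) # ws) = \<omega> (us @ v # u # ws) + \<omega> (us @ v # v # ws)"
    using add[of "us @ [v]" ws u v] l by simp
  finally show ?thesis using z l by simp
qed

text \<open>An element of the bidual of a fibre is the evaluation at a vector, since the fibre has a finite
  basis.\<close>

lemma form_section_spec:
  assumes fr: "frame_at B e m" and \<beta>: "(\<lambda>\<xi>. \<beta> m [\<xi>]) \<in> dual_space (dual_space (fibre B m))"
  shows "form_section B \<beta> m \<in> fibre B m \<and> (\<forall>\<xi>\<in>dual_space (fibre B m). \<xi> (form_section B \<beta> m) = \<beta> m [\<xi>])"
proof -
  define v where "v = (\<Sum>a<brank B. \<beta> m [coframe B e a m] *\<^sub>R snd e a m)"
  have v: "v \<in> fibre B m" unfolding v_def by (rule combination_in_fibre[OF fr])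
  have ev: "\<beta> m [\<xi>] = \<xi> v" if \<xi>: "\<xi> \<in> dual_space (fibre B m)" for \<xi>
  proof -
    have "\<beta> m [\<xi>] = (\<Sum>a<brank B. \<xi> (snd e a m) * \<beta> m [coframe B e a m])"
      using dual_apply[OF dual_frame_at[OF fr], of "\<lambda>\<xi>. \<beta> m [\<xi>]" \<xi>] \<beta> \<xi> coframe_dual[OF fr \<xi>]
      by (simp add: dual_bundle_def dual_frame_def)
    also have "\<dots> = \<xi> v" unfolding v_def
      by (subst dual_sum[OF fr \<xi>]) (auto intro: frame_in_fibre[OF fr] sum.cong)
    finally show ?thesis .
  qed
  have "form_section B \<beta> m = v"
    unfolding form_section_def
  proof (rule the_equality)
    fix w assume w: "w \<in> fibre B m \<and> (\<forall>\<xi>\<in>dual_space (fibre B m). \<beta> m [\<xi>] = \<xi> w)"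
    show "w = v"
    proof (rule fibre_eqI[OF fr])
      fix a show "coframe B e a m w = coframe B e a m v"
        using w ev coframe_in_dual[OF fr, of a] by metis
    qed (use w v in auto)
  qed (use v ev in blast)
  then show ?thesis using v ev by simp
qed

lemma form1_single [simp]: "form1 \<xi> m [v] = \<xi> m v"
  by (simp add: form1_def)

lemma form1_length: "length us \<noteq> 1 \<Longrightarrow> form1 \<xi> m us = 0"
  by (cases us; cases "tl us") (auto simp: form1_def)

lemma alternating_form1:
  fixes \<xi> :: "'m \<Rightarrow> 'v::real_vector \<Rightarrow> real"
  assumes "\<xi> m \<in> dual_space F"
  shows "alternating_form F (form1 \<xi> m)"
  unfolding alternating_form_def
proof (intro conjI ballI allI impI)
  fix us ws u v k assume "us \<in> lists F" "ws \<in> lists F" "u \<in> F" "v \<in> F"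
  then show "form1 \<xi> m (us @ (u + v) # ws) = form1 \<xi> m (us @ u # ws) + form1 \<xi> m (us @ v # ws)"
    "form1 \<xi> m (us @ (k *\<^sub>R u) # ws) = k * form1 \<xi> m (us @ u # ws)"
    using assms by (cases "us = [] \<and> ws = []"; auto simp: form1_length dual_space_def)+
next
  fix us :: "'v list" assume "\<not> distinct us"
  then have "length us \<noteq> 1" by (cases us) auto
  then show "form1 \<xi> m us = 0" by (rule form1_length)
next
  fix us assume us: "us \<notin> lists F"
  show "form1 \<xi> m us = 0"
  proof (cases "length us = 1")
    case True
    then obtain v where "us = [v]" by (cases us) auto
    then show ?thesis using us assms by (simp add: dual_space_def)
  qed (rule form1_length)
qed

locale vbundle =
  fixes M :: "'m::{t2_space,second_countable_topology} manifold"
    and B :: "('m, 'v::real_vector) vbundle"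
  assumes manifold: "smooth_manifold M" and vb: "vector_bundle M B"
begin

lemma frame_at: "e \<in> frames B \<Longrightarrow> m \<in> fst e \<Longrightarrow> frame_at B e m"
  and open_frame: "e \<in> frames B \<Longrightarrow> open (fst e)"
  and frame_cover: "\<exists>e\<in>frames B. m \<in> fst e"
  and chart_cover: "\<exists>c\<in>atlas M. m \<in> fst c"
  and subspace_fibre: "subspace (fibre B m)"
  and transition_smooth: "\<lbrakk>e \<in> frames B; e' \<in> frames B; a < brank B; b < brank B\<rbrakk>
    \<Longrightarrow> smooth_fun_on M (fst e \<inter> fst e') (\<lambda>m. coframe B e b m (snd e' a m))"
  using manifold vb unfolding vector_bundle_frame_at smooth_manifold_def by blast+

lemma open_chart: "c \<in> atlas M \<Longrightarrow> open (fst c)"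
  by (rule smooth_manifold_chart(1)[OF manifold])

lemma section_in_fibre: "X \<in> sections_on M B W \<Longrightarrow> m \<in> W \<Longrightarrow> X m \<in> fibre B m"
  by (simp add: sections_on_def)

lemma section_smooth: "\<lbrakk>X \<in> sections_on M B W; e \<in> frames B; a < brank B\<rbrakk>
    \<Longrightarrow> smooth_fun_on M (W \<inter> fst e) (\<lambda>m. coframe B e a m (X m))"
  by (simp add: sections_on_def)

lemma dual_vector_bundle: "vector_bundle M (dual_bundle B)"
  unfolding vector_bundle_frame_at
proof (intro conjI ballI allI impI)
  show "(\<Union>e\<in>frames (dual_bundle B). fst e) = UNIV"
    using frame_cover by (fastforce simp: dual_bundle_def dual_frame_def)
  fix m show "subspace (fibre (dual_bundle B) m)"
    unfolding subspace_def dual_bundle_def dual_space_def by (auto simp: scaleR_fun_def algebra_simps)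
next
  fix e assume "e \<in> frames (dual_bundle B)"
  then show "open (fst e)" using open_frame by (auto simp: dual_bundle_def dual_frame_def)
next
  fix e m assume e: "e \<in> frames (dual_bundle B)" "m \<in> fst e"
  then obtain f where f: "f \<in> frames B" "e = dual_frame B f" by (auto simp: dual_bundle_def)
  then show "frame_at (dual_bundle B) e m"
    using dual_frame_at[OF frame_at[OF f(1)]] e by (simp add: dual_frame_def)
next
  fix e e' a b assume "e \<in> frames (dual_bundle B)" "e' \<in> frames (dual_bundle B)"
    and ab: "a < brank (dual_bundle B)" "b < brank (dual_bundle B)"
  then obtain f f' where f: "f \<in> frames B" "e = dual_frame B f" "f' \<in> frames B" "e' = dual_frame B f'"
    by (auto simp: dual_bundle_def)
  have o: "open (fst f \<inter> fst f')" by (intro open_Int open_frame) (fact f)+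
  have "smooth_fun_on M (fst f \<inter> fst f') (\<lambda>m. coframe B f' a m (snd f b m))"
    using transition_smooth[of f' f b a] f ab by (simp add: dual_bundle_def Int_commute)
  then have "smooth_fun_on M (fst f \<inter> fst f') (\<lambda>m. coframe (dual_bundle B) (dual_frame B f) b m (coframe B f' a m))"
  proof (rule smooth_fun_on_cong[OF manifold o])
    fix m assume "m \<in> fst f \<inter> fst f'"
    then have fr: "frame_at B f m" "frame_at B f' m" using f frame_at by auto
    have "b < brank B" using ab by (simp add: dual_bundle_def)
    then show "coframe B f' a m (snd f b m) = coframe (dual_bundle B) (dual_frame B f) b m (coframe B f' a m)"
      using coframe_dual[OF fr(1) coframe_in_dual[OF fr(2), of a], of b] by simp
  qed
  then show "smooth_fun_on M (fst e \<inter> fst e') (\<lambda>m. coframe (dual_bundle B) e b m (snd e' a m))"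
    by (simp add: f dual_frame_def)
qed

lemma double_vector_bundle: "vector_bundle M (double_bundle B)"
  unfolding vector_bundle_frame_at
proof (intro conjI ballI allI impI)
  show "(\<Union>e\<in>frames (double_bundle B). fst e) = UNIV"
    using frame_cover by (fastforce simp: double_bundle_def sum_frame_def)
  fix m show "subspace (fibre (double_bundle B) m)"
    using frame_cover[of m] frame_subspace[OF double_frame_at[OF frame_at]] by blast
next
  fix e assume "e \<in> frames (double_bundle B)"
  then show "open (fst e)" using open_frame by (auto simp: double_bundle_def sum_frame_def)
next
  fix e m assume e: "e \<in> frames (double_bundle B)" "m \<in> fst e"
  then obtain f where f: "f \<in> frames B" "e = sum_frame B f" by (auto simp: double_bundle_def)
  then show "frame_at (double_bundle B) e m"
    using double_frame_at[OF frame_at[OF f(1)]] e by (simp add: sum_frame_def)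
next
  fix e e' a b assume "e \<in> frames (double_bundle B)" "e' \<in> frames (double_bundle B)"
    and ab: "a < brank (double_bundle B)" "b < brank (double_bundle B)"
  then obtain f f' where f: "f \<in> frames B" "e = sum_frame B f" "f' \<in> frames B" "e' = sum_frame B f'"
    by (auto simp: double_bundle_def)
  let ?r = "brank B"
  have ab: "a < 2 * ?r" "b < 2 * ?r" using ab by (simp_all add: double_bundle_def)
  have o: "open (fst f \<inter> fst f')" by (intro open_Int open_frame) (fact f)+
  define g where "g = (\<lambda>m. if b < ?r then (if a < ?r then coframe B f b m (snd f' a m) else 0)
      else (if a < ?r then 0 else coframe B f' (a - ?r) m (snd f (b - ?r) m)))"
  have s1: "smooth_fun_on M (fst f \<inter> fst f') (\<lambda>m. coframe B f b m (snd f' a m))" if "a < ?r" "b < ?r"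
    using transition_smooth[of f f' a b] f that by simp
  have s2: "smooth_fun_on M (fst f \<inter> fst f') (\<lambda>m. coframe B f' (a - ?r) m (snd f (b - ?r) m))" if "\<not> a < ?r" "\<not> b < ?r"
    using transition_smooth[of f' f "b - ?r" "a - ?r"] f that ab by (simp add: Int_commute)
  have "smooth_fun_on M (fst f \<inter> fst f') g"
    unfolding g_def using s1 s2 smooth_fun_on_const[OF manifold o]
    by (cases "a < ?r"; cases "b < ?r") simp_all
  then have "smooth_fun_on M (fst f \<inter> fst f') (\<lambda>m. coframe (double_bundle B) (sum_frame B f) b m (snd (sum_frame B f') a m))"
  proof (rule smooth_fun_on_cong[OF manifold o])
    fix m assume m: "m \<in> fst f \<inter> fst f'"
    then have fr: "frame_at B f m" "frame_at B f' m" using f frame_at by auto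
    have z: "0 \<in> fibre B m" "0 \<in> dual_space (fibre B m)"
      using subspace_0[OF subspace_fibre] subspace_0[OF subspace_dual_space[OF fr(1)]] by auto
    have cz: "coframe B f b m 0 = 0" by (rule dual_zero[OF fr(1) coframe_in_dual[OF fr(1)]])
    show "g m = coframe (double_bundle B) (sum_frame B f) b m (snd (sum_frame B f') a m)"
    proof (cases "a < ?r")
      case True
      have "snd (sum_frame B f') a m = (snd f' a m, 0)" using True by (simp add: sum_frame_def)
      then show ?thesis
        using True coframe_double[OF fr(1) frame_in_fibre[OF fr(2) True] z(2) ab(2)] by (simp add: g_def)
    next
      case False
      have "snd (sum_frame B f') a m = (0, coframe B f' (a - ?r) m)" using False by (simp add: sum_frame_def)
      then show ?thesis
        using False cz coframe_double[OF fr(1) z(1) coframe_in_dual[OF fr(2)] ab(2)] by (simp add: g_def)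
    qed
  qed
  then show "smooth_fun_on M (fst e \<inter> fst e') (\<lambda>m. coframe (double_bundle B) e b m (snd e' a m))"
    by (simp add: f sum_frame_def)
qed

text \<open>The components of a section of the dual bundle in the coframe are its values on the frame.\<close>

lemma dual_section_iff:
  assumes W: "open W"
  shows "\<xi> \<in> sections_on M (dual_bundle B) W \<longleftrightarrow> (\<forall>m\<in>W. \<xi> m \<in> dual_space (fibre B m)) \<and>
    (\<forall>e\<in>frames B. \<forall>a<brank B. smooth_fun_on M (W \<inter> fst e) (\<lambda>m. \<xi> m (snd e a m)))"
proof -
  have "smooth_fun_on M (W \<inter> fst e) (\<lambda>m. coframe (dual_bundle B) (dual_frame B e) a m (\<xi> m))
     \<longleftrightarrow> smooth_fun_on M (W \<inter> fst e) (\<lambda>m. \<xi> m (snd e a m))"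
    if "\<forall>m\<in>W. \<xi> m \<in> dual_space (fibre B m)" "e \<in> frames B" "a < brank B" for e a
  proof -
    have o: "open (W \<inter> fst e)" by (intro open_Int W open_frame) (fact that)
    have eq: "coframe (dual_bundle B) (dual_frame B e) a m (\<xi> m) = \<xi> m (snd e a m)" if "m \<in> W \<inter> fst e" for m
      using that \<open>a < brank B\<close> \<open>e \<in> frames B\<close> \<open>\<forall>m\<in>W. _\<close> frame_at by (intro coframe_dual) auto
    show ?thesis
      using smooth_fun_on_cong[OF manifold o, of _ "\<lambda>m. \<xi> m (snd e a m)"]
        smooth_fun_on_cong[OF manifold o, of "\<lambda>m. \<xi> m (snd e a m)" "\<lambda>m. coframe (dual_bundle B) (dual_frame B e) a m (\<xi> m)"] eq
      by (metis (no_types, lifting))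
  qed
  then show ?thesis by (auto simp: sections_on_def dual_bundle_def dual_frame_def)
qed

lemma form0_in_kforms:
  assumes W: "open W" and f: "smooth_fun_on M W f"
  shows "form0 f \<in> kforms_on M B 0 W"
proof -
  have "smooth_fun_on M (W \<inter> fst e) (\<lambda>m. form0 f m (map (\<lambda>a. snd e a m) (sorted_list_of_set S)))"
    if "e \<in> frames B" "S \<subseteq> {..<brank B}" for e S
  proof -
    have fin: "finite S" using that finite_subset by blast
    have o: "open (W \<inter> fst e)" by (intro open_Int W open_frame) (fact that)
    show ?thesis
      using smooth_fun_on_subset[OF f, of "W \<inter> fst e"] smooth_fun_on_const[OF manifold o, of 0] fin
      by (cases "S = {}") (simp_all add: form0_def)
  qed
  then show ?thesis
    by (auto simp: kforms_on_def forms_on_def alternating_form_def form0_def)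
qed

lemma form1_in_kforms:
  assumes W: "open W" and \<xi>: "\<xi> \<in> sections_on M (dual_bundle B) W"
  shows "form1 \<xi> \<in> kforms_on M B 1 W"
proof -
  have d: "\<xi> m \<in> dual_space (fibre B m)" if "m \<in> W" for m using \<xi> that dual_section_iff[OF W] by blast
  have "smooth_fun_on M (W \<inter> fst e) (\<lambda>m. form1 \<xi> m (map (\<lambda>a. snd e a m) (sorted_list_of_set S)))"
    if "e \<in> frames B" "S \<subseteq> {..<brank B}" for e S
  proof -
    have fin: "finite S" using that finite_subset by blast
    have o: "open (W \<inter> fst e)" by (intro open_Int W open_frame) (fact that)
    show ?thesis
    proof (cases "\<exists>a. S = {a}")
      case True
      then obtain a where "S = {a}" by blast
      then show ?thesis using \<xi> that dual_section_iff[OF W] by (simp add: form1_def)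
    next
      case False
      have "length (sorted_list_of_set S) \<noteq> 1" using False by (auto simp: card_1_singleton_iff)
      then have "form1 \<xi> m (map (\<lambda>a. snd e a m) (sorted_list_of_set S)) = 0" for m
        by (intro form1_length) simp
      then show ?thesis using smooth_fun_on_const[OF manifold o, of 0] by simp
    qed
  qed
  moreover have "alternating_form (fibre B m) (form1 \<xi> m)" if "m \<in> W" for m
    using d[OF that] by (rule alternating_form1)
  ultimately show ?thesis
    by (simp add: kforms_on_def forms_on_def form1_length)
qed

lemma coframe_section: "e \<in> frames B \<Longrightarrow> a < brank B \<Longrightarrow> coframe B e a \<in> sections_on M (dual_bundle B) (fst e)"
  using dual_section_iff[OF open_frame] coframe_in_dual[OF frame_at] transition_smooth by auto

lemma kform_alternating: "\<omega> \<in> kforms_on M B k W \<Longrightarrow> m \<in> W \<Longrightarrow> alternating_form (fibre B m) (\<omega> m)"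
  by (simp add: kforms_on_def forms_on_def)

lemma one_form_dual: "\<omega> \<in> kforms_on M B 1 W \<Longrightarrow> m \<in> W \<Longrightarrow> (\<lambda>v. \<omega> m [v]) \<in> dual_space (fibre B m)"
  using form_slot_dual[of "fibre B m" "\<omega> m" "[]" "[]"] kform_alternating by simp

text \<open>Expansion of the first two arguments only: the third one of a trilinear form is kept because it
  will be a frame vector.\<close>

lemma form_apply2:
  assumes "alternating_form (fibre B m) \<omega>" "e \<in> frames B" "m \<in> fst e" "u \<in> fibre B m" "v \<in> fibre B m"
    and ws: "ws \<in> lists (fibre B m)"
  shows "\<omega> (u # v # ws) = (\<Sum>a<brank B. \<Sum>b<brank B.
      coframe B e a m u * coframe B e b m v * \<omega> (snd e a m # snd e b m # ws))"
proof -
  note fr = frame_at[OF assms(2,3)]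
  have "\<omega> (u # v # ws) = (\<Sum>a<brank B. coframe B e a m u * \<omega> (snd e a m # v # ws))"
    using dual_apply[OF fr, of "\<lambda>u. \<omega> (u # v # ws)" u] form_slot_dual[OF assms(1), of "[]" "v # ws"] assms by simp
  also have "\<dots> = (\<Sum>a<brank B. \<Sum>b<brank B.
      coframe B e a m u * coframe B e b m v * \<omega> (snd e a m # snd e b m # ws))"
  proof (rule sum.cong[OF refl])
    fix a assume a: "a \<in> {..<brank B}"
    have "\<omega> (snd e a m # v # ws) = (\<Sum>b<brank B. coframe B e b m v * \<omega> (snd e a m # snd e b m # ws))"
      using dual_apply[OF fr, of "\<lambda>v. \<omega> (snd e a m # v # ws)" v]
        form_slot_dual[OF assms(1), of "[snd e a m]" ws] frame_in_fibre[OF fr] a assms by simp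
    then show "coframe B e a m u * \<omega> (snd e a m # v # ws) = (\<Sum>b<brank B.
        coframe B e a m u * coframe B e b m v * \<omega> (snd e a m # snd e b m # ws))"
      by (simp add: sum_distrib_left mult.assoc)
  qed
  finally show ?thesis .
qed

lemma kform_frame_smooth:
  assumes "\<omega> \<in> kforms_on M B k W" "e \<in> frames B" "S \<subseteq> {..<brank B}"
  shows "smooth_fun_on M (W \<inter> fst e) (\<lambda>m. \<omega> m (map (\<lambda>a. snd e a m) (sorted_list_of_set S)))"
  using assms by (simp add: kforms_on_def forms_on_def)

end

section \<open>Degree one vector fields and their brackets in frames\<close>

text \<open>The coefficients of a degree one vector field \<open>d\<close> on \<open>\<Pi>B\<close>: in a chart and a frame,
  \<open>d x\<^sup>i = \<rho>\<^sub>a\<^sup>i \<xi>\<^sup>a\<close> with \<open>\<rho>\<^sub>a\<^sup>i\<close> the anchor of \<open>e\<^sub>a\<close>, and \<open>(d \<xi>\<^sup>k)(e\<^sub>a, e\<^sub>b)\<close> is minus the \<open>k\<close>-th component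
  of \<open>[e\<^sub>a, e\<^sub>b]\<close>.\<close>

definition frame_anchor :: "('m, 'v) form_op \<Rightarrow> 'm chart \<Rightarrow> ('m, 'v) frame \<Rightarrow> nat \<Rightarrow> nat \<Rightarrow> 'm \<Rightarrow> real" where
  "frame_anchor d c e i a m = d (form0 (\<lambda>p. snd c p i)) m [snd e a m]"

definition frame_structure :: "('m, 'v::real_vector) vbundle \<Rightarrow> ('m, 'v) form_op \<Rightarrow> ('m, 'v) frame \<Rightarrow>
    nat \<Rightarrow> nat \<Rightarrow> nat \<Rightarrow> 'm \<Rightarrow> real" where
  "frame_structure B d e k a b m = d (form1 (coframe B e k)) m [snd e a m, snd e b m]"

text \<open>The vector field on the base that is the anchor of \<open>e\<^sub>a\<close>.\<close>

definition frame_vf :: "'m manifold \<Rightarrow> ('m, 'v) form_op \<Rightarrow> 'm chart \<Rightarrow> ('m, 'v) frame \<Rightarrow> nat \<Rightarrow> ('m \<Rightarrow> real) \<Rightarrow> 'm \<Rightarrow> real" where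
  "frame_vf M d c e a f m = (\<Sum>i<mdim M. frame_anchor d c e i a m * pd c i f m)"

lemma pi_pullback_form0: "pi_pullback B (form0 f) c e m (P, S) = (if P = {#} \<and> S = {} then f m else 0)"
proof (cases "P = {#} \<and> S \<subseteq> {..<brank B} \<and> S \<noteq> {}")
  case True
  then have "finite S" using finite_subset by blast
  then show ?thesis using True by (simp add: pi_pullback_def form0_def)
qed (auto simp: pi_pullback_def form0_def)

lemma pi_pullback_form1_single:
  "a < brank B \<Longrightarrow> pi_pullback B (form1 \<xi>) c e m ({#}, {a}) = \<xi> m (snd e a m)"
  by (simp add: pi_pullback_def)

lemma pi_pullback_form1_zero:
  assumes "finite S" "card S \<noteq> 1"
  shows "pi_pullback B (form1 \<xi>) c e m (P, S) = 0"
proof -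
  have "length (map (\<lambda>a. snd e a m) (sorted_list_of_set S)) \<noteq> 1" using assms by simp
  then have "form1 \<xi> m (map (\<lambda>a. snd e a m) (sorted_list_of_set S)) = 0" by (rule form1_length)
  then show ?thesis unfolding pi_pullback_def prod.case by (simp only: if_cancel)
qed

locale vbundle_vector_field = vbundle M B
  for M :: "'m::{t2_space,second_countable_topology} manifold" and B :: "('m, 'v::real_vector) vbundle" +
  fixes d :: "('m, 'v) form_op"
  assumes vector_field: "vector_field_Pi M B d" and degree: "degree_one M B d"
begin

lemma d_kform: "open W \<Longrightarrow> \<omega> \<in> kforms_on M B k W \<Longrightarrow> d \<omega> \<in> kforms_on M B (Suc k) W"
  using degree unfolding degree_one_def by blast

lemma d_form0: "open W \<Longrightarrow> smooth_fun_on M W f \<Longrightarrow> d (form0 f) \<in> kforms_on M B 1 W"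
  using d_kform[of W "form0 f" 0] form0_in_kforms by simp

lemma d_form1: "open W \<Longrightarrow> \<xi> \<in> sections_on M (dual_bundle B) W \<Longrightarrow> d (form1 \<xi>) \<in> kforms_on M B 2 W"
  using d_kform[of W "form1 \<xi>" 1] form1_in_kforms by (simp add: numeral_2_eq_2)

lemma even_component_supported:
  assumes "c \<in> atlas M" "m \<in> fst c" "i < mdim M"
  shows "form_supported (brank B) 1 (even_component B d i c e m)"
  unfolding even_component_def
  by (rule pi_pullback_supported[OF d_form0[OF open_chart[OF assms(1)] chart_coordinate_smooth[OF manifold assms(1,3)]] assms(2)])

lemma odd_component_supported:
  assumes "e \<in> frames B" "m \<in> fst e" "a < brank B"
  shows "form_supported (brank B) 2 (odd_component B d a c e m)"
  unfolding odd_component_def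
  by (rule pi_pullback_supported[OF d_form1[OF open_frame[OF assms(1)] coframe_section[OF assms(1,3)]] assms(2)])

lemma even_component_coeff: "a < brank B \<Longrightarrow> even_component B d i c e m ({#}, {a}) = frame_anchor d c e i a m"
  by (simp add: even_component_def pi_pullback_def frame_anchor_def)

lemma odd_component_coeff:
  assumes "a < b" "b < brank B"
  shows "odd_component B d k c e m ({#}, {a, b}) = frame_structure B d e k a b m"
proof -
  have "sorted_list_of_set {a, b} = [a, b]"
    using sorted_list_of_set.idem_if_sorted_distinct[of "[a, b]"] assms by simp
  then show ?thesis using assms
    by (simp add: odd_component_def pi_pullback_def frame_structure_def del: sorted_list_of_set_insert_remove)
qed

text \<open>A vector field on \<open>\<Pi>B\<close> is determined by its components; comparing coefficients in this expansion
  gives the classical formulas for \<open>d\<close> on functions and on one-forms.\<close>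

lemma pullback_d:
  assumes "open W" "\<omega> \<in> kforms_on M B k W" "c \<in> atlas M" "e \<in> frames B" "m \<in> W" "m \<in> fst c" "m \<in> fst e"
  shows "pi_pullback B (d \<omega>) c e m z =
     (\<Sum>i<mdim M. (even_component B d i c e m \<odot> d_base c i (pi_pullback B \<omega> c e) m) z) +
     (\<Sum>a<brank B. (odd_component B d a c e m \<odot> d_left a (pi_pullback B \<omega> c e m)) z)"
proof -
  have "\<omega> \<in> forms_on M B W" using assms by (simp add: kforms_on_def)
  then have "pi_pullback B (d \<omega>) c e m =
     (\<Sum>i<mdim M. even_component B d i c e m \<odot> d_base c i (pi_pullback B \<omega> c e) m) +
     (\<Sum>a<brank B. odd_component B d a c e m \<odot> d_left a (pi_pullback B \<omega> c e m))"
    using vector_field assms unfolding vector_field_Pi_def by blast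
  then show ?thesis by (simp only: plus_fun_apply sum_fun_apply)
qed

lemma d_form0_frame:
  assumes W: "open W" "smooth_fun_on M W f" and m: "c \<in> atlas M" "e \<in> frames B" "m \<in> W" "m \<in> fst c" "m \<in> fst e"
    and a: "a < brank B"
  shows "d (form0 f) m [snd e a m] = (\<Sum>i<mdim M. frame_anchor d c e i a m * pd c i f m)"
proof -
  have b: "d_base c i (pi_pullback B (form0 f) c e) m (P, S) = (if P = {#} \<and> S = {} then pd c i f m else 0)" for i P S
  proof (cases "P = {#} \<and> S = {}")
    case True
    then show ?thesis by (simp add: d_base_def pi_pullback_form0 pd_def)
  next
    case False
    show ?thesis
      unfolding d_base_def pi_pullback_form0 pd_def by (simp only: False if_False partial_const)
  qed
  have l: "d_left k (pi_pullback B (form0 f) c e m) (P, S) = 0" for k P S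
    by (simp add: d_left_def pi_pullback_form0)
  have "d (form0 f) m [snd e a m] = pi_pullback B (d (form0 f)) c e m ({#}, {a})"
    using a by (simp add: pi_pullback_def)
  also have "\<dots> = (\<Sum>i<mdim M. (even_component B d i c e m \<odot> d_base c i (pi_pullback B (form0 f) c e) m) ({#}, {a})) +
     (\<Sum>k<brank B. (odd_component B d k c e m \<odot> d_left k (pi_pullback B (form0 f) c e m)) ({#}, {a}))"
    by (rule pullback_d[OF W(1) form0_in_kforms[OF W] m])
  also have "(\<Sum>k<brank B. (odd_component B d k c e m \<odot> d_left k (pi_pullback B (form0 f) c e m)) ({#}, {a})) = 0"
    by (intro sum.neutral ballI superprod_zero) (simp add: l)
  also have "(\<Sum>i<mdim M. (even_component B d i c e m \<odot> d_base c i (pi_pullback B (form0 f) c e) m) ({#}, {a}))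
     = (\<Sum>i<mdim M. frame_anchor d c e i a m * pd c i f m)"
  proof (intro sum.cong refl)
    fix i
    have "(even_component B d i c e m \<odot> d_base c i (pi_pullback B (form0 f) c e) m) ({#}, {a})
      = shuffle_sign {a} ({a} - {a}) * even_component B d i c e m ({#}, {a})
        * d_base c i (pi_pullback B (form0 f) c e) m ({#} - {#}, {a} - {a})"
      by (rule superprod_single_term) (auto simp: b split: if_splits)
    then show "(even_component B d i c e m \<odot> d_base c i (pi_pullback B (form0 f) c e) m) ({#}, {a})
      = frame_anchor d c e i a m * pd c i f m"
      using a by (simp add: b even_component_coeff)
  qed
  finally show ?thesis by simp
qed

lemma frame_structure_swap:
  assumes "e \<in> frames B" "m \<in> fst e" "k < brank B" "a < brank B" "b < brank B"
  shows "frame_structure B d e k b a m = - frame_structure B d e k a b m"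
proof -
  have "alternating_form (fibre B m) (d (form1 (coframe B e k)) m)"
    using kform_alternating[OF d_form1[OF open_frame[OF assms(1)] coframe_section[OF assms(1,3)]] assms(2)] .
  from form_swap[OF this subspace_fibre, of "[]" "[]" "snd e a m" "snd e b m"]
  show ?thesis using frame_in_fibre[OF frame_at[OF assms(1,2)]] assms by (simp add: frame_structure_def)
qed

lemma d_form1_frame:
  assumes W: "open W" "\<xi> \<in> sections_on M (dual_bundle B) W"
    and m: "c \<in> atlas M" "e \<in> frames B" "m \<in> W" "m \<in> fst c" "m \<in> fst e"
    and ab: "a < brank B" "b < brank B"
  shows "d (form1 \<xi>) m [snd e a m, snd e b m] =
     (\<Sum>i<mdim M. frame_anchor d c e i a m * pd c i (\<lambda>p. \<xi> p (snd e b p)) m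
        - frame_anchor d c e i b m * pd c i (\<lambda>p. \<xi> p (snd e a p)) m)
     + (\<Sum>k<brank B. \<xi> m (snd e k m) * frame_structure B d e k a b m)"
proof -
  have less: "d (form1 \<xi>) m [snd e a m, snd e b m] =
     (\<Sum>i<mdim M. frame_anchor d c e i a m * pd c i (\<lambda>p. \<xi> p (snd e b p)) m
        - frame_anchor d c e i b m * pd c i (\<lambda>p. \<xi> p (snd e a p)) m)
     + (\<Sum>k<brank B. \<xi> m (snd e k m) * frame_structure B d e k a b m)"
    if ab: "a < b" "b < brank B" for a b
  proof -
    have a: "a < brank B" using ab by simp
    let ?F = "pi_pullback B (form1 \<xi>) c e"
    have "sorted_list_of_set {a, b} = [a, b]"
      using sorted_list_of_set.idem_if_sorted_distinct[of "[a, b]"] ab by simp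
    then have "d (form1 \<xi>) m [snd e a m, snd e b m] = pi_pullback B (d (form1 \<xi>)) c e m ({#}, {a, b})"
      using ab a by (simp add: pi_pullback_def del: sorted_list_of_set_insert_remove)
    also have "\<dots> = (\<Sum>i<mdim M. (even_component B d i c e m \<odot> d_base c i ?F m) ({#}, {a, b})) +
       (\<Sum>k<brank B. (odd_component B d k c e m \<odot> d_left k (?F m)) ({#}, {a, b}))"
      by (rule pullback_d[OF W(1) form1_in_kforms[OF W] m])
    also have "(\<Sum>i<mdim M. (even_component B d i c e m \<odot> d_base c i ?F m) ({#}, {a, b}))
       = (\<Sum>i<mdim M. frame_anchor d c e i a m * pd c i (\<lambda>p. \<xi> p (snd e b p)) m
        - frame_anchor d c e i b m * pd c i (\<lambda>p. \<xi> p (snd e a p)) m)"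
    proof (intro sum.cong refl)
      fix i assume i: "i \<in> {..<mdim M}"
      have z: "d_base c i ?F m ({#}, S) = 0" if "finite S" "card S \<noteq> 1" for S
        by (simp add: pi_pullback_form1_zero[OF that] d_base_def pd_def partial_const)
      have s: "d_base c i ?F m ({#}, {q}) = pd c i (\<lambda>p. \<xi> p (snd e q p)) m" if "q < brank B" for q
        using pi_pullback_form1_single[OF that] by (simp add: d_base_def)
      show "(even_component B d i c e m \<odot> d_base c i ?F m) ({#}, {a, b})
         = frame_anchor d c e i a m * pd c i (\<lambda>p. \<xi> p (snd e b p)) m
          - frame_anchor d c e i b m * pd c i (\<lambda>p. \<xi> p (snd e a p)) m"
        using ab a by (simp add: superprod_coeff2[OF ab(1)] submultisets_empty z s even_component_coeff)
    qed
    also have "(\<Sum>k<brank B. (odd_component B d k c e m \<odot> d_left k (?F m)) ({#}, {a, b}))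
       = (\<Sum>k<brank B. \<xi> m (snd e k m) * frame_structure B d e k a b m)"
    proof (intro sum.cong refl)
      fix k assume k: "k \<in> {..<brank B}"
      have z: "d_left k (?F m) ({#}, S) = 0" if "finite S" "card S \<noteq> 0" for S
      proof (cases "k \<in> S")
        case False
        then have "card (insert k S) \<noteq> 1" using that by simp
        moreover have "finite (insert k S)" using that by simp
        ultimately have "?F m ({#}, insert k S) = 0" by (intro pi_pullback_form1_zero)
        then show ?thesis by (simp add: d_left_def)
      qed (simp add: d_left_def)
      have s: "d_left k (?F m) ({#}, {}) = \<xi> m (snd e k m)"
        using k pi_pullback_form1_single[of k] by (simp add: d_left_def)
      show "(odd_component B d k c e m \<odot> d_left k (?F m)) ({#}, {a, b})
         = \<xi> m (snd e k m) * frame_structure B d e k a b m"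
        using ab a by (simp add: superprod_coeff2[OF ab(1)] submultisets_empty z s odd_component_coeff)
    qed
    finally show ?thesis .
  qed
  have fr: "frame_at B e m" using frame_at m by blast
  have alt: "alternating_form (fibre B m) (d (form1 \<xi>) m)"
    by (rule kform_alternating[OF d_form1[OF W] m(3)])
  have swap: "d (form1 \<xi>) m [snd e q m, snd e p m] = - d (form1 \<xi>) m [snd e p m, snd e q m]"
    if "p < brank B" "q < brank B" for p q
    using form_swap[OF alt subspace_fibre, of "[]" "[]" "snd e p m" "snd e q m"] frame_in_fibre[OF fr] that by simp
  consider "a < b" | "a = b" | "b < a" by linarith
  then show ?thesis
  proof cases
    case 1 then show ?thesis using less ab by blast
  next
    case 2
    have "frame_structure B d e k a a m = 0" if "k < brank B" for k
      using frame_structure_swap[OF m(2,5) that ab(1) ab(1)] by simp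
    then show ?thesis using 2 swap[OF ab(1) ab(1)] by simp
  next
    case 3
    have "(\<Sum>k<brank B. \<xi> m (snd e k m) * frame_structure B d e k a b m)
        = - (\<Sum>k<brank B. \<xi> m (snd e k m) * frame_structure B d e k b a m)"
      unfolding sum_negf[symmetric]
      using frame_structure_swap[OF m(2,5) _ ab(2) ab(1)] by (intro sum.cong) auto
    then show ?thesis using less[OF 3 ab(1)] swap[OF ab(2) ab(1)]
      by (simp add: sum_subtractf)
  qed
qed

lemma anchor_of_frame:
  assumes W: "open W" "smooth_fun_on M W f" and m: "c \<in> atlas M" "e \<in> frames B" "m \<in> W" "m \<in> fst c" "m \<in> fst e"
    and v: "v \<in> fibre B m"
  shows "d (form0 f) m [v] = (\<Sum>a<brank B. coframe B e a m v * frame_vf M d c e a f m)"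
proof -
  have "d (form0 f) m [v] = (\<Sum>a<brank B. coframe B e a m v * d (form0 f) m [snd e a m])"
    by (rule dual_apply[OF frame_at[OF m(2,5)] one_form_dual[OF d_form0[OF W] m(3)] v])
  then show ?thesis using d_form0_frame[OF W m] by (simp add: frame_vf_def)
qed

lemma dual_section_apply:
  assumes "\<zeta> \<in> sections_on M (dual_bundle B) W" "open W" "X \<in> sections M B" "e \<in> frames B" "p \<in> W \<inter> fst e"
  shows "\<zeta> p (X p) = (\<Sum>k<brank B. \<zeta> p (snd e k p) * coframe B e k p (X p))"
  using dual_apply[OF frame_at, of e p "\<zeta> p" "X p"] assms dual_section_iff[of W \<zeta>] section_in_fibre[of X UNIV p]
  by (simp add: mult.commute)

lemma dual_section_smooth:
  assumes "\<zeta> \<in> sections_on M (dual_bundle B) W" "open W" "X \<in> sections M B" "e \<in> frames B"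
  shows "k < brank B \<Longrightarrow> smooth_fun_on M (W \<inter> fst e) (\<lambda>p. \<zeta> p (snd e k p))"
    "k < brank B \<Longrightarrow> smooth_fun_on M (W \<inter> fst e) (\<lambda>p. coframe B e k p (X p))"
    "smooth_fun_on M (W \<inter> fst e) (\<lambda>p. \<zeta> p (X p))"
proof -
  have o: "open (W \<inter> fst e)" by (intro open_Int assms open_frame)
  show 1: "smooth_fun_on M (W \<inter> fst e) (\<lambda>p. \<zeta> p (snd e k p))" if "k < brank B" for k
    using assms that dual_section_iff by blast
  show 2: "smooth_fun_on M (W \<inter> fst e) (\<lambda>p. coframe B e k p (X p))" if "k < brank B" for k
    using smooth_fun_on_subset[OF section_smooth[OF assms(3,4) that]] by simp
  have "smooth_fun_on M (W \<inter> fst e) (\<lambda>p. \<Sum>k<brank B. \<zeta> p (snd e k p) * coframe B e k p (X p))"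
    by (rule smooth_fun_on_sum[OF manifold o], rule smooth_fun_on_mult[OF manifold o 1 2]) simp_all
  then show "smooth_fun_on M (W \<inter> fst e) (\<lambda>p. \<zeta> p (X p))"
    by (rule smooth_fun_on_cong[OF manifold o]) (simp add: dual_section_apply[OF assms])
qed

lemma frame_vf_pairing:
  assumes W: "\<zeta> \<in> sections_on M (dual_bundle B) W" "open W" "X \<in> sections M B" "e \<in> frames B"
    and c: "c \<in> atlas M" and m: "m \<in> W" "m \<in> fst c" "m \<in> fst e"
  shows "frame_vf M d c e a (\<lambda>p. \<zeta> p (X p)) m
    = (\<Sum>k<brank B. frame_vf M d c e a (\<lambda>p. \<zeta> p (snd e k p)) m * coframe B e k m (X m)
         + \<zeta> m (snd e k m) * frame_vf M d c e a (\<lambda>p. coframe B e k p (X p)) m)"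
proof -
  have o: "open (W \<inter> fst e)" by (intro open_Int W open_frame)
  interpret D: chart_domain M c "fst c \<inter> (W \<inter> fst e)" by (rule chart_domain_Int[OF manifold c o])
  have mD: "m \<in> fst c \<inter> (W \<inter> fst e)" using m by blast
  have sc: "smooth_in_chart M c (fst c \<inter> (W \<inter> fst e)) g" if "smooth_fun_on M (W \<inter> fst e) g" for g
    using smooth_in_chart_subset[OF that c] by blast
  note s1 = sc[OF dual_section_smooth(1)[OF W]] and s2 = sc[OF dual_section_smooth(2)[OF W]]
  have p: "pd c i (\<lambda>p. \<zeta> p (X p)) m = (\<Sum>k<brank B. pd c i (\<lambda>p. \<zeta> p (snd e k p)) m * coframe B e k m (X m)
        + \<zeta> m (snd e k m) * pd c i (\<lambda>p. coframe B e k p (X p)) m)" if i: "i < mdim M" for i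
  proof -
    have "pd c i (\<lambda>p. \<zeta> p (X p)) m = pd c i (\<lambda>p. \<Sum>k<brank B. \<zeta> p (snd e k p) * coframe B e k p (X p)) m"
      by (rule D.pd_cong[OF mD i]) (use dual_section_apply[OF W] in auto)
    also have "\<dots> = (\<Sum>k<brank B. pd c i (\<lambda>p. \<zeta> p (snd e k p) * coframe B e k p (X p)) m)"
      by (rule D.pd_sum[OF _ mD i], rule D.smooth_in_chart_mult[OF s1 s2]) simp_all
    also have "\<dots> = (\<Sum>k<brank B. pd c i (\<lambda>p. \<zeta> p (snd e k p)) m * coframe B e k m (X m)
        + \<zeta> m (snd e k m) * pd c i (\<lambda>p. coframe B e k p (X p)) m)"
      by (intro sum.cong refl D.pd_mult[OF _ _ mD i]) (use s1 s2 in auto)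
    finally show ?thesis .
  qed
  have "frame_vf M d c e a (\<lambda>p. \<zeta> p (X p)) m = (\<Sum>i<mdim M. \<Sum>k<brank B. frame_anchor d c e i a m *
      (pd c i (\<lambda>p. \<zeta> p (snd e k p)) m * coframe B e k m (X m) + \<zeta> m (snd e k m) * pd c i (\<lambda>p. coframe B e k p (X p)) m))"
    unfolding frame_vf_def by (simp add: p sum_distrib_left)
  also have "\<dots> = (\<Sum>k<brank B. \<Sum>i<mdim M. frame_anchor d c e i a m *
      (pd c i (\<lambda>p. \<zeta> p (snd e k p)) m * coframe B e k m (X m) + \<zeta> m (snd e k m) * pd c i (\<lambda>p. coframe B e k p (X p)) m))"
    by (rule sum.swap)
  finally show ?thesis unfolding frame_vf_def
    by (simp add: sum_distrib_left sum_distrib_right sum.distrib algebra_simps)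
qed

text \<open>The right-hand side of the definition of \<open>[X, Y]\<close> is linear over functions in the covector \<open>\<xi>\<close>: the
  derivatives of the components of \<open>\<xi>\<close> coming from the two anchor terms are those contained in
  \<open>d\<xi>(X, Y)\<close>. Hence one vector represents it for all \<open>\<xi>\<close>, and its components are obtained from
  \<open>\<xi> = e\<^sup>k\<close>.\<close>

lemma bracket_of_frame:
  assumes X: "X \<in> sections M B" and Y: "Y \<in> sections M B" and e: "e \<in> frames B" "m \<in> fst e"
  shows "bracket_of M B d X Y m \<in> fibre B m \<and> (\<forall>k<brank B. coframe B e k m (bracket_of M B d X Y m)
     = anchor_of d X (\<lambda>p. coframe B e k p (Y p)) m - anchor_of d Y (\<lambda>p. coframe B e k p (X p)) m
       - d (form1 (coframe B e k)) m [X m, Y m])"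
proof -
  obtain c where c: "c \<in> atlas M" "m \<in> fst c" using chart_cover by blast
  have fr: "frame_at B e p" if "p \<in> fst e" for p using frame_at e that by blast
  have XY: "X p \<in> fibre B p" "Y p \<in> fibre B p" for p using X Y section_in_fibre by auto
  let ?r = "brank B"
  define Z where "Z v f = (\<Sum>a<?r. coframe B e a m v * frame_vf M d c e a f m)" for v f
  have dZ: "d (form0 f) m [v] = Z v f" if "open W" "smooth_fun_on M W f" "m \<in> W" "v \<in> fibre B m" for f v W
    unfolding Z_def using anchor_of_frame[of W f c e m v] that c e by simp
  define rhs where "rhs \<xi> = anchor_of d X (\<lambda>p. \<xi> p (Y p)) m - anchor_of d Y (\<lambda>p. \<xi> p (X p)) m
       - d (form1 \<xi>) m [X m, Y m]" for \<xi>
  \<comment> \<open>Leibniz rule for the pairing of \<open>\<xi>\<close> with a section, in components.\<close>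
  have expand: "anchor_of d V (\<lambda>p. \<xi> p (U p)) m = (\<Sum>k<?r. Z (V m) (\<lambda>p. \<xi> p (snd e k p)) * coframe B e k m (U m)
      + \<xi> m (snd e k m) * Z (V m) (\<lambda>p. coframe B e k p (U p)))"
    if \<xi>: "open W" "m \<in> W" "\<xi> \<in> sections_on M (dual_bundle B) W" and U: "U \<in> sections M B" "V \<in> sections M B" for \<xi> W U V
  proof -
    have oW: "open (W \<inter> fst e)" by (intro open_Int \<xi> open_frame e)
    have "anchor_of d V (\<lambda>p. \<xi> p (U p)) m = Z (V m) (\<lambda>p. \<xi> p (U p))"
      unfolding anchor_of_def
      using dZ[OF oW dual_section_smooth(3)[OF \<xi>(3,1) U(1) e(1)]] \<xi> e section_in_fibre[OF U(2), of m] by simp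
    also have "\<dots> = (\<Sum>a<?r. \<Sum>k<?r. coframe B e a m (V m) * (frame_vf M d c e a (\<lambda>p. \<xi> p (snd e k p)) m * coframe B e k m (U m)
        + \<xi> m (snd e k m) * frame_vf M d c e a (\<lambda>p. coframe B e k p (U p)) m))"
      unfolding Z_def frame_vf_pairing[OF \<xi>(3,1) U(1) e(1) c(1) \<xi>(2) c(2) e(2)] sum_distrib_left ..
    also have "\<dots> = (\<Sum>k<?r. \<Sum>a<?r. coframe B e a m (V m) * (frame_vf M d c e a (\<lambda>p. \<xi> p (snd e k p)) m * coframe B e k m (U m)
        + \<xi> m (snd e k m) * frame_vf M d c e a (\<lambda>p. coframe B e k p (U p)) m))"
      by (rule sum.swap)
    finally show ?thesis
      unfolding Z_def by (simp add: sum_distrib_left sum_distrib_right sum.distrib algebra_simps)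
  qed
  \<comment> \<open>Linearity over functions.\<close>
  have key: "rhs \<xi> = (\<Sum>k<?r. \<xi> m (snd e k m) * rhs (coframe B e k))"
    if \<xi>: "open W" "m \<in> W" "\<xi> \<in> sections_on M (dual_bundle B) W" for \<xi> W
  proof -
    have aX: "anchor_of d X (\<lambda>p. coframe B e k p (Y p)) m = Z (X m) (\<lambda>p. coframe B e k p (Y p))"
      and aY: "anchor_of d Y (\<lambda>p. coframe B e k p (X p)) m = Z (Y m) (\<lambda>p. coframe B e k p (X p))" if "k < ?r" for k
      unfolding anchor_of_def using dZ[OF open_frame[OF e(1)] _ e(2)] XY section_smooth[OF X e(1) that]
        section_smooth[OF Y e(1) that] by auto
    let ?x = "\<lambda>a. coframe B e a m (X m)" and ?y = "\<lambda>a. coframe B e a m (Y m)"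
    have str: "d (form1 (coframe B e k)) m [X m, Y m] = (\<Sum>a<?r. \<Sum>b<?r. ?x a * ?y b * frame_structure B d e k a b m)"
      if "k < ?r" for k
      unfolding frame_structure_def
      by (rule form_apply2[OF kform_alternating[OF d_form1[OF open_frame[OF e(1)] coframe_section[OF e(1) that]] e(2)] e XY lists.Nil])
    have "d (form1 \<xi>) m [X m, Y m] = (\<Sum>a<?r. \<Sum>b<?r. ?x a * ?y b * d (form1 \<xi>) m [snd e a m, snd e b m])"
      by (rule form_apply2[OF kform_alternating[OF d_form1[OF \<xi>(1,3)] \<xi>(2)] e XY lists.Nil])
    also have "\<dots> = (\<Sum>a<?r. \<Sum>b<?r. ?x a * ?y b *
        (frame_vf M d c e a (\<lambda>p. \<xi> p (snd e b p)) m - frame_vf M d c e b (\<lambda>p. \<xi> p (snd e a p)) m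
        + (\<Sum>k<?r. \<xi> m (snd e k m) * frame_structure B d e k a b m)))"
      using d_form1_frame[OF \<xi>(1,3) c(1) e(1) \<xi>(2) c(2) e(2)]
      by (intro sum.cong refl) (simp add: frame_vf_def sum_subtractf)
    also have "\<dots> = (\<Sum>a<?r. \<Sum>b<?r. ?x a * ?y b * frame_vf M d c e a (\<lambda>p. \<xi> p (snd e b p)) m)
        - (\<Sum>a<?r. \<Sum>b<?r. ?x a * ?y b * frame_vf M d c e b (\<lambda>p. \<xi> p (snd e a p)) m)
        + (\<Sum>a<?r. \<Sum>b<?r. \<Sum>k<?r. \<xi> m (snd e k m) * (?x a * ?y b * frame_structure B d e k a b m))"
      by (simp add: sum.distrib sum_subtractf sum_distrib_left algebra_simps)
    also have "(\<Sum>a<?r. \<Sum>b<?r. ?x a * ?y b * frame_vf M d c e a (\<lambda>p. \<xi> p (snd e b p)) m)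
        = (\<Sum>k<?r. Z (X m) (\<lambda>p. \<xi> p (snd e k p)) * ?y k)"
      unfolding Z_def sum_distrib_right by (subst sum.swap) (simp add: algebra_simps)
    also have "(\<Sum>a<?r. \<Sum>b<?r. ?x a * ?y b * frame_vf M d c e b (\<lambda>p. \<xi> p (snd e a p)) m)
        = (\<Sum>k<?r. Z (Y m) (\<lambda>p. \<xi> p (snd e k p)) * ?x k)"
      unfolding Z_def sum_distrib_right by (simp add: algebra_simps)
    also have "(\<Sum>a<?r. \<Sum>b<?r. \<Sum>k<?r. \<xi> m (snd e k m) * (?x a * ?y b * frame_structure B d e k a b m))
        = (\<Sum>a<?r. \<Sum>k<?r. \<Sum>b<?r. \<xi> m (snd e k m) * (?x a * ?y b * frame_structure B d e k a b m))"
      by (intro sum.cong refl sum.swap)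
    also have "\<dots> = (\<Sum>k<?r. \<Sum>a<?r. \<Sum>b<?r. \<xi> m (snd e k m) * (?x a * ?y b * frame_structure B d e k a b m))"
      by (rule sum.swap)
    also have "\<dots> = (\<Sum>k<?r. \<xi> m (snd e k m) * d (form1 (coframe B e k)) m [X m, Y m])"
      by (intro sum.cong refl) (simp add: str sum_distrib_left)
    finally have d\<xi>: "d (form1 \<xi>) m [X m, Y m] = (\<Sum>k<?r. Z (X m) (\<lambda>p. \<xi> p (snd e k p)) * ?y k)
        - (\<Sum>k<?r. Z (Y m) (\<lambda>p. \<xi> p (snd e k p)) * ?x k)
        + (\<Sum>k<?r. \<xi> m (snd e k m) * d (form1 (coframe B e k)) m [X m, Y m])" .
    have "(\<Sum>k<?r. \<xi> m (snd e k m) * rhs (coframe B e k)) = (\<Sum>k<?r. \<xi> m (snd e k m) *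
        (Z (X m) (\<lambda>p. coframe B e k p (Y p)) - Z (Y m) (\<lambda>p. coframe B e k p (X p)) - d (form1 (coframe B e k)) m [X m, Y m]))"
      unfolding rhs_def by (intro sum.cong refl) (simp add: aX aY)
    then show ?thesis
      unfolding rhs_def[of \<xi>] expand[OF \<xi> Y X] expand[OF \<xi> X Y] d\<xi>
      by (simp add: sum.distrib sum_subtractf right_diff_distrib)
  qed
  define v where "v = (\<Sum>k<?r. rhs (coframe B e k) *\<^sub>R snd e k m)"
  have v: "v \<in> fibre B m" unfolding v_def by (rule combination_in_fibre[OF fr[OF e(2)]])
  have vk: "coframe B e k m v = rhs (coframe B e k)" if "k < ?r" for k
    unfolding v_def by (rule coframe_combination[OF fr[OF e(2)] that])
  have v\<xi>: "\<xi> m v = rhs \<xi>" if \<xi>: "open W" "m \<in> W" "\<xi> \<in> sections_on M (dual_bundle B) W" for \<xi> W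
  proof -
    have "\<xi> m \<in> dual_space (fibre B m)" using \<xi> dual_section_iff by blast
    from dual_apply[OF fr[OF e(2)] this v] show ?thesis
      by (simp add: key[OF \<xi>] vk mult.commute)
  qed
  have "bracket_of M B d X Y m = v"
    unfolding bracket_of_def
  proof (rule the_equality)
    show "v \<in> fibre B m \<and> (\<forall>W \<xi>. open W \<and> m \<in> W \<and> \<xi> \<in> sections_on M (dual_bundle B) W \<longrightarrow>
        \<xi> m v = anchor_of d X (\<lambda>p. \<xi> p (Y p)) m - anchor_of d Y (\<lambda>p. \<xi> p (X p)) m - d (form1 \<xi>) m [X m, Y m])"
      using v v\<xi> unfolding rhs_def by blast
    fix w assume w: "w \<in> fibre B m \<and> (\<forall>W \<xi>. open W \<and> m \<in> W \<and> \<xi> \<in> sections_on M (dual_bundle B) W \<longrightarrow>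
        \<xi> m w = anchor_of d X (\<lambda>p. \<xi> p (Y p)) m - anchor_of d Y (\<lambda>p. \<xi> p (X p)) m - d (form1 \<xi>) m [X m, Y m])"
    show "w = v"
    proof (rule fibre_eqI[OF fr[OF e(2)]])
      fix k assume k: "k < ?r"
      have "coframe B e k m w = rhs (coframe B e k)"
        unfolding rhs_def using w open_frame[OF e(1)] e(2) coframe_section[OF e(1) k] by blast
      then show "coframe B e k m w = coframe B e k m v" using vk[OF k] by simp
    qed (use w v in auto)
  qed
  then show ?thesis using v vk unfolding rhs_def by simp
qed

end

section \<open>Lie derivatives in frames and alternating index arrays\<close>

text \<open>Coefficients of superpolynomials are available for increasing indices only. The next two lemmas
  extend a statement to all indices when it is stable under adjacent transpositions and holds for
  coinciding first indices.\<close>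

lemma sorted_induct3:
  fixes N :: "nat set"
  assumes 12: "\<And>I J K. \<lbrakk>I \<in> N; J \<in> N; K \<in> N; P I J K\<rbrakk> \<Longrightarrow> P J I K"
    and 23: "\<And>I J K. \<lbrakk>I \<in> N; J \<in> N; K \<in> N; P I J K\<rbrakk> \<Longrightarrow> P I K J"
    and eq: "\<And>I J. \<lbrakk>I \<in> N; J \<in> N\<rbrakk> \<Longrightarrow> P I I J"
    and sorted: "\<And>I J K. \<lbrakk>I \<in> N; J \<in> N; K \<in> N; I < J; J < K\<rbrakk> \<Longrightarrow> P I J K"
    and N: "I \<in> N" "J \<in> N" "K \<in> N"
  shows "P I J K"
proof -
  have less: "P I J K" if "I \<in> N" "J \<in> N" "K \<in> N" "I < J" for I J K
  proof -
    consider "J < K" | "J = K" | "I < K" "K < J" | "K = I" | "K < I" by linarith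
    then show ?thesis
    proof cases
      case 1 then show ?thesis using sorted that by blast
    next
      case 2 then show ?thesis using 12[OF _ _ _ 23[OF _ _ _ eq[of J I]]] that by blast
    next
      case 3 then show ?thesis using 23[OF _ _ _ sorted[of I K J]] that by blast
    next
      case 4 then show ?thesis using 23[OF _ _ _ eq[of I J]] that by blast
    next
      case 5 then show ?thesis using 23[OF _ _ _ 12[OF _ _ _ sorted[of K I J]]] that by blast
    qed
  qed
  consider "I < J" | "I = J" | "J < I" by linarith
  then show ?thesis
    using less[OF N] eq[OF N(1,3)] 12[OF N(2,1,3) less[OF N(2,1,3)]] by cases auto
qed

lemma sorted_induct4:
  fixes N :: "nat set"
  assumes 12: "\<And>I J K L. \<lbrakk>I \<in> N; J \<in> N; K \<in> N; L \<in> N; P I J K L\<rbrakk> \<Longrightarrow> P J I K L"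
    and 23: "\<And>I J K L. \<lbrakk>I \<in> N; J \<in> N; K \<in> N; L \<in> N; P I J K L\<rbrakk> \<Longrightarrow> P I K J L"
    and 34: "\<And>I J K L. \<lbrakk>I \<in> N; J \<in> N; K \<in> N; L \<in> N; P I J K L\<rbrakk> \<Longrightarrow> P I J L K"
    and eq: "\<And>I K L. \<lbrakk>I \<in> N; K \<in> N; L \<in> N\<rbrakk> \<Longrightarrow> P I I K L"
    and sorted: "\<And>I J K L. \<lbrakk>I \<in> N; J \<in> N; K \<in> N; L \<in> N; I < J; J < K; K < L\<rbrakk> \<Longrightarrow> P I J K L"
    and N: "I \<in> N" "J \<in> N" "K \<in> N" "L \<in> N"
  shows "P I J K L"
proof (rule sorted_induct3[where N = N and P = "\<lambda>I J K. P I J K L"])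
  fix I J K assume n: "I \<in> N" "J \<in> N" "K \<in> N" and o: "I < J" "J < K"
  note N = N(4)
  consider "K < L" | "K = L" | "J < L" "L < K" | "L = J" | "I < L" "L < J" | "L = I" | "L < I" by linarith
  then show "P I J K L"
  proof cases
    case 1 then show ?thesis using sorted n N o by blast
  next
    case 2
    have "P K K I J" using eq n by blast
    then have "P K I K J" using 23 n by blast
    then have "P K I J K" using 34 n by blast
    then have "P I K J K" using 12 n by blast
    then show ?thesis using 23 n 2 by blast
  next
    case 3 then show ?thesis using 34[OF _ _ _ _ sorted[of I J L K]] n N o by blast
  next
    case 4
    have "P J J I K" using eq n by blast
    then have "P J I J K" using 23 n by blast
    then have "P I J J K" using 12 n by blast
    then show ?thesis using 34 n 4 by blast
  next
    case 5
    have "P I L J K" using sorted n N o 5 by blast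
    then have "P I J L K" using 23 n N by blast
    then show ?thesis using 34 n N by blast
  next
    case 6
    have "P I I J K" using eq n by blast
    then have "P I J I K" using 23 n by blast
    then show ?thesis using 34 n 6 by blast
  next
    case 7
    have "P L I J K" using sorted n N o 7 by blast
    then have "P I L J K" using 12 n N by blast
    then have "P I J L K" using 23 n N by blast
    then show ?thesis using 34 n N by blast
  qed
next
  fix I J K assume n: "I \<in> N" "J \<in> N" "K \<in> N" "P I J K L"
  show "P J I K L" by (rule 12[OF n(1-3) N(4) n(4)])
  show "P I K J L" by (rule 23[OF n(1-3) N(4) n(4)])
next
  fix I J assume "I \<in> N" "J \<in> N"
  then show "P I I J L" using eq N(4) by blast
qed (fact N(1-3))+

lemma sum_swap_odd: "(\<Sum>M<2 * r. h (swap_odd r M)) = (\<Sum>M<2 * r. h M)"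
  by (rule sum.reindex_bij_witness[of _ "swap_odd r" "swap_odd r"]) (use swap_odd_in in auto)

text \<open>With the six terms gathered in a sum over all \<open>M < 2r\<close>, the left-hand side changes its sign under
  adjacent transpositions of \<open>I, J, K, L\<close>; so it vanishes for all indices if it does for increasing
  ones.\<close>

lemma quadratic_coeff_all:
  fixes t :: "nat \<Rightarrow> nat \<Rightarrow> nat \<Rightarrow> real"
  assumes t: "alternating3 {..<2 * r} t" and g: "\<And>i. i < n \<Longrightarrow> alternating3 {..<2 * r} (g i)"
    and sorted: "\<And>I J K L. \<lbrakk>I < J; J < K; K < L; L < 2 * r\<rbrakk> \<Longrightarrow>
       (\<Sum>i<n. p i I * g i J K L - p i J * g i I K L + p i K * g i I J L - p i L * g i I J K)
       + (\<Sum>a<r. t (r + a) I J * t a K L - t (r + a) I K * t a J L + t (r + a) I L * t a J K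
           + t (r + a) J K * t a I L - t (r + a) J L * t a I K + t (r + a) K L * t a I J) = 0"
    and N: "I < 2 * r" "J < 2 * r" "K < 2 * r" "L < 2 * r"
  shows "(\<Sum>i<n. p i I * g i J K L - p i J * g i I K L + p i K * g i I J L - p i L * g i I J K)
     + (\<Sum>M<2 * r. t M I J * t (swap_odd r M) K L - t M I K * t (swap_odd r M) J L
          + t M I L * t (swap_odd r M) J K) = 0"
proof -
  let ?N = "{..<2 * r}"
  define Q where "Q I J K L = (\<Sum>M<2 * r. t M I J * t (swap_odd r M) K L)" for I J K L
  define D where "D I J K L = (\<Sum>i<n. p i I * g i J K L - p i J * g i I K L + p i K * g i I J L - p i L * g i I J K)"
    for I J K L
  \<comment> \<open>\<open>D\<close> collects the terms with derivatives, \<open>Q\<close> one of the three pairings of \<open>t\<close> with itself.\<close>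
  define W where "W I J K L = D I J K L + (Q I J K L - Q I K J L + Q I L J K)" for I J K L
  have Qsym: "Q K L I J = Q I J K L" for I J K L
  proof -
    have "Q K L I J = (\<Sum>M<2 * r. t (swap_odd r M) K L * t (swap_odd r (swap_odd r M)) I J)"
      unfolding Q_def by (rule sum_swap_odd[symmetric])
    also have "\<dots> = Q I J K L" unfolding Q_def
      by (intro sum.cong refl) (use swap_odd_in in \<open>auto simp: mult.commute\<close>)
    finally show ?thesis .
  qed
  have s: "swap_odd r M \<in> ?N" if "M \<in> ?N" for M using swap_odd_in that by blast
  have Q1: "Q J I K L = - Q I J K L" if "I \<in> ?N" "J \<in> ?N" for I J K L
    unfolding Q_def sum_negf[symmetric] using alternating3_swap(2)[OF t, of _ I J] that by (intro sum.cong refl) simp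
  have Q2: "Q I J L K = - Q I J K L" if "K \<in> ?N" "L \<in> ?N" for I J K L
    using Q1[OF that, of I J] Qsym by simp
  have ga: "g i J I K = - g i I J K" "g i I K J = - g i I J K"
    if "i < n" "I \<in> ?N" "J \<in> ?N" "K \<in> ?N" for i I J K
    by (rule alternating3_swap(1)[OF g], (fact that)+) (rule alternating3_swap(2)[OF g], (fact that)+)
  have D12: "D J I K L = - D I J K L" and D23: "D I K J L = - D I J K L" and D34: "D I J L K = - D I J K L"
    if "I \<in> ?N" "J \<in> ?N" "K \<in> ?N" "L \<in> ?N" for I J K L
  proof -
    show "D J I K L = - D I J K L" unfolding D_def sum_negf[symmetric]
      using ga(1)[of _ J I K] ga(1)[of _ J I L] that by (intro sum.cong refl) simp
    show "D I K J L = - D I J K L" unfolding D_def sum_negf[symmetric]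
      using ga(1)[of _ J K L] ga(2)[of _ I J K] that by (intro sum.cong refl) simp
    show "D I J L K = - D I J K L" unfolding D_def sum_negf[symmetric]
      using ga(2)[of _ J K L] ga(2)[of _ I K L] that by (intro sum.cong refl) simp
  qed
  have W12: "W J I K L = - W I J K L" if "I \<in> ?N" "J \<in> ?N" "K \<in> ?N" "L \<in> ?N" for I J K L
    using that D12[OF that] Q1[of I J K L] Qsym[of J K I L] Qsym[of J L I K] by (simp add: W_def)
  have W23: "W I K J L = - W I J K L" if "I \<in> ?N" "J \<in> ?N" "K \<in> ?N" "L \<in> ?N" for I J K L
    using that D23[OF that] Q2[of J K I L] by (simp add: W_def)
  have W34: "W I J L K = - W I J K L" if "I \<in> ?N" "J \<in> ?N" "K \<in> ?N" "L \<in> ?N" for I J K L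
    using that D34[OF that] Q2[of K L I J] by (simp add: W_def)
  have "W I J K L = 0"
  proof (rule sorted_induct4[where N = ?N and P = "\<lambda>I J K L. W I J K L = 0"])
    fix I K L assume "I \<in> ?N" "K \<in> ?N" "L \<in> ?N"
    then show "W I I K L = 0" using W12[of I I K L] by simp
  next
    fix I J K L assume n: "I \<in> ?N" "J \<in> ?N" "K \<in> ?N" "L \<in> ?N" and o: "I < J" "J < K" "K < L"
    have q: "Q I' J' K' L' = (\<Sum>a<r. t a I' J' * t (r + a) K' L' + t (r + a) I' J' * t a K' L')" for I' J' K' L'
      unfolding Q_def sum_lessThan_double sum.distrib[symmetric] by (intro sum.cong refl) (simp add: swap_odd_def)
    have "Q I J K L - Q I K J L + Q I L J K = (\<Sum>a<r. t (r + a) I J * t a K L - t (r + a) I K * t a J L + t (r + a) I L * t a J K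
           + t (r + a) J K * t a I L - t (r + a) J L * t a I K + t (r + a) K L * t a I J)"
      unfolding q sum_subtractf[symmetric] sum.distrib[symmetric] by (intro sum.cong refl) (simp add: mult.commute)
    then show "W I J K L = 0" using sorted[OF o] n unfolding W_def D_def by simp
  next
    fix I J K L assume n: "I \<in> ?N" "J \<in> ?N" "K \<in> ?N" "L \<in> ?N" and z: "W I J K L = 0"
    show "W J I K L = 0" "W I K J L = 0" "W I J L K = 0" using W12[OF n] W23[OF n] W34[OF n] z by simp_all
  qed (use N in auto)
  then show ?thesis by (simp add: W_def D_def Q_def sum.distrib sum_subtractf)
qed

context vbundle_vector_field
begin

context
  fixes c e m
  assumes c: "c \<in> atlas M" "m \<in> fst c" and e: "e \<in> frames B" "m \<in> fst e"
begin

lemma d_form0_frame_vf: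
  "\<lbrakk>open W; smooth_fun_on M W f; m \<in> W; a < brank B\<rbrakk> \<Longrightarrow> d (form0 f) m [snd e a m] = frame_vf M d c e a f m"
  unfolding frame_vf_def using d_form0_frame[of W f c e m a] c e by blast

text \<open>Applied to the dual bundle, the next two lemmas also describe \<open>d\<^sub>A\<^sub>*X\<close> and \<open>L\<^sub>\<xi>Y\<close> for sections \<open>X, Y\<close>
  of \<open>A\<close>, which are one-forms on \<open>A\<^sup>*\<close>.\<close>

lemma d_form1_section_frame:
  assumes \<zeta>: "\<zeta> \<in> sections M (dual_bundle B)" and X: "u \<in> fibre B m" and k: "k < brank B"
  shows "d (form1 \<zeta>) m [u, snd e k m] = (\<Sum>a<brank B. coframe B e a m (u) *
     (frame_vf M d c e a (\<lambda>p. \<zeta> p (snd e k p)) m - frame_vf M d c e k (\<lambda>p. \<zeta> p (snd e a p)) m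
       + (\<Sum>l<brank B. \<zeta> m (snd e l m) * frame_structure B d e l a k m)))"
proof -
  note fr = frame_at[OF e]
  have "d (form1 \<zeta>) m [u, snd e k m] = (\<Sum>a<brank B. coframe B e a m (u) * d (form1 \<zeta>) m [snd e a m, snd e k m])"
    using dual_apply[OF fr, of "\<lambda>u. d (form1 \<zeta>) m [u, snd e k m]" "u"] X
      form_slot_dual[OF kform_alternating[OF d_form1[OF open_UNIV \<zeta>]], of m "[]" "[snd e k m]"] frame_in_fibre[OF fr k]
    by simp
  then show ?thesis
    using d_form1_frame[OF open_UNIV \<zeta> c(1) e(1) _ c(2) e(2) _ k]
    by (simp add: frame_vf_def sum_subtractf)
qed

lemma contract_form1: "contract X (form1 \<zeta>) = form0 (\<lambda>p. \<zeta> p (X p))"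
proof (intro ext)
  fix p us
  show "contract X (form1 \<zeta>) p us = form0 (\<lambda>p. \<zeta> p (X p)) p us"
    by (cases "us = []") (simp_all add: contract_def form0_def form1_length)
qed

lemma pairing_smooth_on_frame:
  "\<lbrakk>\<zeta> \<in> sections M (dual_bundle B); X \<in> sections M B\<rbrakk> \<Longrightarrow> smooth_fun_on M (fst e) (\<lambda>p. \<zeta> p (X p))"
  using dual_section_smooth(3)[of \<zeta> UNIV X e] e(1) by simp

lemma lie_derivative_frame:
  assumes \<zeta>: "\<zeta> \<in> sections M (dual_bundle B)" and X: "X \<in> sections M B" and k: "k < brank B"
  shows "lie_derivative d X (form1 \<zeta>) m [snd e k m] = (\<Sum>a<brank B.
      \<zeta> m (snd e a m) * frame_vf M d c e k (\<lambda>p. coframe B e a p (X p)) m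
      + coframe B e a m (X m) * frame_vf M d c e a (\<lambda>p. \<zeta> p (snd e k p)) m
      + (\<Sum>l<brank B. coframe B e a m (X m) * \<zeta> m (snd e l m) * frame_structure B d e l a k m))"
proof -
  have "lie_derivative d X (form1 \<zeta>) m [snd e k m]
     = d (form0 (\<lambda>p. \<zeta> p (X p))) m [snd e k m] + d (form1 \<zeta>) m [X m, snd e k m]"
    by (simp add: lie_derivative_def contract_form1) (simp add: contract_def)
  also have "d (form0 (\<lambda>p. \<zeta> p (X p))) m [snd e k m] = frame_vf M d c e k (\<lambda>p. \<zeta> p (X p)) m"
    by (rule d_form0_frame_vf[OF open_frame[OF e(1)] pairing_smooth_on_frame[OF \<zeta> X] e(2) k])
  finally show ?thesis
    unfolding frame_vf_pairing[OF \<zeta> open_UNIV X e(1) c(1) UNIV_I c(2) e(2)] d_form1_section_frame[OF \<zeta> section_in_fibre[OF X UNIV_I] k]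
    by (simp add: sum.distrib sum_subtractf sum_distrib_left algebra_simps)
qed

lemma lie_derivative_dual:
  assumes \<zeta>: "\<zeta> \<in> sections M (dual_bundle B)" and X: "X \<in> sections M B"
  shows "(\<lambda>v. lie_derivative d X (form1 \<zeta>) m [v]) \<in> dual_space (fibre B m)"
proof -
  have 1: "(\<lambda>v. d (form0 (\<lambda>p. \<zeta> p (X p))) m [v]) \<in> dual_space (fibre B m)"
    by (rule one_form_dual[OF d_form0[OF open_frame[OF e(1)] pairing_smooth_on_frame[OF \<zeta> X]] e(2)])
  have 2: "(\<lambda>v. d (form1 \<zeta>) m [X m, v]) \<in> dual_space (fibre B m)"
    using form_slot_dual[OF kform_alternating[OF d_form1[OF open_UNIV \<zeta>]], of m "[X m]" "[]"] section_in_fibre[OF X, of m] by simp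
  have "(\<lambda>v. lie_derivative d X (form1 \<zeta>) m [v])
     = (\<lambda>v. d (form0 (\<lambda>p. \<zeta> p (X p))) m [v]) + (\<lambda>v. d (form1 \<zeta>) m [X m, v])"
    by (simp add: lie_derivative_def contract_form1 fun_eq_iff) (simp add: contract_def)
  then show ?thesis using subspace_add[OF subspace_dual_space[OF frame_at[OF e]] 1 2] by simp
qed

lemma contract_d_form1_dual:
  assumes \<zeta>: "\<zeta> \<in> sections M (dual_bundle B)" and X: "X \<in> sections M B"
  shows "(\<lambda>v. contract X (d (form1 \<zeta>)) m [v]) \<in> dual_space (fibre B m)"
  using form_slot_dual[OF kform_alternating[OF d_form1[OF open_UNIV \<zeta>]], of m "[X m]" "[]"] section_in_fibre[OF X, of m]
  by (simp add: contract_def)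

lemma bracket_frame:
  assumes X: "X \<in> sections M B" and Y: "Y \<in> sections M B" and k: "k < brank B"
  shows "coframe B e k m (bracket_of M B d X Y m) = (\<Sum>a<brank B.
      coframe B e a m (X m) * frame_vf M d c e a (\<lambda>p. coframe B e k p (Y p)) m
      - coframe B e a m (Y m) * frame_vf M d c e a (\<lambda>p. coframe B e k p (X p)) m
      - (\<Sum>b<brank B. coframe B e a m (X m) * coframe B e b m (Y m) * frame_structure B d e k a b m))"
proof -
  have an: "anchor_of d V (\<lambda>p. coframe B e k p (U p)) m
      = (\<Sum>a<brank B. coframe B e a m (V m) * frame_vf M d c e a (\<lambda>p. coframe B e k p (U p)) m)"
    if "U \<in> sections M B" "V \<in> sections M B" for U V
    unfolding anchor_of_def
    using anchor_of_frame[OF open_frame[OF e(1)] _ c(1) e(1,2) c(2) e(2), of "\<lambda>p. coframe B e k p (U p)" "V m"]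
      section_smooth[OF that(1) e(1) k] section_in_fibre[OF that(2), of m] by simp
  have "d (form1 (coframe B e k)) m [X m, Y m]
     = (\<Sum>a<brank B. \<Sum>b<brank B. coframe B e a m (X m) * coframe B e b m (Y m) * frame_structure B d e k a b m)"
    unfolding frame_structure_def
    by (rule form_apply2[OF kform_alternating[OF d_form1[OF open_frame[OF e(1)] coframe_section[OF e(1) k]] e(2)] e])
      (use X Y section_in_fibre in auto)
  then show ?thesis
    using bracket_of_frame[OF X Y e] k an[OF Y X] an[OF X Y] by (simp add: sum_subtractf)
qed

end

end

section \<open>Courant algebroids in a frame with constant pairing\<close>

text \<open>The local model. \<open>S\<close> is a ring of functions with unit \<open>unit\<close>, realised inside a larger ring \<open>'a\<close>
  whose unit may differ (functions on the manifold vanishing outside a chart). A section is the tuple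
  of its components in a frame \<open>E\<^sub>I\<close> (\<open>I \<in> N\<close>) such that \<open>E\<^sub>I\<close> pairs to \<open>1\<close> with \<open>E\<^sub>J\<close> for
  \<open>J = dual I\<close> and to \<open>0\<close> with all other frame vectors; \<open>rho I\<close> is the anchor of \<open>E\<^sub>I\<close> and \<open>T I J K\<close>
  the pairing of \<open>E\<^sub>I \<circ> E\<^sub>J\<close> with \<open>E\<^sub>K\<close>. The last three assumptions are the components of
  \<open>{\<theta>, \<theta>} = 0\<close>.\<close>

locale courant_frame =
  fixes S :: "'a::comm_ring_1 set" and unit :: 'a and N :: "nat set"
    and dual :: "nat \<Rightarrow> nat" and rho :: "nat \<Rightarrow> 'a \<Rightarrow> 'a" and T :: "nat \<Rightarrow> nat \<Rightarrow> nat \<Rightarrow> 'a"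
  assumes finite_N [simp]: "finite N"
    and dual_in [simp]: "I \<in> N \<Longrightarrow> dual I \<in> N"
    and dual_dual [simp]: "I \<in> N \<Longrightarrow> dual (dual I) = I"
    and S_zero [simp]: "0 \<in> S"
    and S_unit [simp]: "unit \<in> S"
    and S_add [simp]: "\<lbrakk>f \<in> S; g \<in> S\<rbrakk> \<Longrightarrow> f + g \<in> S"
    and S_uminus [simp]: "f \<in> S \<Longrightarrow> - f \<in> S"
    and S_mult [simp]: "\<lbrakk>f \<in> S; g \<in> S\<rbrakk> \<Longrightarrow> f * g \<in> S"
    and unit_mult [simp]: "f \<in> S \<Longrightarrow> unit * f = f"
    and rho_in [simp]: "\<lbrakk>I \<in> N; f \<in> S\<rbrakk> \<Longrightarrow> rho I f \<in> S"
    and rho_add: "\<lbrakk>I \<in> N; f \<in> S; g \<in> S\<rbrakk> \<Longrightarrow> rho I (f + g) = rho I f + rho I g"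
    and rho_mult: "\<lbrakk>I \<in> N; f \<in> S; g \<in> S\<rbrakk> \<Longrightarrow> rho I (f * g) = rho I f * g + f * rho I g"
    and T_in [simp]: "\<lbrakk>I \<in> N; J \<in> N; K \<in> N\<rbrakk> \<Longrightarrow> T I J K \<in> S"
    and T_swap12: "\<lbrakk>I \<in> N; J \<in> N; K \<in> N\<rbrakk> \<Longrightarrow> T J I K = - T I J K"
    and T_swap23: "\<lbrakk>I \<in> N; J \<in> N; K \<in> N\<rbrakk> \<Longrightarrow> T I K J = - T I J K"
    and anchor_isotropic: "\<lbrakk>f \<in> S; g \<in> S\<rbrakk> \<Longrightarrow> (\<Sum>I\<in>N. rho I f * rho (dual I) g) = 0"
    and anchor_bracket: "\<lbrakk>I \<in> N; J \<in> N; f \<in> S\<rbrakk> \<Longrightarrow>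
          rho I (rho J f) - rho J (rho I f) = (\<Sum>K\<in>N. T I J K * rho (dual K) f)"
    and structure_equation: "\<lbrakk>I \<in> N; J \<in> N; K \<in> N; L \<in> N\<rbrakk> \<Longrightarrow>
          rho I (T J K L) - rho J (T I K L) + rho K (T I J L) - rho L (T I J K)
          + (\<Sum>M\<in>N. T J K M * T I (dual M) L - T I J M * T (dual M) K L
                    - T I K M * T J (dual M) L) = 0"
begin

definition sect :: "(nat \<Rightarrow> 'a) \<Rightarrow> bool" where
  "sect s \<longleftrightarrow> (\<forall>I\<in>N. s I \<in> S) \<and> (\<forall>I. I \<notin> N \<longrightarrow> s I = 0)"

definition anch :: "(nat \<Rightarrow> 'a) \<Rightarrow> 'a \<Rightarrow> 'a" where
  "anch s f = (\<Sum>I\<in>N. s I * rho I f)"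

definition pair :: "(nat \<Rightarrow> 'a) \<Rightarrow> (nat \<Rightarrow> 'a) \<Rightarrow> 'a" where
  "pair s t = (\<Sum>I\<in>N. s I * t (dual I))"

definition grad :: "'a \<Rightarrow> nat \<Rightarrow> 'a" where
  "grad f = (\<lambda>K. if K \<in> N then rho (dual K) f else 0)"

text \<open>The Leibniz rules of a Courant algebroid determine the bracket from the pairings \<open>T I J K\<close> of
  \<open>E\<^sub>I \<circ> E\<^sub>J\<close> with \<open>E\<^sub>K\<close>; this is the resulting formula in components.\<close>

definition circ :: "(nat \<Rightarrow> 'a) \<Rightarrow> (nat \<Rightarrow> 'a) \<Rightarrow> nat \<Rightarrow> 'a" where
  "circ s t = (\<lambda>K. if K \<in> N then anch s (t K) - anch t (s K)
      + (\<Sum>I\<in>N. rho (dual K) (s I) * t (dual I))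
      + (\<Sum>I\<in>N. \<Sum>J\<in>N. T I J (dual K) * s I * t J) else 0)"

lemma circ_in: "K \<in> N \<Longrightarrow> circ s t K = anch s (t K) - anch t (s K)
      + (\<Sum>I\<in>N. rho (dual K) (s I) * t (dual I))
      + (\<Sum>I\<in>N. \<Sum>J\<in>N. T I J (dual K) * s I * t J)"
  and circ_out [simp]: "K \<notin> N \<Longrightarrow> circ s t K = 0"
  by (simp_all add: circ_def)

lemma S_diff [simp]: "\<lbrakk>f \<in> S; g \<in> S\<rbrakk> \<Longrightarrow> f - g \<in> S"
  using S_add[of f "- g"] by simp

lemma S_sum [simp]: "(\<And>x. x \<in> X \<Longrightarrow> f x \<in> S) \<Longrightarrow> sum f X \<in> S"
  by (induction X rule: infinite_finite_induct) auto

lemma mult_unit [simp]: "f \<in> S \<Longrightarrow> f * unit = f"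
  by (simp add: mult.commute[of f])

lemma rho_zero [simp]: "I \<in> N \<Longrightarrow> rho I 0 = 0"
  using rho_add[of I 0 0] by simp

lemma rho_uminus: "\<lbrakk>I \<in> N; f \<in> S\<rbrakk> \<Longrightarrow> rho I (- f) = - rho I f"
  using rho_add[of I f "- f"] by (simp add: eq_neg_iff_add_eq_0 add.commute)

lemma rho_unit [simp]: "I \<in> N \<Longrightarrow> rho I unit = 0"
  using rho_mult[of I unit unit] by simp

lemma rho_sum: "\<lbrakk>I \<in> N; \<And>x. x \<in> X \<Longrightarrow> f x \<in> S\<rbrakk> \<Longrightarrow> rho I (sum f X) = (\<Sum>x\<in>X. rho I (f x))"
  by (induction X rule: infinite_finite_induct) (auto simp: rho_add)

lemma sum_dual: "(\<Sum>I\<in>N. h (dual I)) = (\<Sum>I\<in>N. h I)"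
  by (rule sum.reindex_bij_witness[of _ dual dual]) auto

lemma sect_in [simp]: "sect s \<Longrightarrow> s I \<in> S"
  by (cases "I \<in> N") (auto simp: sect_def)

lemma sect_out: "sect s \<Longrightarrow> I \<notin> N \<Longrightarrow> s I = 0"
  by (auto simp: sect_def)

lemma anch_in [simp]: "\<lbrakk>sect s; f \<in> S\<rbrakk> \<Longrightarrow> anch s f \<in> S"
  by (simp add: anch_def)

lemma pair_in [simp]: "\<lbrakk>sect s; sect t\<rbrakk> \<Longrightarrow> pair s t \<in> S"
  by (simp add: pair_def)

lemma sect_grad [simp]: "f \<in> S \<Longrightarrow> sect (grad f)"
  by (simp add: sect_def grad_def)

lemma sect_circ [simp]: "\<lbrakk>sect s; sect t\<rbrakk> \<Longrightarrow> sect (circ s t)"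
  by (subst sect_def) (simp add: circ_in)

lemma sect_add [simp]: "\<lbrakk>sect s; sect t\<rbrakk> \<Longrightarrow> sect (s + t)"
  by (simp add: sect_def)

lemma sect_zero [simp]: "sect 0"
  by (simp add: sect_def)

lemma sect_scale [simp]: "\<lbrakk>f \<in> S; sect s\<rbrakk> \<Longrightarrow> sect (\<lambda>K. f * s K)"
  by (simp add: sect_def)

lemma sect_sum [simp]: "(\<And>x. x \<in> X \<Longrightarrow> sect (f x)) \<Longrightarrow> sect (sum f X)"
  by (induction X rule: infinite_finite_induct) auto

lemma pair_sym: "sect s \<Longrightarrow> sect t \<Longrightarrow> pair s t = pair t s"
  unfolding pair_def by (subst sum_dual[symmetric]) (auto intro!: sum.cong simp: mult.commute)

lemma anch_add_arg: "\<lbrakk>f \<in> S; g \<in> S\<rbrakk> \<Longrightarrow> anch s (f + g) = anch s f + anch s g"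
  by (simp add: anch_def rho_add distrib_left sum.distrib)

lemma anch_mult_arg: "\<lbrakk>sect s; f \<in> S; g \<in> S\<rbrakk> \<Longrightarrow> anch s (f * g) = anch s f * g + f * anch s g"
  by (simp add: anch_def rho_mult sum.distrib sum_distrib_left sum_distrib_right algebra_simps)

lemma anch_sum_arg: "(\<And>x. x \<in> X \<Longrightarrow> f x \<in> S) \<Longrightarrow> anch s (sum f X) = (\<Sum>x\<in>X. anch s (f x))"
  by (induction X rule: infinite_finite_induct) (auto simp: anch_add_arg, auto simp: anch_def)

lemma anch_add: "anch (s + t) f = anch s f + anch t f"
  by (simp add: anch_def distrib_right sum.distrib)

lemma anch_scale: "anch (\<lambda>K. g * s K) f = g * anch s f"
  by (simp add: anch_def sum_distrib_left algebra_simps)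

lemma circ_add_left: "\<lbrakk>sect s; sect s'; sect t\<rbrakk> \<Longrightarrow> circ (s + s') t = circ s t + circ s' t"
  by (rule ext) (simp add: circ_def anch_add anch_add_arg rho_add algebra_simps sum.distrib)

lemma circ_add_right: "\<lbrakk>sect s; sect t; sect t'\<rbrakk> \<Longrightarrow> circ s (t + t') = circ s t + circ s t'"
  by (rule ext) (simp add: circ_def anch_add anch_add_arg rho_add algebra_simps sum.distrib)

lemma circ_zero_right [simp]: "sect t \<Longrightarrow> circ t 0 = 0"
  using circ_add_right[of t 0 0] by simp

lemma circ_leibniz:
  assumes "sect s" "sect t" "f \<in> S"
  shows "circ s (\<lambda>K. f * t K) = (\<lambda>K. f * circ s t K) + (\<lambda>K. anch s f * t K)"
  using assms
  by (auto simp: fun_eq_iff circ_def anch_mult_arg anch_scale sect_out sum_distrib_left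
      algebra_simps intro!: sum.cong)

text \<open>In the left argument the bracket is only linear over the functions that all anchors annihilate,
  in particular over the real constants.\<close>

lemma circ_const_left:
  assumes "sect s" "sect t" "f \<in> S" "\<And>I. I \<in> N \<Longrightarrow> rho I f = 0"
  shows "circ (\<lambda>K. f * s K) t = (\<lambda>K. f * circ s t K)"
proof -
  have "anch t (f * s K) = f * anch t (s K)" for K
    using assms by (simp add: anch_mult_arg) (simp add: anch_def)
  then show ?thesis using assms
    by (auto simp: fun_eq_iff circ_def anch_scale rho_mult sum_distrib_left algebra_simps intro!: sum.cong)
qed

text \<open>\<open>T\<close> is skew in the first two indices, so only the derivative of the pairing remains.\<close>

lemma circ_symmetric_part:
  assumes "sect s" "sect t"
  shows "circ s t + circ t s = grad (pair s t)"
proof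
  fix K
  show "(circ s t + circ t s) K = grad (pair s t) K"
  proof (cases "K \<in> N")
    case True
    have 1: "(\<Sum>I\<in>N. rho (dual K) (t I) * s (dual I)) = (\<Sum>I\<in>N. s I * rho (dual K) (t (dual I)))"
      by (subst sum_dual[symmetric]) (auto intro!: sum.cong simp: mult.commute)
    have "(\<Sum>I\<in>N. \<Sum>J\<in>N. T I J (dual K) * t I * s J) = (\<Sum>J\<in>N. \<Sum>I\<in>N. T I J (dual K) * t I * s J)"
      by (rule sum.swap)
    also have "\<dots> = - (\<Sum>J\<in>N. \<Sum>I\<in>N. T J I (dual K) * s J * t I)"
      unfolding sum_negf[symmetric]
    proof (intro sum.cong refl)
      fix J I assume "J \<in> N" "I \<in> N"
      then have "T I J (dual K) = - T J I (dual K)" using True by (intro T_swap12) auto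
      then show "T I J (dual K) * t I * s J = - (T J I (dual K) * s J * t I)" by simp
    qed
    finally show ?thesis using assms True 1
      by (simp add: circ_def grad_def pair_def rho_sum rho_mult sum.distrib)
  qed (simp add: circ_def grad_def)
qed

text \<open>By total antisymmetry of \<open>T\<close> the last sum is antisymmetric in \<open>s\<close>, \<open>h\<close> and \<open>k\<close>.\<close>

lemma pair_circ:
  assumes "sect s" "sect h" "sect k"
  shows "pair (circ s h) k = (\<Sum>K\<in>N. anch s (h K) * k (dual K)) - (\<Sum>K\<in>N. anch h (s K) * k (dual K))
     + (\<Sum>I\<in>N. anch k (s I) * h (dual I)) + (\<Sum>I\<in>N. \<Sum>J\<in>N. \<Sum>K\<in>N. T I J K * s I * h J * k K)"
proof -
  have 1: "(\<Sum>K\<in>N. (\<Sum>I\<in>N. rho (dual K) (s I) * h (dual I)) * k (dual K))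
      = (\<Sum>I\<in>N. anch k (s I) * h (dual I))"
  proof -
    have "(\<Sum>K\<in>N. (\<Sum>I\<in>N. rho (dual K) (s I) * h (dual I)) * k (dual K))
       = (\<Sum>K\<in>N. (\<Sum>I\<in>N. rho K (s I) * h (dual I)) * k K)"
      by (rule sum_dual[of "\<lambda>K. (\<Sum>I\<in>N. rho K (s I) * h (dual I)) * k K"])
    also have "\<dots> = (\<Sum>K\<in>N. \<Sum>I\<in>N. rho K (s I) * h (dual I) * k K)"
      by (simp add: sum_distrib_right)
    also have "\<dots> = (\<Sum>I\<in>N. \<Sum>K\<in>N. rho K (s I) * h (dual I) * k K)"
      by (rule sum.swap)
    also have "\<dots> = (\<Sum>I\<in>N. anch k (s I) * h (dual I))"
      unfolding anch_def sum_distrib_right by (intro sum.cong refl) (simp add: mult_ac)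
    finally show ?thesis .
  qed
  have 2: "(\<Sum>K\<in>N. (\<Sum>I\<in>N. \<Sum>J\<in>N. T I J (dual K) * s I * h J) * k (dual K))
      = (\<Sum>I\<in>N. \<Sum>J\<in>N. \<Sum>K\<in>N. T I J K * s I * h J * k K)"
  proof -
    have "(\<Sum>K\<in>N. (\<Sum>I\<in>N. \<Sum>J\<in>N. T I J (dual K) * s I * h J) * k (dual K))
       = (\<Sum>K\<in>N. (\<Sum>I\<in>N. \<Sum>J\<in>N. T I J K * s I * h J) * k K)"
      by (rule sum_dual[of "\<lambda>K. (\<Sum>I\<in>N. \<Sum>J\<in>N. T I J K * s I * h J) * k K"])
    also have "\<dots> = (\<Sum>K\<in>N. \<Sum>I\<in>N. \<Sum>J\<in>N. T I J K * s I * h J * k K)"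
      by (simp add: sum_distrib_right)
    also have "\<dots> = (\<Sum>I\<in>N. \<Sum>K\<in>N. \<Sum>J\<in>N. T I J K * s I * h J * k K)"
      by (rule sum.swap)
    also have "\<dots> = (\<Sum>I\<in>N. \<Sum>J\<in>N. \<Sum>K\<in>N. T I J K * s I * h J * k K)"
      by (intro sum.cong refl sum.swap)
    finally show ?thesis .
  qed
  have "pair (circ s h) k = (\<Sum>K\<in>N. anch s (h K) * k (dual K) - anch h (s K) * k (dual K)
      + (\<Sum>I\<in>N. rho (dual K) (s I) * h (dual I)) * k (dual K)
      + (\<Sum>I\<in>N. \<Sum>J\<in>N. T I J (dual K) * s I * h J) * k (dual K))"
    unfolding pair_def by (intro sum.cong refl) (simp add: circ_in algebra_simps)
  then show ?thesis by (simp only: sum.distrib sum_subtractf 1 2)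
qed

text \<open>\<open>T\<close> is skew in the last two indices, and the terms with derivatives of \<open>s\<close> cancel.\<close>

lemma anch_pair:
  assumes "sect s" "sect h" "sect k"
  shows "anch s (pair h k) = pair (circ s h) k + pair h (circ s k)"
proof -
  have "(\<Sum>I\<in>N. \<Sum>J\<in>N. \<Sum>K\<in>N. T I J K * s I * k J * h K)
      = (\<Sum>I\<in>N. \<Sum>K\<in>N. \<Sum>J\<in>N. T I J K * s I * k J * h K)"
    by (intro sum.cong refl sum.swap)
  also have "\<dots> = - (\<Sum>I\<in>N. \<Sum>K\<in>N. \<Sum>J\<in>N. T I K J * s I * h K * k J)"
    unfolding sum_negf[symmetric]
  proof (intro sum.cong refl)
    fix I K J assume "I \<in> N" "K \<in> N" "J \<in> N"
    then have "T I J K = - T I K J" by (intro T_swap23)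
    then show "T I J K * s I * k J * h K = - (T I K J * s I * h K * k J)" by simp
  qed
  finally have 1: "(\<Sum>I\<in>N. \<Sum>J\<in>N. \<Sum>K\<in>N. T I J K * s I * k J * h K)
      = - (\<Sum>I\<in>N. \<Sum>J\<in>N. \<Sum>K\<in>N. T I J K * s I * h J * k K)" .
  have 2: "(\<Sum>K\<in>N. anch s (k K) * h (dual K)) = (\<Sum>K\<in>N. h K * anch s (k (dual K)))"
    by (subst sum_dual[symmetric]) (auto intro!: sum.cong simp: mult.commute)
  have "pair h (circ s k) = pair (circ s k) h" using assms by (simp add: pair_sym)
  then show ?thesis using assms
    unfolding pair_circ[OF assms] pair_circ[OF assms(1,3,2)] 1 2
    by (simp add: pair_def anch_sum_arg anch_mult_arg sum.distrib)
qed

lemma anch_grad: "\<lbrakk>f \<in> S; g \<in> S\<rbrakk> \<Longrightarrow> anch (grad f) g = 0"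
  using anchor_isotropic[of g f] by (simp add: anch_def grad_def mult.commute)

text \<open>The derivatives of \<open>s\<close> contracted with the anchor vanish by isotropy; the terms with \<open>T\<close> are the
  commutators of the \<open>rho I\<close>.\<close>

lemma anch_circ:
  assumes "sect s" "sect t" "f \<in> S"
  shows "anch (circ s t) f = anch s (anch t f) - anch t (anch s f)"
proof -
  have 1: "(\<Sum>K\<in>N. (\<Sum>I\<in>N. rho (dual K) (s I) * t (dual I)) * rho K f) = 0"
  proof -
    have "(\<Sum>K\<in>N. (\<Sum>I\<in>N. rho (dual K) (s I) * t (dual I)) * rho K f)
      = (\<Sum>I\<in>N. \<Sum>K\<in>N. rho (dual K) (s I) * t (dual I) * rho K f)"
      unfolding sum_distrib_right by (rule sum.swap)
    also have "\<dots> = (\<Sum>I\<in>N. t (dual I) * (\<Sum>K\<in>N. rho K f * rho (dual K) (s I)))"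
      by (simp add: sum_distrib_left algebra_simps)
    also have "\<dots> = 0" using assms by (simp add: anchor_isotropic)
    finally show ?thesis .
  qed
  have 2: "(\<Sum>K\<in>N. (\<Sum>I\<in>N. \<Sum>J\<in>N. T I J (dual K) * s I * t J) * rho K f)
     = (\<Sum>I\<in>N. \<Sum>J\<in>N. s I * t J * (rho I (rho J f) - rho J (rho I f)))"
  proof -
    have "(\<Sum>K\<in>N. (\<Sum>I\<in>N. \<Sum>J\<in>N. T I J (dual K) * s I * t J) * rho K f)
       = (\<Sum>K\<in>N. (\<Sum>I\<in>N. \<Sum>J\<in>N. T I J (dual K) * s I * t J) * rho (dual (dual K)) f)"
      by (rule sum.cong) auto
    also have "\<dots> = (\<Sum>K\<in>N. (\<Sum>I\<in>N. \<Sum>J\<in>N. T I J K * s I * t J) * rho (dual K) f)"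
      by (rule sum_dual[of "\<lambda>K. (\<Sum>I\<in>N. \<Sum>J\<in>N. T I J K * s I * t J) * rho (dual K) f"])
    also have "\<dots> = (\<Sum>I\<in>N. \<Sum>K\<in>N. \<Sum>J\<in>N. T I J K * s I * t J * rho (dual K) f)"
      unfolding sum_distrib_right by (rule sum.swap)
    also have "\<dots> = (\<Sum>I\<in>N. \<Sum>J\<in>N. \<Sum>K\<in>N. T I J K * s I * t J * rho (dual K) f)"
      by (intro sum.cong refl sum.swap)
    also have "\<dots> = (\<Sum>I\<in>N. \<Sum>J\<in>N. s I * t J * (\<Sum>K\<in>N. T I J K * rho (dual K) f))"
      by (simp add: sum_distrib_left algebra_simps)
    finally show ?thesis using assms by (simp add: anchor_bracket)
  qed
  have 3: "anch a (anch b f) = (\<Sum>K\<in>N. anch a (b K) * rho K f)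
      + (\<Sum>I\<in>N. \<Sum>J\<in>N. a I * b J * rho I (rho J f))" if "sect a" "sect b" for a b
  proof -
    have "anch a (anch b f) = (\<Sum>K\<in>N. anch a (b K * rho K f))"
      unfolding anch_def[of b f] using that assms by (simp add: anch_sum_arg)
    also have "\<dots> = (\<Sum>K\<in>N. anch a (b K) * rho K f) + (\<Sum>K\<in>N. b K * anch a (rho K f))"
      using that assms by (simp add: anch_mult_arg sum.distrib)
    also have "(\<Sum>K\<in>N. b K * anch a (rho K f)) = (\<Sum>J\<in>N. \<Sum>I\<in>N. a I * b J * rho I (rho J f))"
      by (simp add: anch_def sum_distrib_left algebra_simps)
    also have "\<dots> = (\<Sum>I\<in>N. \<Sum>J\<in>N. a I * b J * rho I (rho J f))" by (rule sum.swap)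
    finally show ?thesis .
  qed
  have 4: "(\<Sum>I\<in>N. \<Sum>J\<in>N. t I * s J * rho I (rho J f)) = (\<Sum>I\<in>N. \<Sum>J\<in>N. s I * t J * rho J (rho I f))"
    by (subst sum.swap) (simp add: algebra_simps)
  have "anch (circ s t) f = (\<Sum>K\<in>N. anch s (t K) * rho K f - anch t (s K) * rho K f
      + (\<Sum>I\<in>N. rho (dual K) (s I) * t (dual I)) * rho K f
      + (\<Sum>I\<in>N. \<Sum>J\<in>N. T I J (dual K) * s I * t J) * rho K f)"
    unfolding anch_def[of "circ s t"] by (intro sum.cong refl) (simp add: circ_in algebra_simps)
  then show ?thesis using assms
    by (simp only: sum.distrib sum_subtractf 1 2 3 4) (simp add: algebra_simps sum_subtractf)
qed

text \<open>The second derivatives of \<open>f\<close> form a commutator of anchors, which is cancelled by the term with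
  \<open>T\<close>.\<close>

lemma circ_grad_left:
  assumes "sect t" "f \<in> S"
  shows "circ (grad f) t = 0"
proof
  fix K
  show "circ (grad f) t K = 0 K"
  proof (cases "K \<in> N")
    case True
    have 1: "(\<Sum>I\<in>N. rho (dual K) (grad f I) * t (dual I)) = (\<Sum>I\<in>N. rho (dual K) (rho I f) * t I)"
      by (subst sum_dual[of "\<lambda>I. rho (dual K) (rho I f) * t I", symmetric])
        (auto simp: grad_def intro!: sum.cong)
    have "(\<Sum>I\<in>N. \<Sum>J\<in>N. T I J (dual K) * grad f I * t J)
        = (\<Sum>J\<in>N. \<Sum>I\<in>N. T I J (dual K) * grad f I * t J)" by (rule sum.swap)
    also have "\<dots> = (\<Sum>J\<in>N. (rho J (rho (dual K) f) - rho (dual K) (rho J f)) * t J)"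
    proof (rule sum.cong[OF refl])
      fix J assume J: "J \<in> N"
      have "(\<Sum>I\<in>N. T I J (dual K) * grad f I * t J)
          = (\<Sum>I\<in>N. T J (dual K) I * rho (dual I) f) * t J"
        unfolding sum_distrib_right
      proof (rule sum.cong[OF refl])
        fix I assume "I \<in> N"
        then have "T I J (dual K) = T J (dual K) I"
          using T_swap12[of J I "dual K"] T_swap23[of J "dual K" I] J True by simp
        then show "T I J (dual K) * grad f I * t J = T J (dual K) I * rho (dual I) f * t J"
          using \<open>I \<in> N\<close> by (simp add: grad_def)
      qed
      then show "(\<Sum>I\<in>N. T I J (dual K) * grad f I * t J)
          = (rho J (rho (dual K) f) - rho (dual K) (rho J f)) * t J"
        using J True assms by (simp add: anchor_bracket)
    qed
    finally have 2: "(\<Sum>I\<in>N. \<Sum>J\<in>N. T I J (dual K) * grad f I * t J)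
        = (\<Sum>J\<in>N. (rho J (rho (dual K) f) - rho (dual K) (rho J f)) * t J)" .
    have 3: "anch t (grad f K) = (\<Sum>J\<in>N. t J * rho J (rho (dual K) f))"
      using True by (simp add: anch_def grad_def)
    show ?thesis
      using True assms by (simp add: circ_in 1 2 3 anch_grad)
        (simp add: algebra_simps sum.distrib sum_subtractf)
  qed simp
qed

lemma circ_grad_right:
  assumes "sect s" "f \<in> S"
  shows "circ s (grad f) = grad (anch s f)"
proof -
  have "pair s (grad f) = anch s f"
    unfolding pair_def anch_def by (auto intro!: sum.cong simp: grad_def)
  then show ?thesis
    using circ_symmetric_part[of s "grad f"] circ_grad_left[of s f] assms by simp
qed

text \<open>The Jacobiator. Because gradients act trivially from the left and \<open>s \<circ> t + t \<circ> s\<close> is a gradient, it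
  changes its sign under adjacent transpositions of its arguments; being linear over functions in the
  last argument, it is so in all of them and only has to be computed on the frame.\<close>

definition jac :: "(nat \<Rightarrow> 'a) \<Rightarrow> (nat \<Rightarrow> 'a) \<Rightarrow> (nat \<Rightarrow> 'a) \<Rightarrow> nat \<Rightarrow> 'a" where
  "jac s t w = circ s (circ t w) - circ (circ s t) w - circ t (circ s w)"

text \<open>The sum of the two Jacobiators is, up to sign, \<open>grad (pair s t) \<circ> w\<close>, which vanishes.\<close>

lemma jac_swap12:
  assumes "sect s" "sect t" "sect w"
  shows "jac t s w = - jac s t w"
proof -
  have "circ (circ s t) w + circ (circ t s) w = circ (circ s t + circ t s) w"
    using assms by (simp add: circ_add_left)
  also have "\<dots> = 0" using assms by (simp add: circ_symmetric_part circ_grad_left)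
  finally have "circ (circ t s) w = - circ (circ s t) w"
    by (simp add: eq_neg_iff_add_eq_0 add.commute)
  then show ?thesis by (simp add: jac_def)
qed

text \<open>Adding the two Jacobiators leaves three gradients, of \<open>anch s (pair t w)\<close>, \<open>pair (s \<circ> t) w\<close> and
  \<open>pair t (s \<circ> w)\<close>; they cancel by invariance of the pairing.\<close>

lemma jac_swap23:
  assumes "sect s" "sect t" "sect w"
  shows "jac s w t = - jac s t w"
proof -
  have 1: "circ s (circ t w) + circ s (circ w t) = grad (anch s (pair t w))"
    using assms by (simp add: circ_add_right[symmetric] circ_symmetric_part circ_grad_right)
  have "grad (f + g) = grad f + grad g" if "f \<in> S" "g \<in> S" for f g
    using that by (simp add: grad_def fun_eq_iff rho_add)
  then have "grad (anch s (pair t w)) = grad (pair (circ s t) w) + grad (pair t (circ s w))"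
    using assms by (simp add: anch_pair)
  also have "\<dots> = (circ (circ s t) w + circ w (circ s t)) + (circ t (circ s w) + circ (circ s w) t)"
    using assms by (simp add: circ_symmetric_part)
  finally have "jac s w t + jac s t w = 0" using 1 by (simp add: jac_def algebra_simps)
  then show ?thesis by (simp add: eq_neg_iff_add_eq_0)
qed

lemma jac_add3:
  assumes "sect s" "sect t" "sect w" "sect w'"
  shows "jac s t (w + w') = jac s t w + jac s t w'"
  using assms by (simp add: jac_def circ_add_right)

text \<open>The terms with derivatives of \<open>f\<close> cancel because the anchor maps \<open>s \<circ> t\<close> to the commutator.\<close>

lemma jac_scale3:
  assumes "sect s" "sect t" "sect w" "f \<in> S"
  shows "jac s t (\<lambda>K. f * w K) = (\<lambda>K. f * jac s t w K)"
proof -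
  have "anch s f \<in> S" "anch t f \<in> S" using assms by auto
  then show ?thesis using assms
    by (simp add: jac_def circ_leibniz circ_add_right anch_circ)
      (simp add: fun_eq_iff algebra_simps)
qed

definition basis :: "nat \<Rightarrow> nat \<Rightarrow> 'a" where
  "basis I = (\<lambda>K. if K = I \<and> I \<in> N then unit else 0)"

lemma sect_basis [simp]: "sect (basis I)"
  by (auto simp: sect_def basis_def)

lemma sect_expand:
  assumes "sect s"
  shows "s = (\<Sum>I\<in>N. (\<lambda>K. s I * basis I K))"
proof
  fix K
  have "(\<Sum>I\<in>N. (\<lambda>K. s I * basis I K)) K = (\<Sum>I\<in>N. s I * basis I K)"
    by (rule sum_fun_apply)
  also have "\<dots> = (\<Sum>I\<in>N. if K = I then s I else 0)"
    using assms by (intro sum.cong refl) (auto simp: basis_def)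
  also have "\<dots> = s K" using assms by (simp add: sect_out)
  finally show "s K = (\<Sum>I\<in>N. (\<lambda>K. s I * basis I K)) K" by simp
qed

lemma jac_eq_zero_if_basis:
  assumes "sect s" "sect t" "sect w" and z: "\<And>K. K \<in> N \<Longrightarrow> jac s t (basis K) = 0"
  shows "jac s t w = 0"
proof -
  define b where "b I = (\<lambda>K. w I * basis I K)" for I
  have b: "sect (b I)" for I using assms by (simp add: b_def)
  have b0: "jac s t (b I) = 0" if "I \<in> N" for I
    using assms that by (simp add: b_def jac_scale3 z) (simp add: fun_eq_iff)
  have z0: "jac s t 0 = 0"
    using assms(1,2) unfolding jac_def by (simp only: circ_zero_right sect_circ) simp
  have "jac s t (sum b X) = 0" if "X \<subseteq> N" for X
    using finite_subset[OF that finite_N] that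
  proof (induction X rule: finite_induct)
    case (insert I X)
    have "jac s t (b I + sum b X) = jac s t (b I) + jac s t (sum b X)"
      by (rule jac_add3) (use assms b in auto)
    moreover have "jac s t (b I) = 0" "jac s t (sum b X) = 0"
      using insert b0 by blast+
    moreover have "sum b (insert I X) = b I + sum b X"
      by (rule sum.insert[OF insert(1,2)])
    ultimately show ?case by (metis add_0)
  qed (simp add: z0)
  from this[of N] show ?thesis using sect_expand[OF assms(3)] by (simp only: b_def[abs_def])
qed

lemma circ_basis: "\<lbrakk>I \<in> N; J \<in> N\<rbrakk> \<Longrightarrow> circ (basis I) (basis J) = (\<lambda>K. if K \<in> N then T I J (dual K) else 0)"
proof -
  assume IJ: "I \<in> N" "J \<in> N"
  have b: "rho K (basis I' L) = 0" if "K \<in> N" for K I' L using that by (simp add: basis_def)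
  have "(\<Sum>I'\<in>N. \<Sum>J'\<in>N. T I' J' (dual K) * basis I I' * basis J J') = T I J (dual K)" if "K \<in> N" for K
  proof -
    have "(\<Sum>I'\<in>N. \<Sum>J'\<in>N. T I' J' (dual K) * basis I I' * basis J J')
      = (\<Sum>I'\<in>N. \<Sum>J'\<in>N. if J' = J then (if I' = I then T I' J' (dual K) else 0) else 0)"
      using IJ that by (intro sum.cong refl) (auto simp: basis_def)
    then show ?thesis using IJ by simp
  qed
  then show ?thesis using IJ by (simp add: circ_def anch_def b fun_eq_iff)
qed

text \<open>On the frame all derivatives fall on \<open>T\<close>, and the Jacobiator becomes the left-hand side of
  \<open>structure_equation\<close>.\<close>

lemma jac_basis:
  assumes "I \<in> N" "J \<in> N" "K \<in> N"
  shows "jac (basis I) (basis J) (basis K) = 0"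
proof
  fix L
  show "jac (basis I) (basis J) (basis K) L = 0 L"
  proof (cases "L \<in> N")
    case True
    have b: "rho A (basis I' L) = 0" if "A \<in> N" for A I' L using that by (simp add: basis_def)
    let ?s = "\<lambda>I J. (\<lambda>K. if K \<in> N then T I J (dual K) else 0)"
    have l: "circ (basis P) (?s Q R) L = rho P (T Q R (dual L)) + (\<Sum>M\<in>N. T Q R M * T P (dual M) (dual L))"
      if "P \<in> N" "Q \<in> N" "R \<in> N" for P Q R
    proof -
      have s: "sect (?s Q R)" using that by (auto simp: sect_def)
      have 1: "anch (basis P) (?s Q R L) = rho P (T Q R (dual L))"
      proof -
        have "anch (basis P) (?s Q R L) = (\<Sum>A\<in>N. if A = P then rho P (T Q R (dual L)) else 0)"
          unfolding anch_def using that True by (intro sum.cong refl) (auto simp: basis_def)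
        then show ?thesis using that by simp
      qed
      have "(\<Sum>I\<in>N. \<Sum>J\<in>N. T I J (dual L) * basis P I * ?s Q R J)
        = (\<Sum>I\<in>N. if I = P then (\<Sum>J\<in>N. T P J (dual L) * T Q R (dual J)) else 0)"
        using that True by (intro sum.cong refl) (auto simp: basis_def intro!: sum.cong)
      also have "\<dots> = (\<Sum>J\<in>N. T P J (dual L) * T Q R (dual J))" using that by simp
      also have "\<dots> = (\<Sum>M\<in>N. T Q R M * T P (dual M) (dual L))"
        by (subst sum_dual[symmetric]) (auto intro!: sum.cong simp: mult.commute)
      finally have 2: "(\<Sum>I\<in>N. \<Sum>J\<in>N. T I J (dual L) * basis P I * ?s Q R J)
        = (\<Sum>M\<in>N. T Q R M * T P (dual M) (dual L))" .
      have 3: "anch (?s Q R) (basis P L) = 0"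
        using b by (simp add: anch_def)
      have 4: "(\<Sum>I\<in>N. rho (dual L) (basis P I) * ?s Q R (dual I)) = 0"
        using b True by (intro sum.neutral) auto
      show ?thesis unfolding circ_in[OF True] 1 2 3 4 by simp
    qed
    have r: "circ (?s P Q) (basis R) L = - rho R (T P Q (dual L)) + rho (dual L) (T P Q R)
        + (\<Sum>M\<in>N. T P Q M * T (dual M) R (dual L))" if "P \<in> N" "Q \<in> N" "R \<in> N" for P Q R
    proof -
      have 1: "anch (basis R) (?s P Q L) = rho R (T P Q (dual L))"
      proof -
        have "anch (basis R) (?s P Q L) = (\<Sum>A\<in>N. if A = R then rho R (T P Q (dual L)) else 0)"
          unfolding anch_def using that True by (intro sum.cong refl) (auto simp: basis_def)
        then show ?thesis using that by simp
      qed
      have 2: "(\<Sum>I\<in>N. rho (dual L) (?s P Q I) * basis R (dual I)) = rho (dual L) (T P Q R)"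
      proof -
        have "(\<Sum>I\<in>N. rho (dual L) (?s P Q I) * basis R (dual I))
          = (\<Sum>I\<in>N. if I = dual R then rho (dual L) (T P Q R) else 0)"
          using that True by (intro sum.cong refl) (auto simp: basis_def)
        then show ?thesis using that by simp
      qed
      have "(\<Sum>I\<in>N. \<Sum>J\<in>N. T I J (dual L) * ?s P Q I * basis R J)
        = (\<Sum>I\<in>N. \<Sum>J\<in>N. if J = R then T I R (dual L) * T P Q (dual I) else 0)"
        using that True by (intro sum.cong refl) (auto simp: basis_def)
      also have "\<dots> = (\<Sum>I\<in>N. T I R (dual L) * T P Q (dual I))" using that by simp
      also have "\<dots> = (\<Sum>M\<in>N. T P Q M * T (dual M) R (dual L))"
        by (subst sum_dual[symmetric]) (auto intro!: sum.cong simp: mult.commute)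
      finally have 3: "(\<Sum>I\<in>N. \<Sum>J\<in>N. T I J (dual L) * ?s P Q I * basis R J)
        = (\<Sum>M\<in>N. T P Q M * T (dual M) R (dual L))" .
      have 4: "anch (?s P Q) (basis R L) = 0"
        using b by (simp add: anch_def)
      show ?thesis unfolding circ_in[OF True] 1 2 3 4 by simp
    qed
    show ?thesis
      using assms True structure_equation[of I J K "dual L"]
      by (simp add: jac_def circ_basis l r sum_subtractf sum.distrib algebra_simps)
  qed (simp add: jac_def)
qed

text \<open>Replace the arguments by frame vectors one after the other, moving each into the last place.\<close>

theorem jacobi:
  assumes "sect s" "sect t" "sect w"
  shows "circ s (circ t w) = circ (circ s t) w + circ t (circ s w)"
proof -
  have 1: "jac (basis I) (basis J) w = 0" if "I \<in> N" "J \<in> N" "sect w" for I J w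
    using jac_eq_zero_if_basis[OF sect_basis sect_basis that(3) jac_basis] that by blast
  have 2: "jac (basis I) t w = 0" if "I \<in> N" "sect t" "sect w" for I t w
  proof (rule jac_eq_zero_if_basis)
    fix K assume "K \<in> N"
    then show "jac (basis I) t (basis K) = 0"
      using jac_swap23[of "basis I" "basis K" t] 1[of I K t] that by simp
  qed (use that in auto)
  have "jac s t w = 0"
  proof (rule jac_eq_zero_if_basis)
    fix K assume "K \<in> N"
    have "jac s t (basis K) = - jac s (basis K) t"
      using jac_swap23[of s "basis K" t] assms by simp
    also have "\<dots> = jac (basis K) s t"
      using jac_swap12[of "basis K" s t] assms by simp
    finally show "jac s t (basis K) = 0" using 2[of K s t] assms \<open>K \<in> N\<close> by simp
  qed (use assms in auto)
  then show ?thesis by (simp add: jac_def algebra_simps)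
qed

end

section \<open>The coefficients of a proto-bialgebroid structure\<close>

locale split_proto_bialgebroid =
  fixes M :: "'m::{t2_space,second_countable_topology} manifold"
    and A :: "('m, 'v::real_vector) vbundle"
    and \<theta> :: "('m, 'v) ctfun"
    and dA :: "('m, 'v) form_op"
    and dA' :: "('m, 'v \<Rightarrow> real) form_op"
    and \<phi> :: "('m, 'v) form"
    and \<psi> :: "('m, 'v \<Rightarrow> real) form"
  assumes smooth_M: "smooth_manifold M"
    and vector_bundle_A: "vector_bundle M A"
    and proto: "proto_bialgebroid M A \<theta>"
    and dA: "vector_field_Pi M A dA" "degree_one M A dA"
    and dA': "vector_field_Pi M (dual_bundle A) dA'" "degree_one M (dual_bundle A) dA'"
    and phi: "\<phi> \<in> kforms_on M A 3 UNIV"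
    and psi: "\<psi> \<in> kforms_on M (dual_bundle A) 3 UNIV"
    and theta: "\<And>c e m. c \<in> atlas M \<Longrightarrow> e \<in> frames A \<Longrightarrow> m \<in> fst c \<inter> fst e \<Longrightarrow>
           \<theta> c e m = hamiltonian_lift M A dA c e m
             + legendre_pullback A (hamiltonian_lift M (dual_bundle A) dA') c e m
             + pi_pullback A \<phi> c e m
             + legendre_pullback A (pi_pullback (dual_bundle A) \<psi>) c e m"
begin

sublocale A: vbundle_vector_field M A dA
  by unfold_locales (fact smooth_M vector_bundle_A dA)+

sublocale A': vbundle_vector_field M "dual_bundle A" dA'
  by unfold_locales (fact smooth_M A.dual_vector_bundle dA')+

abbreviation n :: nat where "n \<equiv> mdim M"
abbreviation r :: nat where "r \<equiv> brank A"

lemma brank_dual [simp]: "brank (dual_bundle A) = r"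
  and fibre_dual [simp]: "fibre (dual_bundle A) m = dual_space (fibre A m)"
  by (simp_all add: dual_bundle_def)

lemma dual_frame_in: "e \<in> frames A \<Longrightarrow> dual_frame A e \<in> frames (dual_bundle A)"
  by (simp add: dual_bundle_def)

lemma fst_dual_frame [simp]: "fst (dual_frame A e) = fst e"
  and snd_dual_frame [simp]: "snd (dual_frame A e) a m = coframe A e a m"
  by (simp_all add: dual_frame_def)

text \<open>The coefficients of \<open>\<theta>\<close>: \<open>anchor_coeff c e i I\<close> belongs to \<open>x\<^sub>i\<^sup>* \<eta>\<^sup>I\<close> and \<open>cubic_coeff e I J K\<close>, for
  increasing indices, to \<open>\<eta>\<^sup>I \<eta>\<^sup>J \<eta>\<^sup>K\<close>. The eight cases of the latter spell out the alternating array
  with these values: two indices below \<open>r\<close> refer to \<open>d\<^sub>A\<close>, two indices from \<open>r\<close> on to \<open>d\<^sub>A\<^sub>*\<close>.\<close>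

definition anchor_coeff :: "'m chart \<Rightarrow> ('m, 'v) frame \<Rightarrow> nat \<Rightarrow> nat \<Rightarrow> 'm \<Rightarrow> real" where
  "anchor_coeff c e i I = (if I < r then frame_anchor dA c e i I
     else frame_anchor dA' c (dual_frame A e) i (I - r))"

definition cubic_coeff :: "('m, 'v) frame \<Rightarrow> nat \<Rightarrow> nat \<Rightarrow> nat \<Rightarrow> 'm \<Rightarrow> real" where
  "cubic_coeff e I J K m = (let
       s = (\<lambda>k a b. frame_structure A dA e k a b m);
       s' = (\<lambda>k a b. frame_structure (dual_bundle A) dA' (dual_frame A e) k a b m) in
     if I < r then
       if J < r then
         if K < r then \<phi> m [snd e I m, snd e J m, snd e K m] else s (K - r) I J
       else if K < r then s (J - r) K I else s' I (J - r) (K - r)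
     else if J < r then
       if K < r then s (I - r) J K else s' J (K - r) (I - r)
     else if K < r then s' K (I - r) (J - r)
     else \<psi> m [coframe A e (I - r) m, coframe A e (J - r) m, coframe A e (K - r) m])"

lemma form3_swaps:
  assumes "alternating_form F \<omega>" "subspace F" "u \<in> F" "v \<in> F" "w \<in> F"
  shows "\<omega> [v, u, w] = - \<omega> [u, v, w]" "\<omega> [u, w, v] = - \<omega> [u, v, w]"
  using form_swap[OF assms(1,2), of "[]" "[w]" u v] form_swap[OF assms(1,2), of "[u]" "[]" v w] assms by auto

lemma cubic_coeff_alternating:
  assumes e: "e \<in> frames A" "m \<in> fst e"
  shows "alternating3 {..<2 * r} (\<lambda>I J K. cubic_coeff e I J K m)"
  unfolding alternating3_def
proof (intro ballI)
  note fr = A.frame_at[OF e]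
  have s: "frame_structure A dA e k b a m = - frame_structure A dA e k a b m"
    if "k < r" "a < r" "b < r" for k a b
    by (rule A.frame_structure_swap[OF e that])
  have s': "frame_structure (dual_bundle A) dA' (dual_frame A e) k b a m
       = - frame_structure (dual_bundle A) dA' (dual_frame A e) k a b m"
    if "k < r" "a < r" "b < r" for k a b
    using A'.frame_structure_swap[OF dual_frame_in[OF e(1)], of m k a b] e that by simp
  have p: "\<phi> m [snd e b m, snd e a m, snd e k m] = - \<phi> m [snd e a m, snd e b m, snd e k m]"
    "\<phi> m [snd e a m, snd e k m, snd e b m] = - \<phi> m [snd e a m, snd e b m, snd e k m]"
    if "k < r" "a < r" "b < r" for k a b
    using form3_swaps[OF A.kform_alternating[OF phi UNIV_I, of m] A.subspace_fibre, of "snd e a m" "snd e b m" "snd e k m"]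
      frame_in_fibre[OF fr] that by simp_all
  have q: "\<psi> m [coframe A e b m, coframe A e a m, coframe A e k m] = - \<psi> m [coframe A e a m, coframe A e b m, coframe A e k m]"
    "\<psi> m [coframe A e a m, coframe A e k m, coframe A e b m] = - \<psi> m [coframe A e a m, coframe A e b m, coframe A e k m]"
    for k a b
    using form3_swaps[OF A'.kform_alternating[OF psi UNIV_I, of m] A'.subspace_fibre,
        of "coframe A e a m" "coframe A e b m" "coframe A e k m"] coframe_in_dual[OF fr] by simp_all
  fix I J K assume "I \<in> {..<2 * r}" "J \<in> {..<2 * r}" "K \<in> {..<2 * r}"
  then have nr: "\<not> I < r \<Longrightarrow> I - r < r" "\<not> J < r \<Longrightarrow> J - r < r" "\<not> K < r \<Longrightarrow> K - r < r"
    by auto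
  show "cubic_coeff e J I K m = - cubic_coeff e I J K m \<and> cubic_coeff e I K J m = - cubic_coeff e I J K m"
  proof (cases "I < r")
    case I: True
    show ?thesis
    proof (cases "J < r")
      case J: True
      show ?thesis
      proof (cases "K < r")
        case K: True
        show ?thesis using I J K nr p[of K I J] by (simp add: cubic_coeff_def)
      next
        case K: False
        show ?thesis using I J K nr s[of "K - r" I J] by (simp add: cubic_coeff_def)
      qed
    next
      case J: False
      show ?thesis
      proof (cases "K < r")
        case K: True
        show ?thesis using I J K nr s[of "J - r" K I] by (simp add: cubic_coeff_def)
      next
        case K: False
        show ?thesis using I J K nr s'[of I "J - r" "K - r"] by (simp add: cubic_coeff_def)
      qed
    qed
  next
    case I: False
    show ?thesis
    proof (cases "J < r")
      case J: True
      show ?thesis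
      proof (cases "K < r")
        case K: True
        show ?thesis using I J K nr s[of "I - r" J K] by (simp add: cubic_coeff_def)
      next
        case K: False
        show ?thesis using I J K nr s'[of J "K - r" "I - r"] by (simp add: cubic_coeff_def)
      qed
    next
      case J: False
      show ?thesis
      proof (cases "K < r")
        case K: True
        show ?thesis using I J K nr s'[of K "I - r" "J - r"] by (simp add: cubic_coeff_def)
      next
        case K: False
        show ?thesis using I J K nr q[where a = "I - r" and b = "J - r" and k = "K - r"] by (simp add: cubic_coeff_def)
      qed
    qed
  qed
qed

lemma hamiltonian_lift_ham: "hamiltonian_lift M A dA c e m
     = ham n r (\<lambda>i. even_component A dA i c e m) (\<lambda>a. odd_component A dA a c e m)"
  and hamiltonian_lift_ham': "hamiltonian_lift M (dual_bundle A) dA' c (dual_frame A e) m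
     = ham n r (\<lambda>i. even_component (dual_bundle A) dA' i c (dual_frame A e) m)
         (\<lambda>a. odd_component (dual_bundle A) dA' a c (dual_frame A e) m)"
  by (simp_all add: hamiltonian_lift_def ham_def)

lemma legendre_pullback_swap: "legendre_pullback A G c e m
     = substitute even_gen (\<lambda>q. odd_gen (swap_odd r q)) (G c (dual_frame A e) m)"
proof -
  have "(\<lambda>q. if q < r then odd_gen (r + q) else odd_gen (q - r)) = (\<lambda>q. odd_gen (swap_odd r q))"
    by (auto simp: swap_odd_def)
  then show ?thesis by (simp add: legendre_pullback_def)
qed

context
  fixes c e m
  assumes c: "c \<in> atlas M" and e: "e \<in> frames A" and m: "m \<in> fst c \<inter> fst e"
begin

lemma supported:
  "i < n \<Longrightarrow> form_supported r 1 (even_component A dA i c e m)"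
  "a < r \<Longrightarrow> form_supported r 2 (odd_component A dA a c e m)"
  "i < n \<Longrightarrow> form_supported r 1 (even_component (dual_bundle A) dA' i c (dual_frame A e) m)"
  "a < r \<Longrightarrow> form_supported r 2 (odd_component (dual_bundle A) dA' a c (dual_frame A e) m)"
  "form_supported r 3 (pi_pullback A \<phi> c e m)"
  "form_supported r 3 (pi_pullback (dual_bundle A) \<psi> c (dual_frame A e) m)"
  using A.even_component_supported[OF c] A.odd_component_supported[OF e] m
    A'.even_component_supported[OF c] A'.odd_component_supported[OF dual_frame_in[OF e]]
    pi_pullback_supported[OF phi UNIV_I] pi_pullback_supported[OF psi UNIV_I] by auto

text \<open>Each monomial receives a contribution from exactly one of the four summands of \<open>\<theta>\<close>.\<close>

lemma theta_momentum_coeff: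
  assumes i: "i < n" and I: "I < 2 * r"
  shows "\<theta> c e m ({#i#}, {I}) = anchor_coeff c e i I m"
proof -
  have 1: "hamiltonian_lift M A dA c e m ({#i#}, {I}) = (if I < r then frame_anchor dA c e i I m else 0)"
  proof -
    have "hamiltonian_lift M A dA c e m ({#i#}, {I}) = even_component A dA i c e m ({#}, {I})"
      unfolding hamiltonian_lift_ham by (rule ham_coeff1) (use supported i in auto)
    moreover have "even_component A dA i c e m ({#}, {I}) = 0" if "\<not> I < r"
      using supported(1)[OF i] that by (force simp: form_supported_def)
    ultimately show ?thesis using A.even_component_coeff by auto
  qed
  have 2: "legendre_pullback A (hamiltonian_lift M (dual_bundle A) dA') c e m ({#i#}, {I})
     = (if I < r then 0 else frame_anchor dA' c (dual_frame A e) i (I - r) m)"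
  proof -
    have "legendre_pullback A (hamiltonian_lift M (dual_bundle A) dA') c e m ({#i#}, {I})
      = (if I < r then 0 else even_component (dual_bundle A) dA' i c (dual_frame A e) m ({#}, {I - r}))"
      unfolding legendre_pullback_swap hamiltonian_lift_ham'
      by (rule legendre_ham_coeff(1)) (use supported i I in auto)
    then show ?thesis using A'.even_component_coeff[of "I - r"] I by auto
  qed
  have 3: "pi_pullback A \<phi> c e m ({#i#}, {I}) = 0"
    by (simp add: pi_pullback_def)
  have 4: "legendre_pullback A (pi_pullback (dual_bundle A) \<psi>) c e m ({#i#}, {I}) = 0"
    unfolding legendre_pullback_swap by (rule legendre_form_coeff(1)[OF supported(6) I])
  show ?thesis unfolding theta[OF c e m] plus_fun_apply 1 2 3 4 by (simp add: anchor_coeff_def)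
qed

lemma theta_cubic_coeff:
  assumes IJK: "I < J" "J < K" "K < 2 * r"
  shows "\<theta> c e m ({#}, {I, J, K}) = cubic_coeff e I J K m"
proof -
  have 1: "hamiltonian_lift M A dA c e m ({#}, {I, J, K})
     = (if J < r \<and> r \<le> K then frame_structure A dA e (K - r) I J m else 0)"
  proof (cases "J < r \<and> r \<le> K")
    case True
    then have "hamiltonian_lift M A dA c e m ({#}, {I, J, K}) = odd_component A dA (K - r) c e m ({#}, {I, J})"
      unfolding hamiltonian_lift_ham by (intro ham_coeff3) (use supported IJK in auto)
    then show ?thesis using True A.odd_component_coeff[OF IJK(1)] by simp
  next
    case False
    have "hamiltonian_lift M A dA c e m ({#}, {I, J, K}) = 0"
    proof (rule ccontr)
      assume "hamiltonian_lift M A dA c e m ({#}, {I, J, K}) \<noteq> 0"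
      from ham_nonzero[OF _ _ this[unfolded hamiltonian_lift_ham]] supported(1,2)
      obtain a where a: "a < r" "r + a \<in> {I, J, K}" "{I, J, K} - {r + a} \<subseteq> {..<r}" by auto
      have "J < r"
      proof (rule ccontr)
        assume "\<not> J < r"
        have "J \<noteq> r + a \<or> K \<noteq> r + a" using IJK by linarith
        then have "J \<in> {..<r} \<or> K \<in> {..<r}" using a(3) by blast
        then show False using \<open>\<not> J < r\<close> IJK by simp
      qed
      moreover have "r \<le> K" using a(2) IJK by (elim insertE emptyE) linarith+
      ultimately show False using False by blast
    qed
    then show ?thesis by (simp only: False if_False)
  qed
  have 2: "legendre_pullback A (hamiltonian_lift M (dual_bundle A) dA') c e m ({#}, {I, J, K})
     = (if I < r \<and> r \<le> J then frame_structure (dual_bundle A) dA' (dual_frame A e) I (J - r) (K - r) m else 0)"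
  proof -
    have "legendre_pullback A (hamiltonian_lift M (dual_bundle A) dA') c e m ({#}, {I, J, K})
      = (if I < r \<and> r \<le> J then odd_component (dual_bundle A) dA' I c (dual_frame A e) m ({#}, {J - r, K - r}) else 0)"
      unfolding legendre_pullback_swap hamiltonian_lift_ham'
      by (rule legendre_ham_coeff(2)) (use supported IJK in auto)
    moreover have "J - r < K - r" "K - r < r" if "r \<le> J" using that IJK by linarith+
    ultimately show ?thesis using A'.odd_component_coeff[of "J - r" "K - r" I c "dual_frame A e" m] by auto
  qed
  have 3: "pi_pullback A \<phi> c e m ({#}, {I, J, K}) = (if K < r then \<phi> m [snd e I m, snd e J m, snd e K m] else 0)"
    using IJK sorted_list_of_set3[of I J K]
    by (auto simp: pi_pullback_def simp del: sorted_list_of_set_insert_remove)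
  have 4: "legendre_pullback A (pi_pullback (dual_bundle A) \<psi>) c e m ({#}, {I, J, K})
     = (if r \<le> I then \<psi> m [coframe A e (I - r) m, coframe A e (J - r) m, coframe A e (K - r) m] else 0)"
  proof -
    have "legendre_pullback A (pi_pullback (dual_bundle A) \<psi>) c e m ({#}, {I, J, K})
       = (if r \<le> I then pi_pullback (dual_bundle A) \<psi> c (dual_frame A e) m ({#}, {I - r, J - r, K - r}) else 0)"
      unfolding legendre_pullback_swap by (rule legendre_form_coeff(2)[OF supported(6) IJK])
    moreover have "I - r < J - r" "J - r < K - r" "I - r < r" "J - r < r" "K - r < r" if "r \<le> I" using that IJK by linarith+
    moreover have "sorted_list_of_set {I - r, J - r, K - r} = [I - r, J - r, K - r]" if "r \<le> I"
      by (rule sorted_list_of_set3) (use that IJK in linarith)+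
    ultimately show ?thesis
      by (simp add: pi_pullback_def del: sorted_list_of_set_insert_remove)
  qed
  have "K < r \<or> (J < r \<and> r \<le> K) \<or> (I < r \<and> r \<le> J) \<or> r \<le> I" by linarith
  then show ?thesis unfolding theta[OF c e m] plus_fun_apply 1 2 3 4
    using IJK by (elim disjE) (auto simp: cubic_coeff_def)
qed

lemma theta_cubic: "cubic r (\<theta> c e m)"
  unfolding cubic_def
proof (intro allI impI)
  fix P S assume nz: "\<theta> c e m (P, S) \<noteq> 0"
  have S: "S \<subseteq> {..<2 * r}" using proto c e m nz unfolding proto_bialgebroid_def ctfun_def by blast
  have "epsilon_degree r (P, S) + delta_degree r (P, S) = 3"
    using proto c e m nz unfolding proto_bialgebroid_def kappa_homogeneous_def by blast
  moreover have "card S = card (S \<inter> {r..<2 * r}) + card (S \<inter> {..<r})"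
  proof -
    have "S = (S \<inter> {r..<2 * r}) \<union> (S \<inter> {..<r})" using S by auto
    moreover have "card ((S \<inter> {r..<2 * r}) \<union> (S \<inter> {..<r})) = card (S \<inter> {r..<2 * r}) + card (S \<inter> {..<r})"
      by (rule card_Un_disjoint) auto
    ultimately show ?thesis by simp
  qed
  ultimately show "S \<subseteq> {..<2 * r} \<and> 2 * size P + card S = 3"
    using S by (simp add: epsilon_degree_def delta_degree_def)
qed

end

context
  fixes c e
  assumes c: "c \<in> atlas M" and e: "e \<in> frames A"
begin

lemma domain: "chart_domain M c (fst c \<inter> fst e)"
  by (rule chart_domain_Int[OF smooth_M c A.open_frame[OF e]])

interpretation D: chart_domain M c "fst c \<inter> fst e" by (rule domain)

lemma d_base_theta_cubic:
  assumes m: "m \<in> fst c \<inter> fst e" and i: "i < n"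
  shows "cubic r (d_base c i (\<theta> c e) m)"
  unfolding cubic_def
proof (intro allI impI)
  fix P S assume nz: "d_base c i (\<theta> c e) m (P, S) \<noteq> 0"
  have "\<exists>p\<in>fst c \<inter> fst e. \<theta> c e p (P, S) \<noteq> 0"
  proof (rule ccontr)
    assume "\<not> ?thesis"
    then have "pd c i (\<lambda>p. \<theta> c e p (P, S)) m = pd c i (\<lambda>_. 0) m" by (intro D.pd_cong m i) auto
    then show False using nz by (simp add: d_base_def)
  qed
  then show "S \<subseteq> {..<2 * r} \<and> 2 * size P + card S = 3"
    using theta_cubic[OF c e] unfolding cubic_def by blast
qed

lemma d_base_theta_momentum:
  "\<lbrakk>m \<in> fst c \<inter> fst e; i < n; j < n; I < 2 * r\<rbrakk>
    \<Longrightarrow> d_base c i (\<theta> c e) m ({#j#}, {I}) = pd c i (anchor_coeff c e j I) m"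
  unfolding d_base_def by (rule D.pd_cong) (auto simp: theta_momentum_coeff[OF c e])

lemma d_base_theta_odd:
  "\<lbrakk>m \<in> fst c \<inter> fst e; i < n\<rbrakk> \<Longrightarrow> odd_coeffs r (d_base c i (\<theta> c e) m) (\<lambda>I J K. pd c i (cubic_coeff e I J K) m)"
  unfolding d_base_def odd_coeffs_def
  by (intro allI impI D.pd_cong) (auto simp: theta_cubic_coeff[OF c e])

lemma poisson_square_theta:
  assumes m: "m \<in> fst c \<inter> fst e"
  shows "poisson_square n r (\<theta> c e m) (\<lambda>i. d_base c i (\<theta> c e) m) z = 0"
proof -
  have "poisson n r c (\<theta> c e) (\<theta> c e) m = 0"
    using proto c e m unfolding proto_bialgebroid_def by blast
  then show ?thesis unfolding poisson_def poisson_square_def by (metis zero_fun_apply)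
qed

text \<open>The three components of \<open>{\<theta>, \<theta>} = 0\<close> follow: with \<open>\<rho>\<^sub>I\<close> the vector field with coefficients
  \<open>anchor_coeff c e i I\<close>, they state that the \<open>\<rho>\<^sub>I\<close> are isotropic for the pairing, what their
  commutators are, and the Jacobi identity for the frame.\<close>

lemma anchor_coeff_isotropic:
  assumes m: "m \<in> fst c \<inter> fst e" and ij: "i < n" "j < n"
  shows "(\<Sum>I<2 * r. anchor_coeff c e i I m * anchor_coeff c e j (swap_odd r I) m) = 0"
proof -
  have "(\<Sum>a<r. \<theta> c e m ({#i#}, {r + a}) * \<theta> c e m ({#j#}, {a}) + \<theta> c e m ({#i#}, {a}) * \<theta> c e m ({#j#}, {r + a})) = 0"
    by (rule poisson_square_momenta2[OF theta_cubic[OF c e m] d_base_theta_cubic[OF m] poisson_square_theta[OF m]])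
  then show ?thesis
    by (simp add: theta_momentum_coeff[OF c e m] ij sum_lessThan_double swap_odd_def sum.distrib add.commute)
qed

lemma anchor_coeff_bracket:
  assumes m: "m \<in> fst c \<inter> fst e" and j: "j < n" and IJ: "I < 2 * r" "J < 2 * r"
  shows "(\<Sum>i<n. anchor_coeff c e i I m * pd c i (anchor_coeff c e j J) m
            - anchor_coeff c e i J m * pd c i (anchor_coeff c e j I) m)
     = - (\<Sum>K<2 * r. cubic_coeff e I J K m * anchor_coeff c e j (swap_odd r K) m)"
proof -
  have me: "m \<in> fst e" using m by blast
  note alt = cubic_coeff_alternating[OF e me]
  have less: "(\<Sum>i<n. anchor_coeff c e i I m * pd c i (anchor_coeff c e j J) m
            - anchor_coeff c e i J m * pd c i (anchor_coeff c e j I) m)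
     = - (\<Sum>K<2 * r. cubic_coeff e I J K m * anchor_coeff c e j (swap_odd r K) m)"
    if IJ: "I < J" "J < 2 * r" for I J
  proof -
    have I: "I < 2 * r" using IJ by simp
    have cyc: "cubic_coeff e K I J m = cubic_coeff e I J K m" if "K < 2 * r" for K
      using alternating3_swap(1)[OF alt, of K I J] alternating3_swap(2)[OF alt, of I K J] that IJ by simp
    have odd: "odd_coeffs r (\<theta> c e m) (\<lambda>I J K. cubic_coeff e I J K m)"
      unfolding odd_coeffs_def using theta_cubic_coeff[OF c e m] by blast
    have "(\<Sum>i<n. \<theta> c e m ({#i#}, {I}) * d_base c i (\<theta> c e) m ({#j#}, {J}) - \<theta> c e m ({#i#}, {J}) * d_base c i (\<theta> c e) m ({#j#}, {I}))
       + (\<Sum>a<r. \<theta> c e m ({#j#}, {r + a}) * cubic_coeff e a I J m + \<theta> c e m ({#j#}, {a}) * cubic_coeff e (r + a) I J m) = 0"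
      by (rule poisson_square_momentum1[OF theta_cubic[OF c e m] d_base_theta_cubic[OF m] alt odd poisson_square_theta[OF m] IJ])
    then have "(\<Sum>i<n. anchor_coeff c e i I m * pd c i (anchor_coeff c e j J) m
            - anchor_coeff c e i J m * pd c i (anchor_coeff c e j I) m)
       = - (\<Sum>a<r. anchor_coeff c e j (r + a) m * cubic_coeff e I J a m + anchor_coeff c e j a m * cubic_coeff e I J (r + a) m)"
      using I IJ j by (simp add: theta_momentum_coeff[OF c e m] d_base_theta_momentum[OF m] cyc)
    then show ?thesis unfolding sum_lessThan_double
      by (simp add: swap_odd_def sum.distrib mult.commute)
  qed
  consider "I < J" | "I = J" | "J < I" by linarith
  then show ?thesis
  proof cases
    case 1 then show ?thesis using less IJ by blast
  next
    case 2
    have "cubic_coeff e I I K m = 0" if "K < 2 * r" for K using alternating3_eq(1)[OF alt, of I K] IJ that by simp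
    then show ?thesis using 2 by simp
  next
    case 3
    have "cubic_coeff e I J K m = - cubic_coeff e J I K m" if "K < 2 * r" for K
      using alternating3_swap(1)[OF alt, of J I K] IJ that by simp
    then have "(\<Sum>K<2 * r. cubic_coeff e I J K m * anchor_coeff c e j (swap_odd r K) m)
       = - (\<Sum>K<2 * r. cubic_coeff e J I K m * anchor_coeff c e j (swap_odd r K) m)"
      unfolding sum_negf[symmetric] by (intro sum.cong) auto
    then show ?thesis using less[OF 3 IJ(1)] by (simp add: sum_subtractf)
  qed
qed

text \<open>For increasing indices the coefficient is a value of a smooth form on frame vectors in increasing
  order; the other indices follow by alternation.\<close>

lemma cubic_coeff_smooth:
  assumes "I < 2 * r" "J < 2 * r" "K < 2 * r"
  shows "smooth_in_chart M c (fst c \<inter> fst e) (cubic_coeff e I J K)"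
proof (rule sorted_induct3[where N = "{..<2 * r}" and P = "\<lambda>I J K. smooth_in_chart M c (fst c \<inter> fst e) (cubic_coeff e I J K)"])
  fix I J K assume N: "I \<in> {..<2 * r}" "J \<in> {..<2 * r}" "K \<in> {..<2 * r}"
  note alt = alternating3_swap[OF cubic_coeff_alternating[OF e] N]
  assume sm: "smooth_in_chart M c (fst c \<inter> fst e) (cubic_coeff e I J K)"
  show "smooth_in_chart M c (fst c \<inter> fst e) (cubic_coeff e J I K)"
    by (rule D.smooth_in_chart_cong[OF D.smooth_in_chart_uminus[OF sm]]) (use alt(1) in auto)
  show "smooth_in_chart M c (fst c \<inter> fst e) (cubic_coeff e I K J)"
    by (rule D.smooth_in_chart_cong[OF D.smooth_in_chart_uminus[OF sm]]) (use alt(2) in auto)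
next
  fix I J assume N: "I \<in> {..<2 * r}" "J \<in> {..<2 * r}"
  show "smooth_in_chart M c (fst c \<inter> fst e) (cubic_coeff e I I J)"
    by (rule D.smooth_in_chart_cong[OF D.smooth_in_chart_const[of 0]])
      (use alternating3_eq(1)[OF cubic_coeff_alternating[OF e] N] in auto)
next
  fix I J K assume N: "I \<in> {..<2 * r}" "J \<in> {..<2 * r}" "K \<in> {..<2 * r}" and o: "I < J" "J < K"
  have sub: "smooth_in_chart M c (fst c \<inter> fst e) f" if "smooth_fun_on M (W \<inter> fst e) f" "fst e \<subseteq> W" for W f
    by (rule smooth_in_chart_subset[OF that(1) c]) (use that(2) in auto)
  have "K < r \<or> (J < r \<and> r \<le> K) \<or> (I < r \<and> r \<le> J) \<or> r \<le> I" by linarith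
  then show "smooth_in_chart M c (fst c \<inter> fst e) (cubic_coeff e I J K)"
  proof (elim disjE conjE)
    assume K: "K < r"
    then have "smooth_in_chart M c (fst c \<inter> fst e) (\<lambda>m. \<phi> m (map (\<lambda>a. snd e a m) (sorted_list_of_set {I, J, K})))"
      using o by (intro sub[OF A.kform_frame_smooth[OF phi e]]) auto
    then show ?thesis
      by (rule D.smooth_in_chart_cong) (use K o sorted_list_of_set3[OF o] in \<open>simp add: cubic_coeff_def\<close>)
  next
    assume K: "J < r" "r \<le> K"
    then have k: "K - r < r" using N by auto
    have l: "sorted_list_of_set {I, J} = [I, J]"
      using sorted_list_of_set.idem_if_sorted_distinct[of "[I, J]"] o by simp
    have sm: "smooth_in_chart M c (fst c \<inter> fst e)
        (\<lambda>m. dA (form1 (coframe A e (K - r))) m (map (\<lambda>a. snd e a m) (sorted_list_of_set {I, J})))"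
      using o K by (intro sub[OF A.kform_frame_smooth[OF A.d_form1[OF A.open_frame[OF e] A.coframe_section[OF e k]] e]]) auto
    show ?thesis
      by (rule D.smooth_in_chart_cong[OF sm]) (use K o l in \<open>simp add: cubic_coeff_def frame_structure_def\<close>)
  next
    assume K: "I < r" "r \<le> J"
    then have k: "J - r < K - r" "K - r < r" using N o by auto
    have l: "sorted_list_of_set {J - r, K - r} = [J - r, K - r]"
      using sorted_list_of_set.idem_if_sorted_distinct[of "[J - r, K - r]"] k by simp
    have sm: "smooth_in_chart M c (fst c \<inter> fst e)
        (\<lambda>m. dA' (form1 (coframe (dual_bundle A) (dual_frame A e) I)) m
          (map (\<lambda>a. snd (dual_frame A e) a m) (sorted_list_of_set {J - r, K - r})))"
      using A'.kform_frame_smooth[OF A'.d_form1[OF A'.open_frame[OF dual_frame_in[OF e]] A'.coframe_section[OF dual_frame_in[OF e], of I]]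
          dual_frame_in[OF e], of "{J - r, K - r}"] K k
      by (intro sub[of "fst e"]) auto
    show ?thesis
      by (rule D.smooth_in_chart_cong[OF sm]) (use K o l in \<open>simp add: cubic_coeff_def frame_structure_def\<close>)
  next
    assume K: "r \<le> I"
    then have k: "I - r < J - r" "J - r < K - r" "K - r < r" using N o by auto
    have "smooth_in_chart M c (fst c \<inter> fst e) (\<lambda>m. \<psi> m (map (\<lambda>a. snd (dual_frame A e) a m) (sorted_list_of_set {I - r, J - r, K - r})))"
      using A'.kform_frame_smooth[OF psi dual_frame_in[OF e], of "{I - r, J - r, K - r}"] k
      by (intro sub[of UNIV]) auto
    then show ?thesis
      by (rule D.smooth_in_chart_cong) (use K o sorted_list_of_set3[OF k(1,2)] in \<open>auto simp: cubic_coeff_def\<close>)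
  qed
qed (use assms in auto)

lemma anchor_coeff_smooth:
  assumes "i < n" "I < 2 * r"
  shows "smooth_in_chart M c (fst c \<inter> fst e) (anchor_coeff c e i I)"
proof (cases "I < r")
  case True
  have "smooth_fun_on M (fst c \<inter> fst e) (\<lambda>m. dA (form0 (\<lambda>p. snd c p i)) m (map (\<lambda>a. snd e a m) (sorted_list_of_set {I})))"
    by (rule A.kform_frame_smooth[OF A.d_form0[OF A.open_chart[OF c] chart_coordinate_smooth[OF smooth_M c assms(1)]] e])
      (use True in auto)
  then show ?thesis using smooth_in_chart_subset[OF _ c, of "fst c \<inter> fst e" _ "fst c \<inter> fst e"] True
    by (simp add: anchor_coeff_def frame_anchor_def[abs_def])
next
  case False
  have "smooth_fun_on M (fst c \<inter> fst (dual_frame A e))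
      (\<lambda>m. dA' (form0 (\<lambda>p. snd c p i)) m (map (\<lambda>a. snd (dual_frame A e) a m) (sorted_list_of_set {I - r})))"
    by (rule A'.kform_frame_smooth[OF A'.d_form0[OF A.open_chart[OF c] chart_coordinate_smooth[OF smooth_M c assms(1)]] dual_frame_in[OF e]])
      (use False assms in auto)
  then show ?thesis using smooth_in_chart_subset[OF _ c, of "fst c \<inter> fst e" _ "fst c \<inter> fst e"] False
    by (simp add: anchor_coeff_def frame_anchor_def[abs_def])
qed

lemma d_cubic_coeff_alternating:
  assumes m: "m \<in> fst c \<inter> fst e" and i: "i < n"
  shows "alternating3 {..<2 * r} (\<lambda>I J K. pd c i (cubic_coeff e I J K) m)"
  unfolding alternating3_def
proof (intro ballI)
  have neg: "pd c i f m = - pd c i g m"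
    if "\<And>p. p \<in> fst c \<inter> fst e \<Longrightarrow> f p = - g p" "smooth_in_chart M c (fst c \<inter> fst e) g" for f g
  proof -
    have "pd c i f m = pd c i (\<lambda>p. -1 * g p) m" by (rule D.pd_cong[OF m i]) (use that in auto)
    then show ?thesis using D.pd_mult[OF D.smooth_in_chart_const[of "-1"] that(2) m i] by simp
  qed
  fix I J K assume N: "I \<in> {..<2 * r}" "J \<in> {..<2 * r}" "K \<in> {..<2 * r}"
  have "cubic_coeff e J I K p = - cubic_coeff e I J K p" "cubic_coeff e I K J p = - cubic_coeff e I J K p"
    if "p \<in> fst c \<inter> fst e" for p
    using alternating3_swap[OF cubic_coeff_alternating[OF e, of p] N] that by auto
  moreover have "smooth_in_chart M c (fst c \<inter> fst e) (cubic_coeff e I J K)"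
    using cubic_coeff_smooth N by simp
  ultimately show "pd c i (cubic_coeff e J I K) m = - pd c i (cubic_coeff e I J K) m
      \<and> pd c i (cubic_coeff e I K J) m = - pd c i (cubic_coeff e I J K) m"
    using neg[of "cubic_coeff e J I K" "cubic_coeff e I J K"] neg[of "cubic_coeff e I K J" "cubic_coeff e I J K"] by simp
qed

lemma cubic_coeff_quadratic:
  assumes m: "m \<in> fst c \<inter> fst e" and N: "I < 2 * r" "J < 2 * r" "K < 2 * r" "L < 2 * r"
  shows "(\<Sum>i<n. anchor_coeff c e i I m * pd c i (cubic_coeff e J K L) m
      - anchor_coeff c e i J m * pd c i (cubic_coeff e I K L) m
      + anchor_coeff c e i K m * pd c i (cubic_coeff e I J L) m
      - anchor_coeff c e i L m * pd c i (cubic_coeff e I J K) m)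
     + (\<Sum>P<2 * r. cubic_coeff e P I J m * cubic_coeff e (swap_odd r P) K L m
          - cubic_coeff e P I K m * cubic_coeff e (swap_odd r P) J L m
          + cubic_coeff e P I L m * cubic_coeff e (swap_odd r P) J K m) = 0"
proof -
  have me: "m \<in> fst e" using m by blast
  note alt = cubic_coeff_alternating[OF e me]
  have odd: "odd_coeffs r (\<theta> c e m) (\<lambda>I J K. cubic_coeff e I J K m)"
    unfolding odd_coeffs_def using theta_cubic_coeff[OF c e m] by blast
  have srt: "(\<Sum>i<n. anchor_coeff c e i I m * pd c i (cubic_coeff e J K L) m
      - anchor_coeff c e i J m * pd c i (cubic_coeff e I K L) m
      + anchor_coeff c e i K m * pd c i (cubic_coeff e I J L) m
      - anchor_coeff c e i L m * pd c i (cubic_coeff e I J K) m)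
     + (\<Sum>a<r. cubic_coeff e (r + a) I J m * cubic_coeff e a K L m - cubic_coeff e (r + a) I K m * cubic_coeff e a J L m
           + cubic_coeff e (r + a) I L m * cubic_coeff e a J K m
           + cubic_coeff e (r + a) J K m * cubic_coeff e a I L m - cubic_coeff e (r + a) J L m * cubic_coeff e a I K m
           + cubic_coeff e (r + a) K L m * cubic_coeff e a I J m) = 0"
    if o: "I < J" "J < K" "K < L" "L < 2 * r" for I J K L
  proof -
    have lt: "I < 2 * r" "J < 2 * r" "K < 2 * r" using o by auto
    from poisson_square_momentum0[OF theta_cubic[OF c e m] d_base_theta_cubic[OF m] alt odd d_base_theta_odd[OF m]
        poisson_square_theta[OF m] o]
    show ?thesis using lt o by (simp add: theta_momentum_coeff[OF c e m])
  qed
  show ?thesis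
    by (rule quadratic_coeff_all[where t = "\<lambda>I J K. cubic_coeff e I J K m"
          and g = "\<lambda>i I J K. pd c i (cubic_coeff e I J K) m" and p = "\<lambda>i I. anchor_coeff c e i I m",
          OF alt d_cubic_coeff_alternating[OF m] srt N])
qed

end

end

section \<open>The local model of a proto-bialgebroid\<close>

context split_proto_bialgebroid
begin

text \<open>The data of the local model over the common domain of the chart \<open>c\<close> and the frame \<open>e\<close>. The structure
  array is minus the array of coefficients of \<open>\<theta>\<close>, because \<open>d\<xi>(X, Y)\<close> contains \<open>- \<xi>([X, Y])\<close>.\<close>

definition local_anchor :: "'m chart \<Rightarrow> ('m, 'v) frame \<Rightarrow> nat \<Rightarrow> ('m \<Rightarrow> real) \<Rightarrow> 'm \<Rightarrow> real" where
  "local_anchor c e I f = (\<lambda>m. \<Sum>i<n. anchor_coeff c e i I m * chart_deriv c (fst c \<inter> fst e) i f m)"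

definition local_structure :: "'m chart \<Rightarrow> ('m, 'v) frame \<Rightarrow> nat \<Rightarrow> nat \<Rightarrow> nat \<Rightarrow> 'm \<Rightarrow> real" where
  "local_structure c e I J K = restrict_fun (fst c \<inter> fst e) (\<lambda>m. - cubic_coeff e I J K m)"

definition component :: "('m, 'v) frame \<Rightarrow> nat \<Rightarrow> 'm \<Rightarrow> 'v \<times> ('v \<Rightarrow> real) \<Rightarrow> real" where
  "component e I m u = (if I < r then coframe A e I m (fst u) else snd u (snd e (I - r) m))"

definition local_section :: "'m chart \<Rightarrow> ('m, 'v) frame \<Rightarrow> ('m \<Rightarrow> 'v \<times> ('v \<Rightarrow> real)) \<Rightarrow> nat \<Rightarrow> 'm \<Rightarrow> real" where
  "local_section c e s I = (if I < 2 * r then restrict_fun (fst c \<inter> fst e) (\<lambda>m. component e I m (s m)) else 0)"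

context
  fixes c e
  assumes c: "c \<in> atlas M" and e: "e \<in> frames A"
begin

interpretation D: chart_domain M c "fst c \<inter> fst e" by (rule domain[OF c e])

abbreviation "U \<equiv> fst c \<inter> fst e"
abbreviation "F \<equiv> chart_funs M c U"

lemma local_anchor_apply: "m \<in> U \<Longrightarrow> local_anchor c e I f m = (\<Sum>i<n. anchor_coeff c e i I m * pd c i f m)"
  and local_anchor_outside: "m \<notin> U \<Longrightarrow> local_anchor c e I f m = 0"
  by (auto simp: local_anchor_def chart_deriv_def restrict_fun_def)

lemma chart_funs_outside: "f \<in> F \<Longrightarrow> m \<notin> U \<Longrightarrow> f m = 0"
  unfolding chart_funs_def by blast

lemma local_anchor_in: "I < 2 * r \<Longrightarrow> f \<in> F \<Longrightarrow> local_anchor c e I f \<in> F"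
proof -
  assume I: "I < 2 * r" and f: "f \<in> F"
  have "smooth_in_chart M c U (\<lambda>m. \<Sum>i<n. anchor_coeff c e i I m * chart_deriv c U i f m)"
    by (intro D.smooth_in_chart_sum D.smooth_in_chart_mult anchor_coeff_smooth[OF c e] D.chart_funs_smooth[OF D.chart_deriv_in[OF f]])
      (use I in auto)
  then show ?thesis using local_anchor_outside unfolding chart_funs_def local_anchor_def by auto
qed

lemma local_structure_in: "\<lbrakk>I < 2 * r; J < 2 * r; K < 2 * r\<rbrakk> \<Longrightarrow> local_structure c e I J K \<in> F"
  unfolding local_structure_def
  by (intro D.restrict_fun_in D.smooth_in_chart_uminus cubic_coeff_smooth[OF c e])

lemma pd_local_anchor:
  assumes m: "m \<in> U" and i: "i < n" and I: "I < 2 * r" and f: "f \<in> F"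
  shows "pd c i (local_anchor c e I f) m
    = (\<Sum>j<n. pd c i (anchor_coeff c e j I) m * pd c j f m + anchor_coeff c e j I m * pd c i (pd c j f) m)"
proof -
  have a: "smooth_in_chart M c U (anchor_coeff c e j I)" if "j < n" for j
    by (rule anchor_coeff_smooth[OF c e that I])
  have p: "smooth_in_chart M c U (pd c j f)" if "j < n" for j
    by (rule D.smooth_in_chart_pd[OF D.chart_funs_smooth[OF f] that])
  have "pd c i (local_anchor c e I f) m = pd c i (\<lambda>p. \<Sum>j<n. anchor_coeff c e j I p * pd c j f p) m"
    by (rule D.pd_cong[OF m i local_anchor_apply])
  also have "\<dots> = (\<Sum>j<n. pd c i (\<lambda>p. anchor_coeff c e j I p * pd c j f p) m)"
    by (rule D.pd_sum[OF _ m i], rule D.smooth_in_chart_mult[OF a p]) simp_all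
  also have "\<dots> = (\<Sum>j<n. pd c i (anchor_coeff c e j I) m * pd c j f m + anchor_coeff c e j I m * pd c i (pd c j f) m)"
    by (intro sum.cong refl D.pd_mult[OF a p m i]) auto
  finally show ?thesis .
qed

lemma pd_local_structure:
  assumes m: "m \<in> U" and i: "i < n" and IJK: "I < 2 * r" "J < 2 * r" "K < 2 * r"
  shows "pd c i (local_structure c e I J K) m = - pd c i (cubic_coeff e I J K) m"
proof -
  have "pd c i (local_structure c e I J K) m = pd c i (\<lambda>p. -1 * cubic_coeff e I J K p) m"
    by (rule D.pd_cong[OF m i]) (simp add: local_structure_def restrict_fun_def)
  then show ?thesis
    using D.pd_mult[OF D.smooth_in_chart_const[of "-1"] cubic_coeff_smooth[OF c e IJK] m i] by simp
qed

lemma local_anchor_isotropic: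
  assumes m: "m \<in> U"
  shows "(\<Sum>I<2 * r. local_anchor c e I f m * local_anchor c e (swap_odd r I) g m) = 0"
proof -
  have "(\<Sum>I<2 * r. local_anchor c e I f m * local_anchor c e (swap_odd r I) g m)
    = (\<Sum>I<2 * r. \<Sum>i<n. \<Sum>j<n. pd c i f m * pd c j g m * (anchor_coeff c e i I m * anchor_coeff c e j (swap_odd r I) m))"
    by (simp add: local_anchor_apply[OF m] sum_product algebra_simps)
  also have "\<dots> = (\<Sum>i<n. \<Sum>I<2 * r. \<Sum>j<n. pd c i f m * pd c j g m * (anchor_coeff c e i I m * anchor_coeff c e j (swap_odd r I) m))"
    by (rule sum.swap)
  also have "\<dots> = (\<Sum>i<n. \<Sum>j<n. \<Sum>I<2 * r. pd c i f m * pd c j g m * (anchor_coeff c e i I m * anchor_coeff c e j (swap_odd r I) m))"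
    by (intro sum.cong refl sum.swap)
  also have "\<dots> = (\<Sum>i<n. \<Sum>j<n. pd c i f m * pd c j g m * (\<Sum>I<2 * r. anchor_coeff c e i I m * anchor_coeff c e j (swap_odd r I) m))"
    by (simp add: sum_distrib_left)
  also have "\<dots> = 0" using anchor_coeff_isotropic[OF c e m] by simp
  finally show ?thesis .
qed

lemma local_anchor_twice:
  assumes m: "m \<in> U" and IJ: "I < 2 * r" "J < 2 * r" and f: "f \<in> F"
  shows "local_anchor c e I (local_anchor c e J f) m
    = (\<Sum>j<n. (\<Sum>i<n. anchor_coeff c e i I m * pd c i (anchor_coeff c e j J) m) * pd c j f m)
    + (\<Sum>i<n. \<Sum>j<n. anchor_coeff c e i I m * anchor_coeff c e j J m * pd c i (pd c j f) m)"
proof -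
  have "local_anchor c e I (local_anchor c e J f) m = (\<Sum>i<n. \<Sum>j<n. anchor_coeff c e i I m * pd c i (anchor_coeff c e j J) m * pd c j f m)
    + (\<Sum>i<n. \<Sum>j<n. anchor_coeff c e i I m * anchor_coeff c e j J m * pd c i (pd c j f) m)"
    by (simp add: local_anchor_apply[OF m] pd_local_anchor[OF m _ IJ(2) f] sum_distrib_left sum.distrib algebra_simps)
  also have "(\<Sum>i<n. \<Sum>j<n. anchor_coeff c e i I m * pd c i (anchor_coeff c e j J) m * pd c j f m)
     = (\<Sum>j<n. \<Sum>i<n. anchor_coeff c e i I m * pd c i (anchor_coeff c e j J) m * pd c j f m)"
    by (rule sum.swap)
  finally show ?thesis by (simp add: sum_distrib_right)
qed

text \<open>Second derivatives of \<open>f\<close> drop out of the commutator since partial derivatives commute.\<close>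

lemma local_anchor_bracket:
  assumes m: "m \<in> U" and IJ: "I < 2 * r" "J < 2 * r" and f: "f \<in> F"
  shows "local_anchor c e I (local_anchor c e J f) m - local_anchor c e J (local_anchor c e I f) m
    = (\<Sum>K<2 * r. local_structure c e I J K m * local_anchor c e (swap_odd r K) f m)"
proof -
  have s: "(\<Sum>i<n. \<Sum>j<n. anchor_coeff c e i J m * anchor_coeff c e j I m * pd c i (pd c j f) m)
     = (\<Sum>i<n. \<Sum>j<n. anchor_coeff c e i I m * anchor_coeff c e j J m * pd c i (pd c j f) m)"
  proof -
    have "(\<Sum>i<n. \<Sum>j<n. anchor_coeff c e i J m * anchor_coeff c e j I m * pd c i (pd c j f) m)
      = (\<Sum>j<n. \<Sum>i<n. anchor_coeff c e i J m * anchor_coeff c e j I m * pd c i (pd c j f) m)"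
      by (rule sum.swap)
    also have "\<dots> = (\<Sum>i<n. \<Sum>j<n. anchor_coeff c e i I m * anchor_coeff c e j J m * pd c i (pd c j f) m)"
      by (intro sum.cong refl) (simp add: D.pd_commute[OF D.chart_funs_smooth[OF f] m])
    finally show ?thesis .
  qed
  have "local_anchor c e I (local_anchor c e J f) m - local_anchor c e J (local_anchor c e I f) m
    = (\<Sum>j<n. (\<Sum>i<n. anchor_coeff c e i I m * pd c i (anchor_coeff c e j J) m
            - anchor_coeff c e i J m * pd c i (anchor_coeff c e j I) m) * pd c j f m)"
    unfolding local_anchor_twice[OF m IJ f] local_anchor_twice[OF m IJ(2,1) f] s
    by (simp add: sum_subtractf left_diff_distrib)
  also have "\<dots> = (\<Sum>j<n. \<Sum>K<2 * r. - cubic_coeff e I J K m * (anchor_coeff c e j (swap_odd r K) m * pd c j f m))"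
    using anchor_coeff_bracket[OF c e m _ IJ] by (simp add: sum_distrib_right sum_negf mult.assoc)
  also have "\<dots> = (\<Sum>K<2 * r. \<Sum>j<n. - cubic_coeff e I J K m * (anchor_coeff c e j (swap_odd r K) m * pd c j f m))"
    by (rule sum.swap)
  also have "\<dots> = (\<Sum>K<2 * r. local_structure c e I J K m * local_anchor c e (swap_odd r K) f m)"
    using m by (simp add: local_structure_def restrict_fun_def local_anchor_apply[OF m] sum_distrib_left)
  finally show ?thesis .
qed

lemma local_structure_equation:
  assumes m: "m \<in> U" and N: "I < 2 * r" "J < 2 * r" "K < 2 * r" "L < 2 * r"
  shows "local_anchor c e I (local_structure c e J K L) m - local_anchor c e J (local_structure c e I K L) m
    + local_anchor c e K (local_structure c e I J L) m - local_anchor c e L (local_structure c e I J K) m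
    + (\<Sum>P<2 * r. local_structure c e J K P m * local_structure c e I (swap_odd r P) L m
       - local_structure c e I J P m * local_structure c e (swap_odd r P) K L m
       - local_structure c e I K P m * local_structure c e J (swap_odd r P) L m) = 0"
proof -
  have me: "m \<in> fst e" using m by blast
  note alt = cubic_coeff_alternating[OF e me]
  let ?t = "\<lambda>I J K. cubic_coeff e I J K m"
  have cyc: "?t X Y P = ?t P X Y" and sw: "?t X P Y = - ?t P X Y"
    if "X < 2 * r" "Y < 2 * r" "P < 2 * r" for X Y P
    using alternating3_swap[OF alt, of P X Y] alternating3_swap[OF alt, of X P Y] that by auto
  have T: "local_structure c e X Y P m = - ?t X Y P" for X Y P
    using m by (simp add: local_structure_def restrict_fun_def)
  have s: "(\<Sum>P<2 * r. ?t P J K * ?t (swap_odd r P) I L) = (\<Sum>P<2 * r. ?t P I L * ?t (swap_odd r P) J K)"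
    by (subst sum_swap_odd[symmetric]) (use swap_odd_in in \<open>auto intro!: sum.cong simp: mult.commute\<close>)
  have "(\<Sum>P<2 * r. local_structure c e J K P m * local_structure c e I (swap_odd r P) L m
       - local_structure c e I J P m * local_structure c e (swap_odd r P) K L m
       - local_structure c e I K P m * local_structure c e J (swap_odd r P) L m)
    = (\<Sum>P<2 * r. - (?t P J K * ?t (swap_odd r P) I L) - ?t P I J * ?t (swap_odd r P) K L
         + ?t P I K * ?t (swap_odd r P) J L)"
  proof (intro sum.cong refl)
    fix P assume P: "P \<in> {..<2 * r}"
    then have P': "P < 2 * r" "swap_odd r P < 2 * r" using swap_odd_in by auto
    show "local_structure c e J K P m * local_structure c e I (swap_odd r P) L m
       - local_structure c e I J P m * local_structure c e (swap_odd r P) K L m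
       - local_structure c e I K P m * local_structure c e J (swap_odd r P) L m
      = - (?t P J K * ?t (swap_odd r P) I L) - ?t P I J * ?t (swap_odd r P) K L
         + ?t P I K * ?t (swap_odd r P) J L"
      unfolding T cyc[OF N(2,3) P'(1)] cyc[OF N(1,2) P'(1)] cyc[OF N(1,3) P'(1)] sw[OF N(1,4) P'(2)] sw[OF N(2,4) P'(2)]
      by simp
  qed
  also have "\<dots> = - (\<Sum>P<2 * r. ?t P I J * ?t (swap_odd r P) K L
          - ?t P I K * ?t (swap_odd r P) J L + ?t P I L * ?t (swap_odd r P) J K)"
    using s by (simp add: sum.distrib sum_subtractf sum_negf)
  finally have 1: "(\<Sum>P<2 * r. local_structure c e J K P m * local_structure c e I (swap_odd r P) L m
       - local_structure c e I J P m * local_structure c e (swap_odd r P) K L m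
       - local_structure c e I K P m * local_structure c e J (swap_odd r P) L m)
     = - (\<Sum>P<2 * r. ?t P I J * ?t (swap_odd r P) K L
          - ?t P I K * ?t (swap_odd r P) J L + ?t P I L * ?t (swap_odd r P) J K)" .
  show ?thesis
    unfolding 1 local_anchor_apply[OF m] using cubic_coeff_quadratic[OF c e m N]
    by (simp add: pd_local_structure[OF m] N sum_negf sum.distrib sum_subtractf)
qed

lemma local_courant_frame:
  "courant_frame F (restrict_fun U (\<lambda>_. 1)) {..<2 * r} (swap_odd r) (local_anchor c e) (local_structure c e)"
proof
  fix I assume "I \<in> {..<2 * r}"
  then show "swap_odd r I \<in> {..<2 * r}" "swap_odd r (swap_odd r I) = I" using swap_odd_in by auto
next
  show "restrict_fun U (\<lambda>_. 1) \<in> F" by (rule D.restrict_fun_in[OF D.smooth_in_chart_const])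
next
  fix f assume "f \<in> F"
  then show "restrict_fun U (\<lambda>_. 1) * f = f"
    using chart_funs_outside by (auto simp: fun_eq_iff restrict_fun_def)
next
  fix I f assume "I \<in> {..<2 * r}" "f \<in> F"
  then show "local_anchor c e I f \<in> F" using local_anchor_in by simp
next
  fix I f g assume I: "I \<in> {..<2 * r}" and fg: "f \<in> F" "g \<in> F"
  note sm = D.chart_funs_smooth[OF fg(1)] D.chart_funs_smooth[OF fg(2)]
  show "local_anchor c e I (f + g) = local_anchor c e I f + local_anchor c e I g"
  proof
    fix m show "local_anchor c e I (f + g) m = (local_anchor c e I f + local_anchor c e I g) m"
    proof (cases "m \<in> U")
      case True
      have "pd c i (f + g) m = pd c i f m + pd c i g m" if "i < n" for i
        using D.pd_add[OF sm True that] by (simp add: plus_fun_def)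
      then show ?thesis by (simp add: local_anchor_apply[OF True] sum.distrib distrib_left)
    qed (simp add: local_anchor_outside)
  qed
  show "local_anchor c e I (f * g) = local_anchor c e I f * g + f * local_anchor c e I g"
  proof
    fix m show "local_anchor c e I (f * g) m = (local_anchor c e I f * g + f * local_anchor c e I g) m"
    proof (cases "m \<in> U")
      case True
      have "pd c i (f * g) m = pd c i f m * g m + f m * pd c i g m" if "i < n" for i
        using D.pd_mult[OF sm True that] by (simp add: times_fun_def)
      then show ?thesis
        by (simp add: local_anchor_apply[OF True] sum.distrib sum_distrib_left sum_distrib_right algebra_simps)
    qed (simp add: local_anchor_outside)
  qed
next
  fix I J K assume N: "I \<in> {..<2 * r}" "J \<in> {..<2 * r}" "K \<in> {..<2 * r}"
  then show "local_structure c e I J K \<in> F" using local_structure_in by simp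
  have "m \<in> U \<Longrightarrow> cubic_coeff e J I K m = - cubic_coeff e I J K m \<and> cubic_coeff e I K J m = - cubic_coeff e I J K m" for m
    using alternating3_swap[OF cubic_coeff_alternating[OF e, of m] N] by simp
  then show "local_structure c e J I K = - local_structure c e I J K" "local_structure c e I K J = - local_structure c e I J K"
    by (auto simp: local_structure_def restrict_fun_def fun_eq_iff)
next
  fix f g assume "f \<in> F" "g \<in> F"
  show "(\<Sum>I<2 * r. local_anchor c e I f * local_anchor c e (swap_odd r I) g) = 0"
  proof
    fix m show "(\<Sum>I<2 * r. local_anchor c e I f * local_anchor c e (swap_odd r I) g) m = 0 m"
      using local_anchor_isotropic[of m f g]
      by (cases "m \<in> U") (simp_all add: sum_fun_apply local_anchor_outside)
  qed
next
  fix I J f assume IJ: "I \<in> {..<2 * r}" "J \<in> {..<2 * r}" and f: "f \<in> F"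
  show "local_anchor c e I (local_anchor c e J f) - local_anchor c e J (local_anchor c e I f)
     = (\<Sum>K<2 * r. local_structure c e I J K * local_anchor c e (swap_odd r K) f)"
  proof
    fix m show "(local_anchor c e I (local_anchor c e J f) - local_anchor c e J (local_anchor c e I f)) m
     = (\<Sum>K<2 * r. local_structure c e I J K * local_anchor c e (swap_odd r K) f) m"
      using local_anchor_bracket[of m I J f] IJ f
      by (cases "m \<in> U") (simp_all add: sum_fun_apply local_anchor_outside)
  qed
next
  fix I J K L assume N: "I \<in> {..<2 * r}" "J \<in> {..<2 * r}" "K \<in> {..<2 * r}" "L \<in> {..<2 * r}"
  show "local_anchor c e I (local_structure c e J K L) - local_anchor c e J (local_structure c e I K L)
    + local_anchor c e K (local_structure c e I J L) - local_anchor c e L (local_structure c e I J K)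
    + (\<Sum>M<2 * r. local_structure c e J K M * local_structure c e I (swap_odd r M) L
       - local_structure c e I J M * local_structure c e (swap_odd r M) K L
       - local_structure c e I K M * local_structure c e J (swap_odd r M) L) = 0"
    (is "?L = 0")
  proof
    fix m show "?L m = 0 m"
    proof (cases "m \<in> U")
      case True
      then show ?thesis using local_structure_equation[OF True, of I J K L] N by (simp add: sum_fun_apply)
    next
      case False
      then have "local_structure c e X Y P m = 0" for X Y P by (simp only: local_structure_def restrict_fun_def if_False)
      then show ?thesis using False by (simp add: sum_fun_apply local_anchor_outside)
    qed
  qed
qed (simp_all add: D.chart_funs_zero D.chart_funs_add D.chart_funs_mult D.chart_funs_uminus)

end

end

section \<open>The components of the bracket\<close>

lemma contract_apply [simp]: "contract X \<omega> m us = \<omega> m (X m # us)"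
  by (simp add: contract_def)

context split_proto_bialgebroid
begin

abbreviation circ where "circ \<equiv> double_circ M A dA dA' \<phi> \<psi>"
abbreviation grad where "grad \<equiv> double_D A dA dA'"
abbreviation anchor where "anchor \<equiv> double_anchor M A dA dA'"
abbreviation E where "E \<equiv> double_bundle A"

text \<open>A section of \<open>A\<close> as a section of the bidual, so that operations on sections of \<open>A\<close> by \<open>d\<^sub>A\<^sub>*\<close> are
  operations on one-forms.\<close>

definition evaluation :: "('m \<Rightarrow> 'v) \<Rightarrow> 'm \<Rightarrow> ('v \<Rightarrow> real) \<Rightarrow> real" where
  "evaluation X = (\<lambda>m \<xi>. if \<xi> \<in> dual_space (fibre A m) then \<xi> (X m) else 0)"

lemma section_form_evaluation: "section_form A X = form1 (evaluation X)"
  by (simp add: section_form_def evaluation_def)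

lemma evaluation_section:
  assumes X: "X \<in> sections M A"
  shows "evaluation X \<in> sections M (dual_bundle (dual_bundle A))"
  unfolding A'.dual_section_iff[OF open_UNIV]
proof (intro conjI ballI allI impI)
  fix m show "evaluation X m \<in> dual_space (fibre (dual_bundle A) m)"
  proof -
    obtain e where "e \<in> frames A" "m \<in> fst e" using A.frame_cover by blast
    from subspace_dual_space[OF A.frame_at[OF this]] show ?thesis
      by (auto simp: evaluation_def dual_space_def[of "dual_space (fibre A m)"] subspace_def scaleR_fun_def)
  qed
next
  fix e' a assume "e' \<in> frames (dual_bundle A)" and a: "a < brank (dual_bundle A)"
  then obtain e where e: "e \<in> frames A" "e' = dual_frame A e" by (auto simp: dual_bundle_def)
  have "smooth_fun_on M (fst e) (\<lambda>m. coframe A e a m (X m))"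
    using A.section_smooth[OF X e(1), of a] a by simp
  then have "smooth_fun_on M (fst e) (\<lambda>m. evaluation X m (coframe A e a m))"
    by (rule smooth_fun_on_cong[OF smooth_M A.open_frame[OF e(1)]])
      (simp add: evaluation_def coframe_in_dual[OF A.frame_at[OF e(1)]])
  then show "smooth_fun_on M (UNIV \<inter> fst e') (\<lambda>m. evaluation X m (snd e' a m))"
    by (simp add: e)
qed

lemma evaluation_coframe: "e \<in> frames A \<Longrightarrow> m \<in> fst e \<Longrightarrow> evaluation X m (coframe A e a m) = coframe A e a m (X m)"
  by (simp add: evaluation_def coframe_in_dual[OF A.frame_at])

lemma coframe_component:
  assumes "e \<in> frames A" "m \<in> fst e" "u \<in> fibre E m" "I < 2 * r"
  shows "coframe E (sum_frame A e) I m u = component e I m u"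
  using coframe_double[OF A.frame_at[OF assms(1,2)], of "fst u" "snd u" I] assms(3,4)
  by (simp add: component_def double_bundle_def mem_Times_iff)

lemma fibre_double: "u \<in> fibre E m \<longleftrightarrow> fst u \<in> fibre A m \<and> snd u \<in> dual_space (fibre A m)"
  by (simp add: double_bundle_def mem_Times_iff)

lemma double_eqI:
  assumes "e \<in> frames A" "m \<in> fst e" "u \<in> fibre E m" "v \<in> fibre E m"
    and "\<And>I. I < 2 * r \<Longrightarrow> component e I m u = component e I m v"
  shows "u = v"
  by (rule fibre_eqI[OF double_frame_at[OF A.frame_at[OF assms(1,2)]] assms(3,4)])
    (use assms coframe_component in \<open>auto simp: double_bundle_def\<close>)

lemma brank_double: "brank E = 2 * r" and frames_double: "frames E = sum_frame A ` frames A"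
  by (simp_all add: double_bundle_def)

lemma fst_sum_frame [simp]: "fst (sum_frame A e) = fst e"
  by (simp add: sum_frame_def)

lemma sections_double_iff:
  "s \<in> sections M E \<longleftrightarrow> (\<forall>m. s m \<in> fibre E m) \<and>
     (\<forall>e\<in>frames A. \<forall>I<2 * r. smooth_fun_on M (fst e) (\<lambda>m. component e I m (s m)))"
proof -
  have "smooth_fun_on M (fst e) (\<lambda>m. coframe E (sum_frame A e) I m (s m))
     \<longleftrightarrow> smooth_fun_on M (fst e) (\<lambda>m. component e I m (s m))"
    if "\<forall>m. s m \<in> fibre E m" "e \<in> frames A" "I < 2 * r" for e I
  proof -
    have eq: "coframe E (sum_frame A e) I m (s m) = component e I m (s m)" if "m \<in> fst e" for m
      using coframe_component \<open>\<forall>m. _\<close> \<open>e \<in> _\<close> \<open>I < _\<close> that by blast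
    show ?thesis
      using smooth_fun_on_cong[OF smooth_M A.open_frame[OF that(2)], of "\<lambda>m. coframe E (sum_frame A e) I m (s m)" "\<lambda>m. component e I m (s m)"]
        smooth_fun_on_cong[OF smooth_M A.open_frame[OF that(2)], of "\<lambda>m. component e I m (s m)" "\<lambda>m. coframe E (sum_frame A e) I m (s m)"] eq
      by metis
  qed
  then show ?thesis by (auto simp: sections_on_def brank_double frames_double)
qed

lemma section_fst: "s \<in> sections M E \<Longrightarrow> fst \<circ> s \<in> sections M A"
  and section_snd: "s \<in> sections M E \<Longrightarrow> snd \<circ> s \<in> sections M (dual_bundle A)"
proof -
  assume s: "s \<in> sections M E"
  have "smooth_fun_on M (fst e) (\<lambda>m. coframe A e a m (fst (s m)))" if "e \<in> frames A" "a < r" for e a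
  proof -
    have "smooth_fun_on M (fst e) (\<lambda>m. component e a m (s m))" using s that sections_double_iff by auto
    then show ?thesis using that by (simp add: component_def)
  qed
  then show "fst \<circ> s \<in> sections M A" using s sections_double_iff by (auto simp: sections_on_def fibre_double)
  have "smooth_fun_on M (fst e) (\<lambda>m. snd (s m) (snd e a m))" if "e \<in> frames A" "a < r" for e a
  proof -
    have "smooth_fun_on M (fst e) (\<lambda>m. component e (r + a) m (s m))" using s that sections_double_iff by auto
    then show ?thesis using that by (simp add: component_def)
  qed
  then show "snd \<circ> s \<in> sections M (dual_bundle A)"
    using s sections_double_iff fibre_double by (simp add: A.dual_section_iff[OF open_UNIV])
qed

lemma section_in_E: "s \<in> sections M E \<Longrightarrow> s m \<in> fibre E m"
  using sections_double_iff by blast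

lemma dual_diff:
  assumes "frame_at A e m" "\<xi> \<in> dual_space (fibre A m)" "u \<in> fibre A m" "v \<in> fibre A m"
  shows "\<xi> (u - v) = \<xi> u - \<xi> v"
  using dual_add[OF assms(1,2), of "u - v" v] assms subspace_diff[OF A.subspace_fibre, of u m v] by simp

context
  fixes s t :: "'m \<Rightarrow> 'v \<times> ('v \<Rightarrow> real)" and m :: 'm
  assumes s: "s \<in> sections M E" and t: "t \<in> sections M E"
begin

abbreviation "X \<equiv> fst \<circ> s"
abbreviation "\<xi> \<equiv> snd \<circ> s"
abbreviation "Y \<equiv> fst \<circ> t"
abbreviation "\<eta> \<equiv> snd \<circ> t"

lemmas X = section_fst[OF s] and \<xi> = section_snd[OF s] and Y = section_fst[OF t] and \<eta> = section_snd[OF t]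

lemma circ_apply: "circ s t m =
    (bracket_of M A dA X Y m
       + form_section A (lie_derivative dA' \<xi> (form1 (evaluation Y))) m
       - form_section A (contract \<eta> (dA' (form1 (evaluation X)))) m
       - form_section A (contract \<eta> (contract \<xi> \<psi>)) m,
     bracket_of M (dual_bundle A) dA' \<xi> \<eta> m
       + form_cosection (lie_derivative dA X (form1 \<eta>)) m
       - form_cosection (contract Y (dA (form1 \<xi>))) m
       - form_cosection (contract Y (contract X \<phi>)) m)"
  by (simp add: double_circ_def section_form_evaluation Let_def)

context
  fixes c e
  assumes c: "c \<in> atlas M" "m \<in> fst c" and e: "e \<in> frames A" "m \<in> fst e"
begin

lemma fr: "frame_at A e m" by (rule A.frame_at[OF e])

lemma e': "dual_frame A e \<in> frames (dual_bundle A)" "m \<in> fst (dual_frame A e)"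
  using dual_frame_in e by auto

lemma dual_parts:
  "(\<lambda>\<zeta>. lie_derivative dA' \<xi> (form1 (evaluation Y)) m [\<zeta>]) \<in> dual_space (dual_space (fibre A m))"
  "(\<lambda>\<zeta>. contract \<eta> (dA' (form1 (evaluation X))) m [\<zeta>]) \<in> dual_space (dual_space (fibre A m))"
  "(\<lambda>\<zeta>. contract \<eta> (contract \<xi> \<psi>) m [\<zeta>]) \<in> dual_space (dual_space (fibre A m))"
  "(\<lambda>v. lie_derivative dA X (form1 \<eta>) m [v]) \<in> dual_space (fibre A m)"
  "(\<lambda>v. contract Y (dA (form1 \<xi>)) m [v]) \<in> dual_space (fibre A m)"
  "(\<lambda>v. contract Y (contract X \<phi>) m [v]) \<in> dual_space (fibre A m)"
proof -
  have mem: "X m \<in> fibre A m" "Y m \<in> fibre A m" "\<xi> m \<in> dual_space (fibre A m)" "\<eta> m \<in> dual_space (fibre A m)"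
    using section_in_E[OF s, of m] section_in_E[OF t, of m] by (simp_all add: fibre_double)
  show "(\<lambda>\<zeta>. lie_derivative dA' \<xi> (form1 (evaluation Y)) m [\<zeta>]) \<in> dual_space (dual_space (fibre A m))"
    using A'.lie_derivative_dual[OF c e' evaluation_section[OF Y] \<xi>] by simp
  show "(\<lambda>\<zeta>. contract \<eta> (dA' (form1 (evaluation X))) m [\<zeta>]) \<in> dual_space (dual_space (fibre A m))"
    using A'.contract_d_form1_dual[OF c e' evaluation_section[OF X] \<eta>] by simp
  show "(\<lambda>\<zeta>. contract \<eta> (contract \<xi> \<psi>) m [\<zeta>]) \<in> dual_space (dual_space (fibre A m))"
    using form_slot_dual[OF A'.kform_alternating[OF psi UNIV_I, of m], of "[\<xi> m, \<eta> m]" "[]"] mem by simp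
  show "(\<lambda>v. lie_derivative dA X (form1 \<eta>) m [v]) \<in> dual_space (fibre A m)"
    by (rule A.lie_derivative_dual[OF c e \<eta> X])
  show "(\<lambda>v. contract Y (dA (form1 \<xi>)) m [v]) \<in> dual_space (fibre A m)"
    by (rule A.contract_d_form1_dual[OF c e \<xi> Y])
  show "(\<lambda>v. contract Y (contract X \<phi>) m [v]) \<in> dual_space (fibre A m)"
    using form_slot_dual[OF A.kform_alternating[OF phi UNIV_I, of m], of "[X m, Y m]" "[]"] mem by simp
qed

lemma bracket_in_fibre: "bracket_of M A dA X Y m \<in> fibre A m"
  "bracket_of M (dual_bundle A) dA' \<xi> \<eta> m \<in> dual_space (fibre A m)"
  using A.bracket_of_frame[OF X Y e] A'.bracket_of_frame[OF \<xi> \<eta> e'] by simp_all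

lemmas form_section_parts =
  form_section_spec[where \<beta> = "lie_derivative dA' \<xi> (form1 (evaluation Y))", OF fr dual_parts(1)]
  form_section_spec[where \<beta> = "contract \<eta> (dA' (form1 (evaluation X)))", OF fr dual_parts(2)]
  form_section_spec[where \<beta> = "contract \<eta> (contract \<xi> \<psi>)", OF fr dual_parts(3)]

lemma circ_in_fibre: "circ s t m \<in> fibre E m"
proof -
  note sd = subspace_dual_space[OF fr]
  show ?thesis
    unfolding circ_apply fibre_double fst_conv snd_conv form_cosection_def
    using form_section_parts bracket_in_fibre dual_parts(4-6)
    by (intro conjI subspace_diff[OF A.subspace_fibre] subspace_add[OF A.subspace_fibre]
        subspace_diff[OF sd] subspace_add[OF sd]) blast+
qed

text \<open>Components of sections are computed by formulas that only agree on the domain of the frame; the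
  vector fields see nothing else.\<close>

lemma frame_vf_cong:
  assumes "\<And>p. p \<in> fst e \<Longrightarrow> f p = g p"
  shows "frame_vf M d c e'' a f m = frame_vf M d c e'' a g m"
proof -
  interpret D: chart_domain M c "fst c \<inter> fst e" by (rule domain[OF c(1) e(1)])
  have "pd c i f m = pd c i g m" if "i < n" for i
    using assms by (intro D.pd_cong) (use c e that in auto)
  then show ?thesis by (simp add: frame_vf_def)
qed

abbreviation "x a p \<equiv> coframe A e a p (X p)"
abbreviation "y a p \<equiv> coframe A e a p (Y p)"
abbreviation "xi a p \<equiv> \<xi> p (snd e a p)"
abbreviation "et a p \<equiv> \<eta> p (snd e a p)"
abbreviation "Z a f \<equiv> frame_vf M dA c e a f m"
abbreviation "Z' a f \<equiv> frame_vf M dA' c (dual_frame A e) a f m"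
abbreviation "S k a b \<equiv> frame_structure A dA e k a b m"
abbreviation "S' k a b \<equiv> frame_structure (dual_bundle A) dA' (dual_frame A e) k a b m"

lemma coframe_dual_section:
  "\<zeta> \<in> sections M (dual_bundle A) \<Longrightarrow> p \<in> fst e \<Longrightarrow> a < r \<Longrightarrow>
     coframe (dual_bundle A) (dual_frame A e) a p (\<zeta> p) = \<zeta> p (snd e a p)"
  using coframe_dual[OF A.frame_at[OF e(1)], of p "\<zeta> p" a] A'.section_in_fibre[of \<zeta> UNIV p] by simp

text \<open>Each of the four summands comes from one term of the defining formula of the bracket. The next
  lemma on the components along \<open>A\<^sup>*\<close> is the dual statement.\<close>

lemma circ_component_vector:
  assumes k: "k < r"
  shows "component e k m (circ s t m) =
     (\<Sum>a<r. x a m * Z a (y k) - y a m * Z a (x k) - (\<Sum>b<r. x a m * y b m * S k a b))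
   + (\<Sum>a<r. y a m * Z' k (xi a) + xi a m * Z' a (y k) + (\<Sum>b<r. xi a m * y b m * S' b a k))
   - (\<Sum>a<r. et a m * (Z' a (x k) - Z' k (x a) + (\<Sum>b<r. x b m * S' b a k)))
   - (\<Sum>a<r. \<Sum>b<r. xi a m * et b m * \<psi> m [coframe A e a m, coframe A e b m, coframe A e k m])"
proof -
  let ?\<kappa> = "coframe A e k m"
  have \<kappa>: "?\<kappa> \<in> dual_space (fibre A m)" by (rule coframe_in_dual[OF fr])
  have mem: "\<xi> m \<in> dual_space (fibre A m)" "\<eta> m \<in> dual_space (fibre A m)"
    using section_in_E[OF s, of m] section_in_E[OF t, of m] by (simp_all add: fibre_double)
  have 0: "component e k m (circ s t m) = ?\<kappa> (bracket_of M A dA X Y m)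
      + lie_derivative dA' \<xi> (form1 (evaluation Y)) m [?\<kappa>]
      - contract \<eta> (dA' (form1 (evaluation X))) m [?\<kappa>]
      - contract \<eta> (contract \<xi> \<psi>) m [?\<kappa>]"
  proof -
    let ?b = "bracket_of M A dA X Y m"
    let ?f1 = "form_section A (lie_derivative dA' \<xi> (form1 (evaluation Y))) m"
    let ?f2 = "form_section A (contract \<eta> (dA' (form1 (evaluation X)))) m"
    let ?f3 = "form_section A (contract \<eta> (contract \<xi> \<psi>)) m"
    have f: "?b \<in> fibre A m" "?f1 \<in> fibre A m" "?f2 \<in> fibre A m" "?f3 \<in> fibre A m"
      using form_section_parts bracket_in_fibre by blast+
    have "component e k m (circ s t m) = ?\<kappa> (?b + ?f1 - ?f2 - ?f3)"
      using k by (simp only: component_def circ_apply fst_conv if_True)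
    also have "\<dots> = ?\<kappa> ?b + ?\<kappa> ?f1 - ?\<kappa> ?f2 - ?\<kappa> ?f3"
      using f subspace_add[OF A.subspace_fibre f(1,2)] subspace_diff[OF A.subspace_fibre subspace_add[OF A.subspace_fibre f(1,2)] f(3)]
      by (simp only: dual_diff[OF fr \<kappa>] dual_add[OF fr \<kappa>])
    finally show ?thesis using form_section_parts \<kappa> by (simp only:)
  qed
  have 1: "?\<kappa> (bracket_of M A dA X Y m)
     = (\<Sum>a<r. x a m * Z a (y k) - y a m * Z a (x k) - (\<Sum>b<r. x a m * y b m * S k a b))"
    by (rule A.bracket_frame[OF c e X Y k])
  have 2: "lie_derivative dA' \<xi> (form1 (evaluation Y)) m [?\<kappa>]
     = (\<Sum>a<r. y a m * Z' k (xi a) + xi a m * Z' a (y k) + (\<Sum>b<r. xi a m * y b m * S' b a k))"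
  proof -
    have "lie_derivative dA' \<xi> (form1 (evaluation Y)) m [?\<kappa>] = (\<Sum>a<r.
        evaluation Y m (coframe A e a m) * Z' k (\<lambda>p. coframe (dual_bundle A) (dual_frame A e) a p (\<xi> p))
        + coframe (dual_bundle A) (dual_frame A e) a m (\<xi> m) * Z' a (\<lambda>p. evaluation Y p (coframe A e k p))
        + (\<Sum>l<r. coframe (dual_bundle A) (dual_frame A e) a m (\<xi> m) * evaluation Y m (coframe A e l m) * S' l a k))"
      using A'.lie_derivative_frame[OF c e' evaluation_section[OF Y] \<xi>, of k] k by simp
    also have "\<dots> = (\<Sum>a<r. y a m * Z' k (xi a) + xi a m * Z' a (y k) + (\<Sum>b<r. xi a m * y b m * S' b a k))"
    proof (intro sum.cong refl)
      fix a assume "a \<in> {..<r}"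
      then have a: "a < r" by simp
      have "Z' k (\<lambda>p. coframe (dual_bundle A) (dual_frame A e) a p (\<xi> p)) = Z' k (xi a)"
        by (rule frame_vf_cong) (rule coframe_dual_section[OF \<xi> _ a])
      moreover have "Z' a (\<lambda>p. evaluation Y p (coframe A e k p)) = Z' a (y k)"
        by (rule frame_vf_cong) (rule evaluation_coframe[OF e(1)])
      ultimately show "evaluation Y m (coframe A e a m) * Z' k (\<lambda>p. coframe (dual_bundle A) (dual_frame A e) a p (\<xi> p))
        + coframe (dual_bundle A) (dual_frame A e) a m (\<xi> m) * Z' a (\<lambda>p. evaluation Y p (coframe A e k p))
        + (\<Sum>l<r. coframe (dual_bundle A) (dual_frame A e) a m (\<xi> m) * evaluation Y m (coframe A e l m) * S' l a k)
        = y a m * Z' k (xi a) + xi a m * Z' a (y k) + (\<Sum>b<r. xi a m * y b m * S' b a k)"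
        by (simp only: evaluation_coframe[OF e] coframe_dual_section[OF \<xi> e(2) a])
    qed
    finally show ?thesis .
  qed
  have 3: "contract \<eta> (dA' (form1 (evaluation X))) m [?\<kappa>]
     = (\<Sum>a<r. et a m * (Z' a (x k) - Z' k (x a) + (\<Sum>b<r. x b m * S' b a k)))"
  proof -
    have "contract \<eta> (dA' (form1 (evaluation X))) m [?\<kappa>] = (\<Sum>a<r. coframe (dual_bundle A) (dual_frame A e) a m (\<eta> m) *
        (Z' a (\<lambda>p. evaluation X p (coframe A e k p)) - Z' k (\<lambda>p. evaluation X p (coframe A e a p))
          + (\<Sum>l<r. evaluation X m (coframe A e l m) * S' l a k)))"
      using A'.d_form1_section_frame[OF c e' evaluation_section[OF X], of "\<eta> m" k] k mem by simp
    also have "\<dots> = (\<Sum>a<r. et a m * (Z' a (x k) - Z' k (x a) + (\<Sum>b<r. x b m * S' b a k)))"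
    proof (intro sum.cong refl)
      fix a assume "a \<in> {..<r}"
      then have a: "a < r" by simp
      have "Z' b (\<lambda>p. evaluation X p (coframe A e l p)) = Z' b (x l)" for b l
        by (rule frame_vf_cong) (rule evaluation_coframe[OF e(1)])
      then show "coframe (dual_bundle A) (dual_frame A e) a m (\<eta> m) *
        (Z' a (\<lambda>p. evaluation X p (coframe A e k p)) - Z' k (\<lambda>p. evaluation X p (coframe A e a p))
          + (\<Sum>l<r. evaluation X m (coframe A e l m) * S' l a k))
        = et a m * (Z' a (x k) - Z' k (x a) + (\<Sum>b<r. x b m * S' b a k))"
        by (simp only: evaluation_coframe[OF e] coframe_dual_section[OF \<eta> e(2) a])
    qed
    finally show ?thesis .
  qed
  have 4: "contract \<eta> (contract \<xi> \<psi>) m [?\<kappa>]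
     = (\<Sum>a<r. \<Sum>b<r. xi a m * et b m * \<psi> m [coframe A e a m, coframe A e b m, coframe A e k m])"
  proof -
    have "\<psi> m [\<xi> m, \<eta> m, ?\<kappa>] = (\<Sum>a<r. \<Sum>b<r. coframe (dual_bundle A) (dual_frame A e) a m (\<xi> m)
        * coframe (dual_bundle A) (dual_frame A e) b m (\<eta> m) * \<psi> m [coframe A e a m, coframe A e b m, ?\<kappa>])"
      using A'.form_apply2[OF A'.kform_alternating[OF psi UNIV_I] e', of "\<xi> m" "\<eta> m" "[?\<kappa>]"] mem \<kappa> by simp
    also have "\<dots> = (\<Sum>a<r. \<Sum>b<r. xi a m * et b m * \<psi> m [coframe A e a m, coframe A e b m, ?\<kappa>])"
      by (intro sum.cong refl) (simp add: coframe_dual_section[OF \<xi> e(2), unfolded comp_def] coframe_dual_section[OF \<eta> e(2), unfolded comp_def])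
    finally show ?thesis by (simp only: contract_apply)
  qed
  show ?thesis unfolding 0 1 2 3 4 ..
qed

lemma circ_component_covector:
  assumes k: "k < r"
  shows "component e (r + k) m (circ s t m) =
     (\<Sum>a<r. xi a m * Z' a (et k) - et a m * Z' a (xi k) - (\<Sum>b<r. xi a m * et b m * S' k a b))
   + (\<Sum>a<r. et a m * Z k (x a) + x a m * Z a (et k) + (\<Sum>b<r. x a m * et b m * S b a k))
   - (\<Sum>a<r. y a m * (Z a (xi k) - Z k (xi a) + (\<Sum>b<r. xi b m * S b a k)))
   - (\<Sum>a<r. \<Sum>b<r. x a m * y b m * \<phi> m [snd e a m, snd e b m, snd e k m])"
proof -
  let ?v = "snd e k m"
  have v: "?v \<in> fibre A m" by (rule frame_in_fibre[OF fr k])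
  have mem: "X m \<in> fibre A m" "Y m \<in> fibre A m"
    using section_in_E[OF s, of m] section_in_E[OF t, of m] by (simp_all add: fibre_double)
  have 0: "component e (r + k) m (circ s t m) = bracket_of M (dual_bundle A) dA' \<xi> \<eta> m ?v
      + lie_derivative dA X (form1 \<eta>) m [?v] - contract Y (dA (form1 \<xi>)) m [?v]
      - contract Y (contract X \<phi>) m [?v]"
    by (simp add: component_def circ_apply form_cosection_def)
  have 1: "bracket_of M (dual_bundle A) dA' \<xi> \<eta> m ?v
     = (\<Sum>a<r. xi a m * Z' a (et k) - et a m * Z' a (xi k) - (\<Sum>b<r. xi a m * et b m * S' k a b))"
  proof -
    have "bracket_of M (dual_bundle A) dA' \<xi> \<eta> m ?v
       = coframe (dual_bundle A) (dual_frame A e) k m (bracket_of M (dual_bundle A) dA' \<xi> \<eta> m)"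
      by (rule coframe_dual[OF fr bracket_in_fibre(2) k, symmetric])
    also have "\<dots> = (\<Sum>a<r. coframe (dual_bundle A) (dual_frame A e) a m (\<xi> m) * Z' a (\<lambda>p. coframe (dual_bundle A) (dual_frame A e) k p (\<eta> p))
        - coframe (dual_bundle A) (dual_frame A e) a m (\<eta> m) * Z' a (\<lambda>p. coframe (dual_bundle A) (dual_frame A e) k p (\<xi> p))
        - (\<Sum>b<r. coframe (dual_bundle A) (dual_frame A e) a m (\<xi> m) * coframe (dual_bundle A) (dual_frame A e) b m (\<eta> m) * S' k a b))"
      using A'.bracket_frame[OF c e' \<xi> \<eta>, of k] k by simp
    also have "\<dots> = (\<Sum>a<r. xi a m * Z' a (et k) - et a m * Z' a (xi k) - (\<Sum>b<r. xi a m * et b m * S' k a b))"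
    proof (intro sum.cong refl)
      fix a assume "a \<in> {..<r}"
      then have a: "a < r" by simp
      have z: "Z' a (\<lambda>p. coframe (dual_bundle A) (dual_frame A e) k p (\<xi> p)) = Z' a (xi k)"
        "Z' a (\<lambda>p. coframe (dual_bundle A) (dual_frame A e) k p (\<eta> p)) = Z' a (et k)"
        by (rule frame_vf_cong, rule coframe_dual_section[OF \<xi> _ k], assumption)
          (rule frame_vf_cong, rule coframe_dual_section[OF \<eta> _ k])
      have "(\<Sum>b<r. coframe (dual_bundle A) (dual_frame A e) a m (\<xi> m) * coframe (dual_bundle A) (dual_frame A e) b m (\<eta> m) * S' k a b)
         = (\<Sum>b<r. xi a m * et b m * S' k a b)"
        by (intro sum.cong refl) (simp only: coframe_dual_section[OF \<xi> e(2) a] coframe_dual_section[OF \<eta> e(2)] lessThan_iff)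
      then show "coframe (dual_bundle A) (dual_frame A e) a m (\<xi> m) * Z' a (\<lambda>p. coframe (dual_bundle A) (dual_frame A e) k p (\<eta> p))
        - coframe (dual_bundle A) (dual_frame A e) a m (\<eta> m) * Z' a (\<lambda>p. coframe (dual_bundle A) (dual_frame A e) k p (\<xi> p))
        - (\<Sum>b<r. coframe (dual_bundle A) (dual_frame A e) a m (\<xi> m) * coframe (dual_bundle A) (dual_frame A e) b m (\<eta> m) * S' k a b)
        = xi a m * Z' a (et k) - et a m * Z' a (xi k) - (\<Sum>b<r. xi a m * et b m * S' k a b)"
        by (simp only: z coframe_dual_section[OF \<xi> e(2) a] coframe_dual_section[OF \<eta> e(2) a])
    qed
    finally show ?thesis .
  qed
  have 2: "lie_derivative dA X (form1 \<eta>) m [?v]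
     = (\<Sum>a<r. et a m * Z k (x a) + x a m * Z a (et k) + (\<Sum>b<r. x a m * et b m * S b a k))"
    by (rule A.lie_derivative_frame[OF c e \<eta> X k])
  have 3: "contract Y (dA (form1 \<xi>)) m [?v]
     = (\<Sum>a<r. y a m * (Z a (xi k) - Z k (xi a) + (\<Sum>b<r. xi b m * S b a k)))"
    unfolding contract_apply by (rule A.d_form1_section_frame[OF c e \<xi> mem(2) k])
  have 4: "contract Y (contract X \<phi>) m [?v]
     = (\<Sum>a<r. \<Sum>b<r. x a m * y b m * \<phi> m [snd e a m, snd e b m, snd e k m])"
    unfolding contract_apply by (rule A.form_apply2[OF A.kform_alternating[OF phi UNIV_I] e mem]) (use v in simp)
  show ?thesis unfolding 0 1 2 3 4 ..
qed

end

end

end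

section \<open>Comparison with the local model\<close>

context split_proto_bialgebroid
begin

context
  fixes c e
  assumes c: "c \<in> atlas M" and e: "e \<in> frames A"
begin

interpretation D: chart_domain M c "fst c \<inter> fst e" by (rule domain[OF c e])
interpretation L: courant_frame "F c e" "restrict_fun (U c e) (\<lambda>_. 1)" "{..<2 * r}" "swap_odd r"
      "local_anchor c e" "local_structure c e"
  by (rule local_courant_frame[OF c e])

abbreviation "loc \<equiv> local_section c e"
abbreviation "res \<equiv> restrict_fun (U c e)"

lemma loc_apply: "m \<in> fst c \<Longrightarrow> m \<in> fst e \<Longrightarrow> I < 2 * r \<Longrightarrow> loc s I m = component e I m (s m)"
  by (simp add: local_section_def restrict_fun_def)

lemma loc_outside: "\<not> (m \<in> fst c \<and> m \<in> fst e) \<Longrightarrow> loc s I m = 0"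
proof -
  assume "\<not> (m \<in> fst c \<and> m \<in> fst e)"
  then have "res f m = 0" for f unfolding restrict_fun_def by (simp only: Int_iff if_False)
  then show ?thesis by (simp add: local_section_def)
qed

lemma sect_loc:
  assumes s: "s \<in> sections M E"
  shows "L.sect (loc s)"
  unfolding L.sect_def
proof (intro conjI ballI allI impI)
  fix I assume I: "I \<in> {..<2 * r}"
  have "smooth_in_chart M c (fst c \<inter> fst e) (\<lambda>m. component e I m (s m))"
    by (rule smooth_in_chart_subset[of M "fst e", OF _ c]) (use s e I sections_double_iff in auto)
  then show "loc s I \<in> F c e"
    using I D.restrict_fun_in by (simp add: local_section_def)
qed (simp add: local_section_def)

lemma local_anchor_loc:
  assumes m: "m \<in> fst c" "m \<in> fst e" and I: "I < 2 * r"
  shows "local_anchor c e J (loc s I) m = (\<Sum>i<n. anchor_coeff c e i J m * pd c i (\<lambda>p. component e I p (s p)) m)"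
proof -
  have "pd c i (loc s I) m = pd c i (\<lambda>p. component e I p (s p)) m" if "i < n" for i
    by (rule D.pd_cong[OF _ that]) (use m loc_apply I in auto)
  then show ?thesis using local_anchor_apply[OF c e, of m J "loc s I"] m by simp
qed

lemma local_anchor_vector:
  assumes m: "m \<in> fst c" "m \<in> fst e" and I: "I < 2 * r" and a: "a < r"
  shows "local_anchor c e a (loc s I) m = frame_vf M dA c e a (\<lambda>p. component e I p (s p)) m"
    "local_anchor c e (r + a) (loc s I) m = frame_vf M dA' c (dual_frame A e) a (\<lambda>p. component e I p (s p)) m"
  using a by (simp_all add: local_anchor_loc[OF m I] frame_vf_def anchor_coeff_def)

text \<open>The components found above are those of the bracket of the local model. The terms \<open>\<rho>(s)t\<close>,
  \<open>\<rho>(t)s\<close> and the derivatives of \<open>s\<close> can be read off; the rest matches after the double sums over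
  \<open>I, J < 2r\<close> are split into four blocks.\<close>

lemma loc_circ:
  assumes s: "s \<in> sections M E" and t: "t \<in> sections M E"
  shows "loc (circ s t) = L.circ (loc s) (loc t)"
proof (intro ext)
  fix K m
  consider "\<not> K < 2 * r" | "K < 2 * r" "\<not> (m \<in> fst c \<and> m \<in> fst e)" | "K < 2 * r" "m \<in> fst c" "m \<in> fst e" by blast
  then show "loc (circ s t) K m = L.circ (loc s) (loc t) K m"
  proof cases
    case 1 then show ?thesis by (simp add: local_section_def)
  next
    case 2
    have "L.circ (loc s) (loc t) K \<in> F c e"
      by (rule L.sect_in[OF L.sect_circ[OF sect_loc[OF s] sect_loc[OF t]]])
    then have "L.circ (loc s) (loc t) K m = 0" using chart_funs_outside[OF c e] 2 by blast
    then show ?thesis using 2 loc_outside by simp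
  next
    case 3
    let ?x = "\<lambda>a p. coframe A e a p (fst (s p))" and ?y = "\<lambda>a p. coframe A e a p (fst (t p))"
    let ?xi = "\<lambda>a p. snd (s p) (snd e a p)" and ?et = "\<lambda>a p. snd (t p) (snd e a p)"
    let ?Z = "\<lambda>a f. frame_vf M dA c e a f m" and ?Z' = "\<lambda>a f. frame_vf M dA' c (dual_frame A e) a f m"
    let ?S = "\<lambda>k a b. frame_structure A dA e k a b m"
    let ?S' = "\<lambda>k a b. frame_structure (dual_bundle A) dA' (dual_frame A e) k a b m"
    note v = local_anchor_vector[OF 3(2,3)]
    have l: "loc u a m = coframe A e a m (fst (u m))" "loc u (r + a) m = snd (u m) (snd e a m)" if "a < r" for a u
      using loc_apply[OF 3(2,3)] that by (simp_all add: component_def)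
    have Zl: "local_anchor c e a (loc u b) m = ?Z a (\<lambda>p. coframe A e b p (fst (u p)))"
      "local_anchor c e a (loc u (r + b)) m = ?Z a (\<lambda>p. snd (u p) (snd e b p))"
      "local_anchor c e (r + a) (loc u b) m = ?Z' a (\<lambda>p. coframe A e b p (fst (u p)))"
      "local_anchor c e (r + a) (loc u (r + b)) m = ?Z' a (\<lambda>p. snd (u p) (snd e b p))"
      if "a < r" "b < r" for a b u
      using v[of b a u] v[of "r + b" a u] that by (simp_all add: component_def)
    have sw: "swap_odd r a = r + a" "swap_odd r (r + a) = a" if "a < r" for a using that by (simp_all add: swap_odd_def)
    have skew: "?S b k a = - ?S b a k" "?S' b k a = - ?S' b a k" if "k < r" "a < r" "b < r" for k a b
      using A.frame_structure_swap[OF e 3(3) that(3,2,1)] A'.frame_structure_swap[OF dual_frame_in[OF e], of m b a k] 3(3) that by simp_all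
    have st: "local_structure c e I J P m = - cubic_coeff e I J P m" for I J P
      using 3 by (simp add: local_structure_def restrict_fun_def)
    have circ: "L.circ (loc s) (loc t) K m =
        (\<Sum>I<2 * r. loc s I m * local_anchor c e I (loc t K) m) - (\<Sum>I<2 * r. loc t I m * local_anchor c e I (loc s K) m)
        + (\<Sum>I<2 * r. local_anchor c e (swap_odd r K) (loc s I) m * loc t (swap_odd r I) m)
        - (\<Sum>I<2 * r. \<Sum>J<2 * r. cubic_coeff e I J (swap_odd r K) m * loc s I m * loc t J m)"
      using 3 by (simp add: L.circ_in L.anch_def sum_fun_apply st sum_negf)
    show ?thesis
    proof (cases "K < r")
      case True
      \<comment> \<open>The blocks are \<open>[X, Y]\<close>, \<open>- i\<^sub>\<eta> dX\<close>, \<open>L\<^sub>\<xi> Y\<close> and \<open>- \<psi>(\<xi>, \<eta>)\<close>, with opposite signs.\<close>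
      have q: "(\<Sum>I<2 * r. \<Sum>J<2 * r. cubic_coeff e I J (r + K) m * loc s I m * loc t J m)
        = (\<Sum>a<r. \<Sum>b<r. ?x a m * ?y b m * ?S K a b) + (\<Sum>a<r. \<Sum>b<r. ?et a m * (?x b m * ?S' b a K))
          - (\<Sum>a<r. \<Sum>b<r. ?xi a m * ?y b m * ?S' b a K)
          + (\<Sum>a<r. \<Sum>b<r. ?xi a m * ?et b m * \<psi> m [coframe A e a m, coframe A e b m, coframe A e K m])"
      proof -
        have "(\<Sum>I<2 * r. \<Sum>J<2 * r. cubic_coeff e I J (r + K) m * loc s I m * loc t J m)
          = (\<Sum>a<r. (\<Sum>b<r. ?x a m * ?y b m * ?S K a b) + (\<Sum>b<r. ?et b m * (?x a m * ?S' a b K)))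
          + (\<Sum>a<r. (\<Sum>b<r. - (?xi a m * ?y b m * ?S' b a K))
          + (\<Sum>b<r. ?xi a m * ?et b m * \<psi> m [coframe A e a m, coframe A e b m, coframe A e K m]))"
          unfolding sum_lessThan_double
          by (intro arg_cong2[where f = "(+)"] sum.cong refl) (simp_all add: l cubic_coeff_def True skew(2)[OF True])
        also have "(\<Sum>a<r. (\<Sum>b<r. ?x a m * ?y b m * ?S K a b) + (\<Sum>b<r. ?et b m * (?x a m * ?S' a b K)))
          = (\<Sum>a<r. \<Sum>b<r. ?x a m * ?y b m * ?S K a b) + (\<Sum>a<r. \<Sum>b<r. ?et a m * (?x b m * ?S' b a K))"
          unfolding sum.distrib by (intro arg_cong2[where f = "(+)"] refl sum.swap)
        finally show ?thesis by (simp add: sum.distrib sum_negf sum_subtractf)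
      qed
      have "loc (circ s t) K m = component e K m (circ s t m)" by (rule loc_apply[OF 3(2,3,1)])
      also have "\<dots> = (\<Sum>a<r. ?x a m * ?Z a (?y K) - ?y a m * ?Z a (?x K) - (\<Sum>b<r. ?x a m * ?y b m * ?S K a b))
         + (\<Sum>a<r. ?y a m * ?Z' K (?xi a) + ?xi a m * ?Z' a (?y K) + (\<Sum>b<r. ?xi a m * ?y b m * ?S' b a K))
         - (\<Sum>a<r. ?et a m * (?Z' a (?x K) - ?Z' K (?x a) + (\<Sum>b<r. ?x b m * ?S' b a K)))
         - (\<Sum>a<r. \<Sum>b<r. ?xi a m * ?et b m * \<psi> m [coframe A e a m, coframe A e b m, coframe A e K m])"
        using circ_component_vector[OF s t c 3(2) e 3(3) True] by simp
      also have "\<dots> = L.circ (loc s) (loc t) K m"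
        unfolding circ sw(1)[OF True] q unfolding sum_lessThan_double
        by (simp add: l Zl True sw) (simp add: sum.distrib sum_subtractf sum_distrib_left algebra_simps)
      finally show ?thesis .
    next
      case False
      define k where "k = K - r"
      have k: "K = r + k" "k < r" using False 3(1) by (auto simp: k_def)
      \<comment> \<open>Here the blocks are \<open>- \<phi>(X, Y)\<close>, \<open>L\<^sub>X \<eta>\<close>, \<open>- i\<^sub>Y d\<xi>\<close> and \<open>[\<xi>, \<eta>]\<close>.\<close>
      have q: "(\<Sum>I<2 * r. \<Sum>J<2 * r. cubic_coeff e I J k m * loc s I m * loc t J m)
        = (\<Sum>a<r. \<Sum>b<r. ?x a m * ?y b m * \<phi> m [snd e a m, snd e b m, snd e k m])
          - (\<Sum>a<r. \<Sum>b<r. ?x a m * ?et b m * ?S b a k)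
          + (\<Sum>a<r. \<Sum>b<r. ?y a m * (?xi b m * ?S b a k))
          + (\<Sum>a<r. \<Sum>b<r. ?xi a m * ?et b m * ?S' k a b)"
      proof -
        have "(\<Sum>I<2 * r. \<Sum>J<2 * r. cubic_coeff e I J k m * loc s I m * loc t J m)
          = (\<Sum>a<r. (\<Sum>b<r. ?x a m * ?y b m * \<phi> m [snd e a m, snd e b m, snd e k m]) + (\<Sum>b<r. - (?x a m * ?et b m * ?S b a k)))
          + (\<Sum>a<r. (\<Sum>b<r. ?y b m * (?xi a m * ?S a b k))
          + (\<Sum>b<r. ?xi a m * ?et b m * ?S' k a b))"
          unfolding sum_lessThan_double
          by (intro arg_cong2[where f = "(+)"] sum.cong refl) (simp_all add: l cubic_coeff_def k(2) skew(1)[OF k(2)])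
        also have "(\<Sum>a<r. (\<Sum>b<r. ?y b m * (?xi a m * ?S a b k)) + (\<Sum>b<r. ?xi a m * ?et b m * ?S' k a b))
          = (\<Sum>a<r. \<Sum>b<r. ?y a m * (?xi b m * ?S b a k)) + (\<Sum>a<r. \<Sum>b<r. ?xi a m * ?et b m * ?S' k a b)"
          unfolding sum.distrib by (intro arg_cong2[where f = "(+)"] refl sum.swap)
        finally show ?thesis by (simp add: sum.distrib sum_negf sum_subtractf)
      qed
      have "loc (circ s t) K m = component e K m (circ s t m)" by (rule loc_apply[OF 3(2,3,1)])
      also have "\<dots> = (\<Sum>a<r. ?xi a m * ?Z' a (?et k) - ?et a m * ?Z' a (?xi k) - (\<Sum>b<r. ?xi a m * ?et b m * ?S' k a b))
         + (\<Sum>a<r. ?et a m * ?Z k (?x a) + ?x a m * ?Z a (?et k) + (\<Sum>b<r. ?x a m * ?et b m * ?S b a k))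
         - (\<Sum>a<r. ?y a m * (?Z a (?xi k) - ?Z k (?xi a) + (\<Sum>b<r. ?xi b m * ?S b a k)))
         - (\<Sum>a<r. \<Sum>b<r. ?x a m * ?y b m * \<phi> m [snd e a m, snd e b m, snd e k m])"
        using circ_component_covector[OF s t c 3(2) e 3(3) k(2)] by (simp add: k(1))
      also have "\<dots> = L.circ (loc s) (loc t) K m"
        unfolding k(1) circ[unfolded k(1) sw(2)[OF k(2)] q] unfolding sum_lessThan_double
        by (simp add: l Zl k(2) sw) (simp add: sum.distrib sum_subtractf sum_distrib_left algebra_simps)
      finally show ?thesis .
    qed
  qed
qed

lemma res_in: "f \<in> smooth_functions M \<Longrightarrow> res f \<in> F c e"
  by (rule D.restrict_fun_in, rule smooth_in_chart_subset[of M UNIV, OF _ c]) (auto simp: smooth_functions_def)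

lemma local_anchor_res:
  assumes m: "m \<in> fst c" "m \<in> fst e"
  shows "local_anchor c e J (res f) m = (\<Sum>i<n. anchor_coeff c e i J m * pd c i f m)"
proof -
  have "pd c i (res f) m = pd c i f m" if "i < n" for i
    by (rule D.pd_cong[OF _ that]) (use m in \<open>auto simp: restrict_fun_def\<close>)
  then show ?thesis using local_anchor_apply[OF c e, of m J "res f"] m by simp
qed

lemma grad_parts:
  assumes f: "f \<in> smooth_functions M" and m: "m \<in> fst c" "m \<in> fst e"
  shows "grad f m \<in> fibre E m"
    "k < r \<Longrightarrow> component e k m (grad f m) = local_anchor c e (r + k) (res f) m"
    "k < r \<Longrightarrow> component e (r + k) m (grad f m) = local_anchor c e k (res f) m"
proof -
  note fr = A.frame_at[OF e m(2)]
  have sf: "smooth_fun_on M UNIV f" using f by (simp add: smooth_functions_def)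
  have d1: "(\<lambda>v. dA (form0 f) m [v]) \<in> dual_space (fibre A m)"
    by (rule A.one_form_dual[OF A.d_form0[OF open_UNIV sf] UNIV_I])
  have d2: "(\<lambda>\<zeta>. dA' (form0 f) m [\<zeta>]) \<in> dual_space (dual_space (fibre A m))"
    using A'.one_form_dual[OF A'.d_form0[OF open_UNIV sf] UNIV_I, of m] by simp
  note sp = form_section_spec[where \<beta> = "dA' (form0 f)", OF fr d2]
  show "grad f m \<in> fibre E m"
    using d1 sp by (simp add: double_D_def fibre_double form_cosection_def)
  show "component e k m (grad f m) = local_anchor c e (r + k) (res f) m" if k: "k < r"
    using k sp coframe_in_dual[OF fr, of k] A'.d_form0_frame[OF open_UNIV sf c dual_frame_in[OF e] UNIV_I m(1), of k] m
    by (simp add: component_def double_D_def local_anchor_res[OF m] anchor_coeff_def)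
  show "component e (r + k) m (grad f m) = local_anchor c e k (res f) m" if k: "k < r"
    using k A.d_form0_frame[OF open_UNIV sf c e UNIV_I m(1,2), of k]
    by (simp add: component_def double_D_def form_cosection_def local_anchor_res[OF m] anchor_coeff_def)
qed

lemma loc_grad:
  assumes f: "f \<in> smooth_functions M"
  shows "loc (grad f) = L.grad (res f)"
proof (intro ext)
  fix K m
  consider "\<not> K < 2 * r" | "K < 2 * r" "\<not> (m \<in> fst c \<and> m \<in> fst e)" | "K < 2 * r" "m \<in> fst c" "m \<in> fst e" by blast
  then show "loc (grad f) K m = L.grad (res f) K m"
  proof cases
    case 1 then show ?thesis by (simp add: local_section_def L.grad_def)
  next
    case 2
    then show ?thesis using loc_outside[of m "grad f" K] local_anchor_outside[OF c e, of m] by (simp add: L.grad_def)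
  next
    case 3
    show ?thesis
    proof (cases "K < r")
      case True
      then show ?thesis using 3 grad_parts(2)[OF f 3(2,3) True] loc_apply[OF 3(2,3,1)]
        by (simp add: L.grad_def swap_odd_def)
    next
      case False
      then have "K - r < r" using 3 by simp
      then show ?thesis using 3 False grad_parts(3)[OF f 3(2,3), of "K - r"] loc_apply[OF 3(2,3,1)]
        by (simp add: L.grad_def swap_odd_def)
    qed
  qed
qed

text \<open>The frame pairs \<open>e\<^sub>a\<close> with \<open>e\<^sup>a\<close>, so the pairing is that of the local model.\<close>

lemma pairing_components:
  assumes m: "m \<in> fst e" and u: "u \<in> fibre E m" and v: "v \<in> fibre E m"
  shows "double_pairing m u v = (\<Sum>I<2 * r. component e I m u * component e (swap_odd r I) m v)"
proof -
  note fr = A.frame_at[OF e m]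
  have 1: "snd v (fst u) = (\<Sum>a<r. coframe A e a m (fst u) * snd v (snd e a m))"
    "snd u (fst v) = (\<Sum>a<r. coframe A e a m (fst v) * snd u (snd e a m))"
    using u v by (auto intro!: dual_apply[OF fr] simp: fibre_double)
  show ?thesis
    unfolding sum_lessThan_double double_pairing_def
    by (simp add: case_prod_beta' 1 component_def swap_odd_def mult.commute)
qed

lemma loc_pair:
  assumes s: "s \<in> sections M E" and t: "t \<in> sections M E"
  shows "res (\<lambda>m. double_pairing m (s m) (t m)) = L.pair (loc s) (loc t)"
proof
  fix m
  show "res (\<lambda>m. double_pairing m (s m) (t m)) m = L.pair (loc s) (loc t) m"
  proof (cases "m \<in> fst c \<and> m \<in> fst e")
    case True
    have "(\<Sum>I<2 * r. component e I m (s m) * component e (swap_odd r I) m (t m)) = (\<Sum>I<2 * r. loc s I m * loc t (swap_odd r I) m)"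
      using True swap_odd_in[of _ r] by (intro sum.cong refl) (simp add: loc_apply)
    then show ?thesis
      using True pairing_components[of m "s m" "t m"] section_in_E[OF s] section_in_E[OF t]
      by (simp add: L.pair_def sum_fun_apply restrict_fun_def)
  next
    case False
    then have "res (\<lambda>m. double_pairing m (s m) (t m)) m = 0"
      unfolding restrict_fun_def by (simp only: Int_iff if_False)
    moreover have "L.pair (loc s) (loc t) m = 0"
      using False loc_outside by (simp add: L.pair_def sum_fun_apply)
    ultimately show ?thesis by simp
  qed
qed

lemma anchor_components:
  assumes f: "f \<in> smooth_functions M" and m: "m \<in> fst c" "m \<in> fst e" and u: "u \<in> fibre E m"
  shows "anchor m u f = (\<Sum>I<2 * r. component e I m u * local_anchor c e I (res f) m)"
proof -
  have "anchor m u f = (\<Sum>I<2 * r. component e I m (grad f m) * component e (swap_odd r I) m u)"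
    using f pairing_components[OF m(2) grad_parts(1)[OF f m] u] by (simp add: double_anchor_def)
  also have "\<dots> = (\<Sum>I<2 * r. component e I m u * local_anchor c e I (res f) m)"
    unfolding sum_lessThan_double by (simp add: grad_parts(2,3)[OF f m] swap_odd_def mult.commute)
  finally show ?thesis .
qed

lemma loc_act_anchor:
  assumes f: "f \<in> smooth_functions M" and s: "s \<in> sections M E"
  shows "res (act_anchor anchor s f) = L.anch (loc s) (res f)"
proof
  fix m
  show "res (act_anchor anchor s f) m = L.anch (loc s) (res f) m"
  proof (cases "m \<in> fst c \<and> m \<in> fst e")
    case True
    then show ?thesis using anchor_components[OF f, of m "s m"] section_in_E[OF s]
      by (simp add: act_anchor_def L.anch_def sum_fun_apply restrict_fun_def loc_apply)
  next
    case False
    then have "res (act_anchor anchor s f) m = 0"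
      unfolding restrict_fun_def by (simp only: Int_iff if_False)
    moreover have "L.anch (loc s) (res f) m = 0"
      using False loc_outside by (simp add: L.anch_def sum_fun_apply)
    ultimately show ?thesis by simp
  qed
qed

lemma component_add: "\<lbrakk>m \<in> fst e; u \<in> fibre E m; v \<in> fibre E m\<rbrakk> \<Longrightarrow> component e I m (u + v) = component e I m u + component e I m v"
  using coframe_add[OF A.frame_at[OF e]] by (simp add: component_def fibre_double)

lemma component_scale: "\<lbrakk>m \<in> fst e; u \<in> fibre E m\<rbrakk> \<Longrightarrow> component e I m (k *\<^sub>R u) = k * component e I m u"
  using coframe_scale[OF A.frame_at[OF e]] by (simp add: component_def fibre_double scaleR_fun_def)

lemma loc_add:
  assumes s: "s \<in> sections M E" and t: "t \<in> sections M E"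
  shows "loc (s + t) = loc s + loc t"
  using component_add section_in_E[OF s] section_in_E[OF t]
  by (auto simp: fun_eq_iff local_section_def restrict_fun_def)

lemma loc_scale:
  assumes s: "s \<in> sections M E"
  shows "loc (\<lambda>m. f m *\<^sub>R s m) = (\<lambda>K. res f * loc s K)"
  using component_scale section_in_E[OF s]
  by (auto simp: fun_eq_iff local_section_def restrict_fun_def)

lemma local_anchor_const: "I < 2 * r \<Longrightarrow> local_anchor c e I (res (\<lambda>_. k)) = 0"
  using local_anchor_res[of _ I "\<lambda>_. k"] local_anchor_outside[OF c e, of _ I]
  by (intro ext) (metis (no_types, lifting) D.pd_const Int_iff mult_zero_right sum.neutral zero_fun_apply)

end

lemma section_eqI:
  assumes "\<And>m. u m \<in> fibre E m" "\<And>m. v m \<in> fibre E m"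
    and "\<And>c e. c \<in> atlas M \<Longrightarrow> e \<in> frames A \<Longrightarrow> local_section c e u = local_section c e v"
  shows "u = v"
proof
  fix m
  obtain c e where ce: "c \<in> atlas M" "m \<in> fst c" "e \<in> frames A" "m \<in> fst e"
    using A.chart_cover A.frame_cover by blast
  show "u m = v m"
  proof (rule double_eqI[OF ce(3,4) assms(1,2)])
    fix I assume "I < 2 * r"
    then show "component e I m (u m) = component e I m (v m)"
      using loc_apply[OF ce(1,3,2,4)] assms(3)[OF ce(1,3)] by metis
  qed
qed

lemma function_eqI:
  assumes "\<And>c e. c \<in> atlas M \<Longrightarrow> e \<in> frames A \<Longrightarrow> restrict_fun (U c e) f = restrict_fun (U c e) g"
  shows "f = g"
proof
  fix m
  obtain c e where ce: "c \<in> atlas M" "m \<in> fst c" "e \<in> frames A" "m \<in> fst e"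
    using A.chart_cover A.frame_cover by blast
  show "f m = g m" using fun_cong[OF assms[OF ce(1,3)], of m] ce by (simp add: restrict_fun_def)
qed

lemma smooth_functionI:
  assumes "\<And>c e. c \<in> atlas M \<Longrightarrow> e \<in> frames A \<Longrightarrow> restrict_fun (U c e) f \<in> F c e"
  shows "f \<in> smooth_functions M"
  unfolding smooth_functions_def mem_Collect_eq smooth_fun_on_chart
proof
  fix c assume c: "c \<in> atlas M"
  show "smooth_in_chart M c (fst c \<inter> UNIV) f"
  proof (rule smooth_in_chart_local[OF smooth_M c])
    fix m assume m: "m \<in> fst c \<inter> UNIV"
    obtain e where e: "e \<in> frames A" "m \<in> fst e" using A.frame_cover by blast
    interpret D: chart_domain M c "fst c \<inter> fst e" by (rule domain[OF c e(1)])
    have "smooth_in_chart M c (fst c \<inter> fst e) f"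
      by (rule D.smooth_in_chart_cong[OF D.chart_funs_smooth[OF assms[OF c e(1)]]]) (simp add: restrict_fun_def)
    then show "\<exists>U'. m \<in> U' \<and> open U' \<and> U' \<subseteq> fst c \<and> smooth_in_chart M c U' f"
      using m e D.open_domain by blast
  qed (use A.open_chart[OF c] in auto)
qed

lemma sectionI:
  assumes "\<And>m. s m \<in> fibre E m"
    and "\<And>c e I. c \<in> atlas M \<Longrightarrow> e \<in> frames A \<Longrightarrow> I < 2 * r \<Longrightarrow> local_section c e s I \<in> F c e"
  shows "s \<in> sections M E"
  unfolding sections_double_iff smooth_fun_on_chart
proof (intro conjI allI ballI impI)
  fix e I c assume e: "e \<in> frames A" and I: "I < 2 * r" and c: "c \<in> atlas M"
  interpret D: chart_domain M c "fst c \<inter> fst e" by (rule domain[OF c e])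
  show "smooth_in_chart M c (fst c \<inter> fst e) (\<lambda>m. component e I m (s m))"
    by (rule D.smooth_in_chart_cong[OF D.chart_funs_smooth[OF assms(2)[OF c e I]]])
      (simp add: local_section_def I restrict_fun_def)
qed (rule assms(1))

end

section \<open>The Courant algebroid\<close>

lemma restrict_fun_add: "restrict_fun U (\<lambda>m. f m + g m) = restrict_fun U f + restrict_fun U g"
  and restrict_fun_diff: "restrict_fun U (f - g) = restrict_fun U f - restrict_fun U g"
  and restrict_fun_mult: "restrict_fun U (\<lambda>m. f m * g m) = restrict_fun U f * restrict_fun U g"
  by (auto simp: restrict_fun_def fun_eq_iff)

context split_proto_bialgebroid
begin

lemma smooth_functions_add: "\<lbrakk>f \<in> smooth_functions M; g \<in> smooth_functions M\<rbrakk> \<Longrightarrow> (\<lambda>p. f p + g p) \<in> smooth_functions M"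
  and smooth_functions_mult: "\<lbrakk>f \<in> smooth_functions M; g \<in> smooth_functions M\<rbrakk> \<Longrightarrow> (\<lambda>p. f p * g p) \<in> smooth_functions M"
  and smooth_functions_const: "(\<lambda>p. k) \<in> smooth_functions M"
  by (simp_all add: smooth_functions_def smooth_fun_on_add[OF smooth_M open_UNIV]
      smooth_fun_on_mult[OF smooth_M open_UNIV] smooth_fun_on_const[OF smooth_M open_UNIV])

lemma subspace_E: "subspace (fibre E m)"
  using A.double_vector_bundle unfolding vector_bundle_frame_at by blast

lemma fibre_add: "\<lbrakk>u \<in> fibre E m; v \<in> fibre E m\<rbrakk> \<Longrightarrow> u + v \<in> fibre E m"
  and fibre_scale: "u \<in> fibre E m \<Longrightarrow> k *\<^sub>R u \<in> fibre E m"
  by (simp_all add: subspace_add[OF subspace_E] subspace_scale[OF subspace_E])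

lemma circ_section:
  assumes s: "s \<in> sections M E" and t: "t \<in> sections M E"
  shows "circ s t \<in> sections M E"
proof (rule sectionI)
  fix m
  obtain c e where "c \<in> atlas M" "m \<in> fst c" "e \<in> frames A" "m \<in> fst e"
    using A.chart_cover A.frame_cover by blast
  then show "circ s t m \<in> fibre E m" by (rule circ_in_fibre[OF s t])
next
  fix c e I assume c: "c \<in> atlas M" and e: "e \<in> frames A"
  interpret L: courant_frame "F c e" "restrict_fun (U c e) (\<lambda>_. 1)" "{..<2 * r}" "swap_odd r"
      "local_anchor c e" "local_structure c e" by (rule local_courant_frame[OF c e])
  show "local_section c e (circ s t) I \<in> F c e"
    unfolding loc_circ[OF c e s t] by (rule L.sect_in[OF L.sect_circ[OF sect_loc[OF c e s] sect_loc[OF c e t]]])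
qed

lemma grad_section:
  assumes f: "f \<in> smooth_functions M"
  shows "grad f \<in> sections M E"
proof (rule sectionI)
  fix m
  obtain c e where "c \<in> atlas M" "e \<in> frames A" "m \<in> fst c" "m \<in> fst e"
    using A.chart_cover A.frame_cover by blast
  then show "grad f m \<in> fibre E m" using grad_parts(1)[OF _ _ f] by blast
next
  fix c e I assume c: "c \<in> atlas M" and e: "e \<in> frames A"
  interpret L: courant_frame "F c e" "restrict_fun (U c e) (\<lambda>_. 1)" "{..<2 * r}" "swap_odd r"
      "local_anchor c e" "local_structure c e" by (rule local_courant_frame[OF c e])
  show "local_section c e (grad f) I \<in> F c e"
    unfolding loc_grad[OF c e f] by (rule L.sect_in[OF L.sect_grad[OF res_in[OF c e f]]])
qed

lemma add_section:
  assumes s: "s \<in> sections M E" and t: "t \<in> sections M E"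
  shows "s + t \<in> sections M E"
proof (rule sectionI)
  fix m show "(s + t) m \<in> fibre E m"
    using fibre_add section_in_E[OF s, of m] section_in_E[OF t, of m] by simp
next
  fix c e I assume c: "c \<in> atlas M" and e: "e \<in> frames A"
  interpret L: courant_frame "F c e" "restrict_fun (U c e) (\<lambda>_. 1)" "{..<2 * r}" "swap_odd r"
      "local_anchor c e" "local_structure c e" by (rule local_courant_frame[OF c e])
  show "local_section c e (s + t) I \<in> F c e"
    unfolding loc_add[OF c e s t] by (rule L.sect_in[OF L.sect_add[OF sect_loc[OF c e s] sect_loc[OF c e t]]])
qed

lemma scale_section:
  assumes f: "f \<in> smooth_functions M" and s: "s \<in> sections M E"
  shows "(\<lambda>m. f m *\<^sub>R s m) \<in> sections M E"
proof (rule sectionI)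
  fix m show "f m *\<^sub>R s m \<in> fibre E m"
    by (rule fibre_scale[OF section_in_E[OF s]])
next
  fix c e I assume c: "c \<in> atlas M" and e: "e \<in> frames A"
  interpret L: courant_frame "F c e" "restrict_fun (U c e) (\<lambda>_. 1)" "{..<2 * r}" "swap_odd r"
      "local_anchor c e" "local_structure c e" by (rule local_courant_frame[OF c e])
  show "local_section c e (\<lambda>m. f m *\<^sub>R s m) I \<in> F c e"
    unfolding loc_scale[OF c e s] by (rule L.sect_in[OF L.sect_scale[OF res_in[OF c e f] sect_loc[OF c e s]]])
qed

lemma pairing_smooth:
  assumes s: "s \<in> sections M E" and t: "t \<in> sections M E"
  shows "(\<lambda>m. double_pairing m (s m) (t m)) \<in> smooth_functions M"
proof (rule smooth_functionI)
  fix c e assume c: "c \<in> atlas M" and e: "e \<in> frames A"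
  interpret L: courant_frame "F c e" "restrict_fun (U c e) (\<lambda>_. 1)" "{..<2 * r}" "swap_odd r"
      "local_anchor c e" "local_structure c e" by (rule local_courant_frame[OF c e])
  show "restrict_fun (U c e) (\<lambda>m. double_pairing m (s m) (t m)) \<in> F c e"
    unfolding loc_pair[OF c e s t] by (rule L.pair_in[OF sect_loc[OF c e s] sect_loc[OF c e t]])
qed

lemma act_anchor_smooth:
  assumes s: "s \<in> sections M E" and f: "f \<in> smooth_functions M"
  shows "act_anchor anchor s f \<in> smooth_functions M"
proof (rule smooth_functionI)
  fix c e assume c: "c \<in> atlas M" and e: "e \<in> frames A"
  interpret L: courant_frame "F c e" "restrict_fun (U c e) (\<lambda>_. 1)" "{..<2 * r}" "swap_odd r"
      "local_anchor c e" "local_structure c e" by (rule local_courant_frame[OF c e])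
  show "restrict_fun (U c e) (act_anchor anchor s f) \<in> F c e"
    unfolding loc_act_anchor[OF c e f s] by (rule L.anch_in[OF sect_loc[OF c e s] res_in[OF c e f]])
qed

lemma fibre_metric_pairing: "fibre_metric M E double_pairing"
  unfolding fibre_metric_def
proof (intro conjI allI ballI impI)
  fix m u v w and k :: real assume uvw: "u \<in> fibre E m" "v \<in> fibre E m" "w \<in> fibre E m"
  obtain e where e: "e \<in> frames A" "m \<in> fst e" using A.frame_cover by blast
  note fr = A.frame_at[OF e]
  show "double_pairing m u v = double_pairing m v u"
    by (simp add: double_pairing_def case_prod_beta')
  show "double_pairing m (u + v) w = double_pairing m u w + double_pairing m v w"
    using uvw dual_add[OF fr] by (simp add: double_pairing_def case_prod_beta' fibre_double)
  show "double_pairing m (k *\<^sub>R u) v = k * double_pairing m u v"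
    using uvw dual_scale[OF fr] by (simp add: double_pairing_def case_prod_beta' fibre_double scaleR_fun_def algebra_simps)
next
  fix m u assume u: "u \<in> fibre E m" and z: "\<forall>v\<in>fibre E m. double_pairing m u v = 0"
  obtain e where e: "e \<in> frames A" "m \<in> fst e" using A.frame_cover by blast
  note fr = A.frame_at[OF e]
  have 0: "0 \<in> fibre A m" "0 \<in> dual_space (fibre A m)"
    using subspace_0[OF A.subspace_fibre] subspace_0[OF subspace_dual_space[OF fr]] by auto
  show "u = 0"
  proof (rule double_eqI[OF e u])
    show "0 \<in> fibre E m" using 0 by (simp add: fibre_double)
    fix I assume I: "I < 2 * r"
    show "component e I m u = component e I m 0"
    proof (cases "I < r")
      case True
      have "(0, coframe A e I m) \<in> fibre E m" using 0 coframe_in_dual[OF fr] by (simp add: fibre_double)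
      then have "double_pairing m u (0, coframe A e I m) = 0" using z by blast
      then show ?thesis using True dual_zero[OF fr, of "snd u"] dual_zero[OF fr coframe_in_dual[OF fr]] u
        by (simp add: double_pairing_def case_prod_beta' component_def fibre_double)
    next
      case False
      then have "I - r < r" using I by simp
      then have "(snd e (I - r) m, 0) \<in> fibre E m" using 0 frame_in_fibre[OF fr] by (simp add: fibre_double)
      then have "double_pairing m u (snd e (I - r) m, 0) = 0" using z by blast
      then show ?thesis using False by (simp add: double_pairing_def case_prod_beta' component_def)
    qed
  qed
qed (rule pairing_smooth)

lemma anchor_bundle_map: "bundle_map_to_tangent M E anchor"
  unfolding bundle_map_to_tangent_def
proof (intro conjI allI ballI)
  fix m u v and k :: real assume u: "u \<in> fibre E m"
  obtain c e where c: "c \<in> atlas M" "m \<in> fst c" and e: "e \<in> frames A" "m \<in> fst e"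
    using A.chart_cover A.frame_cover by blast
  interpret L: courant_frame "F c e" "restrict_fun (U c e) (\<lambda>_. 1)" "{..<2 * r}" "swap_odd r"
      "local_anchor c e" "local_structure c e" by (rule local_courant_frame[OF c(1) e(1)])
  note comp = anchor_components[OF c(1) e(1) _ c(2) e(2)]
  note res = res_in[OF c(1) e(1)]
  have m: "restrict_fun (U c e) f m = f m" for f using c e by (simp add: restrict_fun_def)
  show "anchor m u \<in> tangent_space M m"
    unfolding tangent_space_def mem_Collect_eq
  proof (intro conjI ballI allI impI)
    fix f g assume fg: "f \<in> smooth_functions M" "g \<in> smooth_functions M"
    show "anchor m u (\<lambda>p. f p + g p) = anchor m u f + anchor m u g"
      unfolding comp[OF fg(1) u] comp[OF fg(2) u] comp[OF smooth_functions_add[OF fg] u] restrict_fun_add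
      by (simp add: L.rho_add res fg sum.distrib distrib_left)
    show "anchor m u (\<lambda>p. f p * g p) = f m * anchor m u g + g m * anchor m u f"
      unfolding comp[OF fg(1) u] comp[OF fg(2) u] comp[OF smooth_functions_mult[OF fg] u] restrict_fun_mult
      by (simp add: L.rho_mult res fg m sum.distrib sum_distrib_left algebra_simps)
  next
    fix f k assume f: "f \<in> smooth_functions M"
    note kf = smooth_functions_mult[OF smooth_functions_const f, of k]
    show "anchor m u (\<lambda>p. k * f p) = k * anchor m u f"
      unfolding comp[OF f u] comp[OF kf u] restrict_fun_mult
      by (simp add: L.rho_mult res smooth_functions_const f m local_anchor_const[OF c(1) e(1)] sum_distrib_left algebra_simps)
  next
    fix f assume "f \<notin> smooth_functions M"
    then show "anchor m u f = 0" by (simp add: double_anchor_def)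
  qed
  assume v: "v \<in> fibre E m"
  note uv = fibre_add[OF u v] and ku = fibre_scale[OF u, of k]
  show "anchor m (u + v) = anchor m u + anchor m v"
  proof
    fix f show "anchor m (u + v) f = (anchor m u + anchor m v) f"
    proof (cases "f \<in> smooth_functions M")
      case True then show ?thesis
        using comp[OF True u] comp[OF True v] comp[OF True uv] component_add[OF c(1) e(1,2) u v]
        by (simp add: sum.distrib distrib_right)
    qed (simp add: double_anchor_def)
  qed
  show "anchor m (k *\<^sub>R u) = k *\<^sub>R anchor m u"
  proof
    fix f show "anchor m (k *\<^sub>R u) f = (k *\<^sub>R anchor m u) f"
    proof (cases "f \<in> smooth_functions M")
      case True then show ?thesis
        using comp[OF True u] comp[OF True ku] component_scale[OF c(1) e(1,2) u]
        by (simp add: scaleR_fun_def sum_distrib_left mult.assoc)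
    qed (simp add: double_anchor_def scaleR_fun_def)
  qed
qed (rule act_anchor_smooth)

text \<open>Every axiom is an equality of sections or functions, hence can be verified for the components over
  each chart and frame, where it is the corresponding statement of the local model.\<close>

lemma courant: "courant_algebroid M E double_pairing circ anchor grad"
  unfolding courant_algebroid_def
proof (intro conjI ballI allI)
  show "smooth_manifold M" by (rule smooth_M)
  show "vector_bundle M E" by (rule A.double_vector_bundle)
  show "fibre_metric M E double_pairing" by (rule fibre_metric_pairing)
  show "bundle_map_to_tangent M E anchor" by (rule anchor_bundle_map)
next
  fix f assume f: "f \<in> smooth_functions M"
  show "grad f \<in> sections M E" by (rule grad_section[OF f])
  fix s m show "double_pairing m (grad f m) (s m) = act_anchor anchor s f m"
    using f by (simp add: act_anchor_def double_anchor_def)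
next
  fix s t assume "s \<in> sections M E" "t \<in> sections M E"
  then show "circ s t \<in> sections M E" by (rule circ_section)
next
  fix s t h and k :: real assume s: "s \<in> sections M E" and t: "t \<in> sections M E" and h: "h \<in> sections M E"
  have k: "k *\<^sub>R u = (\<lambda>m. k *\<^sub>R u m)" for u :: "'m \<Rightarrow> 'v \<times> ('v \<Rightarrow> real)" by (simp add: scaleR_fun_def)
  note ks = scale_section[OF smooth_functions_const[of k] s]
  note in_E = section_in_E[OF circ_section]
  show "circ (s + t) h = circ s h + circ t h"
  proof (rule section_eqI)
    fix m show "circ (s + t) h m \<in> fibre E m" "(circ s h + circ t h) m \<in> fibre E m"
      using in_E fibre_add add_section s t h by simp_all
  next
    fix c e assume c: "c \<in> atlas M" and e: "e \<in> frames A"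
    interpret L: courant_frame "F c e" "restrict_fun (U c e) (\<lambda>_. 1)" "{..<2 * r}" "swap_odd r"
      "local_anchor c e" "local_structure c e" by (rule local_courant_frame[OF c e])
    show "local_section c e (circ (s + t) h) = local_section c e (circ s h + circ t h)"
      by (simp only: loc_circ[OF c e] loc_add[OF c e] circ_section add_section s t h
          L.circ_add_left[OF sect_loc[OF c e s] sect_loc[OF c e t] sect_loc[OF c e h]])
  qed
  show "circ h (s + t) = circ h s + circ h t"
  proof (rule section_eqI)
    fix m show "circ h (s + t) m \<in> fibre E m" "(circ h s + circ h t) m \<in> fibre E m"
      using in_E fibre_add add_section s t h by simp_all
  next
    fix c e assume c: "c \<in> atlas M" and e: "e \<in> frames A"
    interpret L: courant_frame "F c e" "restrict_fun (U c e) (\<lambda>_. 1)" "{..<2 * r}" "swap_odd r"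
      "local_anchor c e" "local_structure c e" by (rule local_courant_frame[OF c e])
    show "local_section c e (circ h (s + t)) = local_section c e (circ h s + circ h t)"
      by (simp only: loc_circ[OF c e] loc_add[OF c e] circ_section add_section s t h
          L.circ_add_right[OF sect_loc[OF c e h] sect_loc[OF c e s] sect_loc[OF c e t]])
  qed
  show "circ (k *\<^sub>R s) h = k *\<^sub>R circ s h"
    unfolding k
  proof (rule section_eqI)
    fix m show "circ (\<lambda>m. k *\<^sub>R s m) h m \<in> fibre E m" "k *\<^sub>R circ s h m \<in> fibre E m"
      using in_E[OF ks h] fibre_scale[OF in_E[OF s h]] by simp_all
  next
    fix c e assume c: "c \<in> atlas M" and e: "e \<in> frames A"
    interpret L: courant_frame "F c e" "restrict_fun (U c e) (\<lambda>_. 1)" "{..<2 * r}" "swap_odd r"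
      "local_anchor c e" "local_structure c e" by (rule local_courant_frame[OF c e])
    have "L.circ (\<lambda>K. restrict_fun (U c e) (\<lambda>_. k) * local_section c e s K) (local_section c e h)
        = (\<lambda>K. restrict_fun (U c e) (\<lambda>_. k) * L.circ (local_section c e s) (local_section c e h) K)"
      by (rule L.circ_const_left[OF sect_loc[OF c e s] sect_loc[OF c e h] res_in[OF c e smooth_functions_const]])
        (simp add: local_anchor_const[OF c e])
    then show "local_section c e (circ (\<lambda>m. k *\<^sub>R s m) h) = local_section c e (\<lambda>m. k *\<^sub>R circ s h m)"
      by (simp only: loc_circ[OF c e ks h] loc_scale[OF c e s] loc_scale[OF c e circ_section[OF s h]] loc_circ[OF c e s h])
  qed
  show "circ h (k *\<^sub>R s) = k *\<^sub>R circ h s"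
    unfolding k
  proof (rule section_eqI)
    fix m show "circ h (\<lambda>m. k *\<^sub>R s m) m \<in> fibre E m" "k *\<^sub>R circ h s m \<in> fibre E m"
      using in_E[OF h ks] fibre_scale[OF in_E[OF h s]] by simp_all
  next
    fix c e assume c: "c \<in> atlas M" and e: "e \<in> frames A"
    interpret L: courant_frame "F c e" "restrict_fun (U c e) (\<lambda>_. 1)" "{..<2 * r}" "swap_odd r"
      "local_anchor c e" "local_structure c e" by (rule local_courant_frame[OF c e])
    let ?k = "restrict_fun (U c e) (\<lambda>_. k)"
    have "L.anch (local_section c e h) ?k = 0"
      by (simp add: L.anch_def local_anchor_const[OF c e])
    then have "L.circ (local_section c e h) (\<lambda>K. ?k * local_section c e s K)
        = (\<lambda>K. ?k * L.circ (local_section c e h) (local_section c e s) K)"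
      unfolding L.circ_leibniz[OF sect_loc[OF c e h] sect_loc[OF c e s] res_in[OF c e smooth_functions_const]]
      by (simp add: fun_eq_iff)
    then show "local_section c e (circ h (\<lambda>m. k *\<^sub>R s m)) = local_section c e (\<lambda>m. k *\<^sub>R circ h s m)"
      by (simp only: loc_circ[OF c e h ks] loc_scale[OF c e s] loc_scale[OF c e circ_section[OF h s]] loc_circ[OF c e h s])
  qed
next
  fix s t h assume s: "s \<in> sections M E" and t: "t \<in> sections M E" and h: "h \<in> sections M E"
  show "circ s (circ t h) = circ (circ s t) h + circ t (circ s h)"
  proof (rule section_eqI)
    fix m show "circ s (circ t h) m \<in> fibre E m" "(circ (circ s t) h + circ t (circ s h)) m \<in> fibre E m"
      using section_in_E[OF circ_section] circ_section fibre_add s t h by simp_all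
  next
    fix c e assume c: "c \<in> atlas M" and e: "e \<in> frames A"
    interpret L: courant_frame "F c e" "restrict_fun (U c e) (\<lambda>_. 1)" "{..<2 * r}" "swap_odd r"
      "local_anchor c e" "local_structure c e" by (rule local_courant_frame[OF c e])
    show "local_section c e (circ s (circ t h)) = local_section c e (circ (circ s t) h + circ t (circ s h))"
      by (simp only: loc_circ[OF c e] loc_add[OF c e] circ_section s t h
          L.jacobi[OF sect_loc[OF c e s] sect_loc[OF c e t] sect_loc[OF c e h]])
  qed
next
  fix s t f assume s: "s \<in> sections M E" and t: "t \<in> sections M E" and f: "f \<in> smooth_functions M"
  show "act_anchor anchor (circ s t) f =
      act_anchor anchor s (act_anchor anchor t f) - act_anchor anchor t (act_anchor anchor s f)"
  proof (rule function_eqI)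
    fix c e assume c: "c \<in> atlas M" and e: "e \<in> frames A"
    interpret L: courant_frame "F c e" "restrict_fun (U c e) (\<lambda>_. 1)" "{..<2 * r}" "swap_odd r"
      "local_anchor c e" "local_structure c e" by (rule local_courant_frame[OF c e])
    show "restrict_fun (U c e) (act_anchor anchor (circ s t) f) = restrict_fun (U c e)
        (act_anchor anchor s (act_anchor anchor t f) - act_anchor anchor t (act_anchor anchor s f))"
      by (simp only: restrict_fun_diff loc_act_anchor[OF c e] act_anchor_smooth circ_section s t f loc_circ[OF c e]
          L.anch_circ[OF sect_loc[OF c e s] sect_loc[OF c e t] res_in[OF c e f]])
  qed
next
  fix s t f assume s: "s \<in> sections M E" and t: "t \<in> sections M E" and f: "f \<in> smooth_functions M"
  note ft = scale_section[OF f t] and fst = scale_section[OF f circ_section[OF s t]]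
    and sft = scale_section[OF act_anchor_smooth[OF s f] t]
  have plus: "(\<lambda>m. f m *\<^sub>R circ s t m + act_anchor anchor s f m *\<^sub>R t m)
      = (\<lambda>m. f m *\<^sub>R circ s t m) + (\<lambda>m. act_anchor anchor s f m *\<^sub>R t m)" by (simp add: fun_eq_iff)
  show "circ s (\<lambda>m. f m *\<^sub>R t m) = (\<lambda>m. f m *\<^sub>R circ s t m + act_anchor anchor s f m *\<^sub>R t m)"
    unfolding plus
  proof (rule section_eqI)
    fix m show "circ s (\<lambda>m. f m *\<^sub>R t m) m \<in> fibre E m"
      by (rule section_in_E[OF circ_section[OF s ft]])
    show "((\<lambda>m. f m *\<^sub>R circ s t m) + (\<lambda>m. act_anchor anchor s f m *\<^sub>R t m)) m \<in> fibre E m"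
      by (rule section_in_E[OF add_section[OF fst sft]])
  next
    fix c e assume c: "c \<in> atlas M" and e: "e \<in> frames A"
    interpret L: courant_frame "F c e" "restrict_fun (U c e) (\<lambda>_. 1)" "{..<2 * r}" "swap_odd r"
      "local_anchor c e" "local_structure c e" by (rule local_courant_frame[OF c e])
    show "local_section c e (circ s (\<lambda>m. f m *\<^sub>R t m))
        = local_section c e ((\<lambda>m. f m *\<^sub>R circ s t m) + (\<lambda>m. act_anchor anchor s f m *\<^sub>R t m))"
      by (simp only: loc_circ[OF c e s ft] loc_add[OF c e fst sft] loc_scale[OF c e t] loc_scale[OF c e circ_section[OF s t]]
          loc_circ[OF c e s t] loc_act_anchor[OF c e f s]
          L.circ_leibniz[OF sect_loc[OF c e s] sect_loc[OF c e t] res_in[OF c e f]])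
  qed
next
  fix s assume s: "s \<in> sections M E"
  let ?g = "\<lambda>m. double_pairing m (s m) (s m)"
  note gs = grad_section[OF pairing_smooth[OF s s]]
  have half: "(1/2::real) *\<^sub>R grad ?g = (\<lambda>m. (1/2) *\<^sub>R grad ?g m)" by (simp add: scaleR_fun_def)
  show "circ s s = (1/2::real) *\<^sub>R grad ?g"
    unfolding half
  proof (rule section_eqI)
    fix m show "circ s s m \<in> fibre E m" "(1/2::real) *\<^sub>R grad ?g m \<in> fibre E m"
      using section_in_E[OF circ_section[OF s s]] fibre_scale[OF section_in_E[OF gs]] by simp_all
  next
    fix c e assume c: "c \<in> atlas M" and e: "e \<in> frames A"
    interpret L: courant_frame "F c e" "restrict_fun (U c e) (\<lambda>_. 1)" "{..<2 * r}" "swap_odd r"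
      "local_anchor c e" "local_structure c e" by (rule local_courant_frame[OF c e])
    have g: "local_section c e (grad ?g) = local_section c e (circ s s) + local_section c e (circ s s)"
      by (simp only: loc_grad[OF c e pairing_smooth[OF s s]] loc_pair[OF c e s s] loc_circ[OF c e s s]
          L.circ_symmetric_part[OF sect_loc[OF c e s] sect_loc[OF c e s]])
    show "local_section c e (circ s s) = local_section c e (\<lambda>m. (1/2) *\<^sub>R grad ?g m)"
      unfolding loc_scale[OF c e gs] g
    proof (intro ext)
      fix K m
      show "local_section c e (circ s s) K m = (restrict_fun (U c e) (\<lambda>_. 1/2) *
          (local_section c e (circ s s) + local_section c e (circ s s)) K) m"
        using loc_outside[OF c e, of m "circ s s" K] by (simp add: restrict_fun_def)
    qed
  qed
next
  fix s h h' assume s: "s \<in> sections M E" and h: "h \<in> sections M E" and h': "h' \<in> sections M E"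
  show "act_anchor anchor s (\<lambda>m. double_pairing m (h m) (h' m))
      = (\<lambda>m. double_pairing m (circ s h m) (h' m) + double_pairing m (h m) (circ s h' m))"
  proof (rule function_eqI)
    fix c e assume c: "c \<in> atlas M" and e: "e \<in> frames A"
    interpret L: courant_frame "F c e" "restrict_fun (U c e) (\<lambda>_. 1)" "{..<2 * r}" "swap_odd r"
      "local_anchor c e" "local_structure c e" by (rule local_courant_frame[OF c e])
    show "restrict_fun (U c e) (act_anchor anchor s (\<lambda>m. double_pairing m (h m) (h' m)))
        = restrict_fun (U c e) (\<lambda>m. double_pairing m (circ s h m) (h' m) + double_pairing m (h m) (circ s h' m))"
      unfolding restrict_fun_add loc_act_anchor[OF c e pairing_smooth[OF h h'] s] loc_pair[OF c e h h']
        loc_pair[OF c e circ_section[OF s h] h'] loc_pair[OF c e h circ_section[OF s h']]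
        loc_circ[OF c e s h] loc_circ[OF c e s h']
      by (rule L.anch_pair[OF sect_loc[OF c e s] sect_loc[OF c e h] sect_loc[OF c e h']])
  qed
qed

end

theorem theorem3p8p2:
  fixes M :: "'m::{t2_space,second_countable_topology} manifold"
    and A :: "('m, 'v::real_vector) vbundle"
    and \<theta> :: "('m, 'v) ctfun"
    and dA :: "('m, 'v) form_op"
    and dA' :: "('m, 'v \<Rightarrow> real) form_op"
    and \<phi> :: "('m, 'v) form"
    and \<psi> :: "('m, 'v \<Rightarrow> real) form"
  assumes "smooth_manifold M"
    and "vector_bundle M A"
    and "proto_bialgebroid M A \<theta>"
    and "vector_field_Pi M A dA" and "degree_one M A dA"
    and "vector_field_Pi M (dual_bundle A) dA'" and "degree_one M (dual_bundle A) dA'"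
    and "\<phi> \<in> kforms_on M A 3 UNIV"
    and "\<psi> \<in> kforms_on M (dual_bundle A) 3 UNIV"
    and "\<And>c e m. c \<in> atlas M \<Longrightarrow> e \<in> frames A \<Longrightarrow> m \<in> fst c \<inter> fst e \<Longrightarrow>
           \<theta> c e m = hamiltonian_lift M A dA c e m
             + legendre_pullback A (hamiltonian_lift M (dual_bundle A) dA') c e m
             + pi_pullback A \<phi> c e m
             + legendre_pullback A (pi_pullback (dual_bundle A) \<psi>) c e m"
  shows "courant_algebroid M (double_bundle A) double_pairing
           (double_circ M A dA dA' \<phi> \<psi>) (double_anchor M A dA dA') (double_D A dA dA')"
proof -
  interpret split_proto_bialgebroid M A \<theta> dA dA' \<phi> \<psi>
    by (rule split_proto_bialgebroid.intro[OF assms])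
  show ?thesis by (rule courant)
qed

end
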